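(* Let $G$ and $H$ be countable discrete sofic groups with respective sofic approximations $\Sigma=(\sigma_n:G\to\mathrm{Sym}(V_n))_{n\ge1}$ and $\mathrm T=(\tau_n:H\to\mathrm{Sym}(W_n))_{n\ge1}$, and let $(X,\mu,T)$ be a $G$-system. Assume that $H$ is infinite. Then $$\mathrm h_{\Sigma\times\mathrm T}\big(\mu^{\times H},\mathrm{CInd}_G^{G\times H}T\big)=\mathrm h^{\mathrm q}_{\Sigma\times\mathrm T}\big(\mu^{\times H},\mathrm{CInd}_G^{G\times H}T\big)=\mathrm h^{\mathrm{dq}}_{\Sigma\times\mathrm T}\big(\mu^{\times H},\mathrm{CInd}_G^{G\times H}T\big).$$
   Context: A sofic approximation $\Sigma=(\sigma_n)_{n\ge1}$ to a countable discrete group $G$ is a sequence of nonempty finite sets $V_n$ and maps $\sigma_n:G\to\mathrm{Sym}(V_n)$, $g\mapsto\sigma_n^g$ (not necessarily homomorphisms), such that for all $g,h\in G$ the proportion of $v\in V_n$ with $\sigma_n^g(\sigma_n^h(v))=\sigma_n^{gh}(v)$ tends to $1$, and for all $g\ne e$ the proportion of $v\in V_n$ with $\sigma_n^g(v)\neq v$ tends to $1$. The product sofic approximation $\Sigma\times\mathrm T=(\sigma_n\times\tau_n)_{n\ge1}$ to $G\times H$ is given by $(\sigma_n\times\tau_n)^{(g,h)}=\sigma_n^g\times\tau_n^h\in\mathrm{Sym}(V_n\times W_n)$. A $G$-system $(X,\mu,T)$ is a standard probability space with a measurable $\mu$-preserving action $T$ of $G$. The co-induced $(G\times H)$-system is $(X^H,\mu^{\times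 H},\mathrm{CInd}_G^{G\times H}T)$, where $g\in G$ acts by $(T^g)^{\times H}$ (i.e. $T^g$ on every coordinate) and $h\in H$ acts by $(x_k)_{k\in H}\mapsto(x_{kh})_{k\in H}$. The following definitions are for a group $G$ with sofic approximation $\Sigma$, and are applied with $G\times H$ and $\Sigma\times\mathrm T$. A metric $G$-process $(\mathcal{X}^G,\mu,S,d)$ consists of a standard measurable space $\mathcal{X}$, a compact metric $d$ on $\mathcal X$ whose Borel $\sigma$-algebra is that of $\mathcal X$, the right-shift action $S^g((x_h)_{h})=(x_{hg})_{h}$, and an $S$-invariant probability measure $\mu$ on $\mathcal{X}^G$. $\mathcal{X}^G$ has the product topology from $d$, and $\mathrm{Prob}(\mathcal X^G)$ the resulting weak$^\ast$ topology. For a finite set $V$, a map $\sigma:G\to\mathrm{Sym}(V)$, $\mathbf{x}\in\mathcal{X}^V$, $v\in V$: $\Pi^\sigma_v(\mathbf{x})=(x_{\sigma^g(v)})_{g\in G}\in\mathcal{X}^G$; $P^\sigma_{\mathbf x}=\frac1{|V|}\sum_{v}\delta_{\Pi^\sigma_v(\mathbf x)}$; $\Omega(\mathcal O,\sigma)=\{\mathbf x\in\mathcal X^V: P^\sigma_{\mathbf x}\in\mathcal O\}$ for $\mathcal{O}\subseteq\mathrm{Prob}(\mathcal X^G)$; $d^{(V)}(\mathbf x,\mathbf x')=\frac1{|V|}\sum_v d(x_v,x'_v)$. For a metric space $(Y,d_Y)$, $\mathrm{cov}_\delta(Z,d_Y)$ is the minimum cardinality of a $\delta$-dense subset of $Z\subseteq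 Y$ (with $\log 0=-\infty$), and for a Borel probability $\nu$ on $Y$, $\mathrm{cov}_{\varepsilon,\delta}(\nu,d_Y)=\min\{|F|: F\subseteq Y,\ \nu(B_\delta(F))>1-\varepsilon\}$, with $B_\delta(F)$ the $\delta$-neighbourhood of $F$. Sofic entropy of a metric $G$-process: $$\mathrm h_\Sigma(\mu)=\sup_{\delta>0}\inf_{\mathcal O}\limsup_{n\to\infty}\tfrac1{|V_n|}\log\mathrm{cov}_\delta(\Omega(\mathcal O,\sigma_n),d^{(V_n)}),$$ where $\mathcal O$ ranges over weak$^\ast$ neighbourhoods of $\mu$. A sequence $\mu_i\in\mathrm{Prob}(\mathcal X^{V_{n_i}})$ quenched converges to $\mu$ over $(\sigma_{n_i})_{i\ge1}$ if for every weak$^\ast$ neighbourhood $\mathcal O$ of $\mu$ the proportion of $v\in V_{n_i}$ with $(\Pi^{\sigma_{n_i}}_v)_\ast\mu_i\in\mathcal O$ tends to $1$ and $\mu_i(\Omega(\mathcal O,\sigma_{n_i}))\to1$. It doubly-quenched converges to $\mu$ if $\mu_i\times\mu_i\in\mathrm{Prob}((\mathcal X\times\mathcal X)^{V_{n_i}})$ quenched converges to $\mu\times\mu$ (on $(\mathcal X\times\mathcal X)^G$, with the average of the two copies of $d$). Then $$\mathrm h^{\mathrm{q}}_\Sigma(\mu)=\sup\Big\{\sup_{\delta,\varepsilon>0}\limsup_{i\to\infty}\tfrac1{|V_{n_i}|}\log\mathrm{cov}_{\varepsilon,\delta}(\mu_i,d^{(V_{n_i})})\Big\},$$ the outer supremum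 being over all subsequences $n_i\uparrow\infty$ and all sequences $(\mu_i)$ quenched converging to $\mu$ over $(\sigma_{n_i})_{i\ge1}$ (and $\sup\emptyset=-\infty$); $\mathrm h^{\mathrm{dq}}_\Sigma(\mu)$ is defined identically with doubly-quenched convergence. These quantities do not depend on $d$ and are isomorphism invariants of the underlying system. Every $G$-system is isomorphic to a $G$-process (via $x\mapsto(T^hx)_{h\in G}\in X^G$), and the quantities for a system are defined as those of any isomorphic metric $G$-process. *)

theory Defs
  imports "HOL-Probability.Probability" "HOL-Library.Product_Plus"
begin

text \<open>Groups are types of class \<^class>\<open>group_add\<close>. This class is not commutative: \<open>g + h\<close> is the
  product \<open>gh\<close> and \<open>0\<close> is the identity \<open>e\<close>. The type \<open>'g \<times> 'h\<close> is the direct product group.\<close>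

section \<open>Sofic approximations\<close>

text \<open>All the sets \<open>V n\<close> live in one type, which is no restriction as that type is arbitrary.
  An element of \<open>Sym(V)\<close> is a function that maps \<open>V\<close> bijectively to itself; its values outside \<open>V\<close>
  are never used.\<close>

definition sofic_approximation ::
    "(nat \<Rightarrow> 'v set) \<Rightarrow> (nat \<Rightarrow> 'g::group_add \<Rightarrow> 'v \<Rightarrow> 'v) \<Rightarrow> bool" where
  "sofic_approximation V \<sigma> \<longleftrightarrow>
     (\<forall>n. finite (V n) \<and> V n \<noteq> {}) \<and>
     (\<forall>n g. bij_betw (\<sigma> n g) (V n) (V n)) \<and>
     (\<forall>g h. (\<lambda>n. real (card {v \<in> V n. \<sigma> n g (\<sigma> n h v) = \<sigma> n (g + h) v}) / real (card (V n)))
              \<longlonglongrightarrow> 1) \<and>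
     (\<forall>g. g \<noteq> 0 \<longrightarrow>
          (\<lambda>n. real (card {v \<in> V n. \<sigma> n g v \<noteq> v}) / real (card (V n))) \<longlonglongrightarrow> 1)"

definition prod_sets :: "(nat \<Rightarrow> 'v set) \<Rightarrow> (nat \<Rightarrow> 'w set) \<Rightarrow> nat \<Rightarrow> ('v \<times> 'w) set" where
  "prod_sets V W n = V n \<times> W n"

definition prod_maps ::
    "(nat \<Rightarrow> 'g \<Rightarrow> 'v \<Rightarrow> 'v) \<Rightarrow> (nat \<Rightarrow> 'h \<Rightarrow> 'w \<Rightarrow> 'w) \<Rightarrow> nat \<Rightarrow> 'g \<times> 'h \<Rightarrow> 'v \<times> 'w \<Rightarrow> 'v \<times> 'w" where
  "prod_maps \<sigma> \<tau> n gh = map_prod (\<sigma> n (fst gh)) (\<tau> n (snd gh))"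

section \<open>Systems\<close>

definition standard_borel :: "'x measure \<Rightarrow> bool" where
  "standard_borel M \<longleftrightarrow>
     (\<exists>X. topspace X = space M \<and> completely_metrizable_space X \<and> second_countable X \<and>
          sets M = sigma_sets (space M) {U. openin X U})"

definition group_system :: "'x measure \<Rightarrow> ('g::group_add \<Rightarrow> 'x \<Rightarrow> 'x) \<Rightarrow> bool" where
  "group_system M T \<longleftrightarrow>
     prob_space M \<and> standard_borel M \<and>
     (\<forall>g. T g \<in> measurable M M \<and> distr M M (T g) = M) \<and>
     (\<forall>x\<in>space M. T 0 x = x \<and> (\<forall>g h. T (g + h) x = T g (T h x)))"

definition isomorphic_systems ::
    "'x measure \<Rightarrow> ('g \<Rightarrow> 'x \<Rightarrow> 'x) \<Rightarrow> 'z measure \<Rightarrow> ('g \<Rightarrow> 'z \<Rightarrow> 'z) \<Rightarrow> bool" where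
  "isomorphic_systems M T N S \<longleftrightarrow>
     (\<exists>\<Phi> \<Psi>. \<Phi> \<in> measurable M N \<and> \<Psi> \<in> measurable N M \<and> distr M N \<Phi> = N \<and>
        (AE x in M. \<Psi> (\<Phi> x) = x) \<and> (AE z in N. \<Phi> (\<Psi> z) = z) \<and>
        (\<forall>g. AE x in M. \<Phi> (T g x) = S g (\<Phi> x)))"

definition coinduced_measure :: "'x measure \<Rightarrow> ('h \<Rightarrow> 'x) measure" where
  "coinduced_measure M = PiM UNIV (\<lambda>_. M)"

definition coinduced_action ::
    "('g \<Rightarrow> 'x \<Rightarrow> 'x) \<Rightarrow> 'g \<times> 'h::group_add \<Rightarrow> ('h \<Rightarrow> 'x) \<Rightarrow> 'h \<Rightarrow> 'x" where
  "coinduced_action T gh x = (\<lambda>k. T (fst gh) (x (k + snd gh)))"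

section \<open>Metric processes\<close>

definition right_shift :: "'g::group_add \<Rightarrow> ('g \<Rightarrow> 'y) \<Rightarrow> 'g \<Rightarrow> 'y" where
  "right_shift g x = (\<lambda>h. x (h + g))"

text \<open>The alphabet is the whole type \<open>'y\<close> and the compact metric is its \<^const>\<open>dist\<close>. A compact metric
  space is complete and second countable, so the class \<^class>\<open>polish_space\<close> is no restriction.\<close>

definition metric_process :: "('g::{group_add,countable} \<Rightarrow> 'y::polish_space) measure \<Rightarrow> bool" where
  "metric_process \<mu> \<longleftrightarrow>
     compact (UNIV :: 'y set) \<and> prob_space \<mu> \<and> sets \<mu> = sets borel \<and>
     (\<forall>g. distr \<mu> \<mu> (right_shift g) = \<mu>)"

definition borel_probs :: "'a::topological_space measure set" where
  "borel_probs = {\<mu>. prob_space \<mu> \<and> sets \<mu> = sets borel}"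

definition weak_star :: "'a::topological_space measure topology" where
  "weak_star = topology_generated_by
     {{\<nu> \<in> borel_probs. (\<integral>x. f x \<partial>\<nu>) \<in> U} | (f :: 'a \<Rightarrow> real) U.
        continuous_on UNIV f \<and> bounded (range f) \<and> open U}"

text \<open>Only open neighbourhoods are used. Infima and limit conditions over all neighbourhoods are
  the same by monotonicity, and openness makes the model sets below measurable.\<close>

definition weak_nbhds :: "'a::topological_space measure \<Rightarrow> 'a measure set set" where
  "weak_nbhds \<mu> = {\<O>. openin weak_star \<O> \<and> \<mu> \<in> \<O>}"

section \<open>Good models\<close>

definition pullback_name :: "('g \<Rightarrow> 'v \<Rightarrow> 'v) \<Rightarrow> 'v \<Rightarrow> ('v \<Rightarrow> 'y) \<Rightarrow> 'g \<Rightarrow> 'y" where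
  "pullback_name \<sigma> v x = (\<lambda>g. x (\<sigma> g v))"

text \<open>The average of the point masses at the pullback names is the image of the uniform measure.\<close>

definition empirical ::
    "'v set \<Rightarrow> ('g \<Rightarrow> 'v \<Rightarrow> 'v) \<Rightarrow> ('v \<Rightarrow> 'y::topological_space) \<Rightarrow> ('g \<Rightarrow> 'y) measure" where
  "empirical V \<sigma> x = distr (uniform_count_measure V) borel (\<lambda>v. pullback_name \<sigma> v x)"

text \<open>The set \<open>\<X>\<^sup>V\<close> consists of the functions on \<open>'v\<close> that are \<^const>\<open>undefined\<close> outside \<open>V\<close>.\<close>

definition good_models ::
    "('g \<Rightarrow> 'y::topological_space) measure set \<Rightarrow> 'v set \<Rightarrow> ('g \<Rightarrow> 'v \<Rightarrow> 'v) \<Rightarrow> ('v \<Rightarrow> 'y) set" where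
  "good_models \<O> V \<sigma> = {x \<in> V \<rightarrow>\<^sub>E UNIV. empirical V \<sigma> x \<in> \<O>}"

definition mean_dist :: "'v set \<Rightarrow> ('v \<Rightarrow> 'y::metric_space) \<Rightarrow> ('v \<Rightarrow> 'y) \<Rightarrow> real" where
  "mean_dist V x x' = (\<Sum>v\<in>V. dist (x v) (x' v)) / real (card V)"

section \<open>Covering numbers\<close>

definition set_cov :: "real \<Rightarrow> 'a set \<Rightarrow> ('a \<Rightarrow> 'a \<Rightarrow> real) \<Rightarrow> enat" where
  "set_cov \<delta> Z d =
     (INF F \<in> {F. finite F \<and> F \<subseteq> Z \<and> (\<forall>z\<in>Z. \<exists>f\<in>F. d f z < \<delta>)}. enat (card F))"

definition measure_cov :: "real \<Rightarrow> real \<Rightarrow> 'a measure \<Rightarrow> ('a \<Rightarrow> 'a \<Rightarrow> real) \<Rightarrow> enat" where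
  "measure_cov \<epsilon> \<delta> \<nu> d =
     (INF F \<in> {F. finite F \<and> F \<subseteq> space \<nu> \<and>
                  measure \<nu> {y \<in> space \<nu>. \<exists>f\<in>F. d f y < \<delta>} > 1 - \<epsilon>}. enat (card F))"

definition log_enat :: "enat \<Rightarrow> ereal" where
  "log_enat k =
     (case k of enat m \<Rightarrow> (if m = 0 then - \<infinity> else ereal (ln (real m))) | \<infinity> \<Rightarrow> \<infinity>)"

section \<open>Sofic entropies\<close>

definition sofic_entropy ::
    "(nat \<Rightarrow> 'v set) \<Rightarrow> (nat \<Rightarrow> 'g \<Rightarrow> 'v \<Rightarrow> 'v) \<Rightarrow> ('g \<Rightarrow> 'y::metric_space) measure \<Rightarrow> ereal" where
  "sofic_entropy V \<sigma> \<mu> =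
     (SUP \<delta>\<in>{0<..}. INF \<O>\<in>weak_nbhds \<mu>.
        limsup (\<lambda>n. log_enat (set_cov \<delta> (good_models \<O> (V n) (\<sigma> n)) (mean_dist (V n)))
                      / ereal (real (card (V n)))))"

definition model_measures ::
    "(nat \<Rightarrow> 'v set) \<Rightarrow> (nat \<Rightarrow> ('v \<Rightarrow> 'y::topological_space) measure) \<Rightarrow> bool" where
  "model_measures V m \<longleftrightarrow>
     (\<forall>i. prob_space (m i) \<and> sets (m i) = sets (PiM (V i) (\<lambda>_. borel)))"

definition quenched_converges ::
    "(nat \<Rightarrow> 'v set) \<Rightarrow> (nat \<Rightarrow> 'g \<Rightarrow> 'v \<Rightarrow> 'v) \<Rightarrow> (nat \<Rightarrow> ('v \<Rightarrow> 'y::topological_space) measure) \<Rightarrow>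
     ('g \<Rightarrow> 'y) measure \<Rightarrow> bool" where
  "quenched_converges V \<sigma> m \<mu> \<longleftrightarrow>
     (\<forall>\<O>\<in>weak_nbhds \<mu>.
        (\<lambda>i. real (card {v \<in> V i. distr (m i) borel (pullback_name (\<sigma> i) v) \<in> \<O>})
               / real (card (V i))) \<longlonglongrightarrow> 1 \<and>
        (\<lambda>i. measure (m i) (good_models \<O> (V i) (\<sigma> i))) \<longlonglongrightarrow> 1)"

text \<open>The product measures below are moved along \<open>\<X>\<^sup>V \<times> \<X>\<^sup>V = (\<X> \<times> \<X>)\<^sup>V\<close> and
  \<open>\<X>\<^sup>G \<times> \<X>\<^sup>G = (\<X> \<times> \<X>)\<^sup>G\<close>. Quenched convergence depends on the metric only through its topology,
  and the average of the two copies of the metric on \<open>\<X> \<times> \<X>\<close> gives the product topology.\<close>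

definition pair_model_measure ::
    "'v set \<Rightarrow> ('v \<Rightarrow> 'y::topological_space) measure \<Rightarrow> ('v \<Rightarrow> 'y \<times> 'y) measure" where
  "pair_model_measure V m =
     distr (m \<Otimes>\<^sub>M m) (PiM V (\<lambda>_. borel)) (\<lambda>(x, x'). \<lambda>v\<in>V. (x v, x' v))"

definition pair_process :: "('g \<Rightarrow> 'y::topological_space) measure \<Rightarrow> ('g \<Rightarrow> 'y \<times> 'y) measure" where
  "pair_process \<mu> = distr (\<mu> \<Otimes>\<^sub>M \<mu>) borel (\<lambda>(x, x') g. (x g, x' g))"

definition doubly_quenched_converges ::
    "(nat \<Rightarrow> 'v set) \<Rightarrow> (nat \<Rightarrow> 'g \<Rightarrow> 'v \<Rightarrow> 'v) \<Rightarrow> (nat \<Rightarrow> ('v \<Rightarrow> 'y::topological_space) measure) \<Rightarrow>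
     ('g \<Rightarrow> 'y) measure \<Rightarrow> bool" where
  "doubly_quenched_converges V \<sigma> m \<mu> \<longleftrightarrow>
     quenched_converges V \<sigma> (\<lambda>i. pair_model_measure (V i) (m i)) (pair_process \<mu>)"

definition model_growth ::
    "(nat \<Rightarrow> 'v set) \<Rightarrow> (nat \<Rightarrow> ('v \<Rightarrow> 'y::metric_space) measure) \<Rightarrow> ereal" where
  "model_growth V m =
     (SUP \<delta>\<in>{0<..}. SUP \<epsilon>\<in>{0<..}.
        limsup (\<lambda>i. log_enat (measure_cov \<epsilon> \<delta> (m i) (mean_dist (V i))) / ereal (real (card (V i)))))"

definition quenched_entropy ::
    "(nat \<Rightarrow> 'v set) \<Rightarrow> (nat \<Rightarrow> 'g \<Rightarrow> 'v \<Rightarrow> 'v) \<Rightarrow> ('g \<Rightarrow> 'y::metric_space) measure \<Rightarrow> ereal" where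
  "quenched_entropy V \<sigma> \<mu> =
     (SUP (r, m) \<in> {(r :: nat \<Rightarrow> nat, m). strict_mono r \<and> model_measures (V \<circ> r) m \<and>
                      quenched_converges (V \<circ> r) (\<sigma> \<circ> r) m \<mu>}.
        model_growth (V \<circ> r) m)"

definition doubly_quenched_entropy ::
    "(nat \<Rightarrow> 'v set) \<Rightarrow> (nat \<Rightarrow> 'g \<Rightarrow> 'v \<Rightarrow> 'v) \<Rightarrow> ('g \<Rightarrow> 'y::metric_space) measure \<Rightarrow> ereal" where
  "doubly_quenched_entropy V \<sigma> \<mu> =
     (SUP (r, m) \<in> {(r :: nat \<Rightarrow> nat, m). strict_mono r \<and> model_measures (V \<circ> r) m \<and>
                      doubly_quenched_converges (V \<circ> r) (\<sigma> \<circ> r) m \<mu>}.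
        model_growth (V \<circ> r) m)"

end

theory Submission
  imports Defs
begin

text \<open>Two of the inequalities hold for every process. A quenched convergent measure gives almost full
  mass to the good models, so it is covered as soon as the good models are covered; and the first
  marginal of a doubly quenched sequence is quenched. Hence the entropies decrease from left to right,
  and everything rests on showing that sofic entropy is at most doubly quenched entropy when the
  process is co-induced and \<open>H\<close> is infinite.

  A point of \<open>V \<times> W\<close> is read as a place \<open>v\<close> in the row \<open>w\<close>. Up to the isomorphism, a sample of the
  process is a family \<open>(x\<^sub>h)\<close> of independent points of \<open>X\<close>, and a finite code of \<open>x\<^sub>h\<close> along \<open>G\<close> is
  the row number \<open>h\<close> of an array. The coordinate at the identity is, up to small errors, a function
  \<open>\<phi>\<close> of the codes of finitely many \<open>x\<^sub>h\<close> (\<open>code_approximation_of_map\<close>), and conversely the code of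
  \<open>x\<^sub>h\<close> can be read off a finite window of the process (\<open>code_kernels\<close>). As \<open>H\<close> is infinite, the weak
  law of large numbers along a large finite subset of \<open>H\<close> says that the empirical distribution of the
  rows in the orbit of a typical point is close to the law of one row. A good model inherits this
  (\<open>stage_code\<close>). So for any set \<open>S\<close> of good models, if \<open>y\<close> is drawn uniformly from \<open>S\<close> and \<open>w\<close>
  uniformly from \<open>W\<close>, then the random row number \<open>w\<close> of \<open>y\<close> has the right local law at most \<open>v\<close>
  (\<open>rows_typical\<close>). It is essential that this is a statement about the average over \<open>S\<close>: a place
  \<open>v\<close> may be bad for some members of \<open>S\<close>.

  Now draw such a random row independently for every \<open>w \<in> W\<close> and apply \<open>\<phi>\<close> to the resulting array.
  This random model has two properties.

  \<^item> It is quenched, and so is a pair of two independent copies, because such a pair is again a model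
    with independent rows. The local law at \<open>(v, w)\<close> is right because the rows at distinct points
    of the \<open>\<tau>\<close>-orbit of \<open>w\<close> are independent (\<open>local_quenched\<close>), and empirical averages concentrate
    because most pairs of points of \<open>V \<times> W\<close> depend on disjoint sets of rows
    (\<open>empirical_quenched\<close>).
  \<^item> It has as much entropy as \<open>S\<close> has points. The members of \<open>S\<close> are separated, hence have distinct
    arrays, so by subadditivity of Shannon entropy the random row has entropy at least
    \<open>ln (card S) / card W\<close>, and \<open>card W\<close> independent copies of it are spread over about \<open>card S\<close>
    arrays (\<open>resampled_rows_spread\<close>). A configuration near to a model determines most entries of
    its array, which costs only the volume of a small Hamming ball (\<open>covering_lower_bound\<close>).

  Two codes occur, because the scale at which the covering number is taken must be fixed before the
  accuracy of the quenched convergence. The coarse code is chosen once and carries the entropy. The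
  fine code refines it, gets better along the sequence, and is used to build the models. Taking good
  models for better and better codes along a subsequence gives a doubly quenched sequence with the
  growth rate of the separated sets.\<close>

section \<open>Weak-star neighbourhoods\<close>

text \<open>The weak-star topology is generated by the subbasic sets, so an inductive property of
  neighbourhoods only has to be checked for these, for intersections and for open supersets.\<close>

lemma weak_nbhds_induct [consumes 1, case_names subbasic inter superset]:
  fixes \<mu> :: "'a::topological_space measure"
  assumes nbhd: "\<O> \<in> weak_nbhds \<mu>"
    and sub: "\<And>f U. continuous_on UNIV (f :: 'a \<Rightarrow> real) \<Longrightarrow> bounded (range f) \<Longrightarrow> open U \<Longrightarrow>
                \<mu> \<in> borel_probs \<Longrightarrow> (\<integral>x. f x \<partial>\<mu>) \<in> U \<Longrightarrow> Q {\<nu> \<in> borel_probs. (\<integral>x. f x \<partial>\<nu>) \<in> U}"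
    and int: "\<And>A B. Q A \<Longrightarrow> Q B \<Longrightarrow> Q (A \<inter> B)"
    and up: "\<And>A B. Q A \<Longrightarrow> A \<subseteq> B \<Longrightarrow> openin weak_star B \<Longrightarrow> Q B"
  shows "Q \<O>"
proof -
  let ?S = "{{\<nu> \<in> borel_probs. (\<integral>x. f x \<partial>\<nu>) \<in> U} | (f :: 'a \<Rightarrow> real) U.
        continuous_on UNIV f \<and> bounded (range f) \<and> open U}"
  have "generate_topology_on ?S \<O>"
    using nbhd by (simp add: weak_nbhds_def weak_star_def openin_topology_generated_by_iff)
  then have "\<mu> \<in> \<O> \<longrightarrow> Q \<O>"
  proof induction
    case Empty
    then show ?case by simp
  next
    case (Int a b)
    then show ?case using int by blast
  next
    case (UN K)
    have "openin weak_star (\<Union>K)"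
      unfolding weak_star_def openin_topology_generated_by_iff
      by (rule generate_topology_on.UN) (use UN in auto)
    then show ?case using UN up by (meson Union_iff Union_upper)
  next
    case (Basis s)
    then show ?case using sub by blast
  qed
  then show ?thesis using nbhd by (simp add: weak_nbhds_def)
qed

lemma subbasic_weak_nbhd:
  fixes f :: "'a::topological_space \<Rightarrow> real"
  assumes "continuous_on UNIV f" "bounded (range f)" "open U" "\<mu> \<in> borel_probs" "(\<integral>x. f x \<partial>\<mu>) \<in> U"
  shows "{\<nu> \<in> borel_probs. (\<integral>x. f x \<partial>\<nu>) \<in> U} \<in> weak_nbhds \<mu>"
  unfolding weak_nbhds_def weak_star_def openin_topology_generated_by_iff
  using assms by (auto intro!: generate_topology_on.Basis)

lemma weak_nbhds_Int: "A \<in> weak_nbhds \<mu> \<Longrightarrow> B \<in> weak_nbhds \<mu> \<Longrightarrow> A \<inter> B \<in> weak_nbhds \<mu>"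
  by (auto simp: weak_nbhds_def)

text \<open>One half of the portmanteau theorem: the indicator of an open set is an increasing limit
  of continuous functions.\<close>

lemma weak_nbhd_of_open_set:
  fixes \<mu> :: "'a::metric_space measure"
  assumes \<mu>: "\<mu> \<in> borel_probs" and A: "open A" and c: "measure \<mu> A > c"
  shows "\<exists>\<O>\<in>weak_nbhds \<mu>. \<forall>P\<in>\<O>. measure P A > c"
proof -
  interpret prob_space \<mu> using \<mu> by (simp add: borel_probs_def)
  have sets_eq: "sets \<mu> = sets borel" using \<mu> by (simp add: borel_probs_def)
  define f where "f n x = min 1 (real n * infdist x (- A))" for n x
  have f01: "0 \<le> f n x" "f n x \<le> 1" for n x by (auto simp: f_def infdist_nonneg)
  have f0: "f n x = 0" if "x \<notin> A" for n x using that by (simp add: f_def)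
  have cont: "continuous_on UNIV (f n)" for n
    unfolding f_def by (intro continuous_intros)
  have meas: "f n \<in> borel_measurable M" if "sets M = sets borel" for n M
    using borel_measurable_continuous_onI[OF cont[of n]] measurable_cong_sets[OF that refl] by blast
  have f_le: "f n x \<le> indicator A x" for n x using f01 f0 by (auto simp: indicator_def)
  show ?thesis
  proof (cases "A = UNIV")
    case True
    have "{\<nu> \<in> borel_probs. (\<integral>x. (0::real) \<partial>\<nu>) \<in> UNIV} \<in> weak_nbhds \<mu>"
      using \<mu> by (intro subbasic_weak_nbhd) auto
    moreover have "measure P A = 1" if "P \<in> borel_probs" for P
    proof -
      interpret P: prob_space P using that by (simp add: borel_probs_def)
      have "space P = UNIV" using that sets_eq_imp_space_eq[of P borel] by (simp add: borel_probs_def)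
      then show ?thesis using True P.prob_space by simp
    qed
    moreover have "c < 1" using c prob_le_1[of A] by linarith
    ultimately show ?thesis by (intro bexI[of _ "{\<nu> \<in> borel_probs. (\<integral>x. (0::real) \<partial>\<nu>) \<in> UNIV}"]) auto
  next
    case False
    have "(\<lambda>n. \<integral>x. f n x \<partial>\<mu>) \<longlonglongrightarrow> (\<integral>x. indicator A x \<partial>\<mu>)"
    proof (rule integral_dominated_convergence[where w="\<lambda>_. 1"])
      show "(indicator A :: 'a \<Rightarrow> real) \<in> borel_measurable \<mu>" 
        by (rule borel_measurable_indicator) (simp add: sets_eq A)
      show "AE x in \<mu>. (\<lambda>n. f n x) \<longlonglongrightarrow> indicator A x"
      proof (rule AE_I2)
        fix x
        show "(\<lambda>n. f n x) \<longlonglongrightarrow> indicator A x"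
        proof (cases "x \<in> A")
          case True
          have pos: "infdist x (- A) > 0"
            using A True False infdist_pos_not_in_closed[of "- A" x] by (auto simp: closed_Compl)
          obtain N where N: "1 \<le> real N * infdist x (- A)"
            using reals_Archimedean3[OF pos] by (metis less_imp_le)
          have "f n x = 1" if "n \<ge> N" for n
          proof -
            have "real N * infdist x (- A) \<le> real n * infdist x (- A)"
              using that pos by (intro mult_right_mono) auto
            then show ?thesis using N by (simp add: f_def)
          qed
          then show ?thesis using True
            by (intro tendsto_eventually) (auto simp: eventually_sequentially)
        next
          case False
          then show ?thesis by (simp add: f0)
        qed
      qed
      show "AE x in \<mu>. norm (f n x) \<le> 1" for n using f01 by simp
    qed (simp_all add: meas[OF sets_eq])
    moreover have "(\<integral>x. indicator A x \<partial>\<mu>) = measure \<mu> A" using A sets_eq by simp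
    ultimately have "eventually (\<lambda>n. (\<integral>x. f n x \<partial>\<mu>) > c) sequentially"
      using c by (simp add: order_tendsto_iff)
    then obtain n where n: "(\<integral>x. f n x \<partial>\<mu>) > c" by (auto simp: eventually_sequentially)
    let ?O = "{\<nu> \<in> borel_probs. (\<integral>x. f n x \<partial>\<nu>) \<in> {c<..}}"
    have "bounded (range (f n))" using f01 by (auto simp: bounded_iff intro!: exI[of _ 1])
    then have "?O \<in> weak_nbhds \<mu>" using n \<mu> cont by (intro subbasic_weak_nbhd) auto
    moreover have "measure P A > c" if "P \<in> ?O" for P
    proof -
      interpret P: prob_space P using that by (simp add: borel_probs_def)
      have sP: "sets P = sets borel" using that by (simp add: borel_probs_def)
      have "(\<integral>x. f n x \<partial>P) \<le> (\<integral>x. indicator A x \<partial>P)"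
      proof (rule integral_mono)
        show "integrable P (f n)"
          by (rule P.integrable_const_bound[where B=1]) (use f01 meas[OF sP] in auto)
        show "integrable P (indicator A :: 'a \<Rightarrow> real)"
          using A sP by (intro integrable_real_indicator) (auto simp: less_top[symmetric])
      qed (rule f_le)
      then show ?thesis using that A sP by simp
    qed
    ultimately show ?thesis by blast
  qed
qed

section \<open>Empirical measures\<close>

lemma empirical_in_borel_probs:
  "finite V \<Longrightarrow> V \<noteq> {} \<Longrightarrow> empirical V \<sigma> x \<in> borel_probs"
  unfolding empirical_def borel_probs_def
  by (auto intro!: prob_space.prob_space_distr prob_space_uniform_count_measure)

lemma integral_empirical:
  fixes f :: "('g \<Rightarrow> 'y::topological_space) \<Rightarrow> real"
  assumes "finite V" "f \<in> borel_measurable borel"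
  shows "(\<integral>z. f z \<partial>empirical V \<sigma> x) = (\<Sum>v\<in>V. f (pullback_name \<sigma> v x)) / real (card V)"
proof -
  have "(\<integral>z. f z \<partial>empirical V \<sigma> x) = (\<integral>v. f (pullback_name \<sigma> v x) \<partial>uniform_count_measure V)"
    unfolding empirical_def using assms by (subst integral_distr) auto
  also have "\<dots> = (\<Sum>v\<in>V. (1 / real (card V)) * f (pullback_name \<sigma> v x))"
    unfolding uniform_count_measure_def using assms
    by (subst lebesgue_integral_point_measure_finite) simp_all
  finally show ?thesis by (simp add: sum_divide_distrib)
qed

lemma measure_empirical:
  fixes A :: "('g \<Rightarrow> 'y::topological_space) set"
  assumes "finite V" "V \<noteq> {}" "A \<in> sets borel"
  shows "measure (empirical V \<sigma> x) A = real (card {v \<in> V. pullback_name \<sigma> v x \<in> A}) / real (card V)"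
  unfolding empirical_def using assms
  by (subst measure_distr)
     (auto simp: space_uniform_count_measure measure_uniform_count_measure vimage_def Int_def conj_commute
           intro!: arg_cong2[where f="(/)"])

text \<open>The empirical measure depends on the model through finitely many continuous maps. The
  functions on \<open>V\<close> are encoded as sequences because the index type of \<open>V\<close> need not be countable,
  while the Borel and the product \<open>\<sigma>\<close>-algebra agree for countable powers.\<close>

lemma good_models_measurable:
  fixes \<sigma> :: "'g::countable \<Rightarrow> 'v \<Rightarrow> 'v" and \<O> :: "('g \<Rightarrow> 'y::second_countable_topology) measure set"
  assumes V: "finite V" "V \<noteq> {}" and \<O>: "openin weak_star \<O>"
  shows "good_models \<O> V \<sigma> \<in> sets (PiM V (\<lambda>_. borel))"
proof -
  obtain enc where enc: "bij_betw enc V {..<card V}"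
    using V(1) by (metis bij_betw_iff_card card_lessThan finite_lessThan)
  define dec where "dec = inv_into V enc"
  have dec: "dec (enc v) = v" if "v \<in> V" for v
    using enc that by (simp add: dec_def bij_betw_def)
  have encV: "enc v < card V" if "v \<in> V" for v using enc that by (auto simp: bij_betw_def)
  have decV: "dec n \<in> V" if "n < card V" for n
    using enc that by (metis bij_betw_def dec_def inv_into_into lessThan_iff)
  define \<iota> :: "(nat \<Rightarrow> 'y) \<Rightarrow> 'v \<Rightarrow> 'y" where "\<iota> z = (\<lambda>v\<in>V. z (enc v))" for z
  define \<kappa> :: "('v \<Rightarrow> 'y) \<Rightarrow> nat \<Rightarrow> 'y" where "\<kappa> x = (\<lambda>n. if n < card V then x (dec n) else undefined)" for x
  have \<iota>\<kappa>: "\<iota> (\<kappa> x) = x" if "x \<in> V \<rightarrow>\<^sub>E UNIV" for x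
    using that by (auto simp: \<iota>_def \<kappa>_def fun_eq_iff dec encV PiE_def extensional_def)
  have \<kappa>_meas: "\<kappa> \<in> measurable (PiM V (\<lambda>_. borel)) borel"
  proof -
    have "\<kappa> \<in> measurable (PiM V (\<lambda>_. borel)) (PiM UNIV (\<lambda>_. borel))"
      unfolding \<kappa>_def
    proof (rule measurable_PiM_single')
      show "(\<lambda>x. if n < card V then x (dec n) else undefined) \<in> measurable (PiM V (\<lambda>_. borel)) borel" for n
        by (cases "n < card V") (auto intro: measurable_component_singleton decV)
    qed auto
    then show ?thesis using measurable_cong_sets[OF refl sets_PiM_equal_borel] by blast
  qed
  have "generate_topology_on {{\<nu> \<in> borel_probs. (\<integral>x. f x \<partial>\<nu>) \<in> U} | (f :: ('g \<Rightarrow> 'y) \<Rightarrow> real) U.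
        continuous_on UNIV f \<and> bounded (range f) \<and> open U} \<O>"
    using \<O> by (simp add: weak_star_def openin_topology_generated_by_iff)
  then have "open {z. empirical V \<sigma> (\<iota> z) \<in> \<O>}"
  proof induction
    case Empty
    then show ?case by simp
  next
    case (Int a b)
    then show ?case by (simp add: Collect_conj_eq open_Int)
  next
    case (UN K)
    have "{z. empirical V \<sigma> (\<iota> z) \<in> \<Union>K} = (\<Union>k\<in>K. {z. empirical V \<sigma> (\<iota> z) \<in> k})" by auto
    then show ?case using UN by auto
  next
    case (Basis s)
    then obtain f :: "('g \<Rightarrow> 'y) \<Rightarrow> real" and U where s: "s = {\<nu> \<in> borel_probs. (\<integral>x. f x \<partial>\<nu>) \<in> U}"
      and f: "continuous_on UNIV f" and U: "open U" by blast
    have "{z. empirical V \<sigma> (\<iota> z) \<in> s} =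
          (\<lambda>z. (\<Sum>v\<in>V. f (pullback_name \<sigma> v (\<iota> z))) / real (card V)) -` U"
      using V f by (auto simp: s empirical_in_borel_probs integral_empirical borel_measurable_continuous_onI)
    moreover have "continuous_on UNIV (\<lambda>z. (\<Sum>v\<in>V. f (pullback_name \<sigma> v (\<iota> z))) / real (card V))"
    proof (intro continuous_intros)
      fix v
      have "continuous_on UNIV (\<lambda>z. pullback_name \<sigma> v (\<iota> z))"
      proof (rule continuous_on_coordinatewise_then_product)
        fix g
        show "continuous_on UNIV (\<lambda>z. pullback_name \<sigma> v (\<iota> z) g)"
          by (cases "\<sigma> g v \<in> V")
             (auto simp: pullback_name_def \<iota>_def intro: continuous_on_product_coordinates)
      qed
      then show "continuous_on UNIV (\<lambda>z. f (pullback_name \<sigma> v (\<iota> z)))"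
        using continuous_on_compose2[OF f] by auto
    qed (use V in auto)
    ultimately show ?case using U by (simp add: open_vimage)
  qed
  then have "\<kappa> -` {z. empirical V \<sigma> (\<iota> z) \<in> \<O>} \<inter> space (PiM V (\<lambda>_. borel)) \<in> sets (PiM V (\<lambda>_. borel))"
    by (intro measurable_sets[OF \<kappa>_meas]) auto
  moreover have "good_models \<O> V \<sigma> = \<kappa> -` {z. empirical V \<sigma> (\<iota> z) \<in> \<O>} \<inter> space (PiM V (\<lambda>_. borel))"
    by (auto simp: good_models_def space_PiM \<iota>\<kappa>)
  ultimately show ?thesis by simp
qed

lemma pullback_name_measurable [measurable]:
  fixes \<sigma> :: "'g::countable \<Rightarrow> 'v \<Rightarrow> 'v"
  shows "pullback_name \<sigma> v \<in> measurable (PiM V (\<lambda>_. borel)) (borel :: ('g \<Rightarrow> 'y::second_countable_topology) measure)"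
proof -
  have "pullback_name \<sigma> v \<in> measurable (PiM V (\<lambda>_. borel :: 'y measure)) (PiM UNIV (\<lambda>_. borel))"
    unfolding pullback_name_def
  proof (rule measurable_PiM_single')
    fix g
    show "(\<lambda>x. x (\<sigma> g v)) \<in> measurable (PiM V (\<lambda>_. borel)) (borel :: 'y measure)"
    proof (cases "\<sigma> g v \<in> V")
      case True
      then show ?thesis by (rule measurable_component_singleton)
    next
      case False
      then show ?thesis by (intro measurable_cong[THEN iffD2, OF _ measurable_const[of undefined]])
          (auto simp: space_PiM PiE_def extensional_def)
    qed
  qed auto
  then show ?thesis using measurable_cong_sets[OF refl sets_PiM_equal_borel] by blast
qed

section \<open>The easy inequalities\<close>

lemma log_enat_mono: "a \<le> b \<Longrightarrow> log_enat a \<le> log_enat b"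
  by (cases a; cases b) (auto simp: log_enat_def zero_enat_def[symmetric])

lemma mean_dist_measurable:
  fixes f :: "'v \<Rightarrow> 'y::polish_space"
  assumes "finite V"
  shows "mean_dist V f \<in> borel_measurable (PiM V (\<lambda>_. borel))"
  unfolding mean_dist_def
  by (intro borel_measurable_divide borel_measurable_sum borel_measurable_dist
        measurable_const measurable_component_singleton) auto

lemma covered_set_measurable:
  fixes F :: "('v \<Rightarrow> 'y::polish_space) set"
  assumes V: "finite V" and F: "finite F" and N: "sets N = sets (PiM V (\<lambda>_. borel))"
  shows "{y \<in> space N. \<exists>f\<in>F. mean_dist V f y < \<delta>} \<in> sets N"
proof -
  have "mean_dist V f \<in> borel_measurable N" for f :: "'v \<Rightarrow> 'y"
    using mean_dist_measurable[OF V, of f] measurable_cong_sets[OF N refl] by blast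
  then have "{y \<in> space N. mean_dist V f y < \<delta>} \<in> sets N" for f :: "'v \<Rightarrow> 'y"
    by (intro borel_measurable_less) auto
  then have "(\<Union>f\<in>F. {y \<in> space N. mean_dist V f y < \<delta>}) \<in> sets N"
    using F by blast
  moreover have "(\<Union>f\<in>F. {y \<in> space N. mean_dist V f y < \<delta>}) = {y \<in> space N. \<exists>f\<in>F. mean_dist V f y < \<delta>}"
    by auto
  ultimately show ?thesis by simp
qed

lemma measure_cov_le_set_cov:
  fixes m :: "('v \<Rightarrow> 'y::polish_space) measure"
  assumes V: "finite V" and m: "prob_space m" "sets m = sets (PiM V (\<lambda>_. borel))"
    and Z: "Z \<subseteq> space m" and big: "measure m Z > 1 - \<epsilon>"
  shows "measure_cov \<epsilon> \<delta> m (mean_dist V) \<le> set_cov \<delta> Z (mean_dist V)"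
  unfolding measure_cov_def set_cov_def
proof (rule INF_superset_mono)
  interpret prob_space m by fact
  show "{F. finite F \<and> F \<subseteq> Z \<and> (\<forall>z\<in>Z. \<exists>f\<in>F. mean_dist V f z < \<delta>)}
     \<subseteq> {F. finite F \<and> F \<subseteq> space m \<and> 1 - \<epsilon> < measure m {y \<in> space m. \<exists>f\<in>F. mean_dist V f y < \<delta>}}"
  proof
    fix F assume "F \<in> {F. finite F \<and> F \<subseteq> Z \<and> (\<forall>z\<in>Z. \<exists>f\<in>F. mean_dist V f z < \<delta>)}"
    then have F: "finite F" "F \<subseteq> Z" "\<forall>z\<in>Z. \<exists>f\<in>F. mean_dist V f z < \<delta>" by auto
    have "measure m Z \<le> measure m {y \<in> space m. \<exists>f\<in>F. mean_dist V f y < \<delta>}"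
      using F Z by (intro finite_measure_mono covered_set_measurable V m(2)) auto
    then show "F \<in> {F. finite F \<and> F \<subseteq> space m \<and> 1 - \<epsilon> < measure m {y \<in> space m. \<exists>f\<in>F. mean_dist V f y < \<delta>}}"
      using F Z big by auto
  qed
qed simp

text \<open>A quenched convergent measure is nearly carried by the good models, so a finite set that is
  dense in the good models also covers most of the measure.\<close>

lemma quenched_entropy_le_sofic_entropy:
  fixes \<mu> :: "('g::countable \<Rightarrow> 'y::polish_space) measure"
  assumes V: "\<And>n. finite (V n) \<and> V n \<noteq> {}"
  shows "quenched_entropy V \<sigma> \<mu> \<le> sofic_entropy V \<sigma> \<mu>"
  unfolding quenched_entropy_def
proof (rule SUP_least, clarify)
  fix r :: "nat \<Rightarrow> nat" and m :: "nat \<Rightarrow> ('a \<Rightarrow> 'y) measure"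
  assume r: "strict_mono r" and m: "model_measures (V \<circ> r) m"
    and q: "quenched_converges (V \<circ> r) (\<sigma> \<circ> r) m \<mu>"
  show "model_growth (V \<circ> r) m \<le> sofic_entropy V \<sigma> \<mu>"
    unfolding model_growth_def
  proof (intro SUP_least)
    fix \<delta> \<epsilon> :: real assume \<delta>: "\<delta> \<in> {0<..}" and \<epsilon>: "\<epsilon> \<in> {0<..}"
    let ?X = "\<lambda>\<O> n. log_enat (set_cov \<delta> (good_models \<O> (V n) (\<sigma> n)) (mean_dist (V n)))
                      / ereal (real (card (V n)))"
    have "limsup (\<lambda>i. log_enat (measure_cov \<epsilon> \<delta> (m i) (mean_dist ((V \<circ> r) i))) / ereal (real (card ((V \<circ> r) i))))
          \<le> limsup (?X \<O>)" if \<O>: "\<O> \<in> weak_nbhds \<mu>" for \<O>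
    proof -
      have "(\<lambda>i. measure (m i) (good_models \<O> ((V \<circ> r) i) ((\<sigma> \<circ> r) i))) \<longlonglongrightarrow> 1"
        using q \<O> by (auto simp: quenched_converges_def)
      then have "eventually (\<lambda>i. measure (m i) (good_models \<O> ((V \<circ> r) i) ((\<sigma> \<circ> r) i)) > 1 - \<epsilon>) sequentially"
        using \<epsilon> by (intro order_tendstoD) auto
      then have "eventually (\<lambda>i. log_enat (measure_cov \<epsilon> \<delta> (m i) (mean_dist ((V \<circ> r) i))) / ereal (real (card ((V \<circ> r) i)))
           \<le> (?X \<O> \<circ> r) i) sequentially"
      proof eventually_elim
        case (elim i)
        have mi: "prob_space (m i)" "sets (m i) = sets (PiM (V (r i)) (\<lambda>_. borel))"
          using m by (auto simp: model_measures_def)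
        have "space (m i) = (V (r i) \<rightarrow>\<^sub>E UNIV)"
          using sets_eq_imp_space_eq[OF mi(2)] by (simp add: space_PiM)
        then have "measure_cov \<epsilon> \<delta> (m i) (mean_dist (V (r i)))
          \<le> set_cov \<delta> (good_models \<O> (V (r i)) (\<sigma> (r i))) (mean_dist (V (r i)))"
          using elim V by (intro measure_cov_le_set_cov mi) (auto simp: good_models_def)
        then show ?case
          using V[of "r i"] by (auto intro!: ereal_divide_right_mono log_enat_mono simp: card_gt_0_iff)
      qed
      then have "limsup (\<lambda>i. log_enat (measure_cov \<epsilon> \<delta> (m i) (mean_dist ((V \<circ> r) i))) / ereal (real (card ((V \<circ> r) i))))
           \<le> limsup (?X \<O> \<circ> r)" by (rule Limsup_mono)
      also have "\<dots> \<le> limsup (?X \<O>)" by (rule limsup_subseq_mono[OF r])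
      finally show ?thesis .
    qed
    then show "limsup (\<lambda>i. log_enat (measure_cov \<epsilon> \<delta> (m i) (mean_dist ((V \<circ> r) i))) / ereal (real (card ((V \<circ> r) i))))
      \<le> sofic_entropy V \<sigma> \<mu>"
      unfolding sofic_entropy_def by (intro SUP_upper2[OF \<delta>] INF_greatest)
  qed
qed

text \<open>The passage from doubly quenched to quenched convergence is the projection to the first
  copy of the alphabet, applied to the models and to the process.\<close>

lemma pairing_measurable:
  fixes N :: "('g::countable \<Rightarrow> 'y::polish_space) measure"
  assumes "sets N = sets borel"
  shows "(\<lambda>(x, x') g. (x g, x' g)) \<in> measurable (N \<Otimes>\<^sub>M N) (borel :: ('g \<Rightarrow> 'y \<times> 'y) measure)"
proof (rule measurable_coordinatewise_then_product)
  fix g :: 'g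
  have [measurable_cong]: "sets N = sets borel" by fact
  have "(\<lambda>p. (fst p g, snd p g)) \<in> measurable (N \<Otimes>\<^sub>M N) (borel \<Otimes>\<^sub>M borel :: ('y \<times> 'y) measure)"
    by (intro measurable_Pair measurable_compose[OF measurable_fst] measurable_compose[OF measurable_snd])
       (simp_all add: measurable_cong_sets[OF assms refl])
  then show "(\<lambda>x. (case x of (x, x') \<Rightarrow> \<lambda>g. (x g, x' g)) g) \<in> borel_measurable (N \<Otimes>\<^sub>M N)"
    by (simp add: borel_prod case_prod_beta')
qed

lemma continuous_on_fst_fun:
  "continuous_on UNIV (\<lambda>z g. fst (z g) :: 'y::topological_space)"
  by (intro continuous_intros continuous_on_fst continuous_on_product_coordinates
        continuous_on_coordinatewise_then_product)

lemma fst_borel: "fst \<in> borel_measurable (borel :: ('y::topological_space \<times> 'z::topological_space) measure)"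
  by (intro borel_measurable_continuous_onI continuous_on_fst continuous_on_id)

lemma fst_fun_measurable:
  "(\<lambda>z g. fst (z g)) \<in> measurable (borel :: ('g::countable \<Rightarrow> 'y::polish_space \<times> 'z::polish_space) measure) borel"
  by (rule borel_measurable_continuous_onI[OF continuous_on_fst_fun])

lemma pair_process_in_borel_probs:
  fixes \<mu> :: "('g::countable \<Rightarrow> 'y::polish_space) measure"
  assumes "\<mu> \<in> borel_probs"
  shows "pair_process \<mu> \<in> borel_probs"
proof -
  interpret prob_space \<mu> using assms by (simp add: borel_probs_def)
  interpret P: pair_prob_space \<mu> \<mu> ..
  show ?thesis
    using pairing_measurable[of \<mu>] assms
    by (auto simp: borel_probs_def pair_process_def intro!: P.prob_space_distr)
qed

lemma distr_fst_pair_process: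
  fixes \<mu> :: "('g::countable \<Rightarrow> 'y::polish_space) measure"
  assumes "\<mu> \<in> borel_probs"
  shows "distr (pair_process \<mu>) borel (\<lambda>z g. fst (z g)) = \<mu>"
proof -
  interpret prob_space \<mu> using assms by (simp add: borel_probs_def)
  have s: "sets \<mu> = sets borel" using assms by (simp add: borel_probs_def)
  have "distr (pair_process \<mu>) borel (\<lambda>z g. fst (z g)) = distr (\<mu> \<Otimes>\<^sub>M \<mu>) borel fst"
    unfolding pair_process_def
    by (subst distr_distr[OF fst_fun_measurable pairing_measurable[OF s]])
       (auto intro!: distr_cong simp: comp_def case_prod_beta')
  also have "\<dots> = distr (\<mu> \<Otimes>\<^sub>M \<mu>) \<mu> fst" by (rule distr_cong) (auto simp: s)
  also have "\<dots> = \<mu>" by (rule distr_pair_fst)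
  finally show ?thesis .
qed

text \<open>This is the weak-star continuity of the projection to the first copy.\<close>

lemma weak_nbhd_fst_preimage:
  fixes \<mu> :: "('g::countable \<Rightarrow> 'y::polish_space) measure"
  assumes \<O>: "\<O> \<in> weak_nbhds \<mu>" and \<mu>: "\<mu> \<in> borel_probs"
  shows "\<exists>\<O>2\<in>weak_nbhds (pair_process \<mu>). \<forall>P\<in>\<O>2. distr P borel (\<lambda>z g. fst (z g)) \<in> \<O>"
  using \<O>
proof (induction rule: weak_nbhds_induct)
  case (subbasic f U)
  let ?h = "\<lambda>(z :: 'g \<Rightarrow> 'y \<times> 'y) g. fst (z g)"
  have int: "(\<integral>x. f x \<partial>distr P borel ?h) = (\<integral>z. f (?h z) \<partial>P)" if "sets P = sets borel" for P
    using subbasic(1) fst_fun_measurable measurable_cong_sets[OF that refl]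
    by (intro integral_distr) (auto intro: borel_measurable_continuous_onI)
  have sp: "sets (pair_process \<mu>) = sets borel" by (simp add: pair_process_def)
  let ?O = "{\<nu> \<in> borel_probs. (\<integral>z. f (?h z) \<partial>\<nu>) \<in> U}"
  have "?O \<in> weak_nbhds (pair_process \<mu>)"
  proof (rule subbasic_weak_nbhd)
    show "continuous_on UNIV (\<lambda>z. f (?h z))"
      by (rule continuous_on_compose2[OF subbasic(1) continuous_on_fst_fun]) auto
    show "bounded (range (\<lambda>z. f (?h z)))" by (rule bounded_subset[OF subbasic(2)]) auto
    show "(\<integral>z. f (?h z) \<partial>pair_process \<mu>) \<in> U"
      using subbasic(5) by (simp add: int[OF sp, symmetric] distr_fst_pair_process[OF \<mu>])
  qed (use subbasic \<mu> pair_process_in_borel_probs in auto)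
  moreover have "distr P borel ?h \<in> {\<nu> \<in> borel_probs. (\<integral>x. f x \<partial>\<nu>) \<in> U}" if "P \<in> ?O" for P
    using that fst_fun_measurable measurable_cong_sets[of P borel, OF _ refl] int[of P]
    by (auto simp: borel_probs_def intro!: prob_space.prob_space_distr)
  ultimately show ?case by blast
next
  case (inter A B)
  then obtain A2 B2 where "A2 \<in> weak_nbhds (pair_process \<mu>)" "\<forall>P\<in>A2. distr P borel (\<lambda>z g. fst (z g)) \<in> A"
    "B2 \<in> weak_nbhds (pair_process \<mu>)" "\<forall>P\<in>B2. distr P borel (\<lambda>z g. fst (z g)) \<in> B" by blast
  then show ?case by (intro bexI[of _ "A2 \<inter> B2"]) (auto intro: weak_nbhds_Int)
next
  case (superset A B)
  then show ?case by blast
qed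

lemma pairing_models_measurable:
  fixes m :: "('v \<Rightarrow> 'y::polish_space) measure"
  assumes "sets m = sets (PiM V (\<lambda>_. borel))"
  shows "(\<lambda>(x, x'). \<lambda>v\<in>V. (x v, x' v)) \<in> measurable (m \<Otimes>\<^sub>M m) (PiM V (\<lambda>_. borel :: ('y \<times> 'y) measure))"
proof -
  have "(\<lambda>p. \<lambda>v\<in>V. (fst p v, snd p v)) \<in> measurable (m \<Otimes>\<^sub>M m) (PiM V (\<lambda>_. borel :: ('y \<times> 'y) measure))"
  proof (rule measurable_restrict)
    fix v assume v: "v \<in> V"
    have "(\<lambda>x. x v) \<in> measurable m (borel :: 'y measure)"
      using measurable_cong_sets[OF assms refl] measurable_component_singleton[OF v] by blast
    then have "(\<lambda>p. (fst p v, snd p v)) \<in> measurable (m \<Otimes>\<^sub>M m) (borel \<Otimes>\<^sub>M borel :: ('y \<times> 'y) measure)"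
      by (intro measurable_Pair measurable_compose[OF measurable_fst] measurable_compose[OF measurable_snd])
    then show "(\<lambda>p. (fst p v, snd p v)) \<in> borel_measurable (m \<Otimes>\<^sub>M m)" by (simp add: borel_prod)
  qed
  then show ?thesis by (simp add: case_prod_beta')
qed

lemma distr_fst_pair_model_measure:
  fixes m :: "('v \<Rightarrow> 'y::polish_space) measure"
  assumes m: "prob_space m" "sets m = sets (PiM V (\<lambda>_. borel))"
    and f: "f \<in> measurable (PiM V (\<lambda>_. borel)) N"
  shows "distr (pair_model_measure V m) N (\<lambda>z. f (\<lambda>v\<in>V. fst (z v))) = distr m N f"
proof -
  interpret prob_space m by fact
  have meas: "(\<lambda>z. \<lambda>v\<in>V. fst (z v)) \<in> measurable (PiM V (\<lambda>_. borel :: ('y \<times> 'y) measure)) (PiM V (\<lambda>_. borel :: 'y measure))"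
    by (intro measurable_restrict measurable_compose[OF measurable_component_singleton])
       (auto intro: fst_borel)
  have sp: "x \<in> extensional V" if "x \<in> space m" for x
    using that sets_eq_imp_space_eq[OF m(2)] by (auto simp: space_PiM PiE_def)
  have fm: "f \<in> measurable m N" using f measurable_cong_sets[OF m(2) refl] by blast
  have "distr (pair_model_measure V m) N (\<lambda>z. f (\<lambda>v\<in>V. fst (z v))) = distr (m \<Otimes>\<^sub>M m) N (\<lambda>p. f (fst p))"
    unfolding pair_model_measure_def
    by (subst distr_distr[OF measurable_compose[OF meas f] pairing_models_measurable[OF m(2)]])
       (auto intro!: distr_cong arg_cong[where f=f]
          simp: comp_def case_prod_beta' space_pair_measure fun_eq_iff extensional_def dest!: sp)
  also have "\<dots> = distr (distr (m \<Otimes>\<^sub>M m) m fst) N f"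
    by (subst distr_distr[OF fm]) (auto simp: comp_def)
  finally show ?thesis by (simp add: distr_pair_fst)
qed

lemma pair_model_measure_prob:
  "prob_space m \<Longrightarrow> sets m = sets (PiM V (\<lambda>_. borel :: 'y::polish_space measure)) \<Longrightarrow>
    prob_space (pair_model_measure V m)"
  unfolding pair_model_measure_def
  by (intro prob_space.prob_space_distr pairing_models_measurable prob_space_pair)

lemma doubly_quenched_imp_quenched:
  fixes \<mu> :: "('g::countable \<Rightarrow> 'y::polish_space) measure"
  assumes V: "\<And>n. finite (V n) \<and> V n \<noteq> {}" and V\<sigma>: "\<And>n g v. v \<in> V n \<Longrightarrow> \<sigma> n g v \<in> V n"
    and \<mu>: "\<mu> \<in> borel_probs"
    and m: "model_measures V m" and dq: "doubly_quenched_converges V \<sigma> m \<mu>"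
  shows "quenched_converges V \<sigma> m \<mu>"
  unfolding quenched_converges_def
proof (rule ballI)
  fix \<O> assume \<O>: "\<O> \<in> weak_nbhds \<mu>"
  let ?h = "\<lambda>(z :: 'g \<Rightarrow> 'y \<times> 'y) g. fst (z g)"
  let ?m2 = "\<lambda>i. pair_model_measure (V i) (m i)"
  obtain \<O>2 where \<O>2: "\<O>2 \<in> weak_nbhds (pair_process \<mu>)" "\<And>P. P \<in> \<O>2 \<Longrightarrow> distr P borel ?h \<in> \<O>"
    using weak_nbhd_fst_preimage[OF \<O> \<mu>] by blast
  have mi: "prob_space (m i)" "sets (m i) = sets (PiM (V i) (\<lambda>_. borel))" for i
    using m by (auto simp: model_measures_def)
  have lim: "(\<lambda>i. real (card {v \<in> V i. distr (?m2 i) borel (pullback_name (\<sigma> i) v) \<in> \<O>2}) / real (card (V i))) \<longlonglongrightarrow> 1"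
    "(\<lambda>i. measure (?m2 i) (good_models \<O>2 (V i) (\<sigma> i))) \<longlonglongrightarrow> 1"
    using dq \<O>2(1) by (auto simp: doubly_quenched_converges_def quenched_converges_def)
  have fst_name: "?h (pullback_name (\<sigma> i) v z) = pullback_name (\<sigma> i) v (\<lambda>v\<in>V i. fst (z v))"
    if "v \<in> V i" for i v z using V\<sigma>[OF that] by (auto simp: pullback_name_def)
  show "(\<lambda>i. real (card {v \<in> V i. distr (m i) borel (pullback_name (\<sigma> i) v) \<in> \<O>}) / real (card (V i))) \<longlonglongrightarrow> 1 \<and>
        (\<lambda>i. measure (m i) (good_models \<O> (V i) (\<sigma> i))) \<longlonglongrightarrow> 1"
  proof (intro conjI)
    show "(\<lambda>i. real (card {v \<in> V i. distr (m i) borel (pullback_name (\<sigma> i) v) \<in> \<O>}) / real (card (V i))) \<longlonglongrightarrow> 1"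
    proof (rule tendsto_sandwich[OF _ _ lim(1) tendsto_const])
      show "eventually (\<lambda>i. real (card {v \<in> V i. distr (?m2 i) borel (pullback_name (\<sigma> i) v) \<in> \<O>2}) / real (card (V i))
         \<le> real (card {v \<in> V i. distr (m i) borel (pullback_name (\<sigma> i) v) \<in> \<O>}) / real (card (V i))) sequentially"
      proof (intro always_eventually allI divide_right_mono of_nat_mono card_mono)
        fix i
        show "{v \<in> V i. distr (?m2 i) borel (pullback_name (\<sigma> i) v) \<in> \<O>2}
          \<subseteq> {v \<in> V i. distr (m i) borel (pullback_name (\<sigma> i) v) \<in> \<O>}"
        proof safe
          fix v assume v: "v \<in> V i" and "distr (?m2 i) borel (pullback_name (\<sigma> i) v) \<in> \<O>2"
          then have "distr (distr (?m2 i) borel (pullback_name (\<sigma> i) v)) borel ?h \<in> \<O>" by (intro \<O>2(2))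
          also have "distr (distr (?m2 i) borel (pullback_name (\<sigma> i) v)) borel ?h
             = distr (?m2 i) borel (?h \<circ> pullback_name (\<sigma> i) v)"
            by (rule distr_distr[OF fst_fun_measurable])
               (auto simp: pair_model_measure_def intro: pullback_name_measurable)
          also have "?h \<circ> pullback_name (\<sigma> i) v = (\<lambda>z. pullback_name (\<sigma> i) v (\<lambda>v\<in>V i. fst (z v)))"
            using fst_name[OF v] by (auto simp: fun_eq_iff)
          also have "distr (?m2 i) borel \<dots> = distr (m i) borel (pullback_name (\<sigma> i) v)"
            by (rule distr_fst_pair_model_measure[OF mi]) simp
          finally show "distr (m i) borel (pullback_name (\<sigma> i) v) \<in> \<O>" .
        qed
      qed (use V in auto)
      show "eventually (\<lambda>i. real (card {v \<in> V i. distr (m i) borel (pullback_name (\<sigma> i) v) \<in> \<O>}) / real (card (V i)) \<le> 1) sequentially"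
        using V by (intro always_eventually allI) (auto simp: divide_le_eq_1 card_gt_0_iff intro!: card_mono)
    qed
    show "(\<lambda>i. measure (m i) (good_models \<O> (V i) (\<sigma> i))) \<longlonglongrightarrow> 1"
    proof (rule tendsto_sandwich[OF _ _ lim(2) tendsto_const])
      show "eventually (\<lambda>i. measure (m i) (good_models \<O> (V i) (\<sigma> i)) \<le> 1) sequentially"
        using mi by (intro always_eventually allI prob_space.prob_le_1)
      show "eventually (\<lambda>i. measure (?m2 i) (good_models \<O>2 (V i) (\<sigma> i)) \<le> measure (m i) (good_models \<O> (V i) (\<sigma> i))) sequentially"
      proof (intro always_eventually allI)
        fix i
        interpret m2: prob_space "?m2 i" by (rule pair_model_measure_prob[OF mi])
        let ?f = "\<lambda>x. x :: 'a \<Rightarrow> 'y"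
        have G: "good_models \<O> (V i) (\<sigma> i) \<in> sets (PiM (V i) (\<lambda>_. borel))"
          using \<O> V by (intro good_models_measurable) (auto simp: weak_nbhds_def)
        have meas: "(\<lambda>z. \<lambda>v\<in>V i. fst (z v)) \<in> measurable (?m2 i) (PiM (V i) (\<lambda>_. borel :: 'y measure))"
          unfolding pair_model_measure_def measurable_distr_eq1
          by (intro measurable_restrict measurable_compose[OF measurable_component_singleton])
             (auto intro: fst_borel)
        have "distr (m i) (PiM (V i) (\<lambda>_. borel)) (\<lambda>x. x) = m i"
          by (rule distr_id2) (use mi in auto)
        then have "measure (m i) (good_models \<O> (V i) (\<sigma> i)) =
           measure (distr (?m2 i) (PiM (V i) (\<lambda>_. borel)) (\<lambda>z. \<lambda>v\<in>V i. fst (z v))) (good_models \<O> (V i) (\<sigma> i))"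
          using distr_fst_pair_model_measure[OF mi, where f="\<lambda>x. x" and N="PiM (V i) (\<lambda>_. borel)"] by simp
        also have "\<dots> = measure (?m2 i) ((\<lambda>z. \<lambda>v\<in>V i. fst (z v)) -` good_models \<O> (V i) (\<sigma> i) \<inter> space (?m2 i))"
          using meas G by (rule measure_distr)
        also have "\<dots> \<ge> measure (?m2 i) (good_models \<O>2 (V i) (\<sigma> i))"
        proof (rule m2.finite_measure_mono)
          show "good_models \<O>2 (V i) (\<sigma> i) \<subseteq> (\<lambda>z. \<lambda>v\<in>V i. fst (z v)) -` good_models \<O> (V i) (\<sigma> i) \<inter> space (?m2 i)"
          proof
            fix z assume z: "z \<in> good_models \<O>2 (V i) (\<sigma> i)"
            then have "distr (empirical (V i) (\<sigma> i) z) borel ?h \<in> \<O>"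
              by (intro \<O>2(2)) (auto simp: good_models_def)
            also have "distr (empirical (V i) (\<sigma> i) z) borel ?h = empirical (V i) (\<sigma> i) (\<lambda>v\<in>V i. fst (z v))"
              unfolding empirical_def
              by (subst distr_distr[OF fst_fun_measurable])
                 (auto intro!: distr_cong simp: space_uniform_count_measure fst_name)
            finally show "z \<in> (\<lambda>z. \<lambda>v\<in>V i. fst (z v)) -` good_models \<O> (V i) (\<sigma> i) \<inter> space (?m2 i)"
              using z by (auto simp: good_models_def pair_model_measure_def space_PiM)
          qed
        qed (use meas G in \<open>rule measurable_sets\<close>)
        finally show "measure (?m2 i) (good_models \<O>2 (V i) (\<sigma> i)) \<le> measure (m i) (good_models \<O> (V i) (\<sigma> i))" .
      qed
    qed
  qed
qed

lemma doubly_quenched_entropy_le_quenched_entropy: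
  fixes \<mu> :: "('g::countable \<Rightarrow> 'y::polish_space) measure"
  assumes V: "\<And>n. finite (V n) \<and> V n \<noteq> {}" and V\<sigma>: "\<And>n g v. v \<in> V n \<Longrightarrow> \<sigma> n g v \<in> V n"
    and \<mu>: "\<mu> \<in> borel_probs"
  shows "doubly_quenched_entropy V \<sigma> \<mu> \<le> quenched_entropy V \<sigma> \<mu>"
  unfolding doubly_quenched_entropy_def quenched_entropy_def
proof (rule SUP_subset_mono)
  show "{(r, m). strict_mono r \<and> model_measures (V \<circ> r) m \<and> doubly_quenched_converges (V \<circ> r) (\<sigma> \<circ> r) m \<mu>}
    \<subseteq> {(r, m). strict_mono r \<and> model_measures (V \<circ> r) m \<and> quenched_converges (V \<circ> r) (\<sigma> \<circ> r) m \<mu>}"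
    using doubly_quenched_imp_quenched[of "V \<circ> _" "\<sigma> \<circ> _" \<mu>] V V\<sigma> \<mu> by auto
qed auto

section \<open>Covering numbers and separated sets\<close>

text \<open>A maximal separated set is dense, so separated points can be chosen greedily as long as
  there are fewer of them than the covering number.\<close>

lemma separated_set_of_set_cov:
  assumes sym: "\<And>x y. d x y = d y x" and pos: "\<And>z. z \<in> Z \<Longrightarrow> d z z < \<delta>"
    and N: "enat N \<le> set_cov \<delta> Z d"
  shows "\<exists>S\<subseteq>Z. finite S \<and> card S = N \<and> (\<forall>x\<in>S. \<forall>y\<in>S. x \<noteq> y \<longrightarrow> d x y \<ge> \<delta>)"
  using N
proof (induction N)
  case 0
  then show ?case by (intro exI[of _ "{}"]) auto
next
  case (Suc N)
  have "enat N \<le> set_cov \<delta> Z d" using Suc.prems by (meson enat_ord_simps(1) le_SucI order_refl order_trans)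
  then obtain S where S: "S \<subseteq> Z" "finite S" "card S = N" "\<forall>x\<in>S. \<forall>y\<in>S. x \<noteq> y \<longrightarrow> d x y \<ge> \<delta>"
    using Suc.IH by blast
  have "\<not> (\<forall>z\<in>Z. \<exists>f\<in>S. d f z < \<delta>)"
  proof
    assume "\<forall>z\<in>Z. \<exists>f\<in>S. d f z < \<delta>"
    then have "set_cov \<delta> Z d \<le> enat (card S)"
      unfolding set_cov_def using S by (intro INF_lower) auto
    then show False using Suc.prems S(3) by (metis Suc_n_not_le_n enat_ord_simps(1) order_trans)
  qed
  then obtain z where z: "z \<in> Z" "\<And>f. f \<in> S \<Longrightarrow> d f z \<ge> \<delta>" by (auto simp: not_less)
  then have "z \<notin> S" using pos by force
  then show ?case
    using S z sym by (intro exI[of _ "insert z S"]) auto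
qed

lemma log_enat_measure_cov_ge:
  assumes "\<And>F. finite F \<Longrightarrow> F \<subseteq> space \<nu> \<Longrightarrow> measure \<nu> {y \<in> space \<nu>. \<exists>f\<in>F. d f y < \<delta>} > 1 - \<epsilon> \<Longrightarrow>
     exp x \<le> real (card F)"
  shows "log_enat (measure_cov \<epsilon> \<delta> \<nu> d) \<ge> ereal x"
proof -
  let ?A = "{F. finite F \<and> F \<subseteq> space \<nu> \<and> measure \<nu> {y \<in> space \<nu>. \<exists>f\<in>F. d f y < \<delta>} > 1 - \<epsilon>}"
  show ?thesis
  proof (cases "?A = {}")
    case True
    then have "measure_cov \<epsilon> \<delta> \<nu> d = \<infinity>" unfolding measure_cov_def True by (simp add: top_enat_def)
    then show ?thesis by (simp add: log_enat_def)
  next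
    case False
    then have "measure_cov \<epsilon> \<delta> \<nu> d \<in> (\<lambda>F. enat (card F)) ` ?A"
      unfolding measure_cov_def Inf_enat_def by (auto intro: LeastI)
    then obtain F where F: "F \<in> ?A" "measure_cov \<epsilon> \<delta> \<nu> d = enat (card F)" by auto
    then have "exp x \<le> real (card F)" using assms by auto
    then have "card F > 0" using exp_gt_zero[of x] by linarith
    then show ?thesis using F(2) \<open>exp x \<le> real (card F)\<close>
      by (auto simp: log_enat_def ln_ge_iff)
  qed
qed

section \<open>Finite patterns and weak laws\<close>

definition depends_only_on :: "'k set \<Rightarrow> (('k \<Rightarrow> 'c) \<Rightarrow> 'b) \<Rightarrow> bool" where
  "depends_only_on D F \<longleftrightarrow> (\<forall>a b. (\<forall>k\<in>D. a k = b k) \<longrightarrow> F a = F b)"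

lemma depends_only_onD: "depends_only_on D F \<Longrightarrow> (\<And>k. k \<in> D \<Longrightarrow> a k = b k) \<Longrightarrow> F a = F b"
  by (auto simp: depends_only_on_def)

lemma depends_only_on_mono: "depends_only_on D F \<Longrightarrow> D \<subseteq> D' \<Longrightarrow> depends_only_on D' F"
  unfolding depends_only_on_def by blast

lemma pattern_measurable:
  fixes c :: "'k \<Rightarrow> 'n \<Rightarrow> 'c::countable"
  assumes "finite D" "\<And>k. k \<in> D \<Longrightarrow> c k \<in> measurable N (count_space UNIV)" "depends_only_on D P"
  shows "{x \<in> space N. P (\<lambda>k. c k x)} \<in> sets N"
  using assms
proof (induction D arbitrary: P rule: finite_induct)
  case empty
  then have "P (\<lambda>k. c k x) = P undefined" for x
    by (intro depends_only_onD[OF empty(2)]) auto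
  then show ?case by simp
next
  case (insert k D)
  have "{x \<in> space N. P ((\<lambda>k. c k x)(k := i))} \<in> sets N" for i
  proof (rule insert.IH)
    show "depends_only_on D (\<lambda>a. P (a(k := i)))"
      using insert.prems(2) by (fastforce simp: depends_only_on_def intro!: depends_only_onD[OF insert.prems(2)])
  qed (use insert in auto)
  moreover have "c k -` {i} \<inter> space N \<in> sets N" for i
    using insert.prems(1)[of k] by (intro measurable_sets) auto
  ultimately have "(\<Union>i. (c k -` {i} \<inter> space N) \<inter> {x \<in> space N. P ((\<lambda>k. c k x)(k := i))}) \<in> sets N"
    by (intro sets.countable_UN sets.Int) auto
  moreover have "(\<lambda>k. c k x)(k := c k x) = (\<lambda>k. c k x)" for x by auto
  then have "(\<Union>i. (c k -` {i} \<inter> space N) \<inter> {x \<in> space N. P ((\<lambda>k. c k x)(k := i))}) = {x \<in> space N. P (\<lambda>k. c k x)}"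
    by auto
  ultimately show ?case by simp
qed

lemma pattern_event_measurable:
  fixes c :: "'k \<Rightarrow> 'n \<Rightarrow> 'c::countable"
  assumes "finite D" "\<And>k. k \<in> D \<Longrightarrow> c k \<in> measurable N (count_space UNIV)"
  shows "{x \<in> space N. \<forall>k\<in>D. c k x = a k} \<in> sets N"
  using assms by (intro pattern_measurable[where P="\<lambda>b. \<forall>k\<in>D. b k = a k"]) (auto simp: depends_only_on_def)

lemma (in prob_space) expectation_pattern:
  fixes c :: "'k \<Rightarrow> 'a \<Rightarrow> 'c::countable" and F :: "('k \<Rightarrow> 'c) \<Rightarrow> real"
  assumes D: "finite D" and C: "finite C"
    and c: "\<And>k. k \<in> D \<Longrightarrow> c k \<in> measurable M (count_space UNIV)"
    and cC: "\<And>k x. k \<in> D \<Longrightarrow> x \<in> space M \<Longrightarrow> c k x \<in> C"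
    and F: "depends_only_on D F"
  shows "integrable M (\<lambda>x. F (\<lambda>k. c k x))"
    and "(\<integral>x. F (\<lambda>k. c k x) \<partial>M) = (\<Sum>a\<in>D \<rightarrow>\<^sub>E C. F a * prob {x \<in> space M. \<forall>k\<in>D. c k x = a k})"
proof -
  let ?E = "\<lambda>a. {x \<in> space M. \<forall>k\<in>D. c k x = a k}"
  have E: "?E a \<in> sets M" for a using D c by (rule pattern_event_measurable)
  have fin: "finite (D \<rightarrow>\<^sub>E C)" using D C by (rule finite_PiE)
  have eq: "F (\<lambda>k. c k x) = (\<Sum>a\<in>D \<rightarrow>\<^sub>E C. F a * indicator (?E a) x)" if x: "x \<in> space M" for x
  proof -
    let ?b = "\<lambda>k\<in>D. c k x"
    have b: "?b \<in> D \<rightarrow>\<^sub>E C" using cC x by auto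
    have "(\<Sum>a\<in>D \<rightarrow>\<^sub>E C. F a * indicator (?E a) x) = (\<Sum>a\<in>{?b}. F a * indicator (?E a) x)"
    proof (rule sum.mono_neutral_right[OF fin])
      show "\<forall>i\<in>(D \<rightarrow>\<^sub>E C) - {?b}. F i * indicator (?E i) x = 0"
      proof
        fix i assume i: "i \<in> (D \<rightarrow>\<^sub>E C) - {?b}"
        then have "x \<notin> ?E i" by (auto simp: PiE_def extensional_def restrict_def fun_eq_iff) metis
        then show "F i * indicator (?E i) x = 0" by simp
      qed
    qed (use b in auto)
    also have "\<dots> = F ?b" using x by (auto simp: indicator_def)
    also have "\<dots> = F (\<lambda>k. c k x)" by (rule depends_only_onD[OF F]) auto
    finally show ?thesis by simp
  qed
  have int: "integrable M (\<lambda>x. \<Sum>a\<in>D \<rightarrow>\<^sub>E C. F a * indicator (?E a) x)"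
    using E by (intro Bochner_Integration.integrable_sum integrable_mult_right integrable_real_indicator)
      (auto simp: less_top[symmetric])
  then show "integrable M (\<lambda>x. F (\<lambda>k. c k x))"
    by (rule Bochner_Integration.integrable_cong[THEN iffD2, OF refl, rotated]) (rule eq)
  have "(\<integral>x. F (\<lambda>k. c k x) \<partial>M) = (\<integral>x. (\<Sum>a\<in>D \<rightarrow>\<^sub>E C. F a * indicator (?E a) x) \<partial>M)"
    by (rule Bochner_Integration.integral_cong[OF refl]) (rule eq)
  also have "\<dots> = (\<Sum>a\<in>D \<rightarrow>\<^sub>E C. (\<integral>x. F a * indicator (?E a) x \<partial>M))"
    using E by (intro Bochner_Integration.integral_sum integrable_mult_right integrable_real_indicator)
      (auto simp: less_top[symmetric])
  also have "\<dots> = (\<Sum>a\<in>D \<rightarrow>\<^sub>E C. F a * prob (?E a))"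
    using E by (intro sum.cong refl) (simp add: Int_absorb2 sets.sets_into_space)
  finally show "(\<integral>x. F (\<lambda>k. c k x) \<partial>M) = (\<Sum>a\<in>D \<rightarrow>\<^sub>E C. F a * prob (?E a))" .
qed

text \<open>The total variation distance of two distributions on \<open>D \<rightarrow>\<^sub>E C\<close> is bounded through their
  point masses.\<close>

lemma expectation_pattern_close:
  fixes c :: "'k \<Rightarrow> 'n \<Rightarrow> 'c::countable" and c' :: "'k \<Rightarrow> 'm \<Rightarrow> 'c" and F :: "('k \<Rightarrow> 'c) \<Rightarrow> real"
  assumes N: "prob_space N" "prob_space N'" and D: "finite D" and C: "finite C"
    and c: "\<And>k. k \<in> D \<Longrightarrow> c k \<in> measurable N (count_space UNIV)"
      "\<And>k x. k \<in> D \<Longrightarrow> x \<in> space N \<Longrightarrow> c k x \<in> C"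
    and c': "\<And>k. k \<in> D \<Longrightarrow> c' k \<in> measurable N' (count_space UNIV)"
      "\<And>k x. k \<in> D \<Longrightarrow> x \<in> space N' \<Longrightarrow> c' k x \<in> C"
    and F: "depends_only_on D F" and F1: "\<And>a. \<bar>F a\<bar> \<le> 1"
    and close: "\<And>a. a \<in> D \<rightarrow>\<^sub>E C \<Longrightarrow> \<bar>measure N {x \<in> space N. \<forall>k\<in>D. c k x = a k}
        - measure N' {x \<in> space N'. \<forall>k\<in>D. c' k x = a k}\<bar> \<le> e"
  shows "\<bar>(\<integral>x. F (\<lambda>k. c k x) \<partial>N) - (\<integral>x. F (\<lambda>k. c' k x) \<partial>N')\<bar> \<le> real (card C ^ card D) * e"
proof -
  have "\<bar>(\<integral>x. F (\<lambda>k. c k x) \<partial>N) - (\<integral>x. F (\<lambda>k. c' k x) \<partial>N')\<bar>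
    = \<bar>\<Sum>a\<in>D \<rightarrow>\<^sub>E C. F a * (measure N {x \<in> space N. \<forall>k\<in>D. c k x = a k} - measure N' {x \<in> space N'. \<forall>k\<in>D. c' k x = a k})\<bar>"
    by (subst prob_space.expectation_pattern(2)[OF N(1) D C c F], assumption, assumption, assumption,
        subst prob_space.expectation_pattern(2)[OF N(2) D C c' F])
       (auto simp: sum_subtractf[symmetric] algebra_simps)
  also have "\<dots> \<le> (\<Sum>a\<in>D \<rightarrow>\<^sub>E C. \<bar>F a * (measure N {x \<in> space N. \<forall>k\<in>D. c k x = a k} - measure N' {x \<in> space N'. \<forall>k\<in>D. c' k x = a k})\<bar>)"
    by (rule sum_abs)
  also have "\<dots> \<le> (\<Sum>a\<in>D \<rightarrow>\<^sub>E C. e)"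
  proof (rule sum_mono)
    fix a assume "a \<in> D \<rightarrow>\<^sub>E C"
    from close[OF this] F1[of a]
    show "\<bar>F a * (measure N {x \<in> space N. \<forall>k\<in>D. c k x = a k} - measure N' {x \<in> space N'. \<forall>k\<in>D. c' k x = a k})\<bar> \<le> e"
      unfolding abs_mult by (meson abs_ge_zero mult_left_le_one_le order_trans)
  qed
  also have "\<dots> = real (card C ^ card D) * e" using D by (simp add: card_PiE)
  finally show ?thesis .
qed

text \<open>Chebyshev's inequality for variables that are bounded by \<open>B\<close> and uncorrelated except for
  the pairs in \<open>R\<close>, each of which contributes at most \<open>2 * B\<^sup>2\<close> to the variance.\<close>

lemma (in prob_space) weak_law:
  fixes X :: "'i \<Rightarrow> 'a \<Rightarrow> real"
  assumes I: "finite I" and X: "\<And>i. i \<in> I \<Longrightarrow> random_variable borel (X i)"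
    and B: "\<And>i x. i \<in> I \<Longrightarrow> x \<in> space M \<Longrightarrow> \<bar>X i x\<bar> \<le> B"
    and R: "R \<subseteq> I \<times> I"
    and uncor: "\<And>i j. i \<in> I \<Longrightarrow> j \<in> I \<Longrightarrow> (i, j) \<notin> R \<Longrightarrow>
        expectation (\<lambda>x. X i x * X j x) = expectation (X i) * expectation (X j)"
    and t: "t > 0"
  shows "prob {x \<in> space M. t \<le> \<bar>(\<Sum>i\<in>I. X i x) - (\<Sum>i\<in>I. expectation (X i))\<bar>} \<le> 2 * B\<^sup>2 * real (card R) / t\<^sup>2"
proof -
  let ?Z = "\<lambda>x. \<Sum>i\<in>I. X i x"
  have finR: "finite R" using R I finite_subset by blast
  have B0: "B \<ge> 0" if "i \<in> I" for i
    using not_empty B[OF that] by (metis abs_ge_zero all_not_in_conv order_trans)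
  have int1: "integrable M (X i)" if "i \<in> I" for i
    by (rule integrable_const_bound[where B=B]) (use X B that in auto)
  have XX: "\<bar>X i x * X j x\<bar> \<le> B * B" if "i \<in> I" "j \<in> I" "x \<in> space M" for i j x
    unfolding abs_mult using that B by (intro mult_mono) (auto intro: B0)
  have int2: "integrable M (\<lambda>x. X i x * X j x)" if "i \<in> I" "j \<in> I" for i j
    by (rule integrable_const_bound[where B="B * B"]) (use X XX that in auto)
  have Z2: "(?Z x)\<^sup>2 = (\<Sum>(i, j)\<in>I \<times> I. X i x * X j x)" for x
    by (simp add: power2_eq_square sum_product sum.cartesian_product)
  have EZ: "expectation ?Z = (\<Sum>i\<in>I. expectation (X i))"
    using int1 by (intro Bochner_Integration.integral_sum)
  have intZ: "integrable M ?Z" using int1 by (intro Bochner_Integration.integrable_sum)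
  have intZ2: "integrable M (\<lambda>x. (?Z x)\<^sup>2)"
    unfolding Z2 using int2 by (intro Bochner_Integration.integrable_sum) auto
  have le: "\<bar>expectation f\<bar> \<le> b" if "\<And>x. x \<in> space M \<Longrightarrow> \<bar>f x\<bar> \<le> b" "integrable M f" for f :: "'a \<Rightarrow> real" and b
  proof -
    have "\<bar>expectation f\<bar> \<le> expectation (\<lambda>x. \<bar>f x\<bar>)" by (rule integral_abs_bound)
    also have "\<dots> \<le> expectation (\<lambda>x. b)" using that by (intro integral_mono) auto
    finally show ?thesis by (simp add: prob_space)
  qed
  have "variance ?Z = expectation (\<lambda>x. (?Z x)\<^sup>2) - (expectation ?Z)\<^sup>2"
    by (rule variance_eq[OF intZ intZ2])
  also have "expectation (\<lambda>x. (?Z x)\<^sup>2) = (\<Sum>(i, j)\<in>I \<times> I. expectation (\<lambda>x. X i x * X j x))"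
    unfolding Z2 using int2 by (subst Bochner_Integration.integral_sum) (auto simp: case_prod_beta' intro!: sum.cong)
  also have "(expectation ?Z)\<^sup>2 = (\<Sum>(i, j)\<in>I \<times> I. expectation (X i) * expectation (X j))"
    unfolding EZ by (simp add: power2_eq_square sum_product sum.cartesian_product)
  also have "(\<Sum>(i, j)\<in>I \<times> I. expectation (\<lambda>x. X i x * X j x)) - (\<Sum>(i, j)\<in>I \<times> I. expectation (X i) * expectation (X j))
    = (\<Sum>(i, j)\<in>I \<times> I. expectation (\<lambda>x. X i x * X j x) - expectation (X i) * expectation (X j))"
    by (simp add: sum_subtractf case_prod_beta')
  also have "\<dots> \<le> (\<Sum>p\<in>I \<times> I. if p \<in> R then 2 * B\<^sup>2 else 0)"
  proof (rule sum_mono, clarify)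
    fix i j assume ij: "i \<in> I" "j \<in> I"
    show "expectation (\<lambda>x. X i x * X j x) - expectation (X i) * expectation (X j) \<le> (if (i, j) \<in> R then 2 * B\<^sup>2 else 0)"
    proof (cases "(i, j) \<in> R")
      case True
      have "\<bar>expectation (\<lambda>x. X i x * X j x)\<bar> \<le> B * B" using XX int2 ij by (intro le) auto
      moreover have "\<bar>expectation (X i) * expectation (X j)\<bar> \<le> B * B"
        unfolding abs_mult using ij B int1 by (intro mult_mono le) (auto intro: B0)
      ultimately show ?thesis using True by (simp add: power2_eq_square abs_le_iff)
    next
      case False
      then show ?thesis using uncor ij by simp
    qed
  qed
  also have "\<dots> = 2 * B\<^sup>2 * real (card R)"
    using R I finR by (subst sum.If_cases) (auto simp: Int_absorb1)
  finally have var: "variance ?Z \<le> 2 * B\<^sup>2 * real (card R)" .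
  have "prob {x \<in> space M. t \<le> \<bar>?Z x - expectation ?Z\<bar>} \<le> variance ?Z / t\<^sup>2"
    using X t intZ2 by (intro Chebyshev_inequality borel_measurable_sum) auto
  also have "\<dots> \<le> 2 * B\<^sup>2 * real (card R) / t\<^sup>2" by (rule divide_right_mono[OF var]) simp
  finally show ?thesis by (simp add: EZ)
qed

lemma expectation_Pi_pmf_disjoint:
  fixes f g :: "('w \<Rightarrow> 'j) \<Rightarrow> real"
  assumes W: "finite W" and q: "finite (set_pmf q)" and A: "A \<subseteq> W" "B \<subseteq> W" "A \<inter> B = {}"
    and f: "depends_only_on A f" and g: "depends_only_on B g"
  shows "measure_pmf.expectation (Pi_pmf W d (\<lambda>_. q)) (\<lambda>z. f z * g z)
     = measure_pmf.expectation (Pi_pmf W d (\<lambda>_. q)) f * measure_pmf.expectation (Pi_pmf W d (\<lambda>_. q)) g"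
proof -
  let ?PA = "Pi_pmf A d (\<lambda>_. q)" and ?PB = "Pi_pmf (W - A) d (\<lambda>_. q)"
  let ?mix = "\<lambda>(a, b) x. if x \<in> A then a x else b x"
  have finA: "finite A" "finite (W - A)" using W A finite_subset by auto
  have fin: "finite (set_pmf ?PA)" "finite (set_pmf ?PB)"
    using finA q by (auto simp: set_Pi_pmf intro!: finite_PiE_dflt)
  have WA: "A \<union> (W - A) = W" using A by auto
  have P: "Pi_pmf W d (\<lambda>_. q) = map_pmf ?mix (pair_pmf ?PA ?PB)"
    using Pi_pmf_union[OF finA, of d "\<lambda>_. q"] unfolding WA by blast
  have E: "measure_pmf.expectation (Pi_pmf W d (\<lambda>_. q)) h
     = (\<Sum>a\<in>set_pmf ?PA. \<Sum>b\<in>set_pmf ?PB. h (?mix (a, b)) * (pmf ?PA a * pmf ?PB b))" for h :: "_ \<Rightarrow> real"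
    unfolding P integral_map_pmf using fin
    by (subst integral_measure_pmf_real[of "set_pmf ?PA \<times> set_pmf ?PB"])
       (auto simp: pmf_pair sum.cartesian_product intro!: sum.cong)
  have fm: "f (?mix (a, b)) = f a" for a b by (rule depends_only_onD[OF f]) auto
  have gm: "g (?mix (a, b)) = g b" for a b by (rule depends_only_onD[OF g]) (use A in auto)
  have sA: "(\<Sum>a\<in>set_pmf ?PA. pmf ?PA a) = 1" "(\<Sum>b\<in>set_pmf ?PB. pmf ?PB b) = 1"
    using fin by (auto intro!: sum_pmf_eq_1)
  have "measure_pmf.expectation (Pi_pmf W d (\<lambda>_. q)) f = (\<Sum>a\<in>set_pmf ?PA. f a * pmf ?PA a) * (\<Sum>b\<in>set_pmf ?PB. pmf ?PB b)"
    unfolding E fm sum_product by (simp add: algebra_simps)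
  moreover have "measure_pmf.expectation (Pi_pmf W d (\<lambda>_. q)) g = (\<Sum>a\<in>set_pmf ?PA. pmf ?PA a) * (\<Sum>b\<in>set_pmf ?PB. g b * pmf ?PB b)"
    unfolding E gm sum_product by (simp add: algebra_simps)
  moreover have "measure_pmf.expectation (Pi_pmf W d (\<lambda>_. q)) (\<lambda>z. f z * g z) = (\<Sum>a\<in>set_pmf ?PA. f a * pmf ?PA a) * (\<Sum>b\<in>set_pmf ?PB. g b * pmf ?PB b)"
    unfolding E fm gm sum_product by (simp add: algebra_simps)
  ultimately show ?thesis using sA by simp
qed

lemma Pi_pmf_pair:
  assumes W: "finite W"
  shows "Pi_pmf W (d, d') (\<lambda>_. pair_pmf q q')
     = map_pmf (\<lambda>(a, b) w. (a w, b w)) (pair_pmf (Pi_pmf W d (\<lambda>_. q)) (Pi_pmf W d' (\<lambda>_. q')))"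
proof (rule pmf_eqI)
  fix z :: "'a \<Rightarrow> 'b \<times> 'c"
  let ?h = "\<lambda>(a, b) w. (a w, b w)" and ?P = "pair_pmf (Pi_pmf W d (\<lambda>_. q)) (Pi_pmf W d' (\<lambda>_. q'))"
  have inj: "inj ?h" by (auto simp: inj_on_def fun_eq_iff)
  have z: "z = ?h (fst \<circ> z, snd \<circ> z)" by auto
  have "pmf (map_pmf ?h ?P) z = pmf ?P (fst \<circ> z, snd \<circ> z)"
    by (subst (1) z) (rule pmf_map_inj'[OF inj])
  also have "\<dots> = pmf (Pi_pmf W (d, d') (\<lambda>_. pair_pmf q q')) z"
    using W by (auto simp: pmf_pair pmf_Pi prod.distrib prod_eq_iff split: prod.splits)
       (auto simp: pmf_pair intro!: prod.cong simp flip: prod.distrib, metis prod.collapse pmf_pair)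
  finally show "pmf (Pi_pmf W (d, d') (\<lambda>_. pair_pmf q q')) z = pmf (map_pmf ?h ?P) z" by simp
qed

lemma card_markov:
  fixes f :: "'a \<Rightarrow> real"
  assumes "finite A" "\<And>a. a \<in> A \<Longrightarrow> f a \<ge> 0"
  shows "t * real (card {a \<in> A. f a \<ge> t}) \<le> (\<Sum>a\<in>A. f a)"
proof -
  have "t * real (card {a \<in> A. f a \<ge> t}) = (\<Sum>a\<in>{a \<in> A. f a \<ge> t}. t)" by simp
  also have "\<dots> \<le> (\<Sum>a\<in>{a \<in> A. f a \<ge> t}. f a)" by (rule sum_mono) auto
  also have "\<dots> \<le> (\<Sum>a\<in>A. f a)" using assms by (intro sum_mono2) auto
  finally show ?thesis .
qed

lemma prod_diff_le_sum:
  fixes a b :: "'a \<Rightarrow> real"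
  assumes "finite I" "\<And>i. i \<in> I \<Longrightarrow> 0 \<le> a i \<and> a i \<le> 1" "\<And>i. i \<in> I \<Longrightarrow> 0 \<le> b i \<and> b i \<le> 1"
  shows "\<bar>(\<Prod>i\<in>I. a i) - (\<Prod>i\<in>I. b i)\<bar> \<le> (\<Sum>i\<in>I. \<bar>a i - b i\<bar>)"
  using norm_prod_diff[of I a b] assms by auto

section \<open>Models with independent rows\<close>

text \<open>The seed \<open>z w\<close> selects a row \<open>\<rho> (z w)\<close>, which is a function on \<open>V\<close>, and \<open>\<phi>\<close> turns the
  entries at the place \<open>v\<close> of the rows in the orbit of \<open>w\<close> into a value.\<close>

definition row_model :: "('h \<Rightarrow> 'w \<Rightarrow> 'w) \<Rightarrow> ('j \<Rightarrow> 'v \<Rightarrow> 'c) \<Rightarrow> (('h \<Rightarrow> 'c) \<Rightarrow> 'y) \<Rightarrow> ('w \<Rightarrow> 'j) \<Rightarrow> 'v \<times> 'w \<Rightarrow> 'y" where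
  "row_model \<tau> \<rho> \<phi> z u = \<phi> (\<lambda>h. \<rho> (z (\<tau> h (snd u))) (fst u))"

text \<open>The array that is seen from the point \<open>u\<close>: the two coordinates of the group element move in
  the row and between rows.\<close>

definition row_pattern :: "('g \<Rightarrow> 'v \<Rightarrow> 'v) \<Rightarrow> ('h \<Rightarrow> 'w \<Rightarrow> 'w) \<Rightarrow> ('j \<Rightarrow> 'v \<Rightarrow> 'c) \<Rightarrow> ('w \<Rightarrow> 'j) \<Rightarrow> 'v \<times> 'w \<Rightarrow> 'g \<times> 'h \<Rightarrow> 'c" where
  "row_pattern \<sigma> \<tau> \<rho> z u k = \<rho> (z (\<tau> (snd k) (snd u))) (\<sigma> (fst k) (fst u))"

text \<open>The process that \<open>\<phi>\<close> produces from an array on \<open>G \<times> H\<close>, as \<^const>\<open>row_model\<close> does on \<open>V \<times> W\<close>.\<close>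

definition decode :: "(('h::plus \<Rightarrow> 'c) \<Rightarrow> 'y) \<Rightarrow> ('g \<times> 'h \<Rightarrow> 'c) \<Rightarrow> 'g \<times> 'h \<Rightarrow> 'y" where
  "decode \<phi> a k = \<phi> (\<lambda>h. a (fst k, h + snd k))"

text \<open>The rows are drawn independently from the distribution \<open>q\<close> of seeds. Outside a small set
  \<open>Vb\<close> of places, the pattern of one random row on \<open>DG\<close> has nearly the law \<open>lam\<close>, and outside a
  small set \<open>Wb\<close> of rows, \<open>\<tau>\<close> acts like a free action as far as the window sees. The array \<open>c\<close> over
  \<open>N\<close> is the ideal object that is to be imitated: its rows are independent with law \<open>lam\<close> exactly.
  Windows \<open>DG \<times> DH\<close> of the decoded process are determined by the array on \<open>DG \<times> EE\<close>.\<close>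

locale independent_rows =
  fixes V :: "'v set" and W :: "'w set"
    and \<sigma> :: "'g::{group_add,countable} \<Rightarrow> 'v \<Rightarrow> 'v" and \<tau> :: "'h::{group_add,countable} \<Rightarrow> 'w \<Rightarrow> 'w"
    and q :: "'j pmf" and d :: 'j and \<rho> :: "'j \<Rightarrow> 'v \<Rightarrow> 'c::countable"
    and \<phi> :: "('h \<Rightarrow> 'c) \<Rightarrow> 'y::{metric_space,second_countable_topology}"
    and C :: "'c set" and E :: "'h set" and DG :: "'g set" and DH :: "'h set" and EE :: "'h set"
    and Vb :: "'v set" and Wb :: "'w set" and e :: real and b :: real and lam :: "('g \<Rightarrow> 'c) \<Rightarrow> real"
    and N :: "'n measure" and c :: "'g \<times> 'h \<Rightarrow> 'n \<Rightarrow> 'c"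
  assumes V: "finite V" "V \<noteq> {}" and W: "finite W" "W \<noteq> {}"
    and \<sigma>: "\<And>g v. v \<in> V \<Longrightarrow> \<sigma> g v \<in> V" and \<tau>: "\<And>h. bij_betw (\<tau> h) W W"
    and q: "finite (set_pmf q)" and C: "finite C" and \<rho>: "\<And>j v. \<rho> j v \<in> C"
    and E: "finite E" and DG: "finite DG" and DH: "finite DH" and \<phi>: "depends_only_on E \<phi>"
    and EE: "EE = (\<lambda>(h, h'). h + h') ` (E \<times> DH)"
    and Vb: "real (card (V \<inter> Vb)) \<le> b * real (card V)" and Wb: "real (card (W \<inter> Wb)) \<le> b * real (card W)"
    and rows: "\<And>v a. v \<in> V \<Longrightarrow> v \<notin> Vb \<Longrightarrow> a \<in> DG \<rightarrow>\<^sub>E C \<Longrightarrow>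
        \<bar>measure_pmf.prob q {j. \<forall>g\<in>DG. \<rho> j (\<sigma> g v) = a g} - lam a\<bar> \<le> e"
    and e0: "e \<ge> 0" and lam: "\<And>a. 0 \<le> lam a \<and> lam a \<le> 1"
    and compat: "\<And>w h h'. w \<in> W \<Longrightarrow> w \<notin> Wb \<Longrightarrow> h \<in> E \<Longrightarrow> h' \<in> DH \<Longrightarrow> \<tau> h (\<tau> h' w) = \<tau> (h + h') w"
    and free: "\<And>w. w \<in> W \<Longrightarrow> w \<notin> Wb \<Longrightarrow> inj_on (\<lambda>h. \<tau> h w) EE"
    and N: "prob_space N" and c: "\<And>k. c k \<in> measurable N (count_space UNIV)"
    and cC: "\<And>k x. x \<in> space N \<Longrightarrow> c k x \<in> C"
    and row_law: "\<And>a. a \<in> DG \<times> EE \<rightarrow>\<^sub>E C \<Longrightarrow> measure N {x \<in> space N. \<forall>k\<in>DG \<times> EE. c k x = a k}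
        = (\<Prod>h\<in>EE. lam (\<lambda>g\<in>DG. a (g, h)))"
begin

text \<open>A bound for the total variation distance between the law of the array seen from a good point
  and the law of the ideal array, on the window \<open>DG \<times> EE\<close>. Each of the \<open>card EE\<close> independent rows
  contributes \<open>e\<close> to the error of each pattern.\<close>

definition window_error :: real where "window_error = real (card C ^ card (DG \<times> EE)) * (real (card EE) * e)"

abbreviation "P \<equiv> Pi_pmf W d (\<lambda>_. q)"
abbreviation "\<alpha> \<equiv> row_pattern \<sigma> \<tau> \<rho>"
abbreviation "model z \<equiv> restrict (row_model \<tau> \<rho> \<phi> z) (V \<times> W)"
abbreviation "s \<equiv> (\<lambda>k. map_prod (\<sigma> (fst k)) (\<tau> (snd k)))"

lemma finEE: "finite EE" using E DH by (simp add: EE)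

lemma \<tau>W: "w \<in> W \<Longrightarrow> \<tau> h w \<in> W"
  using \<tau> bij_betwE by blast

text \<open>Distinct points of an orbit carry independent seeds, so that the rows of a window are
  independent.\<close>

lemma window_prob:
  assumes v: "v \<in> V" and w: "w \<in> W" "w \<notin> Wb"
  shows "measure_pmf.prob P {z. \<forall>k\<in>DG \<times> EE. \<alpha> z (v, w) k = a k}
    = (\<Prod>h\<in>EE. measure_pmf.prob q {j. \<forall>g\<in>DG. \<rho> j (\<sigma> g v) = a (g, h)})"
proof -
  let ?B = "\<lambda>w'. {j. \<forall>h\<in>EE. \<tau> h w = w' \<longrightarrow> (\<forall>g\<in>DG. \<rho> j (\<sigma> g v) = a (g, h))}"
  let ?im = "(\<lambda>h. \<tau> h w) ` EE"
  have "{z. \<forall>k\<in>DG \<times> EE. \<alpha> z (v, w) k = a k} = Pi W ?B"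
    using \<tau>W[OF w(1)] by (auto simp: row_pattern_def Pi_iff)
  then have "measure_pmf.prob P {z. \<forall>k\<in>DG \<times> EE. \<alpha> z (v, w) k = a k} = (\<Prod>w'\<in>W. measure_pmf.prob q (?B w'))"
    using W by (simp add: measure_Pi_pmf_Pi)
  also have "\<dots> = (\<Prod>w'\<in>?im. measure_pmf.prob q (?B w'))"
  proof (rule prod.mono_neutral_right)
    show "\<forall>i\<in>W - ?im. measure_pmf.prob q (?B i) = 1"
    proof
      fix i assume i: "i \<in> W - ?im"
      then have "?B i = UNIV" by blast
      then show "measure_pmf.prob q (?B i) = 1" by simp
    qed
  qed (use W \<tau>W[OF w(1)] in auto)
  also have "\<dots> = (\<Prod>h\<in>EE. measure_pmf.prob q (?B (\<tau> h w)))"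
    using free[OF w] by (subst prod.reindex) auto
  also have "\<dots> = (\<Prod>h\<in>EE. measure_pmf.prob q {j. \<forall>g\<in>DG. \<rho> j (\<sigma> g v) = a (g, h)})"
  proof (intro prod.cong refl arg_cong[where f="measure_pmf.prob q"])
    fix h assume "h \<in> EE"
    then show "?B (\<tau> h w) = {j. \<forall>g\<in>DG. \<rho> j (\<sigma> g v) = a (g, h)}"
      using free[OF w] by (auto simp: inj_on_def)
  qed
  finally show ?thesis .
qed

lemma local_law:
  assumes v: "v \<in> V" "v \<notin> Vb" and w: "w \<in> W" "w \<notin> Wb"
    and F: "depends_only_on (DG \<times> EE) F" "\<And>a. \<bar>F a\<bar> \<le> (1::real)"
  shows "\<bar>measure_pmf.expectation P (\<lambda>z. F (\<alpha> z (v, w))) - (\<integral>x. F (\<lambda>k. c k x) \<partial>N)\<bar> \<le> window_error"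
  unfolding window_error_def
proof (rule expectation_pattern_close[where c="\<lambda>k z. \<alpha> z (v, w) k", OF _ N _ C])
  fix a assume a: "a \<in> DG \<times> EE \<rightarrow>\<^sub>E C"
  let ?p = "\<lambda>h. measure_pmf.prob q {j. \<forall>g\<in>DG. \<rho> j (\<sigma> g v) = a (g, h)}"
  let ?l = "\<lambda>h. lam (\<lambda>g\<in>DG. a (g, h))"
  have "\<bar>(\<Prod>h\<in>EE. ?p h) - (\<Prod>h\<in>EE. ?l h)\<bar> \<le> (\<Sum>h\<in>EE. \<bar>?p h - ?l h\<bar>)"
    using finEE lam by (intro prod_diff_le_sum) auto
  also have "\<dots> \<le> (\<Sum>h\<in>EE. e)"
  proof (rule sum_mono)
    fix h assume h: "h \<in> EE"
    have "{j. \<forall>g\<in>DG. \<rho> j (\<sigma> g v) = a (g, h)} = {j. \<forall>g\<in>DG. \<rho> j (\<sigma> g v) = (\<lambda>g\<in>DG. a (g, h)) g}" by auto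
    then show "\<bar>?p h - ?l h\<bar> \<le> e"
      using rows[OF v, of "\<lambda>g\<in>DG. a (g, h)"] a h by auto
  qed
  finally show "\<bar>measure (measure_pmf P) {x \<in> space (measure_pmf P). \<forall>k\<in>DG \<times> EE. \<alpha> x (v, w) k = a k} -
            measure N {x \<in> space N. \<forall>k\<in>DG \<times> EE. c k x = a k}\<bar> \<le> real (card EE) * e"
    using window_prob[OF v(1) w] row_law[OF a] by simp
qed (use F c cC \<rho> DG finEE measure_pmf.prob_space_axioms in \<open>auto simp: row_pattern_def\<close>)

lemma depends_decode:
  assumes f: "\<And>y y'. (\<And>k. k \<in> DG \<times> DH \<Longrightarrow> y k = y' k) \<Longrightarrow> f y = f y'"
  shows "depends_only_on (DG \<times> EE) (\<lambda>a. f (decode \<phi> a))"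
  unfolding depends_only_on_def
proof clarify
  fix a b :: "'g \<times> 'h \<Rightarrow> 'c" assume ab: "\<forall>k\<in>DG \<times> EE. a k = b k"
  show "f (decode \<phi> a) = f (decode \<phi> b)"
  proof (rule f)
    fix k assume k: "k \<in> DG \<times> DH"
    show "decode \<phi> a k = decode \<phi> b k"
      unfolding decode_def
    proof (rule depends_only_onD[OF \<phi>])
      fix h assume "h \<in> E"
      then have "(fst k, h + snd k) \<in> DG \<times> EE" using k by (auto simp: EE)
      then show "a (fst k, h + snd k) = b (fst k, h + snd k)" using ab by blast
    qed
  qed
qed

lemma model_decode:
  assumes v: "v \<in> V" and w: "w \<in> W" "w \<notin> Wb" and k: "k \<in> DG \<times> DH"
  shows "pullback_name s (v, w) (model z) k = decode \<phi> (\<alpha> z (v, w)) k"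
proof -
  have "pullback_name s (v, w) (model z) k = \<phi> (\<lambda>h. \<rho> (z (\<tau> h (\<tau> (snd k) w))) (\<sigma> (fst k) v))"
    using \<sigma>[OF v] \<tau>W[OF w(1)] by (simp add: pullback_name_def row_model_def)
  also have "\<dots> = decode \<phi> (\<alpha> z (v, w)) k"
    unfolding decode_def row_pattern_def
    by (rule depends_only_onD[OF \<phi>]) (use compat[OF w] k in auto)
  finally show ?thesis .
qed

lemma sum_bad_le:
  assumes "b' \<ge> 0"
  shows "(\<Sum>u\<in>V \<times> W. x + (if fst u \<in> Vb then b1 else 0) + (if snd u \<in> Wb then b' else 0))
     \<le> (x + max 0 b1 * b + b' * b) * real (card (V \<times> W))"
proof -
  have *: "V \<times> W \<inter> {u. snd u \<in> Wb} = V \<times> (W \<inter> Wb)" "V \<times> W \<inter> {u. fst u \<in> Vb} = (V \<inter> Vb) \<times> W" by auto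
  have "(\<Sum>u\<in>V \<times> W. x + (if fst u \<in> Vb then b1 else 0) + (if snd u \<in> Wb then b' else 0))
    = x * real (card (V \<times> W)) + b1 * real (card (V \<inter> Vb)) * real (card W) + b' * real (card (W \<inter> Wb)) * real (card V)"
    using V W by (simp add: sum.distrib sum.If_cases * card_cartesian_product algebra_simps)
  also have "b1 * real (card (V \<inter> Vb)) * real (card W) \<le> max 0 b1 * real (card (V \<inter> Vb)) * real (card W)"
    by (intro mult_right_mono) auto
  also have "\<dots> \<le> max 0 b1 * (b * real (card V)) * real (card W)"
    using Vb by (intro mult_right_mono mult_left_mono) auto
  also have "b' * real (card (W \<inter> Wb)) * real (card V) \<le> b' * (b * real (card W)) * real (card V)"
    using Wb assms by (intro mult_right_mono mult_left_mono) auto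
  finally show ?thesis by (simp add: card_cartesian_product algebra_simps)
qed

text \<open>A process \<open>Y\<close> over \<open>N\<close> that is nearly obtained by decoding the ideal array is imitated by the
  row model. The test function \<open>f\<close> has modulus \<open>\<omega>\<close> on the window.\<close>

context
  fixes f :: "('g \<times> 'h \<Rightarrow> 'y) \<Rightarrow> real" and Y :: "'n \<Rightarrow> 'g \<times> 'h \<Rightarrow> 'y" and r \<omega> \<eta> :: real and B :: "'n set"
  assumes f1: "\<And>y. \<bar>f y\<bar> \<le> 1" and fm: "f \<in> borel_measurable borel" and r: "r > 0"
    and modulus: "\<And>y y'. (\<And>k. k \<in> DG \<times> DH \<Longrightarrow> dist (y k) (y' k) < r) \<Longrightarrow> \<bar>f y - f y'\<bar> \<le> \<omega>"
    and Y: "Y \<in> borel_measurable N"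
    and B: "B \<in> sets N" "measure N B \<le> \<eta>"
    and approx: "\<And>x k. x \<in> space N \<Longrightarrow> x \<notin> B \<Longrightarrow> k \<in> DG \<times> DH \<Longrightarrow> dist (Y x k) (decode \<phi> (\<lambda>k. c k x) k) < r"
begin

text \<open>The test function as a function of the array. Setting the values outside the window to a
  constant makes it depend on the window only, while \<open>f\<close> may depend weakly on all coordinates.\<close>

definition G :: "('g \<times> 'h \<Rightarrow> 'c) \<Rightarrow> real" where
  "G a = f (\<lambda>k. if k \<in> DG \<times> DH then decode \<phi> a k else undefined)"

lemma \<omega>0: "\<omega> \<ge> 0"
  using modulus[of "\<lambda>_. undefined" "\<lambda>_. undefined"] r by auto

lemma G_close: "(\<And>k. k \<in> DG \<times> DH \<Longrightarrow> dist (y k) (decode \<phi> a k) < r) \<Longrightarrow> \<bar>f y - G a\<bar> \<le> \<omega>"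
  unfolding G_def by (rule modulus) auto

lemma G1: "\<bar>G a\<bar> \<le> 1" by (simp add: G_def f1)

lemma G_dep: "depends_only_on (DG \<times> EE) G"
proof -
  have "depends_only_on (DG \<times> EE) (\<lambda>a. (\<lambda>y. f (\<lambda>k. if k \<in> DG \<times> DH then y k else undefined)) (decode \<phi> a))"
    by (rule depends_decode) (auto intro!: arg_cong[where f=f])
  then show ?thesis unfolding G_def by simp
qed

lemma process_close: "\<bar>(\<integral>x. f (Y x) \<partial>N) - (\<integral>x. G (\<lambda>k. c k x) \<partial>N)\<bar> \<le> \<omega> + 2 * \<eta>"
proof -
  interpret N: prob_space N by (rule N)
  have i1: "integrable N (\<lambda>x. f (Y x))"
    by (rule N.integrable_const_bound[where B=1]) (use f1 measurable_compose[OF Y fm] in auto)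
  have i2: "integrable N (\<lambda>x. G (\<lambda>k. c k x))"
    by (rule N.expectation_pattern(1)[OF _ C _ _ G_dep]) (use DG finEE c cC in auto)
  have i3: "integrable N (\<lambda>x. \<omega> + 2 * indicator B x)"
    using B by (intro Bochner_Integration.integrable_add integrable_mult_right integrable_real_indicator)
      (auto simp: less_top[symmetric])
  have "\<bar>(\<integral>x. f (Y x) \<partial>N) - (\<integral>x. G (\<lambda>k. c k x) \<partial>N)\<bar> = \<bar>\<integral>x. f (Y x) - G (\<lambda>k. c k x) \<partial>N\<bar>"
    using i1 i2 by simp
  also have "\<dots> \<le> (\<integral>x. \<bar>f (Y x) - G (\<lambda>k. c k x)\<bar> \<partial>N)" by (rule integral_abs_bound)
  also have "\<dots> \<le> (\<integral>x. \<omega> + 2 * indicator B x \<partial>N)"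
  proof (rule integral_mono[OF _ i3])
    fix x assume x: "x \<in> space N"
    show "\<bar>f (Y x) - G (\<lambda>k. c k x)\<bar> \<le> \<omega> + 2 * indicator B x"
    proof (cases "x \<in> B")
      case True
      then show ?thesis using f1[of "Y x"] G1[of "\<lambda>k. c k x"] \<omega>0 by simp
    next
      case False
      then show ?thesis using G_close approx x by simp
    qed
  qed (use i1 i2 in auto)
  also have "\<dots> = \<omega> + 2 * measure N B"
    using B by (subst Bochner_Integration.integral_add) (auto simp: N.prob_space less_top[symmetric])
  finally show ?thesis using B by simp
qed

text \<open>The two errors \<open>\<omega>\<close> come from replacing \<open>f\<close> by a function of the array in the model and in the
  process, and the rest is the difference between the laws of the two arrays.\<close>

lemma local_quenched:
  assumes v: "v \<in> V" "v \<notin> Vb" and w: "w \<in> W" "w \<notin> Wb"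
  shows "\<bar>measure_pmf.expectation P (\<lambda>z. f (pullback_name s (v, w) (model z))) - (\<integral>x. f (Y x) \<partial>N)\<bar> \<le> 2 * \<omega> + 2 * \<eta> + window_error"
proof -
  have fin: "finite (set_pmf P)" using W q by (auto simp: set_Pi_pmf intro!: finite_PiE_dflt)
  have int: "integrable (measure_pmf P) h" for h :: "_ \<Rightarrow> real" by (rule integrable_measure_pmf_finite[OF fin])
  have "\<bar>measure_pmf.expectation P (\<lambda>z. f (pullback_name s (v, w) (model z))) - measure_pmf.expectation P (\<lambda>z. G (\<alpha> z (v, w)))\<bar>
    = \<bar>measure_pmf.expectation P (\<lambda>z. f (pullback_name s (v, w) (model z)) - G (\<alpha> z (v, w)))\<bar>"
    using int by simp
  also have "\<dots> \<le> measure_pmf.expectation P (\<lambda>z. \<bar>f (pullback_name s (v, w) (model z)) - G (\<alpha> z (v, w))\<bar>)"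
    by (rule integral_abs_bound)
  also have "\<dots> \<le> measure_pmf.expectation P (\<lambda>z. \<omega>)"
    by (rule integral_mono) (use int in \<open>auto intro!: G_close simp: model_decode[OF v(1) w] r\<close>)
  finally have "\<bar>measure_pmf.expectation P (\<lambda>z. f (pullback_name s (v, w) (model z))) - measure_pmf.expectation P (\<lambda>z. G (\<alpha> z (v, w)))\<bar> \<le> \<omega>"
    by simp
  then show ?thesis using local_law[OF v w G_dep G1] process_close by linarith
qed

lemma pattern_depends: "depends_only_on ((\<lambda>h. \<tau> h (snd u)) ` EE) (\<lambda>z. G (\<alpha> z u))"
  unfolding depends_only_on_def
proof clarify
  fix a b :: "'w \<Rightarrow> 'j" assume "\<forall>k\<in>(\<lambda>h. \<tau> h (snd u)) ` EE. a k = b k"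
  then show "G (\<alpha> a u) = G (\<alpha> b u)"
    by (intro depends_only_onD[OF G_dep]) (auto simp: row_pattern_def)
qed

text \<open>Two places see disjoint sets of seeds unless their rows lie in overlapping windows of the
  \<open>\<tau>\<close>-orbit. For a given row there are at most \<open>(card EE)\<^sup>2\<close> such rows, so the proportion of
  correlated pairs is of order \<open>1 / card W\<close> and the weak law applies.\<close>

lemma empirical_quenched:
  assumes t: "t > 0"
  shows "measure_pmf.prob P {z. 2 * \<omega> + 2 * \<eta> + window_error + 6 * b + t
           \<le> \<bar>(\<Sum>u\<in>V \<times> W. f (pullback_name s u (model z))) / real (card (V \<times> W)) - (\<integral>x. f (Y x) \<partial>N)\<bar>}
       \<le> 2 * (real (card EE))\<^sup>2 / (t\<^sup>2 * real (card W))"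
proof -
  let ?I = "V \<times> W" and ?n = "real (card (V \<times> W))"
  let ?E = "measure_pmf.expectation P"
  \<comment> \<open>The pairs of points that share a seed.\<close>
  define R where "R = {(u, u') \<in> ?I \<times> ?I. (\<lambda>h. \<tau> h (snd u)) ` EE \<inter> (\<lambda>h. \<tau> h (snd u')) ` EE \<noteq> {}}"
  have n: "?n > 0" using V W by (simp add: card_gt_0_iff)
  have cardR: "real (card R) \<le> (real (card EE))\<^sup>2 * (real (card V))\<^sup>2 * real (card W)"
  proof -
    \<comment> \<open>A shared seed at \<open>\<tau> h w = \<tau> h' w'\<close> determines \<open>w'\<close> from \<open>h\<close>, \<open>h'\<close> and \<open>w\<close>.\<close>
    let ?h = "\<lambda>(h, h', v, v', w). ((v, w), (v', inv_into W (\<tau> h') (\<tau> h w)))"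
    have "R \<subseteq> ?h ` (EE \<times> EE \<times> V \<times> V \<times> W)"
    proof
      fix p assume "p \<in> R"
      then obtain u u' where uu: "p = (u, u')" "u \<in> ?I" "u' \<in> ?I"
        and ne: "(\<lambda>h. \<tau> h (snd u)) ` EE \<inter> (\<lambda>h. \<tau> h (snd u')) ` EE \<noteq> {}" unfolding R_def by blast
      obtain v w v' w' where u: "u = (v, w)" "u' = (v', w')" by (cases u, cases u')
      have p1: "p = ((v, w), (v', w'))" "v \<in> V" "w \<in> W" "v' \<in> V" "w' \<in> W" using uu u by auto
      from ne obtain h h' where "h \<in> EE" "h' \<in> EE" "\<tau> h w = \<tau> h' w'" using u by auto
      note p = p1 this
      have "inv_into W (\<tau> h') (\<tau> h w) = w'"
        using p \<tau>[of h'] by (metis bij_betw_def inv_into_f_f)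
      then have "p = ?h (h, h', v, v', w)" using p(1) by simp
      moreover have "(h, h', v, v', w) \<in> EE \<times> EE \<times> V \<times> V \<times> W" using p(2-7) by simp
      ultimately show "p \<in> ?h ` (EE \<times> EE \<times> V \<times> V \<times> W)" by (rule image_eqI)
    qed
    moreover have fin: "finite (EE \<times> EE \<times> V \<times> V \<times> W)" using finEE V W by simp
    ultimately have "card R \<le> card (?h ` (EE \<times> EE \<times> V \<times> V \<times> W))"
      by (intro card_mono finite_imageI)
    also have "\<dots> \<le> card (EE \<times> EE \<times> V \<times> V \<times> W)" by (rule card_image_le[OF fin])
    also have "\<dots> = card EE ^ 2 * card V ^ 2 * card W"
      by (simp add: card_cartesian_product power2_eq_square)
    finally show ?thesis by (simp flip: of_nat_power of_nat_mult)
  qed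
  have "measure_pmf.prob P {z \<in> space (measure_pmf P). t * ?n \<le> \<bar>(\<Sum>u\<in>?I. G (\<alpha> z u)) - (\<Sum>u\<in>?I. ?E (\<lambda>z. G (\<alpha> z u)))\<bar>}
     \<le> 2 * 1\<^sup>2 * real (card R) / (t * ?n)\<^sup>2"
  proof (rule measure_pmf.weak_law)
    show "R \<subseteq> ?I \<times> ?I" by (auto simp: R_def)
    show "?E (\<lambda>z. G (\<alpha> z i) * G (\<alpha> z j)) = ?E (\<lambda>z. G (\<alpha> z i)) * ?E (\<lambda>z. G (\<alpha> z j))"
      if "i \<in> ?I" "j \<in> ?I" "(i, j) \<notin> R" for i j
    proof (rule expectation_Pi_pmf_disjoint[OF W(1) q _ _ _ pattern_depends pattern_depends])
      show "(\<lambda>h. \<tau> h (snd i)) ` EE \<subseteq> W" "(\<lambda>h. \<tau> h (snd j)) ` EE \<subseteq> W" using that \<tau>W by auto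
      show "(\<lambda>h. \<tau> h (snd i)) ` EE \<inter> (\<lambda>h. \<tau> h (snd j)) ` EE = {}" using that by (auto simp: R_def)
    qed
  qed (use V W t n G1 in auto)
  also have "\<dots> \<le> 2 * ((real (card EE))\<^sup>2 * (real (card V))\<^sup>2 * real (card W)) / (t * ?n)\<^sup>2"
    using cardR by (intro divide_right_mono) auto
  also have "\<dots> = 2 * (real (card EE))\<^sup>2 / (t\<^sup>2 * real (card W))"
    using V W t by (simp add: card_cartesian_product power2_eq_square field_simps card_gt_0_iff)
  finally have main: "measure_pmf.prob P {z. t * ?n \<le> \<bar>(\<Sum>u\<in>?I. G (\<alpha> z u)) - (\<Sum>u\<in>?I. ?E (\<lambda>z. G (\<alpha> z u)))\<bar>}
     \<le> 2 * (real (card EE))\<^sup>2 / (t\<^sup>2 * real (card W))" by simp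
  have "{z. 2 * \<omega> + 2 * \<eta> + window_error + 6 * b + t
           \<le> \<bar>(\<Sum>u\<in>?I. f (pullback_name s u (model z))) / ?n - (\<integral>x. f (Y x) \<partial>N)\<bar>}
    \<subseteq> {z. t * ?n \<le> \<bar>(\<Sum>u\<in>?I. G (\<alpha> z u)) - (\<Sum>u\<in>?I. ?E (\<lambda>z. G (\<alpha> z u)))\<bar>}"
  proof clarify
    fix z assume far: "2 * \<omega> + 2 * \<eta> + window_error + 6 * b + t
           \<le> \<bar>(\<Sum>u\<in>?I. f (pullback_name s u (model z))) / ?n - (\<integral>x. f (Y x) \<partial>N)\<bar>"
    let ?S1 = "\<Sum>u\<in>?I. f (pullback_name s u (model z))" and ?S2 = "\<Sum>u\<in>?I. G (\<alpha> z u)"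
    let ?S3 = "\<Sum>u\<in>?I. ?E (\<lambda>z. G (\<alpha> z u))" and ?g = "\<integral>x. G (\<lambda>k. c k x) \<partial>N"
    have "\<bar>?S1 - ?S2\<bar> \<le> (\<Sum>u\<in>?I. \<bar>f (pullback_name s u (model z)) - G (\<alpha> z u)\<bar>)"
      unfolding sum_subtractf[symmetric] by (rule sum_abs)
    also have "\<dots> \<le> (\<Sum>u\<in>?I. \<omega> + (if fst u \<in> Vb then 0 else 0) + (if snd u \<in> Wb then 2 else 0))"
    proof (rule sum_mono)
      fix u assume u: "u \<in> ?I"
      show "\<bar>f (pullback_name s u (model z)) - G (\<alpha> z u)\<bar> \<le> \<omega> + (if fst u \<in> Vb then 0 else 0) + (if snd u \<in> Wb then 2 else 0)"
      proof (cases "snd u \<in> Wb")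
        case True
        then show ?thesis using f1[of "pullback_name s u (model z)"] G1[of "\<alpha> z u"] \<omega>0 by auto
      next
        case False
        then have "\<bar>f (pullback_name s u (model z)) - G (\<alpha> z u)\<bar> \<le> \<omega>"
          using u r by (intro G_close) (cases u, simp add: model_decode)
        then show ?thesis using False by simp
      qed
    qed
    also have "\<dots> \<le> (\<omega> + max 0 0 * b + 2 * b) * ?n" by (rule sum_bad_le) simp
    finally have 1: "\<bar>?S1 - ?S2\<bar> \<le> (\<omega> + 2 * b) * ?n" by simp
    have tv0': "window_error \<ge> 0" using e0 by (simp add: window_error_def)
    have "\<bar>?S3 - ?g * ?n\<bar> = \<bar>\<Sum>u\<in>?I. (?E (\<lambda>z. G (\<alpha> z u)) - ?g)\<bar>" by (simp add: sum_subtractf mult.commute)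
    also have "\<dots> \<le> (\<Sum>u\<in>?I. \<bar>?E (\<lambda>z. G (\<alpha> z u)) - ?g\<bar>)" by (rule sum_abs)
    also have "\<dots> \<le> (\<Sum>u\<in>?I. window_error + (if fst u \<in> Vb then 2 else 0) + (if snd u \<in> Wb then 2 else 0))"
    proof (rule sum_mono)
      fix u assume u: "u \<in> ?I"
      have fin: "finite (set_pmf P)" using W q by (auto simp: set_Pi_pmf intro!: finite_PiE_dflt)
      interpret N: prob_space N by (rule N)
      have "\<bar>?E (\<lambda>z. G (\<alpha> z u))\<bar> \<le> 1"
        by (rule order_trans[OF integral_abs_bound], rule measure_pmf.integral_le_const)
           (use G1 integrable_measure_pmf_finite[OF fin] in auto)
      moreover have "\<bar>?g\<bar> \<le> (\<integral>x. 1 \<partial>N)"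
      proof (rule order_trans[OF integral_abs_bound], rule integral_mono)
        show "integrable N (\<lambda>x. \<bar>G (\<lambda>k. c k x)\<bar>)"
          by (intro integrable_abs N.expectation_pattern(1)[OF _ C _ _ G_dep]) (use DG finEE c cC in auto)
      qed (use G1 in auto)
      ultimately have "\<bar>?E (\<lambda>z. G (\<alpha> z u)) - ?g\<bar> \<le> 2" by (simp add: N.prob_space)
      moreover have "\<bar>?E (\<lambda>z. G (\<alpha> z u)) - ?g\<bar> \<le> window_error" if "fst u \<notin> Vb" "snd u \<notin> Wb"
        using local_law[OF _ _ _ _ G_dep G1, of "fst u" "snd u"] u that by auto
      ultimately show "\<bar>?E (\<lambda>z. G (\<alpha> z u)) - ?g\<bar> \<le> window_error + (if fst u \<in> Vb then 2 else 0) + (if snd u \<in> Wb then 2 else 0)"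
        using tv0' by auto
    qed
    also have "\<dots> \<le> (window_error + max 0 2 * b + 2 * b) * ?n" by (rule sum_bad_le) simp
    finally have 2: "\<bar>?S3 - ?g * ?n\<bar> \<le> (window_error + 4 * b) * ?n" by (simp add: add.commute)
    have 3: "\<bar>(\<integral>x. f (Y x) \<partial>N) * ?n - ?g * ?n\<bar> \<le> (\<omega> + 2 * \<eta>) * ?n"
      using mult_right_mono[OF process_close, of ?n] by (simp add: abs_mult left_diff_distrib[symmetric])
    have "\<bar>?S1 / ?n - (\<integral>x. f (Y x) \<partial>N)\<bar> * ?n = \<bar>?S1 - (\<integral>x. f (Y x) \<partial>N) * ?n\<bar>"
      using n by (simp add: abs_mult_pos field_simps)
    then have 4: "(2 * \<omega> + 2 * \<eta> + window_error + 6 * b + t) * ?n \<le> \<bar>?S1 - (\<integral>x. f (Y x) \<partial>N) * ?n\<bar>"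
      using mult_right_mono[OF far, of ?n] by simp
    have "(2 * \<omega> + 2 * \<eta> + window_error + 6 * b + t) * ?n = (\<omega> + 2 * b) * ?n + (window_error + 4 * b) * ?n + (\<omega> + 2 * \<eta>) * ?n + t * ?n"
      by (simp add: algebra_simps)
    then show "t * ?n \<le> \<bar>?S2 - ?S3\<bar>" using 1 2 3 4 by linarith
  qed
  then have "measure_pmf.prob P {z. 2 * \<omega> + 2 * \<eta> + window_error + 6 * b + t
           \<le> \<bar>(\<Sum>u\<in>?I. f (pullback_name s u (model z))) / ?n - (\<integral>x. f (Y x) \<partial>N)\<bar>}
    \<le> measure_pmf.prob P {z. t * ?n \<le> \<bar>(\<Sum>u\<in>?I. G (\<alpha> z u)) - (\<Sum>u\<in>?I. ?E (\<lambda>z. G (\<alpha> z u)))\<bar>}"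
    by (intro measure_pmf.finite_measure_mono) auto
  with main show ?thesis by linarith
qed

end

end

section \<open>Counting\<close>

text \<open>Exponential tilting: every deviation from the centre has weight \<open>exp (- t)\<close>, and the total
  weight of all configurations factorises over the places.\<close>

lemma hamming_ball_card:
  fixes A :: "'a set" and U :: "'u set"
  assumes U: "finite U" and A: "finite A" and t: "t \<ge> 0"
  shows "real (card {\<beta> \<in> U \<rightarrow>\<^sub>E A. real (card {u \<in> U. \<beta> u \<noteq> \<beta>0 u}) \<le> k})
     \<le> exp (t * k + real (card U) * (real (card A) * exp (- t)))"
proof -
  let ?wt = "\<lambda>u a. if a = \<beta>0 u then 1 else exp (- t)"
  let ?B = "{\<beta> \<in> U \<rightarrow>\<^sub>E A. real (card {u \<in> U. \<beta> u \<noteq> \<beta>0 u}) \<le> k}"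
  have fin: "finite (U \<rightarrow>\<^sub>E A)" using U A by (intro finite_PiE) auto
  have wt: "(\<Prod>u\<in>U. ?wt u (\<beta> u)) = exp (- t * real (card {u \<in> U. \<beta> u \<noteq> \<beta>0 u}))" for \<beta>
  proof -
    have "(\<Prod>u\<in>U. ?wt u (\<beta> u)) = (\<Prod>u\<in>{u \<in> U. \<beta> u \<noteq> \<beta>0 u}. exp (- t))"
      unfolding prod.inter_filter[OF U] by (intro prod.cong) auto
    then show ?thesis by (simp add: exp_of_nat_mult[symmetric] mult.commute)
  qed
  have "exp (- t * k) * real (card ?B) = (\<Sum>\<beta>\<in>?B. exp (- t * k))" by simp
  also have "\<dots> \<le> (\<Sum>\<beta>\<in>?B. \<Prod>u\<in>U. ?wt u (\<beta> u))"
    unfolding wt using t by (intro sum_mono) (auto intro!: mult_left_mono)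
  also have "\<dots> \<le> (\<Sum>\<beta>\<in>U \<rightarrow>\<^sub>E A. \<Prod>u\<in>U. ?wt u (\<beta> u))"
    using fin by (intro sum_mono2) (auto intro!: prod_nonneg)
  also have "\<dots> = (\<Prod>u\<in>U. \<Sum>a\<in>A. ?wt u a)"
    using U A by (subst prod_sum_PiE) auto
  also have "\<dots> \<le> (\<Prod>u\<in>U. exp (real (card A) * exp (- t)))"
  proof (rule prod_mono, safe)
    fix u assume "u \<in> U"
    show "0 \<le> (\<Sum>a\<in>A. ?wt u a)" by (intro sum_nonneg) auto
    have "(\<Sum>a\<in>A. ?wt u a) \<le> (\<Sum>a\<in>A. (if a = \<beta>0 u then 1 else 0) + exp (- t))"
      by (intro sum_mono) auto
    also have "\<dots> \<le> 1 + real (card A) * exp (- t)" using A by (simp add: sum.distrib)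
    also have "\<dots> \<le> exp (real (card A) * exp (- t))" by (rule exp_ge_add_one_self)
    finally show "(\<Sum>a\<in>A. ?wt u a) \<le> exp (real (card A) * exp (- t))" .
  qed
  also have "\<dots> = exp (real (card U) * (real (card A) * exp (- t)))"
    by (simp add: exp_of_nat_mult[symmetric])
  finally have "exp (- t * k) * real (card ?B) \<le> exp (real (card U) * (real (card A) * exp (- t)))" .
  then have "exp (t * k) * (exp (- t * k) * real (card ?B)) \<le> exp (t * k) * exp (real (card U) * (real (card A) * exp (- t)))"
    by (intro mult_left_mono) auto
  moreover have "exp (t * k) * exp (- t * k) = 1" by (simp flip: exp_add)
  ultimately show ?thesis by (simp only: mult.assoc[symmetric] exp_add mult_1_left)
qed

text \<open>Gibbs' inequality against the uniform distribution on \<open>S\<close>.\<close>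

lemma mean_neg_ln_ge:
  fixes Q :: "'s \<Rightarrow> real"
  assumes S: "finite S" "S \<noteq> {}" and Q: "\<And>y. y \<in> S \<Longrightarrow> Q y > 0" and sum: "(\<Sum>y\<in>S. Q y) \<le> 1"
  shows "real (card S) * ln (real (card S)) \<le> (\<Sum>y\<in>S. - ln (Q y))"
proof -
  have N: "real (card S) > 0" using S by (simp add: card_gt_0_iff)
  have "(\<Sum>y\<in>S. ln (real (card S)) - (real (card S) * Q y - 1)) \<le> (\<Sum>y\<in>S. - ln (Q y))"
  proof (rule sum_mono)
    fix y assume y: "y \<in> S"
    have "ln (real (card S) * Q y) \<le> real (card S) * Q y - 1"
      using Q[OF y] N by (intro ln_le_minus_one) auto
    then show "ln (real (card S)) - (real (card S) * Q y - 1) \<le> - ln (Q y)"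
      using Q[OF y] N by (simp add: ln_mult)
  qed
  moreover have "(\<Sum>y\<in>S. ln (real (card S)) - (real (card S) * Q y - 1))
     = real (card S) * ln (real (card S)) + real (card S) * (1 - (\<Sum>y\<in>S. Q y))"
    by (simp add: sum_subtractf sum_distrib_right algebra_simps)
  moreover have "real (card S) * (1 - (\<Sum>y\<in>S. Q y)) \<ge> 0" using sum N by simp
  ultimately show ?thesis by linarith
qed

text \<open>Resampling rows loses no entropy. Let \<open>\<theta>\<close> be the law of the row of a random member of \<open>S\<close> at a
  random place. As the members have distinct arrays, Gibbs' inequality for the product measure
  \<open>\<theta>\<^sup>W\<close> bounds the mean of \<open>- ln \<theta>\<close> below by \<open>ln (card S) / card W\<close>. By the weak law, a resampled
  array typically has probability at most about \<open>1 / card S\<close>, so few arrays carry little mass.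

  The law is mixed with the uniform law in proportion \<open>\<kappa>\<close>, which makes \<open>- ln \<theta>\<close> bounded and costs
  only a factor \<open>1 / (1 - \<kappa>)\<close> for each row.\<close>

lemma resampled_rows_spread:
  fixes arr :: "'s \<Rightarrow> 'w \<Rightarrow> 'r" and d :: "'s \<times> 'w"
  assumes S: "finite S" "S \<noteq> {}" and W: "finite W" "W \<noteq> {}" and R: "finite R"
    and arr: "\<And>y w. y \<in> S \<Longrightarrow> w \<in> W \<Longrightarrow> arr y w \<in> R"
    and inj: "\<And>y y'. y \<in> S \<Longrightarrow> y' \<in> S \<Longrightarrow> (\<And>w. w \<in> W \<Longrightarrow> arr y w = arr y' w) \<Longrightarrow> y = y'"
    and t: "t > 0" and \<kappa>: "0 < \<kappa>" "\<kappa> < 1" and FF: "finite \<F>"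
  defines "P \<equiv> Pi_pmf W d (\<lambda>_. pmf_of_set (S \<times> W))"
  shows "measure_pmf.prob P {z. (\<lambda>w\<in>W. case_prod arr (z w)) \<in> \<F>}
     \<le> real (card \<F>) * exp (- ln (real (card S)) + (t - ln (1 - \<kappa>)) * real (card W))
       + 2 * (ln (real (card R) / \<kappa>))\<^sup>2 / (t\<^sup>2 * real (card W))"
proof -
  define q where "q = pmf_of_set (S \<times> W)"
  define \<rho> where "\<rho> = case_prod arr"
  define \<theta> where "\<theta> a = measure_pmf.prob q {j. \<rho> j = a}" for a
  define \<theta>' where "\<theta>' a = (1 - \<kappa>) * \<theta> a + \<kappa> / real (card R)" for a
  define g where "g a = - ln (\<theta>' a)" for a
  let ?N = "real (card S)" and ?n = "real (card W)"
  have N: "?N > 0" and n: "?n > 0" using S W by (auto simp: card_gt_0_iff)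
  have "R \<noteq> {}" using S W arr by blast
  then have cR: "real (card R) > 0" using R by (simp add: card_gt_0_iff)
  have cR1: "real (card R) \<ge> 1" using cR by (simp add: real_of_nat_ge_one_iff Suc_le_eq)
  have J: "finite (S \<times> W)" "S \<times> W \<noteq> {}" using S W by auto
  have setq: "set_pmf q = S \<times> W" using J by (simp add: q_def)
  have \<theta>01: "0 \<le> \<theta> a" "\<theta> a \<le> 1" for a by (auto simp: \<theta>_def)
  have \<theta>'ge: "\<theta>' a \<ge> \<kappa> / real (card R)" for a using \<theta>01 \<kappa> by (simp add: \<theta>'_def)
  have \<theta>'pos: "\<theta>' a > 0" for a using \<theta>'ge[of a] \<kappa> cR by (meson divide_pos_pos less_le_trans)
  have \<theta>'le: "\<theta>' a \<le> 1" for a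
  proof -
    have "(1 - \<kappa>) * \<theta> a \<le> (1 - \<kappa>) * 1" using \<theta>01 \<kappa> by (intro mult_left_mono) auto
    moreover have "\<kappa> / real (card R) \<le> \<kappa>" using cR1 \<kappa> by (simp add: divide_le_eq)
    ultimately show ?thesis by (simp add: \<theta>'_def)
  qed
  have \<theta>\<theta>': "\<theta> a \<le> \<theta>' a / (1 - \<kappa>)" for a
    using \<kappa> cR by (simp add: \<theta>'_def field_simps)
  have g: "\<bar>g a\<bar> \<le> ln (real (card R) / \<kappa>)" for a
  proof -
    have "ln (\<kappa> / real (card R)) \<le> ln (\<theta>' a)" using \<theta>'ge \<theta>'pos \<kappa> cR by (subst ln_le_cancel_iff) auto
    moreover have "ln (\<theta>' a) \<le> 0" using \<theta>'le \<theta>'pos by simp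
    ultimately show ?thesis using \<kappa> cR by (simp add: g_def ln_div)
  qed
  have sum\<theta>: "(\<Sum>a\<in>R. \<theta> a) \<le> 1"
  proof -
    have "(\<Sum>a\<in>R. \<theta> a) = (\<Sum>a\<in>R. pmf (map_pmf \<rho> q) a)"
      by (simp add: \<theta>_def pmf_map vimage_def)
    also have "\<dots> = measure_pmf.prob (map_pmf \<rho> q) R" by (rule measure_measure_pmf_finite[OF R, symmetric])
    finally show ?thesis by simp
  qed
  have sum\<theta>': "(\<Sum>a\<in>R. \<theta>' a) \<le> 1"
  proof -
    have "(\<Sum>a\<in>R. \<theta>' a) = (1 - \<kappa>) * (\<Sum>a\<in>R. \<theta> a) + \<kappa>"
      using cR by (simp add: \<theta>'_def sum.distrib sum_distrib_left)
    also have "\<dots> \<le> (1 - \<kappa>) * 1 + \<kappa>" using sum\<theta> \<kappa> by (intro add_right_mono mult_left_mono) auto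
    finally show ?thesis by simp
  qed
  define Q where "Q y = (\<Prod>w\<in>W. \<theta>' (arr y w))" for y
  have sumQ: "(\<Sum>y\<in>S. Q y) \<le> 1"
  proof -
    let ?r = "\<lambda>y. \<lambda>w\<in>W. arr y w"
    have inj': "inj_on ?r S"
    proof (rule inj_onI)
      fix y y' assume "y \<in> S" "y' \<in> S" "?r y = ?r y'"
      then show "y = y'" by (intro inj) (auto dest: fun_cong[where f="?r y"] simp: restrict_def split: if_splits, metis)
    qed
    have "(\<Sum>y\<in>S. Q y) = (\<Sum>\<beta>\<in>?r ` S. \<Prod>w\<in>W. \<theta>' (\<beta> w))"
      by (subst sum.reindex[OF inj']) (auto simp: Q_def intro!: sum.cong prod.cong)
    also have "\<dots> \<le> (\<Sum>\<beta>\<in>W \<rightarrow>\<^sub>E R. \<Prod>w\<in>W. \<theta>' (\<beta> w))"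
      using W R arr less_imp_le[OF \<theta>'pos] by (intro sum_mono2 finite_PiE prod_nonneg) auto
    also have "\<dots> = (\<Prod>w\<in>W. \<Sum>a\<in>R. \<theta>' a)" using W R by (subst prod_sum_PiE) auto
    also have "\<dots> \<le> 1" using sum\<theta>' less_imp_le[OF \<theta>'pos] by (intro prod_le_1) (auto intro: sum_nonneg)
    finally show ?thesis .
  qed
  define Eg where "Eg = measure_pmf.expectation q (\<lambda>j. g (\<rho> j))"
  have Eg: "?n * Eg \<ge> ln ?N"
  proof -
    have "?N * ln ?N \<le> (\<Sum>y\<in>S. - ln (Q y))"
      using S sumQ \<theta>'pos by (intro mean_neg_ln_ge) (auto simp: Q_def intro!: prod_pos)
    also have "\<dots> = (\<Sum>y\<in>S. \<Sum>w\<in>W. g (arr y w))"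
    proof (rule sum.cong[OF refl])
      fix y
      have "ln (Q y) = (\<Sum>w\<in>W. ln (\<theta>' (arr y w)))"
        unfolding Q_def using W(1) less_imp_neq[OF \<theta>'pos, symmetric] by (intro ln_prod) auto
      then show "- ln (Q y) = (\<Sum>w\<in>W. g (arr y w))" by (simp add: g_def sum_negf)
    qed
    also have "\<dots> = ?N * (?n * Eg)"
      using J N n by (simp add: Eg_def q_def integral_pmf_of_set \<rho>_def sum.cartesian_product card_cartesian_product case_prod_beta')
    finally show ?thesis using N by simp
  qed
  have P: "P = Pi_pmf W d (\<lambda>_. q)" by (simp add: P_def q_def)
  have EX: "measure_pmf.expectation P (\<lambda>z. g (\<rho> (z w))) = Eg" if w: "w \<in> W" for w
  proof -
    have "map_pmf (\<lambda>z. z w) P = q" using W w by (simp add: P Pi_pmf_component)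
    then have "Eg = measure_pmf.expectation (map_pmf (\<lambda>z. z w) P) (\<lambda>j. g (\<rho> j))" by (simp add: Eg_def)
    then show ?thesis by simp
  qed
  let ?atyp = "{z. t * ?n \<le> \<bar>(\<Sum>w\<in>W. g (\<rho> (z w))) - (\<Sum>w\<in>W. measure_pmf.expectation P (\<lambda>z. g (\<rho> (z w))))\<bar>}"
  have "measure_pmf.prob P {z \<in> space (measure_pmf P). t * ?n \<le> \<bar>(\<Sum>w\<in>W. g (\<rho> (z w))) - (\<Sum>w\<in>W. measure_pmf.expectation P (\<lambda>z. g (\<rho> (z w))))\<bar>}
     \<le> 2 * (ln (real (card R) / \<kappa>))\<^sup>2 * real (card ((\<lambda>w. (w, w)) ` W)) / (t * ?n)\<^sup>2"
  proof (rule measure_pmf.weak_law)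
    show "measure_pmf.expectation P (\<lambda>x. g (\<rho> (x i)) * g (\<rho> (x j))) =
           measure_pmf.expectation P (\<lambda>z. g (\<rho> (z i))) * measure_pmf.expectation P (\<lambda>z. g (\<rho> (z j)))"
      if "i \<in> W" "j \<in> W" "(i, j) \<notin> (\<lambda>w. (w, w)) ` W" for i j
      unfolding P
      by (rule expectation_Pi_pmf_disjoint[OF W(1), where A="{i}" and B="{j}"])
         (use that J in \<open>auto simp: depends_only_on_def setq\<close>)
  qed (use W t n g in auto)
  also have "card ((\<lambda>w. (w, w)) ` W) = card W" by (rule card_image) (auto simp: inj_on_def)
  also have "2 * (ln (real (card R) / \<kappa>))\<^sup>2 * ?n / (t * ?n)\<^sup>2 = 2 * (ln (real (card R) / \<kappa>))\<^sup>2 / (t\<^sup>2 * ?n)"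
    using n by (simp add: power2_eq_square)
  finally have atyp: "measure_pmf.prob P ?atyp \<le> 2 * (ln (real (card R) / \<kappa>))\<^sup>2 / (t\<^sup>2 * ?n)" by simp
  let ?T = "{\<beta> \<in> \<F>. (\<Sum>w\<in>W. g (\<beta> w)) \<ge> ln ?N - t * ?n}"
  let ?A = "\<lambda>\<beta>. {z. \<forall>w\<in>W. \<rho> (z w) = \<beta> w}"
  have "{z. (\<lambda>w\<in>W. \<rho> (z w)) \<in> \<F>} \<subseteq> ?atyp \<union> (\<Union>\<beta>\<in>?T. ?A \<beta>)"
  proof
    fix z assume z: "z \<in> {z. (\<lambda>w\<in>W. \<rho> (z w)) \<in> \<F>}"
    show "z \<in> ?atyp \<union> (\<Union>\<beta>\<in>?T. ?A \<beta>)"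
    proof (cases "z \<in> ?atyp")
      case False
      then have "(\<Sum>w\<in>W. g (\<rho> (z w))) > ?n * Eg - t * ?n" using EX by auto
      then have "(\<lambda>w\<in>W. \<rho> (z w)) \<in> ?T" using z Eg by simp
      moreover have "z \<in> ?A (\<lambda>w\<in>W. \<rho> (z w))" by simp
      ultimately show ?thesis by blast
    qed simp
  qed
  then have "measure_pmf.prob P {z. (\<lambda>w\<in>W. \<rho> (z w)) \<in> \<F>} \<le> measure_pmf.prob P (?atyp \<union> (\<Union>\<beta>\<in>?T. ?A \<beta>))"
    by (intro measure_pmf.finite_measure_mono) auto
  also have "\<dots> \<le> measure_pmf.prob P ?atyp + measure_pmf.prob P (\<Union>\<beta>\<in>?T. ?A \<beta>)"
    by (rule measure_Un_le) auto
  also have "measure_pmf.prob P (\<Union>\<beta>\<in>?T. ?A \<beta>) \<le> (\<Sum>\<beta>\<in>?T. measure_pmf.prob P (?A \<beta>))"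
    using FF by (intro measure_UNION_le) auto
  also have "\<dots> \<le> (\<Sum>\<beta>\<in>?T. exp (- ln ?N + (t - ln (1 - \<kappa>)) * ?n))"
  proof (rule sum_mono)
    fix \<beta> assume \<beta>: "\<beta> \<in> ?T"
    have "?A \<beta> = Pi W (\<lambda>w. {j. \<rho> j = \<beta> w})" by auto
    then have "measure_pmf.prob P (?A \<beta>) = (\<Prod>w\<in>W. \<theta> (\<beta> w))"
      using W by (simp add: P measure_Pi_pmf_Pi \<theta>_def)
    also have "\<dots> \<le> (\<Prod>w\<in>W. \<theta>' (\<beta> w) / (1 - \<kappa>))" using \<theta>01 \<theta>\<theta>' by (intro prod_mono) auto
    also have "\<dots> = (\<Prod>w\<in>W. exp (- g (\<beta> w) - ln (1 - \<kappa>)))"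
      using \<theta>'pos \<kappa> by (intro prod.cong) (auto simp: g_def exp_diff)
    also have "\<dots> = exp (\<Sum>w\<in>W. - g (\<beta> w) - ln (1 - \<kappa>))" using W by (simp add: exp_sum)
    also have "\<dots> \<le> exp (- ln ?N + (t - ln (1 - \<kappa>)) * ?n)"
      using \<beta> by (simp add: sum_subtractf sum_negf algebra_simps)
    finally show "measure_pmf.prob P (?A \<beta>) \<le> exp (- ln ?N + (t - ln (1 - \<kappa>)) * ?n)" .
  qed
  also have "\<dots> = real (card ?T) * exp (- ln ?N + (t - ln (1 - \<kappa>)) * ?n)" by simp
  also have "\<dots> \<le> real (card \<F>) * exp (- ln ?N + (t - ln (1 - \<kappa>)) * ?n)"
    using FF by (intro mult_right_mono) (auto intro!: card_mono)
  finally show ?thesis unfolding \<rho>_def[symmetric] using atyp by linarith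
qed

section \<open>Uniform structure of a countable power\<close>

text \<open>Test functions on a power of a compact space are uniformly continuous, hence controlled by
  finitely many coordinates at a positive scale.\<close>

lemma compact_UNIV_fun:
  assumes "compact (UNIV :: 'y::topological_space set)"
  shows "compact (UNIV :: ('k \<Rightarrow> 'y) set)"
proof -
  have "compact_space (product_topology (\<lambda>_::'k. euclidean :: 'y topology) UNIV)"
    by (subst compact_space_product_topology) (simp add: compact_space_def assms)
  then show ?thesis
    by (simp add: euclidean_product_topology compact_space_def)
qed

lemma dist_fun_small:
  assumes d: "d > 0"
  shows "\<exists>D r. finite D \<and> r > 0 \<and> (\<forall>y z :: 'k::countable \<Rightarrow> 'y::metric_space. (\<forall>k\<in>D. dist (y k) (z k) < r) \<longrightarrow> dist y z < d)"
proof -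
  obtain n :: nat where n: "(1 / 2) ^ n < d / 2"
    using real_arch_pow_inv[of "d / 2" "1 / 2"] d by auto
  let ?D = "(from_nat :: nat \<Rightarrow> 'k) ` {..n}"
  have "dist y z < d" if y: "\<forall>k\<in>?D. dist (y k) (z k) < d / 4" for y z :: "'k \<Rightarrow> 'y"
  proof -
    let ?S = "{dist (y (from_nat i)) (z (from_nat i)) | i. i \<le> n}"
    have S: "?S = (\<lambda>i. dist (y (from_nat i)) (z (from_nat i))) ` {..n}" by auto
    have "Max ?S < d / 4" unfolding S using y by (subst Max_less_iff) auto
    then show ?thesis using dist_fun_le_dist_first_terms[of y z n] n by linarith
  qed
  then show ?thesis using d by (intro exI[of _ ?D] exI[of _ "d / 4"]) auto
qed

lemma continuous_modulus:
  fixes f :: "('k::countable \<Rightarrow> 'y::metric_space) \<Rightarrow> real"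
  assumes "compact (UNIV :: 'y set)" "continuous_on UNIV f" "\<omega> > 0"
  shows "\<exists>D r. finite D \<and> r > 0 \<and> (\<forall>y z. (\<forall>k\<in>D. dist (y k) (z k) < r) \<longrightarrow> \<bar>f y - f z\<bar> \<le> \<omega>)"
proof -
  have "uniformly_continuous_on UNIV f"
    using compact_uniformly_continuous[OF assms(2) compact_UNIV_fun[OF assms(1)]] .
  then obtain d where d: "d > 0" "\<And>y z. dist y z < d \<Longrightarrow> dist (f y) (f z) < \<omega>"
    unfolding uniformly_continuous_on_def using assms(3) by (metis UNIV_I)
  obtain D r where "finite D" "r > 0" "\<forall>y z :: 'k \<Rightarrow> 'y. (\<forall>k\<in>D. dist (y k) (z k) < r) \<longrightarrow> dist y z < d"
    using dist_fun_small[OF d(1)] by blast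
  then show ?thesis using d(2) by (intro exI[of _ D] exI[of _ r]) (force simp: dist_real_def)
qed

section \<open>Codes\<close>

definition near :: "'k set \<Rightarrow> real \<Rightarrow> ('k \<Rightarrow> 'y::metric_space) set \<Rightarrow> ('k \<Rightarrow> 'y) \<Rightarrow> bool" where
  "near D r K y \<longleftrightarrow> (\<exists>z\<in>K. \<forall>k\<in>D. dist (y k) (z k) < r)"

text \<open>The value \<open>0\<close> is given to points that are near to none of the sets. For
  \<open>separated_codes\<close> the choice is unique: the factor \<open>2\<close> there makes the \<open>r\<close>-neighbourhoods on \<open>D\<close>
  disjoint.\<close>

definition code :: "'k set \<Rightarrow> real \<Rightarrow> (nat \<Rightarrow> ('k \<Rightarrow> 'y::metric_space) set) \<Rightarrow> ('k \<Rightarrow> 'y) \<Rightarrow> nat" where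
  "code D r K y = (if \<exists>a. near D r (K a) y then (SOME a. near D r (K a) y) else 0)"

definition separated_codes :: "'k set \<Rightarrow> real \<Rightarrow> (nat \<Rightarrow> ('k \<Rightarrow> 'y::metric_space) set) \<Rightarrow> bool" where
  "separated_codes D r K \<longleftrightarrow> finite D \<and> r > 0 \<and>
     (\<forall>a b y z. a \<noteq> b \<longrightarrow> y \<in> K a \<longrightarrow> z \<in> K b \<longrightarrow> (\<exists>k\<in>D. dist (y k) (z k) \<ge> 2 * r))"

lemma near_open: "finite D \<Longrightarrow> open {y :: 'k \<Rightarrow> 'y::metric_space. near D r K y}"
proof -
  assume D: "finite D"
  have "{y. near D r K y} = (\<Union>z\<in>K. \<Inter>k\<in>D. {y. dist (y k) (z k) < r})" by (auto simp: near_def)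
  moreover have "open {y :: 'k \<Rightarrow> 'y. dist (y k) (z k) < r}" for k z
    by (intro open_Collect_less continuous_intros continuous_on_product_coordinates)
  ultimately show ?thesis using D by (simp add: open_UN open_INT)
qed

lemma near_unique:
  assumes "separated_codes D r K" "near D r (K a) y" "near D r (K b) y"
  shows "a = b"
proof (rule ccontr)
  assume ne: "a \<noteq> b"
  obtain z z' where z: "z \<in> K a" "\<forall>k\<in>D. dist (y k) (z k) < r" "z' \<in> K b" "\<forall>k\<in>D. dist (y k) (z' k) < r"
    using assms(2,3) by (auto simp: near_def)
  then obtain k where k: "k \<in> D" "dist (z k) (z' k) \<ge> 2 * r"
    using assms(1) ne unfolding separated_codes_def by blast
  have "dist (z k) (z' k) \<le> dist (y k) (z k) + dist (y k) (z' k)" by (rule dist_triangle3)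
  then show False using z k by force
qed

lemma code_eq: "separated_codes D r K \<Longrightarrow> near D r (K a) y \<Longrightarrow> code D r K y = a"
  unfolding code_def using near_unique by (metis (mono_tags, lifting) someI_ex)

lemma near_cong: "(\<And>k. k \<in> D \<Longrightarrow> y k = y' k) \<Longrightarrow> near D r K y = near D r K y'"
  by (simp add: near_def)

lemma code_in: "{a. K a \<noteq> {}} \<subseteq> C \<Longrightarrow> 0 \<in> C \<Longrightarrow> code D r K y \<in> C"
proof (cases "\<exists>a. near D r (K a) y")
  case True
  assume "{a. K a \<noteq> {}} \<subseteq> C"
  moreover have "near D r (K (code D r K y)) y" using True by (auto simp: code_def intro: someI)
  ultimately show ?thesis by (auto simp: near_def)
qed (simp add: code_def)

text \<open>Disjoint compact sets have positive distance, and finitely many coordinates witness it.\<close>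

lemma separated_codes_exist:
  fixes K :: "nat \<Rightarrow> ('k::countable \<Rightarrow> 'y::metric_space) set"
  assumes K: "\<And>a. compact (K a)" and disj: "\<And>a b. a \<noteq> b \<Longrightarrow> K a \<inter> K b = {}" and fin: "finite {a. K a \<noteq> {}}"
  shows "\<exists>D r. separated_codes D r K"
proof -
  let ?I = "{(a, b). K a \<noteq> {} \<and> K b \<noteq> {} \<and> a \<noteq> b}"
  have "?I \<subseteq> {a. K a \<noteq> {}} \<times> {a. K a \<noteq> {}}" by auto
  then have finI: "finite ?I" using fin finite_subset by blast
  have "\<exists>d>0. \<forall>y\<in>K a. \<forall>z\<in>K b. d \<le> dist y z" if "a \<noteq> b" for a b
  proof (cases "K a = {} \<or> K b = {}")
    case True
    then show ?thesis by (intro exI[of _ 1]) auto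
  next
    case False
    obtain y where y: "y \<in> K a" "\<And>x. x \<in> K a \<Longrightarrow> infdist y (K b) \<le> infdist x (K b)"
      using continuous_attains_inf[OF K[of a], of "\<lambda>x. infdist x (K b)"] False
        continuous_on_infdist[OF continuous_on_id, of "K a" "K b"] by auto
    have "y \<notin> K b" using disj[OF that] y(1) by auto
    then have "infdist y (K b) > 0"
      using infdist_pos_not_in_closed[OF compact_imp_closed[OF K[of b]]] False by auto
    moreover have "infdist y (K b) \<le> dist x z" if "x \<in> K a" "z \<in> K b" for x z
      using y(2)[OF that(1)] infdist_le[OF that(2), of x] by linarith
    ultimately show ?thesis by blast
  qed
  then obtain d where d: "\<And>a b. a \<noteq> b \<Longrightarrow> d a b > 0 \<and> (\<forall>y\<in>K a. \<forall>z\<in>K b. d a b \<le> dist y z)" by metis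
  define m where "m = Min (insert 1 ((\<lambda>(a, b). d a b) ` ?I))"
  have m: "m > 0" unfolding m_def using finI d by (subst Min_gr_iff) auto
  have md: "m \<le> dist y z" if "a \<noteq> b" "y \<in> K a" "z \<in> K b" for a b y z
  proof -
    have "m \<le> d a b" unfolding m_def using finI that by (intro Min_le) auto
    then show ?thesis using d[OF that(1)] that by force
  qed
  obtain D r where D: "finite D" "r > 0" "\<forall>y z :: 'k \<Rightarrow> 'y. (\<forall>k\<in>D. dist (y k) (z k) < r) \<longrightarrow> dist y z < m"
    using dist_fun_small[OF m] by blast
  have "separated_codes D (r / 2) K"
    unfolding separated_codes_def
  proof (intro conjI allI impI)
    fix a b y z assume *: "a \<noteq> b" "y \<in> K a" "z \<in> K b"
    have "\<not> (\<forall>k\<in>D. dist (y k) (z k) < r)" using D(3) md[OF *] by force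
    then show "\<exists>k\<in>D. 2 * (r / 2) \<le> dist (y k) (z k)" by (auto simp: not_less)
  qed (use D in auto)
  then show ?thesis by blast
qed

section \<open>Approximation in product spaces by finite codes\<close>

definition finite_code :: "'x measure \<Rightarrow> ('x \<Rightarrow> nat) \<Rightarrow> bool" where
  "finite_code M p \<longleftrightarrow> p \<in> measurable M (count_space UNIV) \<and> finite (range p)"

lemma finite_code_pair:
  assumes "finite_code M p" "finite_code M p'"
  shows "finite_code M (\<lambda>x. prod_encode (p x, p' x))"
proof -
  have [measurable]: "p \<in> measurable M (count_space UNIV)" "p' \<in> measurable M (count_space UNIV)"
    using assms by (auto simp: finite_code_def)
  have "(\<lambda>x. prod_encode (p x, p' x)) \<in> measurable M (count_space UNIV)" by measurable
  moreover have "range (\<lambda>x. prod_encode (p x, p' x)) \<subseteq> prod_encode ` (range p \<times> range p')" by auto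
  moreover have "finite (prod_encode ` (range p \<times> range p'))" using assms by (simp add: finite_code_def)
  ultimately show ?thesis unfolding finite_code_def by (blast intro: finite_subset)
qed

lemma coordinate_code_measurable:
  "finite_code M p \<Longrightarrow> (\<lambda>x. p (x h)) \<in> measurable (PiM UNIV (\<lambda>_. M)) (count_space UNIV)"
  unfolding finite_code_def by (auto intro: measurable_compose[OF measurable_component_singleton])

definition code_error :: "'x measure \<Rightarrow> ('x \<Rightarrow> nat) \<Rightarrow> (('h \<Rightarrow> nat) \<Rightarrow> bool) \<Rightarrow> ('h \<Rightarrow> 'x) set \<Rightarrow> ('h \<Rightarrow> 'x) set" where
  "code_error M p R A = {x \<in> space (PiM UNIV (\<lambda>_. M)). (x \<in> A) \<noteq> R (\<lambda>h. p (x h))}"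

lemma code_error_measurable:
  assumes "A \<in> sets (PiM UNIV (\<lambda>_. M))" "finite_code M p" "finite E" "depends_only_on E R"
  shows "code_error M p R A \<in> sets (PiM UNIV (\<lambda>_. M))"
proof -
  let ?B = "{x \<in> space (PiM UNIV (\<lambda>_. M)). R (\<lambda>h. p (x h))}"
  have "?B \<in> sets (PiM UNIV (\<lambda>_. M))"
    by (rule pattern_measurable[OF assms(3) _ assms(4)]) (rule coordinate_code_measurable[OF assms(2)])
  moreover have "code_error M p R A = (A - ?B) \<union> (?B - A)"
    using sets.sets_into_space[OF assms(1)] by (auto simp: code_error_def)
  ultimately show ?thesis using assms(1) by auto
qed

definition code_approximable :: "'x measure \<Rightarrow> ('h \<Rightarrow> 'x) set \<Rightarrow> bool" where
  "code_approximable M A \<longleftrightarrow> (\<forall>\<epsilon>>0. \<exists>p E R. finite_code M p \<and> finite E \<and> depends_only_on E R \<and>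
       measure (PiM UNIV (\<lambda>_. M)) (code_error M p R A) < \<epsilon>)"

lemma code_approximable_family:
  fixes A :: "'i \<Rightarrow> ('h \<Rightarrow> 'x) set"
  assumes "finite J" "\<And>j. j \<in> J \<Longrightarrow> code_approximable M (A j)" "\<epsilon> > 0"
  shows "\<exists>p E R. finite_code M p \<and> finite E \<and> (\<forall>j\<in>J. depends_only_on E (R j) \<and>
       measure (PiM UNIV (\<lambda>_. M)) (code_error M p (R j) (A j)) < \<epsilon>)"
  using assms
proof (induction J rule: finite_induct)
  case empty
  show ?case by (intro exI[of _ "\<lambda>_. 0"] exI[of _ "{}"]) (auto simp: finite_code_def)
next
  case (insert j J)
  obtain p1 E1 R1 where 1: "finite_code M p1" "finite E1" "\<And>i. i \<in> J \<Longrightarrow> depends_only_on E1 (R1 i)"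
    "\<And>i. i \<in> J \<Longrightarrow> measure (PiM UNIV (\<lambda>_. M)) (code_error M p1 (R1 i) (A i)) < \<epsilon>"
    using insert by (metis (no_types, lifting) insertI2)
  obtain p2 E2 R2 where 2: "finite_code M p2" "finite E2" "depends_only_on E2 R2"
    "measure (PiM UNIV (\<lambda>_. M)) (code_error M p2 R2 (A j)) < \<epsilon>"
    using insert.prems by (metis code_approximable_def insertI1)
  define p where "p x = prod_encode (p1 x, p2 x)" for x
  define R where "R i a = (if i = j then R2 (\<lambda>h. snd (prod_decode (a h))) else R1 i (\<lambda>h. fst (prod_decode (a h))))" for i and a :: "'h \<Rightarrow> nat"
  have p: "finite_code M p" unfolding p_def by (rule finite_code_pair[OF 1(1) 2(1)])
  have dep: "depends_only_on (E1 \<union> E2) (R i)" if "i \<in> insert j J" for i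
    unfolding depends_only_on_def
  proof clarify
    fix a b :: "'h \<Rightarrow> nat" assume ab: "\<forall>h\<in>E1 \<union> E2. a h = b h"
    show "R i a = R i b"
    proof (cases "i = j")
      case True
      then show ?thesis unfolding R_def using ab by (auto intro!: depends_only_onD[OF 2(3)])
    next
      case False
      then have "i \<in> J" using that by auto
      then show ?thesis unfolding R_def using ab False by (auto intro!: depends_only_onD[OF 1(3)])
    qed
  qed
  have eq: "code_error M p (R i) (A i) = (if i = j then code_error M p2 R2 (A j) else code_error M p1 (R1 i) (A i))" for i
    by (simp add: code_error_def R_def p_def)
  have err: "measure (PiM UNIV (\<lambda>_. M)) (code_error M p (R i) (A i)) < \<epsilon>" if "i \<in> insert j J" for i
    using 1(4)[of i] 2(4) that by (cases "i = j") (auto simp: eq)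
  show ?case
  proof (intro exI conjI ballI)
    show "finite (E1 \<union> E2)" using 1(2) 2(2) by simp
  qed (fact p dep err)+
qed

text \<open>The approximable sets form a \<open>\<sigma>\<close>-algebra that contains the cylinders.\<close>

lemma sets_code_approximable:
  fixes A :: "('h \<Rightarrow> 'x) set"
  assumes M: "prob_space M" and A: "A \<in> sets (PiM UNIV (\<lambda>_. M))"
  shows "code_approximable M A"
proof -
  let ?P = "PiM UNIV (\<lambda>_::'h. M)"
  interpret P: prob_space ?P by (rule prob_space_PiM) (rule M)
  have sp: "space ?P = (\<Pi>\<^sub>E i\<in>UNIV. space M)" by (simp add: space_PiM)
  have "A \<in> sigma_sets (\<Pi>\<^sub>E i\<in>UNIV. space M) {{f \<in> \<Pi>\<^sub>E i\<in>UNIV. space M. f i \<in> B} | i B. i \<in> (UNIV :: 'h set) \<and> B \<in> sets M}"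
    using A by (simp add: sets_PiM_single)
  then have "A \<in> sets ?P \<and> code_approximable M A"
  proof induction
    case (Basic a)
    then obtain i :: 'h and B where a: "a = {f \<in> \<Pi>\<^sub>E i\<in>UNIV. space M. f i \<in> B}" and B: "B \<in> sets M" by auto
    have aset: "a \<in> sets ?P"
      unfolding sets_PiM_single using B a by (intro sigma_sets.Basic) auto
    define p where "p x = (if x \<in> B then 1 else 0 :: nat)" for x
    have "p \<in> measurable M (count_space UNIV)"
      unfolding p_def using B by measurable
    then have "finite_code M p"
      by (auto simp: finite_code_def p_def intro: finite_subset[of _ "{0, 1}"])
    moreover have "code_error M p (\<lambda>b. b i = Suc 0) a = {}"
      by (auto simp: code_error_def a p_def sp)
    moreover have "depends_only_on {i} (\<lambda>b. b i = Suc 0)" by (auto simp: depends_only_on_def)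
    ultimately show ?case
      unfolding code_approximable_def using aset
      by (intro conjI allI impI exI[of _ p] exI[of _ "{i}"] exI[of _ "\<lambda>b. b i = 1"]) auto
  next
    case Empty
    have "code_error M (\<lambda>_. 0) (\<lambda>_. False) ({} :: ('h \<Rightarrow> 'x) set) = {}" by (auto simp: code_error_def)
    then show ?case
      unfolding code_approximable_def
      by (intro conjI allI impI exI[of _ "\<lambda>_. 0"] exI[of _ "{}"] exI[of _ "\<lambda>_. False"])
         (auto simp: finite_code_def depends_only_on_def)
  next
    case (Compl a)
    have "code_approximable M ((\<Pi>\<^sub>E i\<in>UNIV. space M) - a)"
      unfolding code_approximable_def
    proof (intro allI impI)
      fix \<epsilon> :: real assume "\<epsilon> > 0"
      then obtain p E R where p: "finite_code M p" "finite E" "depends_only_on E R" "measure ?P (code_error M p R a) < \<epsilon>"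
        using Compl.IH unfolding code_approximable_def by blast
      have "code_error M p (\<lambda>b. \<not> R b) ((\<Pi>\<^sub>E i\<in>UNIV. space M) - a) = code_error M p R a"
        by (auto simp: code_error_def sp)
      moreover have "depends_only_on E (\<lambda>b. \<not> R b)" using p(3) by (simp add: depends_only_on_def)
      ultimately show "\<exists>p E R. finite_code M p \<and> finite E \<and> depends_only_on E R \<and>
           measure ?P (code_error M p R ((\<Pi>\<^sub>E i\<in>UNIV. space M) - a)) < \<epsilon>"
        using p by (intro exI[of _ p] exI[of _ E] exI[of _ "\<lambda>b. \<not> R b"]) simp
    qed
    then show ?case using Compl.IH sets.compl_sets[of a ?P] by (simp add: sp)
  next
    case (Union a)
    have aset: "a i \<in> sets ?P" and aapp: "code_approximable M (a i)" for i using Union by auto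
    have Uset: "(\<Union>i. a i) \<in> sets ?P" using aset by auto
    have "code_approximable M (\<Union>i. a i)"
      unfolding code_approximable_def
    proof (intro allI impI)
      fix \<epsilon> :: real assume \<epsilon>: "\<epsilon> > 0"
      let ?U = "\<lambda>n. \<Union>i<n. a i"
      have "incseq ?U" unfolding incseq_def by (intro allI impI UN_mono) auto
      then have "(\<lambda>n. measure ?P (?U n)) \<longlonglongrightarrow> measure ?P (\<Union>n. ?U n)"
        using aset by (intro P.finite_Lim_measure_incseq) auto
      moreover have "(\<Union>n. ?U n) = (\<Union>i. a i)" by auto
      ultimately have "eventually (\<lambda>n. measure ?P (?U n) > measure ?P (\<Union>i. a i) - \<epsilon> / 2) sequentially"
        using \<epsilon> by (intro order_tendstoD) auto
      then obtain n where n: "measure ?P (?U n) > measure ?P (\<Union>i. a i) - \<epsilon> / 2"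
        by (auto simp: eventually_sequentially)
      have "\<exists>p E R. finite_code M p \<and> finite E \<and> (\<forall>j\<in>{..<n}. depends_only_on E (R j) \<and>
         measure ?P (code_error M p (R j) (a j)) < \<epsilon> / (2 * (real n + 1)))"
        using aapp \<epsilon> by (intro code_approximable_family) auto
      then obtain p E R where p1: "finite_code M p" "finite E" "\<forall>j\<in>{..<n}. depends_only_on E (R j) \<and>
         measure ?P (code_error M p (R j) (a j)) < \<epsilon> / (2 * (real n + 1))" by blast
      then have p: "finite_code M p" "finite E" "\<And>i. i < n \<Longrightarrow> depends_only_on E (R i)"
        "\<And>i. i < n \<Longrightarrow> measure ?P (code_error M p (R i) (a i)) < \<epsilon> / (2 * (real n + 1))" by auto
      let ?R = "\<lambda>b. \<exists>i<n. R i b"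
      have dep: "depends_only_on E ?R" using p(3) unfolding depends_only_on_def by blast
      have err: "code_error M p (R i) (a i) \<in> sets ?P" if "i < n" for i
        using p that aset by (intro code_error_measurable)
      have D: "(\<Union>i. a i) - ?U n \<in> sets ?P" using aset by auto
      have "code_error M p ?R (\<Union>i. a i) \<subseteq> ((\<Union>i. a i) - ?U n) \<union> (\<Union>i<n. code_error M p (R i) (a i))"
        by (auto simp: code_error_def)
      then have "measure ?P (code_error M p ?R (\<Union>i. a i)) \<le> measure ?P (((\<Union>i. a i) - ?U n) \<union> (\<Union>i<n. code_error M p (R i) (a i)))"
        using D err by (intro P.finite_measure_mono) auto
      also have "\<dots> \<le> measure ?P ((\<Union>i. a i) - ?U n) + measure ?P (\<Union>i<n. code_error M p (R i) (a i))"
        using D err by (intro measure_Un_le) auto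
      also have "measure ?P ((\<Union>i. a i) - ?U n) = measure ?P (\<Union>i. a i) - measure ?P (?U n)"
        using aset by (intro P.finite_measure_Diff) auto
      also have "measure ?P (\<Union>i<n. code_error M p (R i) (a i)) \<le> (\<Sum>i<n. measure ?P (code_error M p (R i) (a i)))"
        using err by (intro measure_UNION_le) auto
      also have "\<dots> \<le> (\<Sum>i<n. \<epsilon> / (2 * (real n + 1)))"
        using p(4) by (intro sum_mono) (auto intro: less_imp_le)
      also have "\<dots> \<le> \<epsilon> / 2" using \<epsilon> by (simp add: field_simps)
      finally have "measure ?P (code_error M p ?R (\<Union>i. a i)) < \<epsilon>" using n by linarith
      then show "\<exists>p E R. finite_code M p \<and> finite E \<and> depends_only_on E R \<and> measure ?P (code_error M p R (\<Union>i. a i)) < \<epsilon>"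
        using p dep by blast
    qed
    then show ?case using Uset by blast
  qed
  then show ?thesis by blast
qed

text \<open>Cover the compact space by finitely many small balls and approximate their preimages. The code
  is paired with \<open>p0\<close>, so that it refines a code that was chosen before.\<close>

lemma code_approximation_of_map:
  fixes Y :: "('h \<Rightarrow> 'x) \<Rightarrow> 'y::{metric_space,second_countable_topology}"
  assumes M: "prob_space M" and Y: "Y \<in> borel_measurable (PiM UNIV (\<lambda>_. M))"
    and cpt: "compact (UNIV :: 'y set)" and \<eta>: "\<eta> > 0" and p0: "finite_code M p0"
  shows "\<exists>p \<pi> E \<phi> B. finite_code M p \<and> p0 = \<pi> \<circ> p \<and> finite E \<and> depends_only_on E \<phi> \<and>
     B \<in> sets (PiM UNIV (\<lambda>_. M)) \<and> measure (PiM UNIV (\<lambda>_. M)) B \<le> \<eta> \<and>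
     (\<forall>x\<in>space (PiM UNIV (\<lambda>_. M)) - B. dist (Y x) (\<phi> (\<lambda>h. p (x h))) < \<eta>)"
proof -
  let ?P = "PiM UNIV (\<lambda>_::'h. M)"
  obtain k where k: "finite k" "UNIV = (\<Union>t\<in>k. ball t \<eta> :: 'y set)"
  proof -
    have "\<exists>k. finite k \<and> UNIV \<subseteq> (\<Union>t\<in>k. ball t \<eta> :: 'y set)"
      using cpt \<eta> unfolding compact_eq_totally_bounded by blast
    then show ?thesis using that by blast
  qed
  let ?A = "\<lambda>t. {x \<in> space ?P. dist (Y x) t < \<eta>}"
  have Aset: "?A t \<in> sets ?P" for t
  proof -
    have "(\<lambda>x. dist (Y x) t) \<in> borel_measurable ?P" by (intro borel_measurable_dist Y) simp
    then show ?thesis by (intro borel_measurable_less) auto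
  qed
  have \<eta>': "\<eta> / (real (card k) + 1) > 0" using \<eta> by simp
  have "\<exists>p E R. finite_code M p \<and> finite E \<and> (\<forall>t\<in>k. depends_only_on E (R t) \<and>
     measure ?P (code_error M p (R t) (?A t)) < \<eta> / (real (card k) + 1))"
    by (rule code_approximable_family[OF k(1) sets_code_approximable[OF M Aset] \<eta>'])
  then obtain p E R where "finite_code M p" "finite E" "\<forall>t\<in>k. depends_only_on E (R t) \<and>
     measure ?P (code_error M p (R t) (?A t)) < \<eta> / (real (card k) + 1)" by blast
  then have p: "finite_code M p" "finite E" "\<And>t. t \<in> k \<Longrightarrow> depends_only_on E (R t)"
     "\<And>t. t \<in> k \<Longrightarrow> measure ?P (code_error M p (R t) (?A t)) < \<eta> / (real (card k) + 1)" by auto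
  define \<phi> where "\<phi> b = (SOME t. t \<in> k \<and> R t b)" for b
  define q where "q x = prod_encode (p x, p0 x)" for x
  define \<phi>' where "\<phi>' b = \<phi> (\<lambda>h. fst (prod_decode (b h)))" for b
  define B where "B = (\<Union>t\<in>k. code_error M p (R t) (?A t))"
  have err: "code_error M p (R t) (?A t) \<in> sets ?P" if "t \<in> k" for t
    using p that Aset by (intro code_error_measurable)
  have 1: "finite_code M q" unfolding q_def by (rule finite_code_pair[OF p(1) p0])
  have 2: "p0 = (snd \<circ> prod_decode) \<circ> q" by (auto simp: q_def)
  have 3: "depends_only_on E \<phi>'"
    unfolding depends_only_on_def
  proof clarify
    fix a b :: "'h \<Rightarrow> nat" assume ab: "\<forall>h\<in>E. a h = b h"
    have "R t (\<lambda>h. fst (prod_decode (a h))) = R t (\<lambda>h. fst (prod_decode (b h)))" if "t \<in> k" for t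
      using ab by (intro depends_only_onD[OF p(3)[OF that]]) auto
    then have "(\<lambda>t. t \<in> k \<and> R t (\<lambda>h. fst (prod_decode (a h)))) = (\<lambda>t. t \<in> k \<and> R t (\<lambda>h. fst (prod_decode (b h))))"
      by auto
    then show "\<phi>' a = \<phi>' b" unfolding \<phi>'_def \<phi>_def by simp
  qed
  have 4: "B \<in> sets ?P" using err k by (auto simp: B_def)
  have 5: "measure ?P B \<le> \<eta>"
  proof -
    have "measure ?P B \<le> (\<Sum>t\<in>k. measure ?P (code_error M p (R t) (?A t)))"
      unfolding B_def using k err by (intro measure_UNION_le) auto
    also have "\<dots> \<le> (\<Sum>t\<in>k. \<eta> / (real (card k) + 1))" using p(4) by (intro sum_mono) (auto intro: less_imp_le)
    also have "\<dots> \<le> \<eta>" using \<eta> by (simp add: field_simps)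
    finally show ?thesis .
  qed
  have 6: "dist (Y x) (\<phi>' (\<lambda>h. q (x h))) < \<eta>" if x: "x \<in> space ?P - B" for x
  proof -
    have eq: "R t (\<lambda>h. p (x h)) \<longleftrightarrow> x \<in> ?A t" if "t \<in> k" for t
      using x that by (auto simp: B_def code_error_def)
    obtain t where t: "t \<in> k" "dist t (Y x) < \<eta>" using k(2) by (metis UNIV_I UN_E mem_ball)
    then have "\<exists>t. t \<in> k \<and> R t (\<lambda>h. p (x h))" using eq x by (auto simp: dist_commute)
    then have "\<phi> (\<lambda>h. p (x h)) \<in> k \<and> R (\<phi> (\<lambda>h. p (x h))) (\<lambda>h. p (x h))"
      unfolding \<phi>_def by (rule someI_ex)
    then have "x \<in> ?A (\<phi> (\<lambda>h. p (x h)))" using eq by blast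
    then show ?thesis by (simp add: \<phi>'_def q_def)
  qed
  show ?thesis
    by (intro exI conjI ballI) (fact 1 2 p(2) 3 4 5 6)+
qed

section \<open>The co-induced process seen through codes\<close>

definition orbit_code :: "('g \<Rightarrow> 'x \<Rightarrow> 'x) \<Rightarrow> ('x \<Rightarrow> nat) \<Rightarrow> 'g \<times> 'h \<Rightarrow> ('h \<Rightarrow> 'x) \<Rightarrow> nat" where
  "orbit_code T p k x = p (T (fst k) (x (snd k)))"

definition row_law :: "'x measure \<Rightarrow> ('g \<Rightarrow> 'x \<Rightarrow> 'x) \<Rightarrow> ('x \<Rightarrow> nat) \<Rightarrow> 'g set \<Rightarrow> ('g \<Rightarrow> nat) \<Rightarrow> real" where
  "row_law M T p D a = measure M {x \<in> space M. \<forall>g\<in>D. p (T g x) = a g}"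

text \<open>The event that \<open>Q\<close> holds for the codes of the translates, as far as these codes are certain.
  Quantifying over the array \<open>\<alpha>\<close> instead of computing it makes the event open whenever \<open>Q\<close> is open
  in the first argument, so that it can be transferred to good models.\<close>

definition coded_event ::
    "'k::group_add set \<Rightarrow> real \<Rightarrow> (nat \<Rightarrow> ('k \<Rightarrow> 'y::metric_space) set) \<Rightarrow> 'k set \<Rightarrow> ('y \<Rightarrow> ('k \<Rightarrow> nat) \<Rightarrow> bool) \<Rightarrow> ('k \<Rightarrow> 'y) set" where
  "coded_event D r K F Q = {z. \<exists>\<alpha>. (\<forall>k\<in>F. near D r (K (\<alpha> k)) (right_shift k z)) \<and> Q (z 0) \<alpha>}"

lemma right_shift_measurable:
  "right_shift k \<in> measurable (borel :: ('k::{group_add,countable} \<Rightarrow> 'y::second_countable_topology) measure) borel"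
  unfolding right_shift_def by (intro measurable_coordinatewise_then_product measurable_product_coordinates)

lemma continuous_on_right_shift:
  "continuous_on UNIV (right_shift k :: ('k::group_add \<Rightarrow> 'y::topological_space) \<Rightarrow> _)"
  unfolding right_shift_def
  by (intro continuous_on_coordinatewise_then_product continuous_on_product_coordinates)

lemma coded_event_open:
  assumes D: "finite D" and F: "finite F" and Q: "\<And>\<alpha>. open {t. Q t \<alpha>}"
  shows "open (coded_event D r K F Q)"
proof -
  have "coded_event D r K F Q = (\<Union>\<alpha>. (\<Inter>k\<in>F. right_shift k -` {z. near D r (K (\<alpha> k)) z}) \<inter> (\<lambda>z. z 0) -` {t. Q t \<alpha>})"
    by (auto simp: coded_event_def)
  moreover have "open ((\<lambda>z. z 0) -` {t. Q t \<alpha>})" for \<alpha>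
    using Q by (intro open_vimage continuous_on_product_coordinates)
  moreover have "open (right_shift k -` {z. near D r (K (\<alpha> k)) z})" for k and \<alpha>
    using near_open[OF D] by (intro open_vimage continuous_on_right_shift)
  ultimately show ?thesis using F by (simp only:) (intro open_UN ballI open_Int open_INT)
qed

lemma coded_event_pullback:
  assumes sep: "separated_codes D r K" and Q: "depends_only_on F (Q (y u))"
    and compat: "\<And>d k. d \<in> D \<Longrightarrow> k \<in> F \<Longrightarrow> s d (s k u) = s (d + k) u" and s0: "s 0 u = u"
    and ev: "pullback_name s u y \<in> coded_event D r K F Q"
  shows "Q (y u) (\<lambda>k. code D r K (pullback_name s (s k u) y))"
proof -
  obtain \<alpha> where \<alpha>: "\<And>k. k \<in> F \<Longrightarrow> near D r (K (\<alpha> k)) (right_shift k (pullback_name s u y))" "Q (y u) \<alpha>"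
    using ev s0 by (auto simp: coded_event_def pullback_name_def)
  have "code D r K (pullback_name s (s k u) y) = \<alpha> k" if k: "k \<in> F" for k
  proof -
    have "near D r (K (\<alpha> k)) (pullback_name s (s k u) y) = near D r (K (\<alpha> k)) (right_shift k (pullback_name s u y))"
      using k compat by (intro near_cong) (simp add: right_shift_def pullback_name_def)
    then show ?thesis using \<alpha>(1)[OF k] by (intro code_eq[OF sep]) simp
  qed
  then have "Q (y u) (\<lambda>k. code D r K (pullback_name s (s k u) y)) = Q (y u) \<alpha>"
    by (intro depends_only_onD[OF Q])
  then show ?thesis using \<alpha>(2) by simp
qed

text \<open>The maps \<open>\<Phi>\<close> and \<open>\<Psi>\<close> are the isomorphism and its inverse, which are inverse and
  equivariant only up to null sets.\<close>

locale coinduced_process =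
  fixes M :: "'x measure" and T :: "'g::{group_add,countable} \<Rightarrow> 'x \<Rightarrow> 'x"
    and \<nu> :: "('g \<times> 'h::{group_add,countable} \<Rightarrow> 'y::polish_space) measure"
    and \<Phi> :: "('h \<Rightarrow> 'x) \<Rightarrow> 'g \<times> 'h \<Rightarrow> 'y" and \<Psi> :: "('g \<times> 'h \<Rightarrow> 'y) \<Rightarrow> 'h \<Rightarrow> 'x"
  assumes sys: "group_system M T" and proc: "metric_process \<nu>"
    and \<Phi>: "\<Phi> \<in> measurable (coinduced_measure M) \<nu>" and \<Psi>: "\<Psi> \<in> measurable \<nu> (coinduced_measure M)"
    and distr_\<Phi>: "distr (coinduced_measure M) \<nu> \<Phi> = \<nu>"
    and \<Psi>\<Phi>: "AE x in coinduced_measure M. \<Psi> (\<Phi> x) = x"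
    and equiv: "\<And>k. AE x in coinduced_measure M. \<Phi> (coinduced_action T k x) = right_shift k (\<Phi> x)"
begin

abbreviation P :: "('h \<Rightarrow> 'x) measure" where "P \<equiv> coinduced_measure M"

lemma P_def: "P = PiM UNIV (\<lambda>_::'h. M)" by (simp add: coinduced_measure_def)

lemma M_prob: "prob_space M" using sys by (simp add: group_system_def)

sublocale P: prob_space P
  unfolding P_def by (rule prob_space_PiM) (rule M_prob)

sublocale N: prob_space \<nu> using proc by (simp add: metric_process_def)

lemma cpt: "compact (UNIV :: 'y set)" using proc by (simp add: metric_process_def)

lemma sets_\<nu>: "sets \<nu> = sets borel" using proc by (simp add: metric_process_def)

lemma space_\<nu>: "space \<nu> = UNIV" using sets_eq_imp_space_eq[OF sets_\<nu>] by simp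

lemma shift_invariant: "distr \<nu> \<nu> (right_shift k) = \<nu>"
proof -
  have "\<forall>k. distr \<nu> \<nu> (right_shift k) = \<nu>" 
    using proc unfolding metric_process_def by (elim conjE)
  then show ?thesis ..
qed

lemma \<nu>_borel_probs: "\<nu> \<in> borel_probs" using N.prob_space_axioms sets_\<nu> by (simp add: borel_probs_def)

lemma T_meas: "T g \<in> measurable M M" and T_pres: "distr M M (T g) = M"
  using sys by (auto simp: group_system_def)

lemma \<Phi>_borel: "\<Phi> \<in> borel_measurable P"
  using \<Phi> measurable_cong_sets[OF refl sets_\<nu>] by blast

lemma space_P: "space P = (\<Pi>\<^sub>E i\<in>UNIV. space M)" by (simp add: P_def space_PiM)

lemma coinduced_action_measurable: "coinduced_action T k \<in> measurable P P"
  unfolding P_def coinduced_action_def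
proof (rule measurable_PiM_single')
  show "(\<lambda>x. T (fst k) (x (h + snd k))) \<in> measurable (PiM UNIV (\<lambda>_::'h. M)) M" for h
    by (rule measurable_compose[OF _ T_meas], rule measurable_component_singleton) simp
  then show "(\<lambda>x h. T (fst k) (x (h + snd k))) \<in> space (PiM UNIV (\<lambda>_::'h. M)) \<rightarrow> (\<Pi>\<^sub>E i\<in>UNIV. space M)"
    by (auto dest: measurable_space)
qed

lemma coinduced_action_preserves: "distr P P (coinduced_action T k) = P"
proof -
  obtain g h where k: "k = (g, h)" by (cases k)
  have "P = distr P P (coinduced_action T k)"
    unfolding P_def
  proof (rule measure_eqI_PiM_infinite[OF refl])
    show "finite_measure (PiM UNIV (\<lambda>_::'h. M))" using P.finite_measure_axioms by (simp add: P_def)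
    fix A :: "'h \<Rightarrow> 'x set" and J :: "'h set" assume J: "finite J" "J \<subseteq> UNIV" and A: "\<And>i. i \<in> J \<Longrightarrow> A i \<in> sets M"
    let ?X = "prod_emb UNIV (\<lambda>_::'h. M) J (Pi\<^sub>E J A)"
    let ?J = "(\<lambda>j. j + h) ` J" and ?A = "\<lambda>i. T g -` A (i - h) \<inter> space M"
    have A': "?A i \<in> sets M" if "i \<in> ?J" for i
      using that A by (auto intro!: measurable_sets[OF T_meas])
    have X: "?X \<in> sets (PiM UNIV (\<lambda>_::'h. M))" using J A by (intro sets_PiM_I) auto
    have "emeasure (distr (PiM UNIV (\<lambda>_::'h. M)) (PiM UNIV (\<lambda>_::'h. M)) (coinduced_action T k)) ?X
       = emeasure (PiM UNIV (\<lambda>_::'h. M)) (coinduced_action T k -` ?X \<inter> space (PiM UNIV (\<lambda>_::'h. M)))"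
      using coinduced_action_measurable X by (intro emeasure_distr) (simp_all add: P_def)
    also have "coinduced_action T k -` ?X \<inter> space (PiM UNIV (\<lambda>_::'h. M)) = prod_emb UNIV (\<lambda>_::'h. M) ?J (Pi\<^sub>E ?J ?A)"
      using measurable_space[OF T_meas]
      by (auto simp: prod_emb_def coinduced_action_def k space_PiM PiE_iff)
    also have "emeasure (PiM UNIV (\<lambda>_::'h. M)) \<dots> = (\<Prod>i\<in>?J. emeasure M (?A i))"
      using J A' M_prob by (intro emeasure_PiM_emb) auto
    also have "\<dots> = (\<Prod>j\<in>J. emeasure M (T g -` A j \<inter> space M))"
      by (subst prod.reindex) (auto simp: inj_on_def)
    also have "\<dots> = (\<Prod>j\<in>J. emeasure M (A j))"
      using A T_meas by (intro prod.cong refl) (metis T_pres emeasure_distr)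
    also have "\<dots> = emeasure (PiM UNIV (\<lambda>_::'h. M)) ?X"
      using J A M_prob by (intro emeasure_PiM_emb[symmetric]) auto
    finally show "emeasure (PiM UNIV (\<lambda>_::'h. M)) ?X = emeasure (distr (PiM UNIV (\<lambda>_::'h. M)) (PiM UNIV (\<lambda>_::'h. M)) (coinduced_action T k)) ?X"
      by simp
  qed simp
  then show ?thesis by simp
qed

text \<open>As the group is countable, the exceptional null sets of all group elements can be joined.\<close>

lemma exceptional_set:
  obtains N0 where "N0 \<in> null_sets P"
    "\<And>x k. x \<in> space P \<Longrightarrow> x \<notin> N0 \<Longrightarrow> \<Phi> (coinduced_action T k x) = right_shift k (\<Phi> x)"
    "\<And>x k. x \<in> space P \<Longrightarrow> x \<notin> N0 \<Longrightarrow> \<Psi> (\<Phi> (coinduced_action T k x)) = coinduced_action T k x"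
proof -
  have "AE x in P. \<Psi> (\<Phi> (coinduced_action T k x)) = coinduced_action T k x" for k
  proof (rule AE_distrD[OF coinduced_action_measurable])
    show "AE x in distr P P (coinduced_action T k). \<Psi> (\<Phi> x) = x"
      unfolding coinduced_action_preserves by (rule \<Psi>\<Phi>)
  qed
  then have "AE x in P. \<forall>k. \<Phi> (coinduced_action T k x) = right_shift k (\<Phi> x) \<and> \<Psi> (\<Phi> (coinduced_action T k x)) = coinduced_action T k x"
    using equiv by (subst AE_all_countable) auto
  then obtain N0 where N0: "{x \<in> space P. \<not> (\<forall>k. \<Phi> (coinduced_action T k x) = right_shift k (\<Phi> x) \<and> \<Psi> (\<Phi> (coinduced_action T k x)) = coinduced_action T k x)} \<subseteq> N0"
    "emeasure P N0 = 0" "N0 \<in> sets P"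
    by (rule AE_E)
  show ?thesis
  proof (rule that[of N0])
    show "N0 \<in> null_sets P" using N0 by (intro null_setsI)
  qed (use N0(1) in blast)+
qed

lemma orbit_code_measurable:
  assumes "finite_code M p"
  shows "orbit_code T p k \<in> measurable P (count_space UNIV)"
proof -
  have "(\<lambda>x. x (snd k)) \<in> measurable (PiM UNIV (\<lambda>_::'h. M)) M"
    by (rule measurable_component_singleton) simp
  from measurable_compose[OF measurable_compose[OF this T_meas], of p] show ?thesis
    using assms unfolding orbit_code_def P_def finite_code_def by blast
qed

lemma row_event_measurable: "finite_code M p \<Longrightarrow> finite D \<Longrightarrow> {x \<in> space M. \<forall>g\<in>D. p (T g x) = a g} \<in> sets M"
  by (rule pattern_event_measurable) (auto simp: finite_code_def intro: measurable_compose[OF T_meas])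

text \<open>The coordinates of the co-induced system are independent, so the codes form an array with
  independent rows.\<close>

lemma orbit_code_rows:
  assumes p: "finite_code M p" and D: "finite D" and E: "finite E"
  shows "measure P {x \<in> space P. \<forall>k\<in>D \<times> E. orbit_code T p k x = a k} = (\<Prod>h\<in>E. row_law M T p D (\<lambda>g\<in>D. a (g, h)))"
proof -
  interpret M: prob_space M by (rule M_prob)
  interpret PP: product_prob_space "\<lambda>_::'h. M" UNIV ..
  let ?X = "\<lambda>h. {x \<in> space M. \<forall>g\<in>D. p (T g x) = a (g, h)}"
  have "{x \<in> space P. \<forall>k\<in>D \<times> E. orbit_code T p k x = a k} = {x \<in> space (PiM UNIV (\<lambda>_::'h. M)). \<forall>h\<in>E. x h \<in> ?X h}"
    by (auto simp: P_def orbit_code_def space_PiM)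
  then have "emeasure P {x \<in> space P. \<forall>k\<in>D \<times> E. orbit_code T p k x = a k} = (\<Prod>h\<in>E. emeasure M (?X h))"
    unfolding P_def using row_event_measurable[OF p D] E by (simp only:) (rule PP.emeasure_PiM_Collect, auto)
  also have "\<dots> = (\<Prod>h\<in>E. ennreal (row_law M T p D (\<lambda>g\<in>D. a (g, h))))"
    by (intro prod.cong refl) (auto simp: row_law_def M.emeasure_eq_measure intro!: arg_cong[where f="measure M"])
  also have "\<dots> = ennreal (\<Prod>h\<in>E. row_law M T p D (\<lambda>g\<in>D. a (g, h)))"
    by (rule prod_ennreal) (simp add: row_law_def)
  finally show ?thesis
    by (simp add: P.emeasure_eq_measure prod_nonneg row_law_def)
qed

lemma row_law_01: "0 \<le> row_law M T p D a \<and> row_law M T p D a \<le> 1"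
  using prob_space.prob_le_1[OF M_prob] by (simp add: row_law_def)

text \<open>By equivariance, an approximation of the coordinate at the identity spreads to a window.\<close>

lemma window_approximation:
  assumes B: "B \<in> sets P" "measure P B \<le> \<eta>"
    and approx: "\<And>x. x \<in> space P \<Longrightarrow> x \<notin> B \<Longrightarrow> dist (\<Phi> x 0) (\<phi> (\<lambda>h. p (x h))) < \<eta>" and D: "finite D"
  shows "\<exists>B'\<in>sets P. measure P B' \<le> real (card D) * \<eta> \<and>
     (\<forall>x\<in>space P. x \<notin> B' \<longrightarrow> (\<forall>k\<in>D. dist (\<Phi> x k) (decode \<phi> (\<lambda>k. orbit_code T p k x) k) < \<eta>))"
proof -
  obtain N0 where N0: "N0 \<in> null_sets P"
    "\<And>x k. x \<in> space P \<Longrightarrow> x \<notin> N0 \<Longrightarrow> \<Phi> (coinduced_action T k x) = right_shift k (\<Phi> x)"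
    by (rule exceptional_set) blast
  let ?B = "\<lambda>k. coinduced_action T k -` B \<inter> space P"
  have Bk: "?B k \<in> sets P" for k using coinduced_action_measurable B(1) by (rule measurable_sets)
  have mB: "measure P (?B k) = measure P B" for k
    using measure_distr[OF coinduced_action_measurable B(1), of k] by (simp add: coinduced_action_preserves)
  let ?B' = "N0 \<union> (\<Union>k\<in>D. ?B k)"
  have "measure P ?B' \<le> measure P N0 + measure P (\<Union>k\<in>D. ?B k)"
    by (intro measure_Un_le sets.finite_UN null_setsD2[OF N0(1)] D Bk)
  also have "measure P N0 = 0" using N0(1) by (simp add: null_sets_def measure_def)
  also have "measure P (\<Union>k\<in>D. ?B k) \<le> (\<Sum>k\<in>D. measure P (?B k))" by (intro measure_UNION_le D Bk)
  also have "\<dots> \<le> (\<Sum>k\<in>D. \<eta>)" using mB B by (intro sum_mono) simp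
  finally have "measure P ?B' \<le> real (card D) * \<eta>" by simp
  moreover have "?B' \<in> sets P" by (intro sets.Un sets.finite_UN null_setsD2[OF N0(1)] D Bk)
  moreover have "dist (\<Phi> x k) (decode \<phi> (\<lambda>k. orbit_code T p k x) k) < \<eta>" if x: "x \<in> space P" "x \<notin> ?B'" and k: "k \<in> D" for x k
  proof -
    have "\<Phi> x k = \<Phi> (coinduced_action T k x) 0" using N0(2)[OF x(1)] x(2) by (simp add: right_shift_def)
    moreover have "decode \<phi> (\<lambda>k. orbit_code T p k x) k = \<phi> (\<lambda>h. p (coinduced_action T k x h))"
      by (simp add: decode_def orbit_code_def coinduced_action_def)
    moreover have "coinduced_action T k x \<in> space P" using measurable_space[OF coinduced_action_measurable x(1)] .
    moreover have "coinduced_action T k x \<notin> B" using x k by auto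
    ultimately show ?thesis using approx by simp
  qed
  ultimately show ?thesis by blast
qed

text \<open>The code of the coordinate at the identity is a measurable function of the process. By inner
  regularity it is constant on compact sets that carry most of the measure.\<close>

lemma code_kernels:
  assumes p: "finite_code M p" and \<eta>: "\<eta> > 0"
  shows "\<exists>K. (\<forall>a. compact (K a)) \<and> (\<forall>a b. a \<noteq> b \<longrightarrow> K a \<inter> K b = {}) \<and> {a. K a \<noteq> {}} \<subseteq> range p \<and>
     measure \<nu> (- (\<Union>a. K a)) \<le> \<eta> \<and> (\<forall>a. \<forall>y\<in>K a. p (\<Psi> y 0) = a)"
proof -
  let ?A = "\<lambda>a. {y. p (\<Psi> y 0) = a}"
  let ?n = "real (card (range p))"
  have fin: "finite (range p)" using p by (simp add: finite_code_def)
  have meas: "(\<lambda>y. p (\<Psi> y 0)) \<in> measurable \<nu> (count_space UNIV)"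
    using p by (intro measurable_compose[OF \<Psi>]) (auto simp: P_def finite_code_def intro: measurable_compose[OF measurable_component_singleton])
  have A: "?A a \<in> sets \<nu>" for a
    using measurable_sets[OF meas, of "{a}"] by (simp add: space_\<nu> vimage_def)
  have "\<exists>K. K \<subseteq> ?A a \<and> compact K \<and> measure \<nu> (?A a - K) \<le> \<eta> / ?n" if a: "a \<in> range p" for a
  proof -
    have n: "?n > 0" using fin a by (auto simp: card_gt_0_iff)
    have eq: "emeasure \<nu> (?A a) = (SUP K \<in> {K. K \<subseteq> ?A a \<and> compact K}. emeasure \<nu> K)"
      using A sets_\<nu> by (intro inner_regular) auto
    show ?thesis
    proof (cases "emeasure \<nu> (?A a) = 0")
      case True
      then show ?thesis using \<eta> n by (intro exI[of _ "{}"]) (auto simp: measure_def)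
    next
      case False
      then have "measure \<nu> (?A a) > 0" by (simp add: N.emeasure_eq_measure zero_less_measure_iff)
      then have "ennreal (measure \<nu> (?A a) - \<eta> / ?n) < emeasure \<nu> (?A a)"
        using \<eta> n by (simp add: N.emeasure_eq_measure ennreal_lessI)
      then obtain K where K: "K \<subseteq> ?A a" "compact K" "ennreal (measure \<nu> (?A a) - \<eta> / ?n) < emeasure \<nu> K"
        unfolding eq less_SUP_iff by blast
      have Ks: "K \<in> sets \<nu>" using borel_closed[OF compact_imp_closed[OF K(2)]] sets_\<nu> by simp
      have "measure \<nu> (?A a) - \<eta> / ?n \<le> measure \<nu> K"
      proof (rule ccontr)
        assume "\<not> ?thesis"
        then have "ennreal (measure \<nu> K) \<le> ennreal (measure \<nu> (?A a) - \<eta> / ?n)" by (intro ennreal_leI) simp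
        then show False using K(3) by (simp add: N.emeasure_eq_measure)
      qed
      then have "measure \<nu> (?A a - K) \<le> \<eta> / ?n"
        using A Ks K(1) by (subst N.finite_measure_Diff) auto
      then show ?thesis using K by blast
    qed
  qed
  then obtain K0 where K0: "\<And>a. a \<in> range p \<Longrightarrow> K0 a \<subseteq> ?A a \<and> compact (K0 a) \<and> measure \<nu> (?A a - K0 a) \<le> \<eta> / ?n"
    by metis
  define K where "K a = (if a \<in> range p then K0 a else {})" for a
  have KA: "K a \<subseteq> ?A a" for a using K0 by (auto simp: K_def)
  have Kc: "compact (K a)" for a using K0 by (auto simp: K_def)
  have Ks: "K a \<in> sets \<nu>" for a using borel_closed[OF compact_imp_closed[OF Kc]] sets_\<nu> by simp
  have "- (\<Union>a. K a) \<subseteq> (\<Union>a\<in>range p. ?A a - K a)" by auto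
  then have "measure \<nu> (- (\<Union>a. K a)) \<le> measure \<nu> (\<Union>a\<in>range p. ?A a - K a)"
    by (intro N.finite_measure_mono sets.finite_UN sets.Diff A Ks fin)
  also have "\<dots> \<le> (\<Sum>a\<in>range p. measure \<nu> (?A a - K a))" by (intro measure_UNION_le sets.Diff A Ks fin)
  also have "\<dots> \<le> (\<Sum>a\<in>range p. \<eta> / ?n)" using K0 by (intro sum_mono) (auto simp: K_def)
  also have "\<dots> = \<eta>" using fin by simp
  finally have small: "measure \<nu> (- (\<Union>a. K a)) \<le> \<eta>" .
  show ?thesis
  proof (intro exI[of _ K] conjI allI impI ballI)
    show "K a \<inter> K b = {}" if "a \<noteq> b" for a b using KA[of a] KA[of b] that by blast
    show "{a. K a \<noteq> {}} \<subseteq> range p" by (auto simp: K_def)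
    show "p (\<Psi> y 0) = a" if "y \<in> K a" for a y using KA[of a] that by blast
  qed (fact Kc small)+
qed

text \<open>Outside a small set, all the translates in the window lie in the compact sets on which the
  code is known.\<close>

lemma coded_event_likely:
  assumes K: "\<And>a. compact (K a)" "{a. K a \<noteq> {}} \<subseteq> range p" "\<And>a y. y \<in> K a \<Longrightarrow> p (\<Psi> y 0) = a"
    and \<eta>: "measure \<nu> (- (\<Union>a. K a)) \<le> \<eta>" and p: "finite_code M p"
    and D: "finite D" and r: "r > 0" and F: "finite F" and Q: "\<And>t. depends_only_on F (Q t)" "\<And>\<alpha>. open {t. Q t \<alpha>}"
    and B: "B \<in> sets P" "measure P B \<le> \<epsilon>'" and ev: "\<And>x. x \<in> space P \<Longrightarrow> x \<notin> B \<Longrightarrow> Q (\<Phi> x 0) (\<lambda>k. orbit_code T p k x)"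
  shows "measure \<nu> (coded_event D r K F Q) \<ge> 1 - \<epsilon>' - real (card F) * \<eta>"
proof -
  obtain N0 where N0: "N0 \<in> null_sets P"
    "\<And>x k. x \<in> space P \<Longrightarrow> x \<notin> N0 \<Longrightarrow> \<Phi> (coinduced_action T k x) = right_shift k (\<Phi> x)"
    "\<And>x k. x \<in> space P \<Longrightarrow> x \<notin> N0 \<Longrightarrow> \<Psi> (\<Phi> (coinduced_action T k x)) = coinduced_action T k x"
    by (rule exceptional_set) blast
  let ?U = "- (\<Union>a. K a)"
  have Us: "?U \<in> sets \<nu>"
  proof -
    have "(\<Union>a. K a) \<in> sets \<nu>" using borel_closed[OF compact_imp_closed[OF K(1)]] sets_\<nu> by (intro sets.countable_UN) auto
    then show ?thesis using space_\<nu> sets.compl_sets[of "\<Union>a. K a" \<nu>] by (simp add: Compl_eq_Diff_UNIV)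
  qed
  have rs: "right_shift k \<in> measurable \<nu> \<nu>" for k
    using right_shift_measurable measurable_cong_sets[OF sets_\<nu> sets_\<nu>] by blast
  let ?b = "\<lambda>k. (\<lambda>x. right_shift k (\<Phi> x)) -` ?U \<inter> space P"
  have bs: "?b k \<in> sets P" for k using measurable_compose[OF \<Phi> rs] Us by (rule measurable_sets)
  have mb: "measure P (?b k) \<le> \<eta>" for k
  proof -
    have "measure P (?b k) = measure (distr P \<nu> (\<lambda>x. right_shift k (\<Phi> x))) ?U"
      using measurable_compose[OF \<Phi> rs] Us by (rule measure_distr[symmetric])
    also have "distr P \<nu> (\<lambda>x. right_shift k (\<Phi> x)) = distr (distr P \<nu> \<Phi>) \<nu> (right_shift k)"
      using rs \<Phi> by (subst distr_distr) (auto simp: comp_def)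
    also have "\<dots> = \<nu>" unfolding distr_\<Phi> by (rule shift_invariant)
    finally show ?thesis using \<eta> by simp
  qed
  let ?A = "coded_event D r K F Q"
  have As: "?A \<in> sets \<nu>" using coded_event_open[OF D F Q(2)] sets_\<nu> by simp
  let ?bad = "(B \<union> N0) \<union> (\<Union>k\<in>F. ?b k)"
  have bads: "?bad \<in> sets P" by (intro sets.Un sets.finite_UN null_setsD2[OF N0(1)] F bs B(1))
  have "measure P ?bad \<le> measure P (B \<union> N0) + measure P (\<Union>k\<in>F. ?b k)" 
    by (intro measure_Un_le sets.Un sets.finite_UN null_setsD2[OF N0(1)] F bs B(1))
  also have "measure P (B \<union> N0) \<le> measure P B + measure P N0" by (intro measure_Un_le null_setsD2[OF N0(1)] B(1))
  also have "measure P N0 = 0" using N0(1) by (simp add: null_sets_def measure_def)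
  also have "measure P (\<Union>k\<in>F. ?b k) \<le> (\<Sum>k\<in>F. measure P (?b k))" by (intro measure_UNION_le F bs)
  also have "\<dots> \<le> (\<Sum>k\<in>F. \<eta>)" using mb by (intro sum_mono)
  finally have bad: "measure P ?bad \<le> \<epsilon>' + real (card F) * \<eta>" using B by simp
  have "space P - ?bad \<subseteq> \<Phi> -` ?A \<inter> space P"
  proof
    fix x assume x: "x \<in> space P - ?bad"
    have "near D r (K (orbit_code T p k x)) (right_shift k (\<Phi> x))" if k: "k \<in> F" for k
    proof -
      have "x \<notin> ?b k" using x k by blast
      then obtain a where a: "right_shift k (\<Phi> x) \<in> K a" using x by auto
      have "p (\<Psi> (right_shift k (\<Phi> x)) 0) = a" using K(3)[OF a] .
      moreover have "\<Psi> (right_shift k (\<Phi> x)) = coinduced_action T k x" using N0(2,3)[of x k] x by simp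
      ultimately have "orbit_code T p k x = a" by (simp add: orbit_code_def coinduced_action_def)
      then show ?thesis using a r by (auto simp: near_def intro!: bexI[of _ "right_shift k (\<Phi> x)"])
    qed
    moreover have "Q (\<Phi> x 0) (\<lambda>k. orbit_code T p k x)" using x by (intro ev) auto
    ultimately have "\<Phi> x \<in> ?A"
      unfolding coded_event_def by (intro CollectI exI[of _ "\<lambda>k. orbit_code T p k x"]) auto
    then show "x \<in> \<Phi> -` ?A \<inter> space P" using x by simp
  qed
  then have "measure P (space P - ?bad) \<le> measure P (\<Phi> -` ?A \<inter> space P)"
    using \<Phi> As by (intro P.finite_measure_mono) (auto intro: measurable_sets)
  also have "\<dots> = measure \<nu> ?A" using measure_distr[OF \<Phi> As] by (simp add: distr_\<Phi>)
  finally show ?thesis using bad P.prob_compl[OF bads] by simp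
qed

text \<open>Openness gives a weak-star neighbourhood on which the event keeps its probability, and the
  probability under the empirical measure is a proportion of places.\<close>

lemma good_models_coded:
  assumes A: "open A" and big: "measure \<nu> A > 1 - \<epsilon>"
  shows "\<exists>\<O>\<in>weak_nbhds \<nu>. \<forall>U (s :: 'g \<times> 'h \<Rightarrow> 'u \<Rightarrow> 'u) y. finite U \<longrightarrow> U \<noteq> {} \<longrightarrow> y \<in> good_models \<O> U s \<longrightarrow>
     real (card {u \<in> U. pullback_name s u y \<notin> A}) \<le> \<epsilon> * real (card U)"
proof -
  obtain \<O> where \<O>: "\<O> \<in> weak_nbhds \<nu>" "\<And>R. R \<in> \<O> \<Longrightarrow> measure R A > 1 - \<epsilon>"
    using weak_nbhd_of_open_set[OF \<nu>_borel_probs A big] by blast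
  have "real (card {u \<in> U. pullback_name s u y \<notin> A}) \<le> \<epsilon> * real (card U)"
    if U: "finite U" "U \<noteq> {}" and y: "y \<in> good_models \<O> U s" for U and s :: "'g \<times> 'h \<Rightarrow> 'u \<Rightarrow> 'u" and y
  proof -
    have "measure (empirical U s y) A > 1 - \<epsilon>" using y \<O>(2) by (auto simp: good_models_def)
    then have "real (card {u \<in> U. pullback_name s u y \<in> A}) / real (card U) > 1 - \<epsilon>"
      using measure_empirical[OF U, of A s y] A by simp
    then have "real (card {u \<in> U. pullback_name s u y \<in> A}) \<ge> (1 - \<epsilon>) * real (card U)"
      using U by (simp add: field_simps card_gt_0_iff)
    moreover have "card U = card {u \<in> U. pullback_name s u y \<in> A} + card {u \<in> U. pullback_name s u y \<notin> A}"
      using U by (subst card_Un_disjoint[symmetric]) (auto intro!: arg_cong[where f=card])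
    ultimately show ?thesis by (simp add: algebra_simps)
  qed
  then show ?thesis using \<O>(1) by blast
qed

end

section \<open>Sofic approximations\<close>

text \<open>Asymptotic statements on the proportion of points become stable under finite conjunctions and
  under changes of variables in this form.\<close>

definition mostly :: "(nat \<Rightarrow> 'v set) \<Rightarrow> (nat \<Rightarrow> 'v \<Rightarrow> bool) \<Rightarrow> bool" where
  "mostly V P \<longleftrightarrow> (\<forall>e>0. eventually (\<lambda>n. real (card {v \<in> V n. \<not> P n v}) \<le> e * real (card (V n))) sequentially)"

lemma mostlyD: "mostly V P \<Longrightarrow> e > 0 \<Longrightarrow> eventually (\<lambda>n. real (card {v \<in> V n. \<not> P n v}) \<le> e * real (card (V n))) sequentially"
  by (simp add: mostly_def)

lemma mostly_mono:
  assumes V: "\<And>n. finite (V n)" and P: "mostly V P" and PQ: "\<And>n v. v \<in> V n \<Longrightarrow> P n v \<Longrightarrow> Q n v"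
  shows "mostly V Q"
  unfolding mostly_def
proof (intro allI impI)
  fix e :: real assume "e > 0"
  from mostlyD[OF P this] show "eventually (\<lambda>n. real (card {v \<in> V n. \<not> Q n v}) \<le> e * real (card (V n))) sequentially"
  proof eventually_elim
    case (elim n)
    have "card {v \<in> V n. \<not> Q n v} \<le> card {v \<in> V n. \<not> P n v}" using V PQ by (intro card_mono) auto
    then show ?case using elim by linarith
  qed
qed

lemma mostly_True: "mostly V (\<lambda>n v. True)"
  by (auto simp: mostly_def)

lemma mostly_conj:
  assumes V: "\<And>n. finite (V n)" and P: "mostly V P" and Q: "mostly V Q"
  shows "mostly V (\<lambda>n v. P n v \<and> Q n v)"
  unfolding mostly_def
proof (intro allI impI)
  fix e :: real assume e: "e > 0"
  then have e2: "e / 2 > 0" by simp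
  from mostlyD[OF P e2] mostlyD[OF Q e2]
  show "eventually (\<lambda>n. real (card {v \<in> V n. \<not> (P n v \<and> Q n v)}) \<le> e * real (card (V n))) sequentially"
  proof eventually_elim
    case (elim n)
    have "{v \<in> V n. \<not> (P n v \<and> Q n v)} = {v \<in> V n. \<not> P n v} \<union> {v \<in> V n. \<not> Q n v}" by auto
    then have "card {v \<in> V n. \<not> (P n v \<and> Q n v)} \<le> card {v \<in> V n. \<not> P n v} + card {v \<in> V n. \<not> Q n v}"
      by (simp add: card_Un_le)
    then show ?case using elim by (simp add: field_simps)
  qed
qed

lemma mostly_ball:
  assumes V: "\<And>n. finite (V n)" and F: "finite F" and P: "\<And>x. x \<in> F \<Longrightarrow> mostly V (P x)"
  shows "mostly V (\<lambda>n v. \<forall>x\<in>F. P x n v)"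
  using F P
proof (induction F rule: finite_induct)
  case empty
  then show ?case by (simp add: mostly_True)
next
  case (insert x F)
  then show ?case using mostly_conj[OF V, where P="P x" and Q="\<lambda>n v. \<forall>x\<in>F. P x n v"] by simp
qed

lemma mostly_of_limit:
  assumes V: "\<And>n. finite (V n)" and lim: "(\<lambda>n. real (card {v \<in> V n. P n v}) / real (card (V n))) \<longlonglongrightarrow> 1"
  shows "mostly V P"
  unfolding mostly_def
proof (intro allI impI)
  fix e :: real assume "e > 0"
  then have "eventually (\<lambda>n. real (card {v \<in> V n. P n v}) / real (card (V n)) > 1 - e) sequentially"
    using lim by (intro order_tendstoD) auto
  then show "eventually (\<lambda>n. real (card {v \<in> V n. \<not> P n v}) \<le> e * real (card (V n))) sequentially"
  proof eventually_elim
    case (elim n)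
    have "card (V n) = card {v \<in> V n. P n v} + card {v \<in> V n. \<not> P n v}"
      using V by (subst card_Un_disjoint[symmetric]) (auto intro!: arg_cong[where f=card])
    moreover have "real (card {v \<in> V n. P n v}) \<ge> (1 - e) * real (card (V n))"
      using elim by (cases "card (V n) = 0") (auto simp: field_simps)
    ultimately show ?case by (simp add: algebra_simps)
  qed
qed

lemma mostly_bij:
  assumes f: "\<And>n. bij_betw (f n) (V n) (V n)" and P: "mostly V P"
  shows "mostly V (\<lambda>n v. P n (f n v))"
proof -
  have "card {v \<in> V n. \<not> P n (f n v)} = card {v \<in> V n. \<not> P n v}" for n
  proof (rule bij_betw_same_card[of "f n"])
    show "bij_betw (f n) {v \<in> V n. \<not> P n (f n v)} {v \<in> V n. \<not> P n v}"
      using f[of n] unfolding bij_betw_def by (auto simp: inj_on_def)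
  qed
  then show ?thesis using P by (simp add: mostly_def)
qed

lemma mostly_fst: "mostly V P \<Longrightarrow> mostly (prod_sets V W) (\<lambda>n u. P n (fst u))"
proof -
  have "{u \<in> prod_sets V W n. \<not> P n (fst u)} = {v \<in> V n. \<not> P n v} \<times> W n" for n by (auto simp: prod_sets_def)
  then have *: "card {u \<in> prod_sets V W n. \<not> P n (fst u)} = card {v \<in> V n. \<not> P n v} * card (W n)" for n
    by (simp add: card_cartesian_product)
  assume "mostly V P"
  then show ?thesis unfolding mostly_def *
    by (auto simp: prod_sets_def card_cartesian_product elim!: eventually_mono intro!: mult_right_mono simp: mult.assoc[symmetric])
qed

lemma mostly_snd: "mostly W P \<Longrightarrow> mostly (prod_sets V W) (\<lambda>n u. P n (snd u))"
proof -
  have "{u \<in> prod_sets V W n. \<not> P n (snd u)} = V n \<times> {v \<in> W n. \<not> P n v}" for n by (auto simp: prod_sets_def)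
  then have *: "card {u \<in> prod_sets V W n. \<not> P n (snd u)} = card (V n) * card {v \<in> W n. \<not> P n v}" for n
    by (simp add: card_cartesian_product)
  assume P: "mostly W P"
  show ?thesis
    unfolding mostly_def *
  proof (intro allI impI)
    fix e :: real assume "e > 0"
    from mostlyD[OF P this]
    show "eventually (\<lambda>n. real (card (V n) * card {v \<in> W n. \<not> P n v}) \<le> e * real (card (prod_sets V W n))) sequentially"
    proof eventually_elim
      case (elim n)
      from mult_left_mono[OF this, of "real (card (V n))"] show ?case
        by (simp add: prod_sets_def card_cartesian_product mult.left_commute)
    qed
  qed
qed

context
  fixes V :: "nat \<Rightarrow> 'v set" and \<sigma> :: "nat \<Rightarrow> 'g::group_add \<Rightarrow> 'v \<Rightarrow> 'v"
  assumes sofic: "sofic_approximation V \<sigma>"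
begin

lemma sofic_finite: "finite (V n)" "V n \<noteq> {}"
  using sofic by (auto simp: sofic_approximation_def)

lemma sofic_bij: "bij_betw (\<sigma> n g) (V n) (V n)"
  using sofic by (auto simp: sofic_approximation_def)

lemma sofic_in: "v \<in> V n \<Longrightarrow> \<sigma> n g v \<in> V n"
  using sofic_bij bij_betwE by blast

lemma sofic_mult: "mostly V (\<lambda>n v. \<sigma> n g (\<sigma> n h v) = \<sigma> n (g + h) v)"
  using sofic by (intro mostly_of_limit sofic_finite) (auto simp: sofic_approximation_def)

lemma sofic_distinct:
  assumes "g \<noteq> h"
  shows "mostly V (\<lambda>n v. \<sigma> n g v \<noteq> \<sigma> n h v)"
proof -
  have "g - h \<noteq> 0" using assms by simp
  then have "mostly V (\<lambda>n v. \<sigma> n (g - h) v \<noteq> v)"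
    using sofic by (intro mostly_of_limit sofic_finite) (auto simp: sofic_approximation_def)
  from mostly_bij[OF sofic_bij this, of "\<lambda>_. h"]
  have "mostly V (\<lambda>n v. \<sigma> n (g - h) (\<sigma> n h v) \<noteq> \<sigma> n h v)" .
  from mostly_conj[OF sofic_finite(1) this sofic_mult[of "g - h" h]] show ?thesis
    by (rule mostly_mono[OF sofic_finite(1)]) auto
qed

lemma sofic_zero: "mostly V (\<lambda>n v. \<sigma> n 0 v = v)"
proof (rule mostly_mono[OF sofic_finite(1) sofic_mult[of 0 0]])
  fix n v assume v: "v \<in> V n" "\<sigma> n 0 (\<sigma> n 0 v) = \<sigma> n (0 + 0) v"
  then have "\<sigma> n 0 (\<sigma> n 0 v) = \<sigma> n 0 v" by simp
  then show "\<sigma> n 0 v = v" using sofic_bij[of n 0] sofic_in[OF v(1), of 0] v(1) by (auto simp: bij_betw_def inj_on_def)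
qed

lemma sofic_free:
  assumes "finite F"
  shows "mostly V (\<lambda>n v. inj_on (\<lambda>g. \<sigma> n g v) F)"
proof -
  have "mostly V (\<lambda>n v. \<forall>x\<in>{(g, h). g \<in> F \<and> h \<in> F \<and> g \<noteq> h}. \<sigma> n (fst x) v \<noteq> \<sigma> n (snd x) v)"
  proof (rule mostly_ball[OF sofic_finite(1)])
    show "finite {(g, h). g \<in> F \<and> h \<in> F \<and> g \<noteq> h}"
      by (rule finite_subset[of _ "F \<times> F"]) (use assms in auto)
  qed (auto intro: sofic_distinct)
  then show ?thesis by (rule mostly_mono[OF sofic_finite(1)]) (auto simp: inj_on_def)
qed

text \<open>A point with \<open>k\<close> distinct images under group elements needs at least \<open>k\<close> points.\<close>

lemma sofic_card_unbounded:
  assumes "infinite (UNIV :: 'g set)"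
  shows "filterlim (\<lambda>n. real (card (V n))) at_top sequentially"
proof -
  have "eventually (\<lambda>n. k \<le> card (V n)) sequentially" for k
  proof -
    obtain F :: "'g set" where F: "finite F" "card F = k" using infinite_arbitrarily_large[OF assms] by blast
    have "(1 / 2 :: real) > 0" by simp
    from mostlyD[OF sofic_free[OF F(1)] this] show ?thesis
    proof eventually_elim
      case (elim n)
      have "card (V n) > 0" using sofic_finite by (simp add: card_gt_0_iff)
      then have "card {v \<in> V n. \<not> inj_on (\<lambda>g. \<sigma> n g v) F} \<noteq> card (V n)" using elim by auto
      then obtain v where v: "v \<in> V n" "inj_on (\<lambda>g. \<sigma> n g v) F"
        by (metis (mono_tags, lifting) Collect_mem_eq Collect_cong)
      have "card ((\<lambda>g. \<sigma> n g v) ` F) \<le> card (V n)"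
        using v(1) sofic_in sofic_finite by (intro card_mono) auto
      then show ?case using F v by (simp add: card_image)
    qed
  qed
  then have "filterlim (\<lambda>n. card (V n)) at_top sequentially" by (simp add: filterlim_at_top)
  then show ?thesis by (rule filterlim_compose[OF filterlim_real_sequentially])
qed

end

lemma sofic_prod_mult:
  assumes V: "sofic_approximation V \<sigma>" and W: "sofic_approximation W \<tau>"
  shows "mostly (prod_sets V W) (\<lambda>n u. prod_maps \<sigma> \<tau> n k (prod_maps \<sigma> \<tau> n k' u) = prod_maps \<sigma> \<tau> n (k + k') u)"
proof -
  have fin: "finite (prod_sets V W n)" for n
    using sofic_finite[OF V] sofic_finite[OF W] by (simp add: prod_sets_def)
  from mostly_conj[OF fin mostly_fst[OF sofic_mult[OF V, of "fst k" "fst k'"]] mostly_snd[OF sofic_mult[OF W, of "snd k" "snd k'"]]]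
  show ?thesis by (rule mostly_mono[OF fin]) (auto simp: prod_maps_def)
qed

lemma sofic_prod_zero:
  assumes V: "sofic_approximation V \<sigma>" and W: "sofic_approximation W \<tau>"
  shows "mostly (prod_sets V W) (\<lambda>n u. prod_maps \<sigma> \<tau> n 0 u = u)"
proof -
  have fin: "finite (prod_sets V W n)" for n
    using sofic_finite[OF V] sofic_finite[OF W] by (simp add: prod_sets_def)
  from mostly_conj[OF fin mostly_fst[OF sofic_zero[OF V]] mostly_snd[OF sofic_zero[OF W]]]
  show ?thesis by (rule mostly_mono[OF fin]) (auto simp: prod_maps_def)
qed

section \<open>Row statistics of good models\<close>

text \<open>The places that are bad for too many pairs \<open>(y, w)\<close> are few by Markov's inequality. At the
  other places \<open>v\<close>, the average over \<open>W\<close> is rearranged into an average of orbit averages along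
  \<open>\<tau>\<close>, each of which is typical unless \<open>(v, w)\<close> is bad for \<open>y\<close>.\<close>

lemma rows_typical:
  fixes Z :: "'s \<Rightarrow> 'v \<Rightarrow> 'w \<Rightarrow> 'a \<Rightarrow> real"
  assumes V: "finite V" and W: "finite W" "W \<noteq> {}" and S: "finite S" "S \<noteq> {}"
    and \<tau>: "\<And>h. bij_betw (\<tau> h) W W" and H: "finite H" "H \<noteq> {}"
    and Z: "\<And>y v w a. 0 \<le> Z y v w a \<and> Z y v w a \<le> 1" and lam: "\<And>a. 0 \<le> lam a \<and> lam a \<le> 1"
    and e: "e > 0" and bad: "\<And>y. y \<in> S \<Longrightarrow> real (card {u \<in> V \<times> W. u \<in> bad y}) \<le> e * b * real (card (V \<times> W))"
    and typical: "\<And>y v w a. y \<in> S \<Longrightarrow> v \<in> V \<Longrightarrow> w \<in> W \<Longrightarrow> (v, w) \<notin> bad y \<Longrightarrow> a \<in> A \<Longrightarrow>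
        \<bar>(\<Sum>h\<in>H. Z y v (\<tau> h w) a) / real (card H) - lam a\<bar> \<le> e"
  shows "\<exists>Vb\<subseteq>V. real (card Vb) \<le> b * real (card V) \<and>
    (\<forall>v\<in>V - Vb. \<forall>a\<in>A. \<bar>(\<Sum>y\<in>S. \<Sum>w\<in>W. Z y v w a) / (real (card S) * real (card W)) - lam a\<bar> \<le> 2 * e)"
proof -
  let ?n = "real (card W)" and ?N = "real (card S)" and ?m = "real (card H)"
  have n: "?n > 0" and N: "?N > 0" and m: "?m > 0" using W S H by (auto simp: card_gt_0_iff)
  \<comment> \<open>The proportion of the pairs \<open>(y, w)\<close> for which the place \<open>v\<close> is bad.\<close>
  define f where "f v = (\<Sum>y\<in>S. real (card {w \<in> W. (v, w) \<in> bad y})) / (?N * ?n)" for v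
  define Vb where "Vb = {v \<in> V. f v \<ge> e}"
  have "e * real (card Vb) \<le> (\<Sum>v\<in>V. f v)"
    unfolding Vb_def by (rule card_markov) (use V n N in \<open>auto simp: f_def intro!: sum_nonneg divide_nonneg_pos\<close>)
  also have "\<dots> = (\<Sum>y\<in>S. \<Sum>v\<in>V. real (card {w \<in> W. (v, w) \<in> bad y})) / (?N * ?n)"
    unfolding f_def sum_divide_distrib[symmetric] by (subst sum.swap) simp
  also have "\<dots> \<le> (\<Sum>y\<in>S. e * b * real (card (V \<times> W))) / (?N * ?n)"
  proof (intro divide_right_mono sum_mono)
    fix y assume y: "y \<in> S"
    have "{u \<in> V \<times> W. u \<in> bad y} = (SIGMA v:V. {w \<in> W. (v, w) \<in> bad y})" by auto
    then have "(\<Sum>v\<in>V. real (card {w \<in> W. (v, w) \<in> bad y})) = real (card {u \<in> V \<times> W. u \<in> bad y})"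
      using V W by (simp add: card_SigmaI)
    then show "(\<Sum>v\<in>V. real (card {w \<in> W. (v, w) \<in> bad y})) \<le> e * b * real (card (V \<times> W))" using bad[OF y] by simp
  qed simp
  also have "\<dots> = e * (b * real (card V))" using n N by (simp add: card_cartesian_product)
  finally have "real (card Vb) \<le> b * real (card V)" using e by simp
  moreover have "\<bar>(\<Sum>y\<in>S. \<Sum>w\<in>W. Z y v w a) / (?N * ?n) - lam a\<bar> \<le> 2 * e" if v: "v \<in> V - Vb" and a: "a \<in> A" for v a
  proof -
    let ?L = "\<lambda>y w. (\<Sum>h\<in>H. Z y v (\<tau> h w) a) / ?m"
    have avg: "(\<Sum>w\<in>W. Z y v w a) = (\<Sum>w\<in>W. ?L y w)" for y
    proof -
      have "(\<Sum>w\<in>W. ?L y w) = (\<Sum>h\<in>H. \<Sum>w\<in>W. Z y v (\<tau> h w) a) / ?m"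
        unfolding sum_divide_distrib[symmetric] by (subst sum.swap) simp
      also have "(\<Sum>h\<in>H. \<Sum>w\<in>W. Z y v (\<tau> h w) a) = (\<Sum>h\<in>H. \<Sum>w\<in>W. Z y v w a)"
        using \<tau> by (intro sum.cong refl sum.reindex_bij_betw)
      finally show ?thesis using m by simp
    qed
    have L01: "0 \<le> ?L y w \<and> ?L y w \<le> 1" for y w
    proof -
      have "(\<Sum>h\<in>H. Z y v (\<tau> h w) a) \<le> (\<Sum>h\<in>H. 1)" using Z by (intro sum_mono) auto
      then show ?thesis using Z m by (auto intro!: divide_nonneg_pos sum_nonneg simp: divide_le_eq)
    qed
    have "\<bar>(\<Sum>y\<in>S. \<Sum>w\<in>W. Z y v w a) - lam a * (?N * ?n)\<bar> = \<bar>\<Sum>y\<in>S. \<Sum>w\<in>W. (?L y w - lam a)\<bar>"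
      unfolding avg by (simp add: sum_subtractf algebra_simps)
    also have "\<dots> \<le> (\<Sum>y\<in>S. \<Sum>w\<in>W. \<bar>?L y w - lam a\<bar>)"
      by (rule order_trans[OF sum_abs]) (intro sum_mono sum_abs)
    also have "\<dots> \<le> (\<Sum>y\<in>S. \<Sum>w\<in>W. e + (if (v, w) \<in> bad y then 1 else 0))"
    proof (intro sum_mono)
      fix y w assume y: "y \<in> S" and w: "w \<in> W"
      have "\<bar>?L y w - lam a\<bar> \<le> 1" using L01[of y w] lam[of a] by linarith
      then show "\<bar>?L y w - lam a\<bar> \<le> e + (if (v, w) \<in> bad y then 1 else 0)"
        using typical[OF y _ w _ a, of v] v e by auto
    qed
    also have "\<dots> = e * (?N * ?n) + (\<Sum>y\<in>S. real (card {w \<in> W. (v, w) \<in> bad y}))"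
      using W by (simp add: sum.distrib sum.If_cases Int_def)
    also have "(\<Sum>y\<in>S. real (card {w \<in> W. (v, w) \<in> bad y})) = f v * (?N * ?n)" using n N by (simp add: f_def)
    also have "\<dots> \<le> e * (?N * ?n)" using v n N by (intro mult_right_mono) (auto simp: Vb_def)
    finally have "\<bar>(\<Sum>y\<in>S. \<Sum>w\<in>W. Z y v w a) - lam a * (?N * ?n)\<bar> \<le> 2 * e * (?N * ?n)" by simp
    moreover have "(\<Sum>y\<in>S. \<Sum>w\<in>W. Z y v w a) / (?N * ?n) - lam a = ((\<Sum>y\<in>S. \<Sum>w\<in>W. Z y v w a) - lam a * (?N * ?n)) / (?N * ?n)"
      using n N by (simp add: field_simps)
    ultimately show ?thesis using n N by (simp add: abs_divide divide_le_eq)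
  qed
  ultimately show ?thesis by (intro exI[of _ Vb]) (auto simp: Vb_def)
qed

definition row_frequencies ::
    "'g set \<Rightarrow> nat set \<Rightarrow> 'h set \<Rightarrow> (('g \<Rightarrow> nat) \<Rightarrow> real) \<Rightarrow> real \<Rightarrow> ('g \<times> 'h \<Rightarrow> nat) \<Rightarrow> bool" where
  "row_frequencies D C H lam e \<alpha> \<longleftrightarrow> (\<forall>a\<in>D \<rightarrow>\<^sub>E C.
     \<bar>(\<Sum>h\<in>H. if \<forall>g\<in>D. \<alpha> (g, h) = a g then 1 else 0) / real (card H) - lam a\<bar> \<le> e)"

lemma row_frequencies_depends: "depends_only_on (D \<times> H) (row_frequencies D C H lam e)"
  unfolding depends_only_on_def row_frequencies_def
  by (intro allI impI ball_cong refl) (auto intro!: arg_cong[where f="\<lambda>x. \<bar>x / _ - _\<bar> \<le> e"] sum.cong)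

context coinduced_process
begin

text \<open>The weak law for the independent rows along \<open>H\<close>, for all patterns of a row at once.\<close>

lemma row_frequencies_likely:
  assumes p: "finite_code M p" and D: "finite D" and C: "finite C" and H: "finite H" "H \<noteq> {}" and e: "e > 0"
  shows "measure P {x \<in> space P. \<not> row_frequencies D C H (row_law M T p D) e (\<lambda>k. orbit_code T p k x)}
     \<le> real (card (D \<rightarrow>\<^sub>E C)) * (2 / (e\<^sup>2 * real (card H)))"
proof -
  let ?m = "real (card H)"
  have m: "?m > 0" using H by (simp add: card_gt_0_iff)
  let ?X = "\<lambda>a h x. if \<forall>g\<in>D. orbit_code T p (g, h) x = a g then 1 else 0 :: real"
  let ?lam = "row_law M T p D"
  have ev: "{x \<in> space P. \<forall>k\<in>D \<times> H'. orbit_code T p k x = a k} \<in> sets P" if "finite H'" for a and H' :: "'h set"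
    using D that by (intro pattern_event_measurable orbit_code_measurable p) auto
  have ev1: "{x \<in> space P. \<forall>g\<in>D. orbit_code T p (g, h) x = a g} \<in> sets P" for a h
    using ev[of "{h}" "\<lambda>k. a (fst k)"] by simp
  have lamr: "?lam (\<lambda>g\<in>D. a g) = ?lam a" for a by (auto simp: row_law_def intro!: arg_cong[where f="measure M"])
  have Xind: "?X a h x = indicator {x \<in> space P. \<forall>g\<in>D. orbit_code T p (g, h) x = a g} x" if "x \<in> space P" for a h x
    using that by (auto simp: indicator_def)
  have Xm: "?X a h \<in> borel_measurable P" for a h
    using ev1[of h a] by (subst measurable_cong[OF Xind]) (auto intro: borel_measurable_indicator)
  have EX: "(\<integral>x. ?X a h x \<partial>P) = ?lam a" for a h
  proof -
    have "(\<integral>x. ?X a h x \<partial>P) = measure P {x \<in> space P. \<forall>g\<in>D. orbit_code T p (g, h) x = a g}"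
      using ev1[of h a] by (subst Bochner_Integration.integral_cong[OF refl Xind]) auto
    also have "\<dots> = ?lam a" using orbit_code_rows[OF p D, of "{h}" "\<lambda>k. a (fst k)"] by (simp add: lamr)
    finally show ?thesis .
  qed
  have EXX: "(\<integral>x. ?X a h x * ?X a h' x \<partial>P) = ?lam a * ?lam a" if "h \<noteq> h'" for a h h'
  proof -
    have "(\<integral>x. ?X a h x * ?X a h' x \<partial>P) = (\<integral>x. indicator {x \<in> space P. \<forall>k\<in>D \<times> {h, h'}. orbit_code T p k x = a (fst k)} x \<partial>P)"
      by (intro Bochner_Integration.integral_cong refl) (auto simp: indicator_def)
    also have "\<dots> = measure P {x \<in> space P. \<forall>k\<in>D \<times> {h, h'}. orbit_code T p k x = a (fst k)}"
      using ev[of "{h, h'}" "\<lambda>k. a (fst k)"] by simp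
    also have "\<dots> = ?lam a * ?lam a" using orbit_code_rows[OF p D, of "{h, h'}" "\<lambda>k. a (fst k)"] that by (simp add: lamr)
    finally show ?thesis .
  qed
  let ?B = "\<lambda>a. {x \<in> space P. e * ?m \<le> \<bar>(\<Sum>h\<in>H. ?X a h x) - (\<Sum>h\<in>H. (\<integral>x. ?X a h x \<partial>P))\<bar>}"
  have Bs: "?B a \<in> sets P" for a
    by (intro borel_measurable_le borel_measurable_abs borel_measurable_diff borel_measurable_sum Xm) auto
  have B: "measure P (?B a) \<le> 2 / (e\<^sup>2 * ?m)" for a
  proof -
    have "measure P (?B a) \<le> 2 * 1\<^sup>2 * real (card ((\<lambda>h. (h, h)) ` H)) / (e * ?m)\<^sup>2"
    proof (rule P.weak_law)
      show "(\<integral>x. ?X a i x * ?X a j x \<partial>P) = (\<integral>x. ?X a i x \<partial>P) * (\<integral>x. ?X a j x \<partial>P)"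
        if "i \<in> H" "j \<in> H" "(i, j) \<notin> (\<lambda>h. (h, h)) ` H" for i j
        unfolding EX using that by (intro EXX) auto
    qed (use H e m Xm in auto)
    also have "card ((\<lambda>h. (h, h)) ` H) = card H" by (rule card_image) (auto simp: inj_on_def)
    finally show ?thesis using m by (simp add: power2_eq_square)
  qed
  have fin: "finite (D \<rightarrow>\<^sub>E C)" using D C by (rule finite_PiE)
  have "{x \<in> space P. \<not> row_frequencies D C H ?lam e (\<lambda>k. orbit_code T p k x)} \<subseteq> (\<Union>a\<in>D \<rightarrow>\<^sub>E C. ?B a)"
  proof clarify
    fix x assume x: "x \<in> space P" "\<not> row_frequencies D C H ?lam e (\<lambda>k. orbit_code T p k x)"
    then obtain a where a: "a \<in> D \<rightarrow>\<^sub>E C" "\<bar>(\<Sum>h\<in>H. ?X a h x) / ?m - ?lam a\<bar> > e"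
      by (auto simp: row_frequencies_def not_le)
    have "(\<Sum>h\<in>H. ?X a h x) - ?m * ?lam a = ((\<Sum>h\<in>H. ?X a h x) / ?m - ?lam a) * ?m" using m by (simp add: field_simps)
    then have "\<bar>(\<Sum>h\<in>H. ?X a h x) - ?m * ?lam a\<bar> = \<bar>(\<Sum>h\<in>H. ?X a h x) / ?m - ?lam a\<bar> * ?m" by (simp add: abs_mult)
    then have "\<bar>(\<Sum>h\<in>H. ?X a h x) - ?m * ?lam a\<bar> \<ge> e * ?m" using a(2) m by simp
    then have "x \<in> ?B a" using x(1) by (simp only: EX sum_constant mem_Collect_eq simp_thms)
    then show "x \<in> (\<Union>a\<in>D \<rightarrow>\<^sub>E C. ?B a)" using a(1) by (rule UN_I[rotated])
  qed
  then have "measure P {x \<in> space P. \<not> row_frequencies D C H ?lam e (\<lambda>k. orbit_code T p k x)} \<le> measure P (\<Union>a\<in>D \<rightarrow>\<^sub>E C. ?B a)"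
    by (intro P.finite_measure_mono sets.finite_UN fin Bs)
  also have "\<dots> \<le> (\<Sum>a\<in>D \<rightarrow>\<^sub>E C. measure P (?B a))" by (intro measure_UNION_le fin Bs)
  also have "\<dots> \<le> (\<Sum>a\<in>D \<rightarrow>\<^sub>E C. 2 / (e\<^sup>2 * ?m))" by (intro sum_mono B)
  finally show ?thesis by simp
qed

end

section \<open>Covering numbers of row models\<close>

lemma image_filter_eq: "f ` {x \<in> A. R (f x)} = {y \<in> f ` A. R y}"
  by auto

lemma depends_only_on_compose: "depends_only_on D F \<Longrightarrow> depends_only_on D (\<lambda>a. G (F a))"
  unfolding depends_only_on_def by (metis (no_types))

context independent_rows
begin

text \<open>Markov's inequality for the number of bad places.\<close>

lemma bad_patterns_rare:
  assumes Q: "depends_only_on (DG \<times> EE) Q" and N': "measure N {x \<in> space N. \<not> Q (\<lambda>k. c k x)} \<le> \<eta>" and x: "x > 0" and \<eta>: "\<eta> \<ge> 0"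
  shows "measure_pmf.prob P {z. x * real (card (V \<times> W)) \<le> real (card {u \<in> V \<times> W. \<not> Q (\<alpha> z u)})} \<le> (\<eta> + window_error + 2 * b) / x"
proof -
  interpret N: prob_space N by (rule N)
  let ?I = "V \<times> W" and ?n = "real (card (V \<times> W))"
  have n: "?n > 0" using V W by (simp add: card_gt_0_iff)
  have tv0: "window_error \<ge> 0" using e0 by (simp add: window_error_def)
  let ?F = "\<lambda>a. if Q a then 0 else 1 :: real"
  have dep: "depends_only_on (DG \<times> EE) ?F"
    by (rule depends_only_on_compose[OF Q, of "\<lambda>q. if q then 0 else 1"])
  have fin: "finite (set_pmf P)" using W q by (auto simp: set_Pi_pmf intro!: finite_PiE_dflt)
  have int: "integrable (measure_pmf P) h" for h :: "_ \<Rightarrow> real" by (rule integrable_measure_pmf_finite[OF fin])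
  have ev: "{x \<in> space N. \<not> Q (\<lambda>k. c k x)} \<in> sets N"
    by (rule pattern_measurable[OF _ c depends_only_on_compose[OF Q, of Not]]) (use DG finEE in auto)
  have EN: "(\<integral>x. ?F (\<lambda>k. c k x) \<partial>N) \<le> \<eta>"
  proof -
    have "(\<integral>x. ?F (\<lambda>k. c k x) \<partial>N) = (\<integral>x. indicator {x \<in> space N. \<not> Q (\<lambda>k. c k x)} x \<partial>N)"
      by (intro Bochner_Integration.integral_cong refl) (auto simp: indicator_def)
    then show ?thesis using ev N' by simp
  qed
  have loc: "measure_pmf.expectation P (\<lambda>z. ?F (\<alpha> z u)) \<le> \<eta> + window_error + (if fst u \<in> Vb then 1 else 0) + (if snd u \<in> Wb then 1 else 0)"
    if u: "u \<in> ?I" for u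
  proof (cases "fst u \<in> Vb \<or> snd u \<in> Wb")
    case True
    have "measure_pmf.expectation P (\<lambda>z. ?F (\<alpha> z u)) \<le> 1"
      by (rule measure_pmf.integral_le_const[OF int]) auto
    then show ?thesis using True tv0 \<eta> by auto
  next
    case False
    have "\<bar>measure_pmf.expectation P (\<lambda>z. ?F (\<alpha> z (fst u, snd u))) - (\<integral>x. ?F (\<lambda>k. c k x) \<partial>N)\<bar> \<le> window_error"
      using u False by (intro local_law dep) auto
    then show ?thesis using EN False by auto
  qed
  have sum: "real (card {u \<in> ?I. \<not> Q (\<alpha> z u)}) = (\<Sum>u\<in>?I. ?F (\<alpha> z u))" for z
    using V W by (simp add: sum.If_cases Int_def)
  have "x * ?n * measure_pmf.prob P {z \<in> space (measure_pmf P). (\<Sum>u\<in>?I. ?F (\<alpha> z u)) \<ge> x * ?n} \<le> measure_pmf.expectation P (\<lambda>z. \<Sum>u\<in>?I. ?F (\<alpha> z u))"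
  proof -
    have "measure_pmf.prob P {z \<in> space (measure_pmf P). (\<Sum>u\<in>?I. ?F (\<alpha> z u)) \<ge> x * ?n} \<le> measure_pmf.expectation P (\<lambda>z. \<Sum>u\<in>?I. ?F (\<alpha> z u)) / (x * ?n)"
      using x n by (intro integral_Markov_inequality_measure[OF int, where A="{}"]) (auto intro!: AE_I2 sum_nonneg)
    then show ?thesis using x n by (simp only: pos_le_divide_eq[OF mult_pos_pos[OF x n]] mult.commute)
  qed
  also have "\<dots> = (\<Sum>u\<in>?I. measure_pmf.expectation P (\<lambda>z. ?F (\<alpha> z u)))"
    using int by (intro Bochner_Integration.integral_sum) auto
  also have "\<dots> \<le> (\<Sum>u\<in>?I. \<eta> + window_error + (if fst u \<in> Vb then 1 else 0) + (if snd u \<in> Wb then 1 else 0))"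
    by (intro sum_mono loc)
  also have "\<dots> \<le> (\<eta> + window_error + max 0 1 * b + 1 * b) * ?n" by (rule sum_bad_le) simp
  finally have "x * measure_pmf.prob P {z. x * ?n \<le> (\<Sum>u\<in>?I. ?F (\<alpha> z u))} * ?n \<le> (\<eta> + window_error + 2 * b) * ?n"
    by (simp add: algebra_simps)
  then have "x * measure_pmf.prob P {z. x * ?n \<le> (\<Sum>u\<in>?I. ?F (\<alpha> z u))} \<le> \<eta> + window_error + 2 * b"
    using n by simp
  then show ?thesis unfolding sum using x by (simp add: field_simps)
qed

text \<open>The array determines a process that is well inside the set \<open>K a\<close> of its own central code
  \<open>a\<close>. The radius \<open>r / 2\<close> leaves room for another model that is close on \<open>D\<close> to have the same code.\<close>

definition recoverable :: "(nat \<Rightarrow> ('g \<times> 'h \<Rightarrow> 'y) set) \<Rightarrow> ('g \<times> 'h) set \<Rightarrow> real \<Rightarrow> ('c \<Rightarrow> nat) \<Rightarrow> ('g \<times> 'h \<Rightarrow> 'c) \<Rightarrow> bool" where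
  "recoverable K D r \<pi> a \<longleftrightarrow> (\<exists>z\<in>K (\<pi> (a 0)). \<forall>k\<in>D. dist (decode \<phi> a k) (z k) < r / 2)"

lemma recoverable_depends:
  assumes "D \<subseteq> DG \<times> DH" "0 \<in> DG" "0 \<in> EE"
  shows "depends_only_on (DG \<times> EE) (recoverable K D r \<pi>)"
  unfolding depends_only_on_def
proof clarify
  fix a b :: "'g \<times> 'h \<Rightarrow> 'c" assume ab: "\<forall>k\<in>DG \<times> EE. a k = b k"
  have "a 0 = b 0" using ab assms by (auto simp: zero_prod_def)
  moreover have "decode \<phi> a k = decode \<phi> b k" if "k \<in> D" for k
    unfolding decode_def
  proof (rule depends_only_onD[OF \<phi>])
    fix h assume "h \<in> E"
    then have "h + snd k \<in> EE"
      unfolding EE using that assms(1) by (intro image_eqI[of _ _ "(h, snd k)"]) auto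
    then have "(fst k, h + snd k) \<in> DG \<times> EE" using that assms(1) by auto
    then show "a (fst k, h + snd k) = b (fst k, h + snd k)" using ab by blast
  qed
  ultimately show "recoverable K D r \<pi> a = recoverable K D r \<pi> b" by (simp add: recoverable_def)
qed

text \<open>A configuration close to a model reads off the coarse rows of the model at most places: by
  Markov's inequality it is \<open>r / 2\<close>-close at most places, and the codes are separated.\<close>

lemma coarse_rows_recovered:
  assumes sep: "separated_codes D r K" and D: "D \<subseteq> DG \<times> DH"
    and \<sigma>bij: "\<And>g. bij_betw (\<sigma> g) V V"
    and \<sigma>0: "\<And>v. v \<in> V \<Longrightarrow> v \<notin> Vb \<Longrightarrow> \<sigma> 0 v = v" and \<tau>0: "\<And>w. w \<in> W \<Longrightarrow> w \<notin> Wb \<Longrightarrow> \<tau> 0 w = w"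
    and few: "real (card {u \<in> V \<times> W. \<not> recoverable K D r \<pi> (\<alpha> z u)}) \<le> x * real (card (V \<times> W))"
    and close: "mean_dist (V \<times> W) f (model z) < \<delta>"
  shows "real (card {u \<in> V \<times> W. \<pi> (\<rho> (z (snd u)) (fst u)) \<noteq> code D r K (pullback_name s u f)})
     \<le> (x + 2 * b + 2 * real (card D) * \<delta> / r) * real (card (V \<times> W))"
proof -
  let ?I = "V \<times> W" and ?n = "real (card (V \<times> W))"
  have n: "?n > 0" using V W by (simp add: card_gt_0_iff)
  have r: "r > 0" and finD: "finite D" using sep by (auto simp: separated_codes_def)
  have finI: "finite ?I" using V W by simp
  let ?far = "{u \<in> ?I. dist (f u) (model z u) \<ge> r / 2}"
  let ?fark = "\<lambda>k. {u \<in> ?I. dist (f (s k u)) (model z (s k u)) \<ge> r / 2}"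
  have far: "real (card ?far) \<le> 2 * \<delta> / r * ?n"
  proof -
    have "r / 2 * real (card ?far) \<le> (\<Sum>u\<in>?I. dist (f u) (model z u))" by (rule card_markov[OF finI]) simp
    also have "\<dots> \<le> \<delta> * ?n" using close n by (simp add: mean_dist_def divide_less_eq)
    finally show ?thesis using r by (simp add: field_simps)
  qed
  have bij: "bij_betw (s k) ?I ?I" for k
    using bij_betw_map_prod[OF \<sigma>bij \<tau>] by blast
  have cardk: "card (?fark k) = card ?far" for k
  proof (rule bij_betw_same_card[of "s k"])
    show "bij_betw (s k) (?fark k) ?far"
    proof (rule bij_betw_subset[OF bij])
      have "s k ` ?fark k = {u \<in> s k ` ?I. dist (f u) (model z u) \<ge> r / 2}"
        by (rule image_filter_eq[where R="\<lambda>u. dist (f u) (model z u) \<ge> r / 2"])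
      also have "s k ` ?I = ?I" using bij[of k] by (rule bij_betw_imp_surj_on)
      finally show "s k ` ?fark k = ?far" .
    qed blast
  qed
  have sub: "{u \<in> ?I. \<pi> (\<rho> (z (snd u)) (fst u)) \<noteq> code D r K (pullback_name s u f)}
     \<subseteq> ({u \<in> ?I. \<not> recoverable K D r \<pi> (\<alpha> z u)} \<union> {u \<in> ?I. fst u \<in> Vb}) \<union> ({u \<in> ?I. snd u \<in> Wb} \<union> (\<Union>k\<in>D. ?fark k))"
  proof (rule subsetI, rule ccontr)
    fix u assume u: "u \<in> {u \<in> ?I. \<pi> (\<rho> (z (snd u)) (fst u)) \<noteq> code D r K (pullback_name s u f)}"
      and nu: "u \<notin> ({u \<in> ?I. \<not> recoverable K D r \<pi> (\<alpha> z u)} \<union> {u \<in> ?I. fst u \<in> Vb}) \<union> ({u \<in> ?I. snd u \<in> Wb} \<union> (\<Union>k\<in>D. ?fark k))"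
    obtain v w where uvw: "u = (v, w)" by (cases u)
    have uI: "u \<in> ?I" using u by blast
    have v: "v \<in> V" "v \<notin> Vb" and w: "w \<in> W" "w \<notin> Wb" and rec: "recoverable K D r \<pi> (\<alpha> z u)"
      using uI nu uvw by auto
    have nf: "dist (f (s k u)) (model z (s k u)) < r / 2" if "k \<in> D" for k
    proof -
      have "u \<notin> ?fark k" using nu that by blast
      then show ?thesis using uI by (simp only: mem_Collect_eq not_le simp_thms)
    qed
    have \<alpha>0: "\<alpha> z u 0 = \<rho> (z w) v" using \<sigma>0[OF v] \<tau>0[OF w] by (simp add: row_pattern_def uvw zero_prod_def)
    obtain z0 where z0: "z0 \<in> K (\<pi> (\<alpha> z u 0))" "\<And>k. k \<in> D \<Longrightarrow> dist (decode \<phi> (\<alpha> z u) k) (z0 k) < r / 2"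
      using rec by (auto simp: recoverable_def)
    have "dist (pullback_name s u f k) (z0 k) < r" if k: "k \<in> D" for k
    proof -
      have "model z (s k u) = decode \<phi> (\<alpha> z u) k"
        using model_decode[OF v(1) w, of k z] k D uvw by (auto simp: pullback_name_def)
      then have "dist (f (s k u)) (decode \<phi> (\<alpha> z u) k) < r / 2" using nf[OF k] by simp
      moreover have "dist (f (s k u)) (z0 k) \<le> dist (f (s k u)) (decode \<phi> (\<alpha> z u) k) + dist (decode \<phi> (\<alpha> z u) k) (z0 k)"
        by (rule dist_triangle)
      ultimately have "dist (f (s k u)) (z0 k) < r" using z0(2)[OF k] by linarith
      then show ?thesis by (simp add: pullback_name_def)
    qed
    then have "near D r (K (\<pi> (\<alpha> z u 0))) (pullback_name s u f)"
      using z0(1) unfolding near_def by blast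
    then have "code D r K (pullback_name s u f) = \<pi> (\<rho> (z w) v)" using code_eq[OF sep] \<alpha>0 by simp
    then show False using u uvw by simp
  qed
  have "card {u \<in> ?I. \<pi> (\<rho> (z (snd u)) (fst u)) \<noteq> code D r K (pullback_name s u f)}
    \<le> card (({u \<in> ?I. \<not> recoverable K D r \<pi> (\<alpha> z u)} \<union> {u \<in> ?I. fst u \<in> Vb}) \<union> ({u \<in> ?I. snd u \<in> Wb} \<union> (\<Union>k\<in>D. ?fark k)))"
    using finI finD by (intro card_mono[OF _ sub]) auto
  also have "\<dots> \<le> (card {u \<in> ?I. \<not> recoverable K D r \<pi> (\<alpha> z u)} + card {u \<in> ?I. fst u \<in> Vb}) + (card {u \<in> ?I. snd u \<in> Wb} + card (\<Union>k\<in>D. ?fark k))"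
    by (intro order_trans[OF card_Un_le] add_mono card_Un_le order_refl)
  finally have "real (card {u \<in> ?I. \<pi> (\<rho> (z (snd u)) (fst u)) \<noteq> code D r K (pullback_name s u f)})
    \<le> (real (card {u \<in> ?I. \<not> recoverable K D r \<pi> (\<alpha> z u)}) + real (card {u \<in> ?I. fst u \<in> Vb})) + (real (card {u \<in> ?I. snd u \<in> Wb}) + real (card (\<Union>k\<in>D. ?fark k)))"
    by (simp flip: of_nat_add)
  moreover have "real (card {u \<in> ?I. fst u \<in> Vb}) \<le> b * ?n"
  proof -
    have "{u \<in> ?I. fst u \<in> Vb} = (V \<inter> Vb) \<times> W" by auto
    then show ?thesis using mult_right_mono[OF Vb, of "real (card W)"] by (simp add: card_cartesian_product mult.assoc)
  qed
  moreover have "real (card {u \<in> ?I. snd u \<in> Wb}) \<le> b * ?n"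
  proof -
    have "{u \<in> ?I. snd u \<in> Wb} = V \<times> (W \<inter> Wb)" by auto
    then show ?thesis using mult_left_mono[OF Wb, of "real (card V)"] by (simp add: card_cartesian_product mult.left_commute)
  qed
  moreover have "real (card (\<Union>k\<in>D. ?fark k)) \<le> real (card D) * (2 * \<delta> / r * ?n)"
  proof -
    have "card (\<Union>k\<in>D. ?fark k) \<le> (\<Sum>k\<in>D. card (?fark k))" by (rule card_UN_le[OF finD])
    then have "real (card (\<Union>k\<in>D. ?fark k)) \<le> (\<Sum>k\<in>D. real (card (?fark k)))" by (simp flip: of_nat_sum)
    also have "\<dots> = real (card D) * real (card ?far)" by (simp only: cardk sum_constant)
    also have "\<dots> \<le> real (card D) * (2 * \<delta> / r * ?n)" by (intro mult_left_mono far) simp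
    finally show ?thesis .
  qed
  ultimately show ?thesis using few by (simp add: algebra_simps)
qed

definition model_law :: "('v \<times> 'w \<Rightarrow> 'y) measure" where
  "model_law = distr (measure_pmf P) (PiM (V \<times> W) (\<lambda>_. borel)) (\<lambda>z. model z)"

lemma model_measurable [measurable]: "(\<lambda>z. model z) \<in> measurable (measure_pmf P) (PiM (V \<times> W) (\<lambda>_. borel))"
  by (simp add: space_PiM)

lemma model_law_prob: "prob_space model_law" "sets model_law = sets (PiM (V \<times> W) (\<lambda>_. borel))"
  unfolding model_law_def by (auto intro!: measure_pmf.prob_space_distr model_measurable)

end

text \<open>A set \<open>F\<close> of configurations that covers half of the row model in mean distance reads off the resampled coarse
  rows up to a Hamming ball. Hence the arrays in the union of these balls have probability at
  least \<open>1 / 4\<close>, and there must be about \<open>card S\<close> of them. The losses are \<open>2 * \<zeta>\<close> for the balls, \<open>2 * \<zeta>\<close> for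
  the spread of the resampled rows and \<open>\<zeta>\<close> for the constant factor.\<close>

lemma covering_lower_bound:
  fixes \<rho> :: "'s \<times> 'w \<Rightarrow> 'v \<Rightarrow> 'c::countable" and \<phi> :: "('h::{group_add,countable} \<Rightarrow> 'c) \<Rightarrow> 'y::polish_space"
  assumes rows: "independent_rows V W \<sigma> \<tau> (pmf_of_set (S \<times> W)) \<rho> \<phi> C E DG DH EE Vb Wb e b lam N c"
    and S: "finite S" "S \<noteq> {}"
    and sep: "separated_codes D r K" and D: "D \<subseteq> DG \<times> DH" "0 \<in> DG" "0 \<in> EE"
    and \<sigma>bij: "\<And>g. bij_betw (\<sigma> g) V V"
    and \<sigma>0: "\<And>v. v \<in> V \<Longrightarrow> v \<notin> Vb \<Longrightarrow> \<sigma> 0 v = v" and \<tau>0: "\<And>w. w \<in> W \<Longrightarrow> w \<notin> Wb \<Longrightarrow> \<tau> 0 w = w"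
    and N': "measure N {x \<in> space N. \<not> independent_rows.recoverable \<phi> K D r \<pi> (\<lambda>k. c k x)} \<le> \<eta>"
    and \<eta>: "\<eta> \<ge> 0" and x: "x > 0" and small: "(\<eta> + independent_rows.window_error C DG EE e + 2 * b) / x \<le> 1 / 8"
    and L: "finite L" "\<And>a. \<pi> a \<in> L" and inj: "\<And>y y'. y \<in> S \<Longrightarrow> y' \<in> S \<Longrightarrow>
        (\<And>v w. v \<in> V \<Longrightarrow> w \<in> W \<Longrightarrow> \<pi> (\<rho> (y, w) v) = \<pi> (\<rho> (y', w) v)) \<Longrightarrow> y = y'"
    and t: "t \<ge> 0" "t * (x + 2 * b + 2 * real (card D) * \<delta> / r) \<le> \<zeta>" "real (card L) * exp (- t) \<le> \<zeta>" and \<zeta>: "\<zeta> > 0"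
    and W_large: "2 * (ln (real (card L)) - ln (1 - exp (- \<zeta>)))\<^sup>2 / (\<zeta>\<^sup>2 * real (card W)) \<le> 1 / 8"
      "ln 4 \<le> \<zeta> * real (card W)"
    and F: "finite F" and cover: "measure (independent_rows.model_law V W \<tau> (pmf_of_set (S \<times> W)) d \<rho> \<phi>)
        {y \<in> space (independent_rows.model_law V W \<tau> (pmf_of_set (S \<times> W)) d \<rho> \<phi>). \<exists>f\<in>F. mean_dist (V \<times> W) f y < \<delta>} > 1 / 2"
  shows "exp (ln (real (card S)) - 5 * \<zeta> * real (card (V \<times> W))) \<le> real (card F)"
proof -
  interpret independent_rows V W \<sigma> \<tau> "pmf_of_set (S \<times> W)" d \<rho> \<phi> C E DG DH EE Vb Wb e b lam N c by (rule rows)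
  let ?n = "real (card (V \<times> W))"
  have nV: "real (card V) \<ge> 1" and nW: "real (card W) \<ge> 1"
    using V W by (simp_all add: real_of_nat_ge_one_iff Suc_le_eq card_gt_0_iff)
  have n: "?n = real (card V) * real (card W)" by (simp add: card_cartesian_product)
  have nW': "real (card W) \<le> ?n" using mult_right_mono[OF nV, of "real (card W)"] n by simp
  have N: "real (card S) > 0" using S by (simp add: card_gt_0_iff)
  have "L \<noteq> {}" using L(2) by blast
  then have Lne: "real (card L) \<ge> 1" using L(1) by (simp add: real_of_nat_ge_one_iff Suc_le_eq card_gt_0_iff)
  define k where "k = (x + 2 * b + 2 * real (card D) * \<delta> / r) * ?n"
  define cur :: "('v \<times> 'w \<Rightarrow> nat) \<Rightarrow> 'w \<Rightarrow> 'v \<Rightarrow> nat" where "cur \<beta> = (\<lambda>w\<in>W. \<lambda>v\<in>V. \<beta> (v, w))" for \<beta>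
  define ball where "ball f = {\<beta> \<in> V \<times> W \<rightarrow>\<^sub>E L. real (card {u \<in> V \<times> W. \<beta> u \<noteq> code D r K (pullback_name s u f)}) \<le> k}" for f
  define FF where "FF = (\<Union>f\<in>F. cur ` ball f)"
  define arr :: "'s \<Rightarrow> 'w \<Rightarrow> 'v \<Rightarrow> nat" where "arr y w = (\<lambda>v\<in>V. \<pi> (\<rho> (y, w) v))" for y w
  have finU: "finite (V \<times> W)" using V W by simp
  have fball: "finite (ball f)" for f
    unfolding ball_def using finU L by (auto intro: finite_subset[OF _ finite_PiE[OF finU, of "\<lambda>_. L"]])
  have cball: "real (card (ball f)) \<le> exp (2 * \<zeta> * ?n)" for f
  proof -
    have "real (card (ball f)) \<le> exp (t * k + ?n * (real (card L) * exp (- t)))"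
      unfolding ball_def by (rule hamming_ball_card[OF finU L(1) t(1)])
    also have "\<dots> \<le> exp (\<zeta> * ?n + ?n * \<zeta>)"
    proof -
      have "t * k \<le> \<zeta> * ?n" unfolding k_def using mult_right_mono[OF t(2), of ?n] by (simp only: mult.assoc of_nat_0_le_iff)
      moreover have "?n * (real (card L) * exp (- t)) \<le> ?n * \<zeta>" by (rule mult_left_mono[OF t(3)]) simp
      moreover have "?n * \<zeta> = \<zeta> * ?n" by (rule mult.commute)
      ultimately have "t * k + ?n * (real (card L) * exp (- t)) \<le> \<zeta> * ?n + ?n * \<zeta>" by linarith
      then show ?thesis by (subst exp_le_cancel_iff)
    qed
    finally show ?thesis by (simp add: algebra_simps)
  qed
  have FFc: "real (card FF) \<le> real (card F) * exp (2 * \<zeta> * ?n)"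
  proof -
    have "card FF \<le> (\<Sum>f\<in>F. card (cur ` ball f))" unfolding FF_def by (rule card_UN_le[OF F])
    also have "\<dots> \<le> (\<Sum>f\<in>F. card (ball f))" by (intro sum_mono card_image_le fball)
    finally have "real (card FF) \<le> (\<Sum>f\<in>F. real (card (ball f)))" by (simp flip: of_nat_sum)
    also have "\<dots> \<le> (\<Sum>f\<in>F. exp (2 * \<zeta> * ?n))" by (intro sum_mono cball)
    finally show ?thesis by simp
  qed
  have FFf: "finite FF" unfolding FF_def using F fball by auto
  let ?cov = "{z. \<exists>f\<in>F. mean_dist (V \<times> W) f (model z) < \<delta>}"
  let ?bad = "{z. x * ?n \<le> real (card {u \<in> V \<times> W. \<not> recoverable K D r \<pi> (\<alpha> z u)})}"
  let ?hit = "{z. (\<lambda>w\<in>W. case_prod arr (z w)) \<in> FF}"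
  have cs: "{y \<in> space model_law. \<exists>f\<in>F. mean_dist (V \<times> W) f y < \<delta>} \<in> sets (PiM (V \<times> W) (\<lambda>_. borel))"
    using covered_set_measurable[OF finU F model_law_prob(2), of \<delta>] by (simp only: model_law_prob(2))
  have "1 / 2 < measure model_law {y \<in> space model_law. \<exists>f\<in>F. mean_dist (V \<times> W) f y < \<delta>}"
    using cover .
  also have "\<dots> = measure_pmf.prob P ((\<lambda>z. model z) -` {y \<in> space model_law. \<exists>f\<in>F. mean_dist (V \<times> W) f y < \<delta>} \<inter> space (measure_pmf P))"
    unfolding model_law_def
    by (rule measure_distr[OF model_measurable])
       (use cs in \<open>simp only: model_law_def\<close>)
  also have "(\<lambda>z. model z) -` {y \<in> space model_law. \<exists>f\<in>F. mean_dist (V \<times> W) f y < \<delta>} \<inter> space (measure_pmf P) = ?cov"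
    using measurable_space[OF model_measurable] by (auto simp: model_law_def)
  finally have pcov: "1 / 2 < measure_pmf.prob P ?cov" .
  have "?cov \<subseteq> ?bad \<union> ?hit"
  proof
    fix z assume "z \<in> ?cov"
    then obtain f where f: "f \<in> F" "mean_dist (V \<times> W) f (model z) < \<delta>" by auto
    show "z \<in> ?bad \<union> ?hit"
    proof (cases "z \<in> ?bad")
      case False
      let ?\<beta> = "\<lambda>u\<in>V \<times> W. \<pi> (\<rho> (z (snd u)) (fst u))"
      have "real (card {u \<in> V \<times> W. \<pi> (\<rho> (z (snd u)) (fst u)) \<noteq> code D r K (pullback_name s u f)}) \<le> k"
        unfolding k_def using False by (intro coarse_rows_recovered[OF sep D(1) \<sigma>bij \<sigma>0 \<tau>0 _ f(2)]) auto
      moreover have "{u \<in> V \<times> W. ?\<beta> u \<noteq> code D r K (pullback_name s u f)} = {u \<in> V \<times> W. \<pi> (\<rho> (z (snd u)) (fst u)) \<noteq> code D r K (pullback_name s u f)}"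
        by auto
      ultimately have "?\<beta> \<in> ball f" unfolding ball_def using L by auto
      moreover have "cur ?\<beta> = (\<lambda>w\<in>W. case_prod arr (z w))"
        by (auto simp: cur_def arr_def fun_eq_iff restrict_def split: prod.splits)
      ultimately have "(\<lambda>w\<in>W. case_prod arr (z w)) \<in> FF" unfolding FF_def using f(1) by (intro UN_I[of f]) (auto intro: rev_image_eqI)
      then show ?thesis by simp
    qed simp
  qed
  then have "measure_pmf.prob P ?cov \<le> measure_pmf.prob P (?bad \<union> ?hit)" by (intro measure_pmf.finite_measure_mono) auto
  also have "\<dots> \<le> measure_pmf.prob P ?bad + measure_pmf.prob P ?hit" by (intro measure_Un_le) auto
  also have "measure_pmf.prob P ?bad \<le> 1 / 8"
    using bad_patterns_rare[OF recoverable_depends[OF D] N' x \<eta>] small by linarith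
  also have "measure_pmf.prob P ?hit \<le> real (card FF) * exp (- ln (real (card S)) + (\<zeta> * real (card V) - ln (1 - (1 - exp (- \<zeta>)))) * real (card W))
       + 2 * (ln (real (card (V \<rightarrow>\<^sub>E L)) / (1 - exp (- \<zeta>))))\<^sup>2 / ((\<zeta> * real (card V))\<^sup>2 * real (card W))"
  proof (rule resampled_rows_spread[OF S W])
    show "finite (V \<rightarrow>\<^sub>E L)" using V L by (intro finite_PiE) auto
    show "y = y'" if "y \<in> S" "y' \<in> S" "\<And>w. w \<in> W \<Longrightarrow> arr y w = arr y' w" for y y'
    proof (rule inj[OF that(1,2)])
      fix v w assume "v \<in> V" "w \<in> W"
      then show "\<pi> (\<rho> (y, w) v) = \<pi> (\<rho> (y', w) v)" using fun_cong[OF that(3), of w v] by (simp add: arr_def)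
    qed
  qed (use L \<zeta> nV FFf in \<open>auto simp: arr_def\<close>)
  also have "2 * (ln (real (card (V \<rightarrow>\<^sub>E L)) / (1 - exp (- \<zeta>))))\<^sup>2 / ((\<zeta> * real (card V))\<^sup>2 * real (card W)) \<le> 1 / 8"
  proof -
    let ?l = "ln (real (card L))" and ?m = "ln (1 - exp (- \<zeta>))"
    have \<kappa>: "0 < 1 - exp (- \<zeta>)" "1 - exp (- \<zeta>) \<le> 1" using \<zeta> by auto
    have m: "?m \<le> 0" using \<kappa> by simp
    have l: "?l \<ge> 0" using Lne by simp
    have "ln (real (card (V \<rightarrow>\<^sub>E L)) / (1 - exp (- \<zeta>))) = real (card V) * ?l - ?m"
      using V Lne \<kappa> by (simp add: card_PiE ln_div ln_realpow)
    moreover have "0 \<le> real (card V) * ?l - ?m"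
      using mult_nonneg_nonneg[of "real (card V)" ?l] l m by linarith
    moreover have "real (card V) * ?l - ?m \<le> real (card V) * (?l - ?m)"
      using mult_right_mono_neg[OF nV m] by (simp add: algebra_simps)
    ultimately have "(ln (real (card (V \<rightarrow>\<^sub>E L)) / (1 - exp (- \<zeta>))))\<^sup>2 \<le> (real (card V) * (?l - ?m))\<^sup>2"
      by (simp add: power_mono)
    then have "2 * (ln (real (card (V \<rightarrow>\<^sub>E L)) / (1 - exp (- \<zeta>))))\<^sup>2 / ((\<zeta> * real (card V))\<^sup>2 * real (card W))
      \<le> 2 * (real (card V) * (?l - ?m))\<^sup>2 / ((\<zeta> * real (card V))\<^sup>2 * real (card W))"
      by (intro divide_right_mono mult_left_mono) auto
    also have "\<dots> = 2 * (?l - ?m)\<^sup>2 / (\<zeta>\<^sup>2 * real (card W))"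
      using nV by (simp add: power_mult_distrib)
    finally show ?thesis using W_large(1) by linarith
  qed
  also have "- ln (real (card S)) + (\<zeta> * real (card V) - ln (1 - (1 - exp (- \<zeta>)))) * real (card W) = - ln (real (card S)) + \<zeta> * ?n + \<zeta> * real (card W)"
    by (simp add: n algebra_simps)
  finally have "1 / 4 < real (card FF) * exp (- ln (real (card S)) + \<zeta> * ?n + \<zeta> * real (card W))" using pcov by linarith
  also have "\<dots> \<le> real (card F) * exp (2 * \<zeta> * ?n) * exp (- ln (real (card S)) + \<zeta> * ?n + \<zeta> * ?n)"
    using FFc nW' \<zeta> by (intro mult_mono) auto
  also have "\<dots> = real (card F) * exp (4 * \<zeta> * ?n - ln (real (card S)))"
    by (simp add: exp_add[symmetric] mult.assoc algebra_simps)
  finally have "1 / 4 * exp (ln (real (card S)) - 4 * \<zeta> * ?n) \<le> real (card F) * exp (4 * \<zeta> * ?n - ln (real (card S))) * exp (ln (real (card S)) - 4 * \<zeta> * ?n)"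
    by (intro mult_right_mono) auto
  also have "\<dots> = real (card F)" by (simp add: mult.assoc exp_add[symmetric])
  finally have main: "exp (ln (real (card S)) - 4 * \<zeta> * ?n) / 4 \<le> real (card F)" by simp
  have "ln 4 \<le> \<zeta> * ?n" using W_large(2) mult_left_mono[OF nW', of \<zeta>] \<zeta> by linarith
  then have "exp (ln (real (card S)) - 5 * \<zeta> * ?n) \<le> exp (ln (real (card S)) - 4 * \<zeta> * ?n - ln 4)" by simp
  also have "\<dots> = exp (ln (real (card S)) - 4 * \<zeta> * ?n) / 4" by (simp add: exp_diff)
  finally show ?thesis using main by linarith
qed

section \<open>Pairs of row models\<close>

lemma prob_pair_pmf_Times:
  assumes "finite (set_pmf p)" "finite (set_pmf q)"
  shows "measure_pmf.prob (pair_pmf p q) (A \<times> B) = measure_pmf.prob p A * measure_pmf.prob q B"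
proof -
  have "measure_pmf.prob (pair_pmf p q) (A \<times> B) = measure_pmf.prob (pair_pmf p q) ((A \<times> B) \<inter> set_pmf (pair_pmf p q))"
    by (rule measure_Int_set_pmf[symmetric])
  also have "(A \<times> B) \<inter> set_pmf (pair_pmf p q) = (A \<inter> set_pmf p) \<times> (B \<inter> set_pmf q)" by auto
  also have "measure_pmf.prob (pair_pmf p q) \<dots> = measure_pmf.prob p (A \<inter> set_pmf p) * measure_pmf.prob q (B \<inter> set_pmf q)"
    using assms by (intro measure_pmf_prob_product) (auto intro: countable_finite)
  finally show ?thesis by (simp add: measure_Int_set_pmf)
qed

lemma measure_pair_Times:
  assumes "prob_space N" "A \<in> sets N" "B \<in> sets N"
  shows "measure (N \<Otimes>\<^sub>M N) (A \<times> B) = measure N A * measure N B"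
proof -
  interpret prob_space N by fact
  have "emeasure (N \<Otimes>\<^sub>M N) (A \<times> B) = emeasure N A * emeasure N B"
    using assms by (intro emeasure_pair_measure_Times)
  then show ?thesis by (simp add: measure_def enn2real_mult)
qed

text \<open>A pair of independent copies is a model with independent rows whose seeds and codes are
  pairs. This is why quenched convergence of row models is automatically double.\<close>

lemma independent_rows_pair:
  fixes V :: "'v set" and W :: "'w set" and \<sigma> :: "'g::{group_add,countable} \<Rightarrow> 'v \<Rightarrow> 'v"
    and \<phi> :: "('h::{group_add,countable} \<Rightarrow> 'c::countable) \<Rightarrow> 'y::{metric_space,second_countable_topology}"
  assumes "independent_rows V W \<sigma> \<tau> q \<rho> \<phi> C E DG DH EE Vb Wb e b lam N c"
  shows "independent_rows V W \<sigma> \<tau> (pair_pmf q q) (\<lambda>j v. (\<rho> (fst j) v, \<rho> (snd j) v))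
     (\<lambda>\<alpha>. (\<phi> (\<lambda>h. fst (\<alpha> h)), \<phi> (\<lambda>h. snd (\<alpha> h)))) (C \<times> C) E DG DH EE Vb Wb (2 * e) b
     (\<lambda>a. lam (\<lambda>g\<in>DG. fst (a g)) * lam (\<lambda>g\<in>DG. snd (a g))) (N \<Otimes>\<^sub>M N) (\<lambda>k x. (c k (fst x), c k (snd x)))"
proof -
  interpret independent_rows V W \<sigma> \<tau> q undefined \<rho> \<phi> C E DG DH EE Vb Wb e b lam N c by fact
  interpret N: prob_space N by (rule N)
    have 1: "depends_only_on E (\<lambda>\<alpha>. (\<phi> (\<lambda>h. fst (\<alpha> h)), \<phi> (\<lambda>h. snd (\<alpha> h))))"
      unfolding depends_only_on_def
    proof (intro allI impI)
      fix a a' :: "'h \<Rightarrow> 'c \<times> 'c" assume eq: "\<forall>h\<in>E. a h = a' h"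
      have "\<phi> (\<lambda>h. fst (a h)) = \<phi> (\<lambda>h. fst (a' h))" using eq by (intro depends_only_onD[OF \<phi>]) auto
      moreover have "\<phi> (\<lambda>h. snd (a h)) = \<phi> (\<lambda>h. snd (a' h))" using eq by (intro depends_only_onD[OF \<phi>]) auto
      ultimately show "(\<phi> (\<lambda>h. fst (a h)), \<phi> (\<lambda>h. snd (a h))) = (\<phi> (\<lambda>h. fst (a' h)), \<phi> (\<lambda>h. snd (a' h)))" by simp
    qed
    have 2: "prob_space (N \<Otimes>\<^sub>M N)" using N by (intro prob_space_pair)
    have 3: "0 \<le> lam (\<lambda>g\<in>DG. fst (a g)) * lam (\<lambda>g\<in>DG. snd (a g)) \<and> lam (\<lambda>g\<in>DG. fst (a g)) * lam (\<lambda>g\<in>DG. snd (a g)) \<le> 1" for a :: "'g \<Rightarrow> 'c \<times> 'c"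
      using lam by (auto intro!: mult_le_one)
    have 4: "\<bar>measure_pmf.prob (pair_pmf q q) {j. \<forall>g\<in>DG. (\<rho> (fst j) (\<sigma> g v), \<rho> (snd j) (\<sigma> g v)) = a g}
       - lam (\<lambda>g\<in>DG. fst (a g)) * lam (\<lambda>g\<in>DG. snd (a g))\<bar> \<le> 2 * e"
      if v: "v \<in> V" "v \<notin> Vb" and a: "a \<in> DG \<rightarrow>\<^sub>E C \<times> C" for v a
    proof -
      let ?A = "{j. \<forall>g\<in>DG. \<rho> j (\<sigma> g v) = fst (a g)}" and ?B = "{j. \<forall>g\<in>DG. \<rho> j (\<sigma> g v) = snd (a g)}"
      let ?a = "\<lambda>g\<in>DG. fst (a g)" and ?b = "\<lambda>g\<in>DG. snd (a g)"
      have "?a \<in> DG \<rightarrow>\<^sub>E C" "?b \<in> DG \<rightarrow>\<^sub>E C" using a by (auto simp: PiE_iff mem_Times_iff)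
      from rows[OF v this(1)] rows[OF v this(2)]
      have 1: "\<bar>measure_pmf.prob q ?A - lam ?a\<bar> \<le> e" "\<bar>measure_pmf.prob q ?B - lam ?b\<bar> \<le> e" by simp_all
      have "{j. \<forall>g\<in>DG. (\<rho> (fst j) (\<sigma> g v), \<rho> (snd j) (\<sigma> g v)) = a g} = ?A \<times> ?B"
        by (auto simp: prod_eq_iff)
      then have "measure_pmf.prob (pair_pmf q q) {j. \<forall>g\<in>DG. (\<rho> (fst j) (\<sigma> g v), \<rho> (snd j) (\<sigma> g v)) = a g} = measure_pmf.prob q ?A * measure_pmf.prob q ?B"
        using q by (simp add: prob_pair_pmf_Times)
      moreover have "measure_pmf.prob q ?A * measure_pmf.prob q ?B - lam ?a * lam ?b
        = (measure_pmf.prob q ?A - lam ?a) * measure_pmf.prob q ?B + lam ?a * (measure_pmf.prob q ?B - lam ?b)"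
        by (simp add: algebra_simps)
      moreover have "\<bar>(measure_pmf.prob q ?A - lam ?a) * measure_pmf.prob q ?B\<bar> \<le> e * 1"
        unfolding abs_mult using 1 e0 by (intro mult_mono) auto
      moreover have "\<bar>lam ?a * (measure_pmf.prob q ?B - lam ?b)\<bar> \<le> 1 * e"
        unfolding abs_mult using 1 e0 lam[of ?a] by (intro mult_mono) auto
      ultimately show ?thesis by linarith
    qed
    have 5: "(\<lambda>x. (c k (fst x), c k (snd x))) \<in> measurable (N \<Otimes>\<^sub>M N) (count_space UNIV)" for k
    proof -
      have "(\<lambda>x. (c k (fst x), c k (snd x))) \<in> measurable (N \<Otimes>\<^sub>M N) (count_space UNIV \<Otimes>\<^sub>M count_space UNIV)"
        by (intro measurable_Pair measurable_compose[OF measurable_fst c] measurable_compose[OF measurable_snd c])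
      then show ?thesis by (simp add: pair_measure_countable)
    qed
    have 6: "measure (N \<Otimes>\<^sub>M N) {x \<in> space (N \<Otimes>\<^sub>M N). \<forall>k\<in>DG \<times> EE. (c k (fst x), c k (snd x)) = a k}
       = (\<Prod>h\<in>EE. lam (\<lambda>g\<in>DG. fst ((\<lambda>g\<in>DG. a (g, h)) g)) * lam (\<lambda>g\<in>DG. snd ((\<lambda>g\<in>DG. a (g, h)) g)))"
      if a: "a \<in> DG \<times> EE \<rightarrow>\<^sub>E C \<times> C" for a
    proof -
      let ?A = "\<lambda>\<pi>. {x \<in> space N. \<forall>k\<in>DG \<times> EE. c k x = (\<lambda>k\<in>DG \<times> EE. \<pi> (a k)) k}"
      have ev: "?A \<pi> \<in> sets N" for \<pi> :: "'c \<times> 'c \<Rightarrow> 'c" using DG finEE c by (intro pattern_event_measurable) auto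
      have "{x \<in> space (N \<Otimes>\<^sub>M N). \<forall>k\<in>DG \<times> EE. (c k (fst x), c k (snd x)) = a k} = ?A fst \<times> ?A snd"
        by (auto simp: space_pair_measure prod_eq_iff)
      then have "measure (N \<Otimes>\<^sub>M N) {x \<in> space (N \<Otimes>\<^sub>M N). \<forall>k\<in>DG \<times> EE. (c k (fst x), c k (snd x)) = a k}
        = measure N (?A fst) * measure N (?A snd)"
        using measure_pair_Times[OF N ev ev] by simp
      moreover have "(\<lambda>k\<in>DG \<times> EE. \<pi> (a k)) \<in> DG \<times> EE \<rightarrow>\<^sub>E C" if "\<pi> = fst \<or> \<pi> = snd" for \<pi>
        using that a by (auto simp: PiE_iff mem_Times_iff)
      then have "measure N (?A \<pi>) = (\<Prod>h\<in>EE. lam (\<lambda>g\<in>DG. \<pi> (a (g, h))))" if "\<pi> = fst \<or> \<pi> = snd" for \<pi>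
        using row_law[of "\<lambda>k\<in>DG \<times> EE. \<pi> (a k)"] that by (auto intro!: prod.cong arg_cong[where f=lam])
      ultimately show ?thesis
        by (simp add: prod.distrib cong: restrict_cong)
    qed
  show ?thesis
  proof (rule independent_rows.intro)
    show "finite (set_pmf (pair_pmf q q))" using q by simp
    show "finite (C \<times> C)" using C by simp
    show "(\<rho> (fst j) v, \<rho> (snd j) v) \<in> C \<times> C" for j v using \<rho> by simp
    show "0 \<le> 2 * e" using e0 by simp
    show "(c k (fst x), c k (snd x)) \<in> C \<times> C" if "x \<in> space (N \<Otimes>\<^sub>M N)" for k x
      using that cC[of "fst x" k] cC[of "snd x" k] by (simp add: space_pair_measure mem_Times_iff)
    show "\<tau> h (\<tau> h' w) = \<tau> (h + h') w" if "w \<in> W" "w \<notin> Wb" "h \<in> E" "h' \<in> DH" for w h h'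
      using that by (rule compat)
    show "inj_on (\<lambda>h. \<tau> h w) EE" if "w \<in> W" "w \<notin> Wb" for w
      using that by (rule free)
  qed (fact V W \<sigma> \<tau> E DG DH EE Vb Wb 1 2 3 5 | rule 4, assumption+ | rule 6, assumption)+
qed

lemma pair_model_law:
  fixes V :: "'v set" and W :: "'w set" and \<sigma> :: "'g::{group_add,countable} \<Rightarrow> 'v \<Rightarrow> 'v"
    and \<phi> :: "('h::{group_add,countable} \<Rightarrow> 'c::countable) \<Rightarrow> 'y::polish_space"
  assumes "independent_rows V W \<sigma> \<tau> q \<rho> \<phi> C E DG DH EE Vb Wb e b lam N c"
  shows "pair_model_measure (V \<times> W) (independent_rows.model_law V W \<tau> q d \<rho> \<phi>)
    = independent_rows.model_law V W \<tau> (pair_pmf q q) (d, d) (\<lambda>j v. (\<rho> (fst j) v, \<rho> (snd j) v))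
        (\<lambda>\<alpha>. (\<phi> (\<lambda>h. fst (\<alpha> h)), \<phi> (\<lambda>h. snd (\<alpha> h))))"
proof -
  interpret R: independent_rows V W \<sigma> \<tau> q d \<rho> \<phi> C E DG DH EE Vb Wb e b lam N c by fact
  let ?\<rho> = "\<lambda>j v. (\<rho> (fst j) v, \<rho> (snd j) v)" and ?\<phi> = "\<lambda>\<alpha>. (\<phi> (\<lambda>h. fst (\<alpha> h)), \<phi> (\<lambda>h. snd (\<alpha> h)))"
  interpret R2: independent_rows V W \<sigma> \<tau> "pair_pmf q q" "(d, d)" ?\<rho> ?\<phi> "C \<times> C" E DG DH EE Vb Wb "2 * e" b
     "\<lambda>a. lam (\<lambda>g\<in>DG. fst (a g)) * lam (\<lambda>g\<in>DG. snd (a g))" "N \<Otimes>\<^sub>M N" "\<lambda>k x. (c k (fst x), c k (snd x))"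
    by (rule independent_rows_pair[OF assms])
  let ?P = "measure_pmf R.P" and ?S = "PiM (V \<times> W) (\<lambda>_. borel) :: ('v \<times> 'w \<Rightarrow> 'y) measure"
  let ?S2 = "PiM (V \<times> W) (\<lambda>_. borel) :: ('v \<times> 'w \<Rightarrow> 'y \<times> 'y) measure"
  let ?m = "\<lambda>z. restrict (row_model \<tau> \<rho> \<phi> z) (V \<times> W)"
  let ?f = "\<lambda>p. \<lambda>u\<in>V \<times> W. (?m (fst p) u, ?m (snd p) u)"
  have m: "?m \<in> measurable ?P ?S" by (rule R.model_measurable)
  interpret RL: prob_space R.model_law by (rule R.model_law_prob)
  have "R.model_law \<Otimes>\<^sub>M R.model_law = distr (?P \<Otimes>\<^sub>M ?P) (?S \<Otimes>\<^sub>M ?S) (\<lambda>(x, y). (?m x, ?m y))"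
    unfolding R.model_law_def
    by (rule pair_measure_distr[OF m m]) (use RL.sigma_finite_measure_axioms in \<open>simp add: R.model_law_def\<close>)
  then have 1: "pair_model_measure (V \<times> W) R.model_law = distr (?P \<Otimes>\<^sub>M ?P) ?S2 ?f"
    unfolding pair_model_measure_def
  proof (simp only:)
    have g: "(\<lambda>(x, x'). \<lambda>v\<in>V \<times> W. (x v, x' v)) \<in> measurable (?S \<Otimes>\<^sub>M ?S) ?S2"
      by (rule pairing_models_measurable) simp
    have h: "(\<lambda>(x, y). (?m x, ?m y)) \<in> measurable (?P \<Otimes>\<^sub>M ?P) (?S \<Otimes>\<^sub>M ?S)"
      unfolding case_prod_beta'
      by (intro measurable_Pair measurable_compose[OF measurable_fst m] measurable_compose[OF measurable_snd m])
    show "distr (distr (?P \<Otimes>\<^sub>M ?P) (?S \<Otimes>\<^sub>M ?S) (\<lambda>(x, y). (?m x, ?m y))) ?S2 (\<lambda>(x, x'). \<lambda>v\<in>V \<times> W. (x v, x' v)) = distr (?P \<Otimes>\<^sub>M ?P) ?S2 ?f"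
      by (subst distr_distr[OF g h]) (auto intro!: distr_cong simp: comp_def case_prod_beta')
  qed
  have f: "?f \<in> measurable (?P \<Otimes>\<^sub>M ?P) ?S2"
  proof (rule measurable_restrict)
    fix u assume u: "u \<in> V \<times> W"
    have mu: "(\<lambda>z. ?m z u) \<in> measurable ?P borel" by simp
    have "(\<lambda>p. (?m (fst p) u, ?m (snd p) u)) \<in> measurable (?P \<Otimes>\<^sub>M ?P) (borel \<Otimes>\<^sub>M borel)"
      by (intro measurable_Pair measurable_compose[OF measurable_fst mu] measurable_compose[OF measurable_snd mu])
    then show "(\<lambda>p. (?m (fst p) u, ?m (snd p) u)) \<in> borel_measurable (?P \<Otimes>\<^sub>M ?P)" by (simp add: borel_prod)
  qed
  interpret PP: pair_sigma_finite ?P ?P ..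
  have f': "?f \<in> measurable (measure_pmf (pair_pmf R.P R.P)) ?S2" by (simp add: space_PiM)
  have 2: "distr (?P \<Otimes>\<^sub>M ?P) ?S2 ?f = distr (measure_pmf (pair_pmf R.P R.P)) ?S2 ?f"
  proof (rule measure_eqI)
    fix A assume "A \<in> sets (distr (?P \<Otimes>\<^sub>M ?P) ?S2 ?f)"
    then have A: "A \<in> sets ?S2" by simp
    have sp: "space (?P \<Otimes>\<^sub>M ?P) = UNIV" by (simp add: space_pair_measure)
    have "emeasure (distr (?P \<Otimes>\<^sub>M ?P) ?S2 ?f) A = emeasure (?P \<Otimes>\<^sub>M ?P) (?f -` A \<inter> space (?P \<Otimes>\<^sub>M ?P))"
      by (rule emeasure_distr[OF f A])
    also have "\<dots> = (\<integral>\<^sup>+ x. \<integral>\<^sup>+ y. indicator (?f -` A \<inter> space (?P \<Otimes>\<^sub>M ?P)) (x, y) \<partial>?P \<partial>?P)"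
      by (rule measure_pmf.emeasure_pair_measure[OF measurable_sets[OF f A]])
    also have "\<dots> = (\<integral>\<^sup>+ p. indicator (?f -` A) p \<partial>measure_pmf (pair_pmf R.P R.P))"
      unfolding sp by (simp add: nn_integral_pair_pmf')
    also have "\<dots> = emeasure (measure_pmf (pair_pmf R.P R.P)) (?f -` A)" by simp
    also have "\<dots> = emeasure (distr (measure_pmf (pair_pmf R.P R.P)) ?S2 ?f) A"
      using emeasure_distr[OF f' A] by simp
    finally show "emeasure (distr (?P \<Otimes>\<^sub>M ?P) ?S2 ?f) A = emeasure (distr (measure_pmf (pair_pmf R.P R.P)) ?S2 ?f) A" .
  qed simp
  have "R2.model_law = distr (measure_pmf (map_pmf (\<lambda>(a, b) w. (a w, b w)) (pair_pmf R.P R.P))) ?S2 (\<lambda>z. restrict (row_model \<tau> ?\<rho> ?\<phi> z) (V \<times> W))"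
    unfolding R2.model_law_def using R.W(1) by (subst Pi_pmf_pair) auto
  also have "\<dots> = distr (measure_pmf (pair_pmf R.P R.P)) ?S2 ?f"
    unfolding map_pmf_rep_eq
    by (subst distr_distr) (auto simp: space_PiM comp_def row_model_def fun_eq_iff intro!: distr_cong)
  finally show ?thesis using 1 2 by simp
qed

section \<open>Finitary quenched convergence\<close>

definition has_modulus :: "'k set \<Rightarrow> real \<Rightarrow> real \<Rightarrow> (('k \<Rightarrow> 'y::metric_space) \<Rightarrow> real) \<Rightarrow> bool" where
  "has_modulus D r \<omega> f \<longleftrightarrow> (\<forall>y z. (\<forall>k\<in>D. dist (y k) (z k) < r) \<longrightarrow> \<bar>f y - f z\<bar> \<le> \<omega>)"

text \<open>A quantitative form of the two conditions of quenched convergence, tested on all functions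
  that are controlled at the scale \<open>(D, r)\<close> at once. Having one scale for all test functions allows a
  diagonal choice of models.\<close>

definition quenched_close ::
    "'u set \<Rightarrow> ('k \<Rightarrow> 'u \<Rightarrow> 'u) \<Rightarrow> ('u \<Rightarrow> 'y) measure \<Rightarrow> ('k \<Rightarrow> 'y::metric_space) measure \<Rightarrow> 'k set \<Rightarrow> real \<Rightarrow> bool" where
  "quenched_close U s m \<mu> D r \<longleftrightarrow> (\<forall>f \<omega>. continuous_on UNIV f \<longrightarrow> (\<forall>y. \<bar>f y\<bar> \<le> 1) \<longrightarrow> has_modulus D r \<omega> f \<longrightarrow>
     real (card {u \<in> U. \<not> \<bar>(\<integral>z. f z \<partial>distr m borel (pullback_name s u)) - (\<integral>z. f z \<partial>\<mu>)\<bar> \<le> 2 * \<omega> + r}) \<le> r * real (card U) \<and>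
     measure m {y \<in> space m. \<not> \<bar>(\<Sum>u\<in>U. f (pullback_name s u y)) / real (card U) - (\<integral>z. f z \<partial>\<mu>)\<bar> \<le> 2 * \<omega> + r} \<le> r)"

lemma quenched_close_imp_converges:
  fixes m :: "nat \<Rightarrow> ('u \<Rightarrow> 'y::{metric_space,second_countable_topology}) measure" and \<mu> :: "('k::countable \<Rightarrow> 'y) measure"
  assumes U: "\<And>i. finite (U i)" "\<And>i. U i \<noteq> {}" and cpt: "compact (UNIV :: 'y set)"
    and m: "model_measures U m"
    and close: "\<And>i. quenched_close (U i) (s i) (m i) \<mu> (D i) (r i)"
    and D: "\<And>F. finite F \<Longrightarrow> eventually (\<lambda>i. F \<subseteq> D i) sequentially" and r: "r \<longlonglongrightarrow> 0"
  shows "quenched_converges U s m \<mu>"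
  unfolding quenched_converges_def
proof
  fix \<O> assume \<O>: "\<O> \<in> weak_nbhds \<mu>"
  have mi: "prob_space (m i)" "sets (m i) = sets (PiM (U i) (\<lambda>_. borel))" for i
    using m by (auto simp: model_measures_def)
  let ?G = "\<lambda>\<O> i. {v \<in> U i. distr (m i) borel (pullback_name (s i) v) \<in> \<O>}"
  let ?p = "\<lambda>\<O> i. real (card (?G \<O> i)) / real (card (U i))"
  let ?q = "\<lambda>\<O> i. measure (m i) (good_models \<O> (U i) (s i))"
  have cU: "real (card (U i)) > 0" for i using U by (simp add: card_gt_0_iff)
  have p1: "?p \<O> i \<le> 1" for \<O> i using U by (auto simp: divide_le_eq_1 card_gt_0_iff intro!: card_mono)
  have q1: "?q \<O> i \<le> 1" for \<O> i using mi by (intro prob_space.prob_le_1)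
  have goodm: "good_models \<O> (U i) (s i) \<in> sets (m i)" if "openin weak_star \<O>" for \<O> i
    using good_models_measurable[OF U that] mi by simp
  have "openin weak_star \<O> \<and> ?p \<O> \<longlonglongrightarrow> 1 \<and> ?q \<O> \<longlonglongrightarrow> 1"
    using \<O>
  proof (induction rule: weak_nbhds_induct)
    case (subbasic f X)
    let ?O = "{\<nu> \<in> borel_probs. (\<integral>x. f x \<partial>\<nu>) \<in> X}"
    have opn: "openin weak_star ?O" using subbasic_weak_nbhd[OF subbasic] by (simp add: weak_nbhds_def)
    obtain K where K: "K > 0" "\<And>y. \<bar>f y\<bar> \<le> K" using subbasic(2) by (auto simp: bounded_pos)
    obtain t where t: "t > 0" "\<And>x. \<bar>x - (\<integral>x. f x \<partial>\<mu>)\<bar> < t \<Longrightarrow> x \<in> X"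
      using subbasic(3,5) unfolding open_dist dist_real_def by blast
    define f' where "f' y = f y / K" for y
    define \<omega> where "\<omega> = t / (4 * K)"
    have \<omega>: "\<omega> > 0" using t K by (simp add: \<omega>_def)
    have cf': "continuous_on UNIV f'" unfolding f'_def using K by (intro continuous_intros subbasic(1)) auto
    have f'1: "\<bar>f' y\<bar> \<le> 1" for y using K by (simp add: f'_def abs_divide divide_le_eq)
    obtain F r0 where F: "finite F" "r0 > 0" "\<And>y z. (\<forall>k\<in>F. dist (y k) (z k) < r0) \<Longrightarrow> \<bar>f' y - f' z\<bar> \<le> \<omega>"
      using continuous_modulus[OF cpt cf' \<omega>] by blast
    have intK: "(\<integral>x. f x \<partial>\<nu>) = K * (\<integral>x. f' x \<partial>\<nu>)" for \<nu> using K by (simp add: f'_def)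
    have inX: "(\<integral>x. f x \<partial>\<nu>) \<in> X" if "\<bar>(\<integral>x. f' x \<partial>\<nu>) - (\<integral>x. f' x \<partial>\<mu>)\<bar> \<le> 2 * \<omega> + \<rho>" "\<rho> < \<omega>" for \<nu> \<rho>
    proof (rule t(2))
      have "\<bar>(\<integral>x. f x \<partial>\<nu>) - (\<integral>x. f x \<partial>\<mu>)\<bar> = K * \<bar>(\<integral>x. f' x \<partial>\<nu>) - (\<integral>x. f' x \<partial>\<mu>)\<bar>"
        using K(1) by (simp add: intK right_diff_distrib[symmetric] abs_mult)
      also have "\<dots> < K * (4 * \<omega>)" using that \<omega> K by (intro mult_strict_left_mono) auto
      also have "\<dots> = t" using K by (simp add: \<omega>_def)
      finally show "\<bar>(\<integral>x. f x \<partial>\<nu>) - (\<integral>x. f x \<partial>\<mu>)\<bar> < t" .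
    qed
    have fm: "f' \<in> borel_measurable borel" by (rule borel_measurable_continuous_onI[OF cf'])
    have "eventually (\<lambda>i. r i < min r0 \<omega>) sequentially" using r F \<omega> by (intro order_tendstoD) auto
    with D[OF F(1)] have ev: "eventually (\<lambda>i. 1 - r i \<le> ?p ?O i \<and> 1 - r i \<le> ?q ?O i) sequentially"
    proof eventually_elim
      case (elim i)
      have mod: "has_modulus (D i) (r i) \<omega> f'"
        unfolding has_modulus_def 
      proof (intro allI impI)
        fix y z :: "'k \<Rightarrow> 'y" assume yz: "\<forall>k\<in>D i. dist (y k) (z k) < r i"
        have "r i < r0" using elim by simp
        then show "\<bar>f' y - f' z\<bar> \<le> \<omega>" using yz elim by (intro F(3)) force
      qed
      from close[of i, unfolded quenched_close_def] cf' f'1 mod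
      have c1: "real (card {u \<in> U i. \<not> \<bar>(\<integral>z. f' z \<partial>distr (m i) borel (pullback_name (s i) u)) - (\<integral>z. f' z \<partial>\<mu>)\<bar> \<le> 2 * \<omega> + r i}) \<le> r i * real (card (U i))"
        and c2: "measure (m i) {y \<in> space (m i). \<not> \<bar>(\<Sum>u\<in>U i. f' (pullback_name (s i) u y)) / real (card (U i)) - (\<integral>z. f' z \<partial>\<mu>)\<bar> \<le> 2 * \<omega> + r i} \<le> r i"
        by blast+
      have pm: "pullback_name (s i) u \<in> measurable (m i) borel" for u
        using pullback_name_measurable[of "s i" u "U i"] measurable_cong_sets[OF mi(2) refl] by blast
      have "U i - ?G ?O i \<subseteq> {u \<in> U i. \<not> \<bar>(\<integral>z. f' z \<partial>distr (m i) borel (pullback_name (s i) u)) - (\<integral>z. f' z \<partial>\<mu>)\<bar> \<le> 2 * \<omega> + r i}"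
      proof
        fix u assume u: "u \<in> U i - ?G ?O i"
        have "distr (m i) borel (pullback_name (s i) u) \<in> borel_probs"
          using prob_space.prob_space_distr[OF mi(1) pm] by (simp add: borel_probs_def)
        then have "(\<integral>x. f x \<partial>distr (m i) borel (pullback_name (s i) u)) \<notin> X" using u by blast
        moreover have "r i < \<omega>" using elim by simp
        ultimately have "\<not> \<bar>(\<integral>z. f' z \<partial>distr (m i) borel (pullback_name (s i) u)) - (\<integral>z. f' z \<partial>\<mu>)\<bar> \<le> 2 * \<omega> + r i"
          using inX[of "distr (m i) borel (pullback_name (s i) u)" "r i"] by blast
        then show "u \<in> {u \<in> U i. \<not> \<bar>(\<integral>z. f' z \<partial>distr (m i) borel (pullback_name (s i) u)) - (\<integral>z. f' z \<partial>\<mu>)\<bar> \<le> 2 * \<omega> + r i}"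
          using u by blast
      qed
      then have "card (U i - ?G ?O i) \<le> card {u \<in> U i. \<not> \<bar>(\<integral>z. f' z \<partial>distr (m i) borel (pullback_name (s i) u)) - (\<integral>z. f' z \<partial>\<mu>)\<bar> \<le> 2 * \<omega> + r i}"
        by (rule card_mono[rotated]) (simp add: U)
      then have "real (card (U i - ?G ?O i)) \<le> r i * real (card (U i))" using c1 by linarith
      moreover have "card (U i - ?G ?O i) = card (U i) - card (?G ?O i)" using U by (intro card_Diff_subset) auto
      moreover have "card (?G ?O i) \<le> card (U i)" using U by (intro card_mono) auto
      ultimately have "(1 - r i) * real (card (U i)) \<le> real (card (?G ?O i))" by (simp add: of_nat_diff algebra_simps)
      then have P: "1 - r i \<le> ?p ?O i" using cU[of i] by (simp only: pos_le_divide_eq)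
      let ?B = "{y \<in> space (m i). \<not> \<bar>(\<Sum>u\<in>U i. f' (pullback_name (s i) u y)) / real (card (U i)) - (\<integral>z. f' z \<partial>\<mu>)\<bar> \<le> 2 * \<omega> + r i}"
      have fpm: "(\<lambda>y. f' (pullback_name (s i) u y)) \<in> borel_measurable (m i)" for u
        by (rule measurable_compose[OF pm fm])
      have "{y \<in> space (m i). \<bar>(\<Sum>u\<in>U i. f' (pullback_name (s i) u y)) / real (card (U i)) - (\<integral>z. f' z \<partial>\<mu>)\<bar> \<le> 2 * \<omega> + r i} \<in> sets (m i)"
        by (intro borel_measurable_le borel_measurable_abs borel_measurable_diff borel_measurable_divide borel_measurable_sum fpm borel_measurable_const)
      then have Bs: "?B \<in> sets (m i)" by (rule sets.sets_Collect_neg)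
      have "space (m i) - ?B \<subseteq> good_models ?O (U i) (s i)"
      proof
        fix y assume y: "y \<in> space (m i) - ?B"
        have "y \<in> U i \<rightarrow>\<^sub>E UNIV" using y sets_eq_imp_space_eq[OF mi(2)] by (auto simp: space_PiM)
        moreover have "(\<integral>x. f x \<partial>empirical (U i) (s i) y) \<in> X"
        proof (rule inX)
          show "r i < \<omega>" using elim by simp
          show "\<bar>(\<integral>x. f' x \<partial>empirical (U i) (s i) y) - (\<integral>x. f' x \<partial>\<mu>)\<bar> \<le> 2 * \<omega> + r i"
            unfolding integral_empirical[OF U(1) fm] using y by blast
        qed
        ultimately show "y \<in> good_models ?O (U i) (s i)"
          using empirical_in_borel_probs[OF U] by (auto simp: good_models_def)
      qed
      then have "measure (m i) (space (m i) - ?B) \<le> ?q ?O i"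
        using goodm[OF opn] by (intro finite_measure.finite_measure_mono prob_space.finite_measure mi(1))
      then have "1 - r i \<le> ?q ?O i" using prob_space.prob_compl[OF mi(1) Bs] c2 by simp
      with P show ?case by blast
    qed
    have lim: "(\<lambda>i. 1 - r i) \<longlonglongrightarrow> 1" using tendsto_diff[OF tendsto_const r, of 1] by simp
    have "?p ?O \<longlonglongrightarrow> 1"
    proof (rule tendsto_sandwich[OF _ _ lim tendsto_const])
      show "eventually (\<lambda>i. 1 - r i \<le> ?p ?O i) sequentially" using ev by (rule eventually_mono) blast
      show "eventually (\<lambda>i. ?p ?O i \<le> 1) sequentially" by (rule always_eventually, rule allI, rule p1)
    qed
    moreover have "?q ?O \<longlonglongrightarrow> 1"
    proof (rule tendsto_sandwich[OF _ _ lim tendsto_const])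
      show "eventually (\<lambda>i. 1 - r i \<le> ?q ?O i) sequentially" using ev by (rule eventually_mono) blast
      show "eventually (\<lambda>i. ?q ?O i \<le> 1) sequentially" by (rule always_eventually, rule allI, rule q1)
    qed
    ultimately show ?case using opn by blast
  next
    case (inter A B)
    have A: "openin weak_star A" "?p A \<longlonglongrightarrow> 1" "?q A \<longlonglongrightarrow> 1" using inter(1) by blast+
    have B: "openin weak_star B" "?p B \<longlonglongrightarrow> 1" "?q B \<longlonglongrightarrow> 1" using inter(2) by blast+
    have lim1: "(\<lambda>i. ?p A i + ?p B i - 1) \<longlonglongrightarrow> 1"
      using tendsto_diff[OF tendsto_add[OF A(2) B(2)] tendsto_const[of "1 :: real"]] by simp
    have lim2: "(\<lambda>i. ?q A i + ?q B i - 1) \<longlonglongrightarrow> 1"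
      using tendsto_diff[OF tendsto_add[OF A(3) B(3)] tendsto_const[of "1 :: real"]] by simp
    have P: "?p A i + ?p B i - 1 \<le> ?p (A \<inter> B) i" for i
    proof -
      have "card (?G A i) + card (?G B i) = card (?G A i \<union> ?G B i) + card (?G A i \<inter> ?G B i)"
        using U by (intro card_Un_Int) auto
      moreover have "card (?G A i \<union> ?G B i) \<le> card (U i)" using U by (intro card_mono) auto
      moreover have "?G A i \<inter> ?G B i = ?G (A \<inter> B) i" by auto
      ultimately have "real (card (?G A i)) + real (card (?G B i)) \<le> real (card (U i)) + real (card (?G (A \<inter> B) i))" by (simp flip: of_nat_add)
      from divide_right_mono[OF this, of "real (card (U i))"] show ?thesis
        using cU[of i] by (simp add: add_divide_distrib)
    qed
    have Q: "?q A i + ?q B i - 1 \<le> ?q (A \<inter> B) i" for i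
    proof -
      interpret prob_space "m i" by (rule mi)
      let ?a = "good_models A (U i) (s i)" and ?b = "good_models B (U i) (s i)"
      have ab: "?a \<in> sets (m i)" "?b \<in> sets (m i)" using A(1) B(1) by (auto intro: goodm)
      have "measure (m i) (?a \<union> ?b) = measure (m i) ?a + measure (m i) ?b - measure (m i) (?a \<inter> ?b)"
        using measure_Un3[of ?a "m i" ?b] ab by (simp add: fmeasurable_eq_sets)
      moreover have "?a \<inter> ?b = good_models (A \<inter> B) (U i) (s i)" by (auto simp: good_models_def)
      ultimately show ?thesis using prob_le_1[of "?a \<union> ?b"] by simp
    qed
    have "?p (A \<inter> B) \<longlonglongrightarrow> 1"
      by (rule tendsto_sandwich[OF _ _ lim1 tendsto_const]; rule always_eventually, rule allI, rule P p1)
    moreover have "?q (A \<inter> B) \<longlonglongrightarrow> 1"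
      by (rule tendsto_sandwich[OF _ _ lim2 tendsto_const]; rule always_eventually, rule allI, rule Q q1)
    ultimately show ?case using openin_Int[OF A(1) B(1)] by blast
  next
    case (superset A B)
    have A: "?p A \<longlonglongrightarrow> 1" "?q A \<longlonglongrightarrow> 1" using superset(1) by blast+
    have P: "?p A i \<le> ?p B i" for i
      using U superset(2) by (intro divide_right_mono of_nat_mono card_mono) auto
    have Q: "?q A i \<le> ?q B i" for i
      using superset(2) goodm[OF superset(3)] by (intro finite_measure.finite_measure_mono prob_space.finite_measure mi(1)) (auto simp: good_models_def)
    have "?p B \<longlonglongrightarrow> 1"
      by (rule tendsto_sandwich[OF _ _ A(1) tendsto_const]; rule always_eventually, rule allI, rule P p1)
    moreover have "?q B \<longlonglongrightarrow> 1"
      by (rule tendsto_sandwich[OF _ _ A(2) tendsto_const]; rule always_eventually, rule allI, rule Q q1)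
    ultimately show ?case using superset(3) by blast
  qed
  then show "?p \<O> \<longlonglongrightarrow> 1 \<and> ?q \<O> \<longlonglongrightarrow> 1" by blast
qed

section \<open>Quenched convergence of row models\<close>

lemma prod_maps_eq: "prod_maps \<sigma> \<tau> n = (\<lambda>k. map_prod (\<sigma> n (fst k)) (\<tau> n (snd k)))"
  by (simp add: prod_maps_def fun_eq_iff)

lemma dist_pair_le: "dist (a, b) (c, d) \<le> dist a c + dist b d"
  unfolding dist_Pair_Pair by (rule sqrt_sum_squares_le_sum) auto

context coinduced_process
begin

lemma pair_process_coinduced:
  "pair_process \<nu> = distr (P \<Otimes>\<^sub>M P) borel (\<lambda>x k. (\<Phi> (fst x) k, \<Phi> (snd x) k))"
proof -
  have s: "sigma_finite_measure (distr P \<nu> \<Phi>)" unfolding distr_\<Phi> by (rule N.sigma_finite_measure_axioms)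
  have "\<nu> \<Otimes>\<^sub>M \<nu> = distr P \<nu> \<Phi> \<Otimes>\<^sub>M distr P \<nu> \<Phi>" by (simp only: distr_\<Phi>)
  also have "\<dots> = distr (P \<Otimes>\<^sub>M P) (\<nu> \<Otimes>\<^sub>M \<nu>) (\<lambda>(x, y). (\<Phi> x, \<Phi> y))"
    by (rule pair_measure_distr[OF \<Phi> \<Phi> s])
  finally have eq: "\<nu> \<Otimes>\<^sub>M \<nu> = distr (P \<Otimes>\<^sub>M P) (\<nu> \<Otimes>\<^sub>M \<nu>) (\<lambda>(x, y). (\<Phi> x, \<Phi> y))" .
  have m: "(\<lambda>(x, y). (\<Phi> x, \<Phi> y)) \<in> measurable (P \<Otimes>\<^sub>M P) (\<nu> \<Otimes>\<^sub>M \<nu>)"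
    unfolding case_prod_beta'
    by (intro measurable_Pair measurable_compose[OF measurable_fst \<Phi>] measurable_compose[OF measurable_snd \<Phi>])
  have "pair_process \<nu> = distr (distr (P \<Otimes>\<^sub>M P) (\<nu> \<Otimes>\<^sub>M \<nu>) (\<lambda>(x, y). (\<Phi> x, \<Phi> y))) borel (\<lambda>(x, x') g. (x g, x' g))"
    unfolding pair_process_def by (simp only: eq[symmetric])
  also have "\<dots> = distr (P \<Otimes>\<^sub>M P) borel (\<lambda>x k. (\<Phi> (fst x) k, \<Phi> (snd x) k))"
    by (subst distr_distr[OF pairing_measurable[OF sets_\<nu>] m])
       (auto intro!: distr_cong simp: comp_def case_prod_beta')
  finally show ?thesis .
qed

lemma pair_coordinates_measurable:
  "(\<lambda>x k. (\<Phi> (fst x) k, \<Phi> (snd x) k)) \<in> borel_measurable (P \<Otimes>\<^sub>M P)"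
proof (rule measurable_coordinatewise_then_product)
  fix k
  have "(\<lambda>x. \<Phi> x k) \<in> borel_measurable P" by (rule measurable_compose[OF \<Phi>_borel measurable_product_coordinates])
  then have "(\<lambda>x. (\<Phi> (fst x) k, \<Phi> (snd x) k)) \<in> measurable (P \<Otimes>\<^sub>M P) (borel \<Otimes>\<^sub>M borel)"
    by (intro measurable_Pair measurable_compose[OF measurable_fst] measurable_compose[OF measurable_snd])
  then show "(\<lambda>x. (\<Phi> (fst x) k, \<Phi> (snd x) k)) \<in> borel_measurable (P \<Otimes>\<^sub>M P)" by (simp add: borel_prod)
qed

text \<open>The errors of the single copy double for the pair: \<open>r / 2\<close> becomes \<open>r\<close>, \<open>\<eta>\<close> becomes
  \<open>2 * \<eta>\<close> and \<open>e\<close> becomes \<open>2 * e\<close>.\<close>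

lemma row_model_quenched_close:
  fixes V :: "'v set" and W :: "'w set" and \<phi> :: "('h \<Rightarrow> 'c::countable) \<Rightarrow> 'y"
  assumes rows: "independent_rows V W \<sigma> \<tau> q \<rho> \<phi> C E DG DH EE Vb Wb e b lam P c"
    and D: "D \<subseteq> DG \<times> DH" and B: "B \<in> sets P" "measure P B \<le> \<eta>" and r: "r > 0"
    and approx: "\<And>x k. x \<in> space P \<Longrightarrow> x \<notin> B \<Longrightarrow> k \<in> DG \<times> DH \<Longrightarrow> dist (\<Phi> x k) (decode \<phi> (\<lambda>k. c k x) k) < r / 2"
    and small: "4 * \<eta> + independent_rows.window_error (C \<times> C) DG EE (2 * e) + 6 * b + r / 4 \<le> r" "2 * b \<le> r"
    and W_large: "2 * (real (card EE))\<^sup>2 / ((r / 4)\<^sup>2 * real (card W)) \<le> r"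
  shows "quenched_close (V \<times> W) (\<lambda>k. map_prod (\<sigma> (fst k)) (\<tau> (snd k)))
    (pair_model_measure (V \<times> W) (independent_rows.model_law V W \<tau> q d \<rho> \<phi>)) (pair_process \<nu>) D r"
proof -
  let ?\<rho> = "\<lambda>j v. (\<rho> (fst j) v, \<rho> (snd j) v)" and ?\<phi> = "\<lambda>\<alpha>. (\<phi> (\<lambda>h. fst (\<alpha> h)), \<phi> (\<lambda>h. snd (\<alpha> h)))"
  interpret R2: independent_rows V W \<sigma> \<tau> "pair_pmf q q" "(d, d)" ?\<rho> ?\<phi> "C \<times> C" E DG DH EE Vb Wb "2 * e" b
     "\<lambda>a. lam (\<lambda>g\<in>DG. fst (a g)) * lam (\<lambda>g\<in>DG. snd (a g))" "P \<Otimes>\<^sub>M P" "\<lambda>k x. (c k (fst x), c k (snd x))"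
    by (rule independent_rows_pair[OF rows])
  let ?s = "\<lambda>k. map_prod (\<sigma> (fst k)) (\<tau> (snd k))"
  let ?Y = "\<lambda>x k. (\<Phi> (fst x) k, \<Phi> (snd x) k)"
  let ?m = "\<lambda>z. restrict (row_model \<tau> ?\<rho> ?\<phi> z) (V \<times> W)"
  let ?B = "(B \<times> space P) \<union> (space P \<times> B)"
  have Bs: "?B \<in> sets (P \<Otimes>\<^sub>M P)" using B(1) by auto
  have "measure (P \<Otimes>\<^sub>M P) ?B \<le> measure (P \<Otimes>\<^sub>M P) (B \<times> space P) + measure (P \<Otimes>\<^sub>M P) (space P \<times> B)"
    using B(1) by (intro measure_Un_le) auto
  also have "\<dots> \<le> 2 * \<eta>"
    using B by (simp add: measure_pair_Times[OF P.prob_space_axioms] P.prob_space)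
  finally have Bm: "measure (P \<Otimes>\<^sub>M P) ?B \<le> 2 * \<eta>" .
  have approx2: "dist (?Y x k) (decode ?\<phi> (\<lambda>k. (c k (fst x), c k (snd x))) k) < r"
    if x: "x \<in> space (P \<Otimes>\<^sub>M P)" "x \<notin> ?B" and k: "k \<in> DG \<times> DH" for x k
  proof -
    have x12: "fst x \<in> space P" "fst x \<notin> B" "snd x \<in> space P" "snd x \<notin> B"
      using x by (auto simp: space_pair_measure mem_Times_iff)
    have "dist (?Y x k) (decode ?\<phi> (\<lambda>k. (c k (fst x), c k (snd x))) k)
      \<le> dist (\<Phi> (fst x) k) (decode \<phi> (\<lambda>k. c k (fst x)) k) + dist (\<Phi> (snd x) k) (decode \<phi> (\<lambda>k. c k (snd x)) k)"
      unfolding decode_def fst_conv snd_conv by (rule dist_pair_le)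
    then show ?thesis using approx[OF x12(1,2) k] approx[OF x12(3,4) k] by linarith
  qed
  have m: "pair_model_measure (V \<times> W) (independent_rows.model_law V W \<tau> q d \<rho> \<phi>) = R2.model_law"
    by (rule pair_model_law[OF rows])
  have b0: "b \<ge> 0"
  proof -
    have "0 \<le> b * real (card V)" by (rule order_trans[OF of_nat_0_le_iff R2.Vb])
    then show ?thesis using R2.V by (simp add: zero_le_mult_iff card_gt_0_iff)
  qed
  show ?thesis
    unfolding quenched_close_def m
  proof (intro allI impI)
    fix f :: "('g \<times> 'h \<Rightarrow> 'y \<times> 'y) \<Rightarrow> real" and \<omega> :: real
    assume f: "continuous_on UNIV f" and "\<forall>y. \<bar>f y\<bar> \<le> 1" and mod: "has_modulus D r \<omega> f"
    then have f1: "\<bar>f y\<bar> \<le> 1" for y by blast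
    have fm: "f \<in> borel_measurable borel" by (rule borel_measurable_continuous_onI[OF f])
    have mod': "\<bar>f y - f y'\<bar> \<le> \<omega>" if "\<And>k. k \<in> DG \<times> DH \<Longrightarrow> dist (y k) (y' k) < r" for y y'
      using mod that D unfolding has_modulus_def by blast
    have I: "(\<integral>z. f z \<partial>pair_process \<nu>) = (\<integral>x. f (?Y x) \<partial>(P \<Otimes>\<^sub>M P))"
      unfolding pair_process_coinduced by (rule integral_distr[OF pair_coordinates_measurable fm])
    have loc: "(\<integral>z. f z \<partial>distr R2.model_law borel (pullback_name ?s u)) = measure_pmf.expectation R2.P (\<lambda>z. f (pullback_name ?s u (?m z)))" for u
    proof -
      have pm: "pullback_name ?s u \<in> measurable (PiM (V \<times> W) (\<lambda>_. borel :: ('y \<times> 'y) measure)) borel" by (rule pullback_name_measurable)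
      have "(\<integral>z. f z \<partial>distr R2.model_law borel (pullback_name ?s u)) = (\<integral>y. f (pullback_name ?s u y) \<partial>R2.model_law)"
        using pm by (intro integral_distr fm) (simp add: R2.model_law_def)
      also have "\<dots> = measure_pmf.expectation R2.P (\<lambda>z. f (pullback_name ?s u (?m z)))"
        unfolding R2.model_law_def by (rule integral_distr[OF R2.model_measurable measurable_compose[OF pm fm]])
      finally show ?thesis .
    qed
    let ?J = "\<integral>x. f (?Y x) \<partial>(P \<Otimes>\<^sub>M P)"
    let ?N = "{u \<in> V \<times> W. \<not> \<bar>measure_pmf.expectation R2.P (\<lambda>z. f (pullback_name ?s u (?m z))) - ?J\<bar> \<le> 2 * \<omega> + r}"
    let ?avg = "\<lambda>y. (\<Sum>u\<in>V \<times> W. f (pullback_name ?s u y)) / real (card (V \<times> W))"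
    let ?X = "\<lambda>S. {y \<in> S. \<not> \<bar>?avg y - ?J\<bar> \<le> 2 * \<omega> + r}"
    have "?N \<subseteq> (V \<inter> Vb) \<times> W \<union> V \<times> (W \<inter> Wb)"
    proof
      fix u assume u: "u \<in> ?N"
      obtain v w where vw: "u = (v, w)" "v \<in> V" "w \<in> W" using u by blast
      have "v \<in> Vb \<or> w \<in> Wb"
      proof (rule ccontr)
        assume nb: "\<not> (v \<in> Vb \<or> w \<in> Wb)"
        have "\<bar>measure_pmf.expectation R2.P (\<lambda>z. f (pullback_name ?s (v, w) (?m z))) - ?J\<bar> \<le> 2 * \<omega> + 2 * (2 * \<eta>) + R2.window_error"
          by (rule R2.local_quenched[OF f1 fm r mod' pair_coordinates_measurable Bs Bm approx2]) (use vw nb in blast)+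
        moreover have "2 * (2 * \<eta>) + R2.window_error \<le> r" using small(1) b0 r by linarith
        ultimately have "\<bar>measure_pmf.expectation R2.P (\<lambda>z. f (pullback_name ?s u (?m z))) - ?J\<bar> \<le> 2 * \<omega> + r"
          unfolding vw(1) by linarith
        then show False using u by blast
      qed
      then show "u \<in> (V \<inter> Vb) \<times> W \<union> V \<times> (W \<inter> Wb)" using vw by blast
    qed
    then have "card ?N \<le> card ((V \<inter> Vb) \<times> W \<union> V \<times> (W \<inter> Wb))"
      by (rule card_mono[rotated]) (use R2.V R2.W in blast)
    also have "\<dots> \<le> card ((V \<inter> Vb) \<times> W) + card (V \<times> (W \<inter> Wb))" by (rule card_Un_le)
    also have "\<dots> = card (V \<inter> Vb) * card W + card V * card (W \<inter> Wb)" by (simp add: card_cartesian_product)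
    finally have "real (card ?N) \<le> real (card (V \<inter> Vb)) * real (card W) + real (card V) * real (card (W \<inter> Wb))"
      by (simp only: of_nat_mult[symmetric] of_nat_add[symmetric] of_nat_le_iff)
    also have "\<dots> \<le> b * real (card V) * real (card W) + real (card V) * (b * real (card W))"
      using R2.Vb R2.Wb by (intro add_mono mult_right_mono mult_left_mono) auto
    also have "\<dots> = 2 * b * real (card (V \<times> W))" by (simp add: card_cartesian_product)
    also have "\<dots> \<le> r * real (card (V \<times> W))" by (intro mult_right_mono small(2)) simp
    finally have 1: "real (card ?N) \<le> r * real (card (V \<times> W))" .
    let ?S = "PiM (V \<times> W) (\<lambda>_. borel) :: ('v \<times> 'w \<Rightarrow> 'y \<times> 'y) measure"
    let ?Z = "{z. 2 * \<omega> + 2 * (2 * \<eta>) + R2.window_error + 6 * b + r / 4 \<le> \<bar>?avg (?m z) - ?J\<bar>}"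
    have fpm: "(\<lambda>y. f (pullback_name ?s u y)) \<in> borel_measurable ?S" for u
      by (rule measurable_compose[OF pullback_name_measurable fm])
    have "{y \<in> space ?S. \<bar>?avg y - ?J\<bar> \<le> 2 * \<omega> + r} \<in> sets ?S"
      by (intro borel_measurable_le borel_measurable_abs borel_measurable_diff borel_measurable_divide borel_measurable_sum fpm borel_measurable_const)
    from sets.sets_Collect_neg[OF this] have Xs: "?X (space ?S) \<in> sets ?S" .
    have "measure R2.model_law (?X (space R2.model_law)) = measure_pmf.prob R2.P ((\<lambda>z. ?m z) -` ?X (space ?S) \<inter> space (measure_pmf R2.P))"
      unfolding R2.model_law_def space_distr by (rule measure_distr[OF R2.model_measurable Xs])
    also have "\<dots> \<le> measure_pmf.prob R2.P ?Z"
    proof (rule measure_pmf.finite_measure_mono)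
      show "(\<lambda>z. ?m z) -` ?X (space ?S) \<inter> space (measure_pmf R2.P) \<subseteq> ?Z"
      proof
        fix z assume "z \<in> (\<lambda>z. ?m z) -` ?X (space ?S) \<inter> space (measure_pmf R2.P)"
        then have "\<not> \<bar>?avg (?m z) - ?J\<bar> \<le> 2 * \<omega> + r" by blast
        then have "2 * \<omega> + 2 * (2 * \<eta>) + R2.window_error + 6 * b + r / 4 \<le> \<bar>?avg (?m z) - ?J\<bar>" using small(1) by linarith
        then show "z \<in> ?Z" by blast
      qed
    qed simp
    also have "\<dots> \<le> 2 * (real (card EE))\<^sup>2 / ((r / 4)\<^sup>2 * real (card W))"
      by (rule R2.empirical_quenched[OF f1 fm r mod' pair_coordinates_measurable Bs Bm approx2]) (use r in simp_all)
    also have "\<dots> \<le> r" by (rule W_large)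
    finally have 2: "measure R2.model_law (?X (space R2.model_law)) \<le> r" .
    show "real (card {u \<in> V \<times> W. \<not> \<bar>(\<integral>z. f z \<partial>distr R2.model_law borel (pullback_name ?s u)) - (\<integral>z. f z \<partial>pair_process \<nu>)\<bar> \<le> 2 * \<omega> + r}) \<le> r * real (card (V \<times> W)) \<and>
      measure R2.model_law {y \<in> space R2.model_law. \<not> \<bar>?avg y - (\<integral>z. f z \<partial>pair_process \<nu>)\<bar> \<le> 2 * \<omega> + r} \<le> r"
      unfolding loc I using 1 2 by blast
  qed
qed

end

section \<open>Rows of good models\<close>

locale coinduced_models = coinduced_process M T \<nu> \<Phi> \<Psi>
  for M :: "'x measure" and T :: "'g::{group_add,countable} \<Rightarrow> 'x \<Rightarrow> 'x"
    and \<nu> :: "('g \<times> 'h::{group_add,countable} \<Rightarrow> 'y::polish_space) measure" and \<Phi> and \<Psi> +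
  fixes V :: "nat \<Rightarrow> 'v set" and \<sigma> :: "nat \<Rightarrow> 'g \<Rightarrow> 'v \<Rightarrow> 'v"
    and W :: "nat \<Rightarrow> 'w set" and \<tau> :: "nat \<Rightarrow> 'h \<Rightarrow> 'w \<Rightarrow> 'w"
  assumes sV: "sofic_approximation V \<sigma>" and sW: "sofic_approximation W \<tau>" and infH: "infinite (UNIV :: 'h set)"
begin

abbreviation "U \<equiv> prod_sets V W"
abbreviation "s \<equiv> prod_maps \<sigma> \<tau>"

lemma finU: "finite (U n)" "U n \<noteq> {}"
  using sofic_finite[OF sV] sofic_finite[OF sW] by (simp_all add: prod_sets_def)

lemma sU: "u \<in> U n \<Longrightarrow> s n k u \<in> U n"
  using sofic_in[OF sV] sofic_in[OF sW] by (auto simp: prod_sets_def prod_maps_def)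

text \<open>The code of the array can be read off good models, and it has two properties there. At most
  points the row frequencies along \<open>H\<close> are typical, and at most points the coarse part \<open>\<pi>\<close> of the
  code determines the value. Both are likely open events of the process.

  The proportion of atypical points is required to be at most \<open>e * b\<close>, so that Markov's inequality
  leaves a proportion \<open>b\<close> of places at which more than \<open>e\<close> of the rows are atypical.\<close>

lemma stage_code:
  assumes p: "finite_code M p" and DG: "finite DG" and e: "e > 0" and b: "b > 0"
    and EA: "finite EA" and \<phi>A: "depends_only_on EA \<phi>A" and \<eta>A: "\<eta>A > 0"
    and BA: "BA \<in> sets P" "measure P BA \<le> \<eta>A"
    and approx: "\<And>x. x \<in> space P \<Longrightarrow> x \<notin> BA \<Longrightarrow> dist (\<Phi> x 0) (\<phi>A (\<lambda>h. \<pi> (p (x h)))) < \<eta>A"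
  shows "\<exists>cd \<O> H. (\<forall>z. cd z \<in> insert 0 (range p)) \<and> \<O> \<in> weak_nbhds \<nu> \<and> finite H \<and> H \<noteq> {} \<and>
    eventually (\<lambda>n. \<forall>y\<in>good_models \<O> (U n) (s n).
      real (card {u \<in> U n. \<not> row_frequencies DG (insert 0 (range p)) H (row_law M T p DG) e (\<lambda>k. cd (pullback_name (s n) (s n k u) y))})
        \<le> e * b * real (card (U n)) \<and>
      real (card {u \<in> U n. \<not> dist (y u) (\<phi>A (\<lambda>h. \<pi> (cd (pullback_name (s n) (s n (0, h) u) y)))) < \<eta>A})
        \<le> 3 * \<eta>A * real (card (U n))) sequentially"
proof -
  let ?C = "insert 0 (range p)" and ?lam = "row_law M T p DG"
  let ?L = "real (card (DG \<rightarrow>\<^sub>E ?C))"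
  have finC: "finite ?C" using p by (simp add: finite_code_def)
  have eb: "e * b > 0" using e b by simp
  have scale_cancel: "(real k + 1) * (X / (m * (real k + 1))) = X / m" for k X m
  proof -
    have "real k + 1 \<noteq> 0" by linarith
    then show ?thesis by simp
  qed
  obtain N0 :: nat where N0: "8 * ?L / (e\<^sup>2 * (e * b)) \<le> real N0" using real_arch_simple by blast
  obtain H :: "'h set" where H: "finite H" "card H = Suc N0" using infinite_arbitrarily_large[OF infH] by blast
  have Hne: "H \<noteq> {}" using H by auto
  let ?F1 = "DG \<times> H" and ?F2 = "{0} \<times> EA :: ('g \<times> 'h) set"
  have finF: "finite ?F1" "finite ?F2" using DG H EA by auto
  define \<eta> where "\<eta> = min (e * b / (4 * (real (card ?F1) + 1))) (\<eta>A / (2 * (real (card ?F2) + 1)))"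
  have \<eta>: "\<eta> > 0" unfolding \<eta>_def using eb \<eta>A by simp
  have F1\<eta>: "real (card ?F1) * \<eta> \<le> e * b / 4"
  proof -
    have "real (card ?F1) * \<eta> \<le> (real (card ?F1) + 1) * (e * b / (4 * (real (card ?F1) + 1)))"
      unfolding \<eta>_def using eb \<eta>A by (intro mult_mono) auto
    also have "\<dots> = e * b / 4" by (rule scale_cancel)
    finally show ?thesis .
  qed
  have F2\<eta>: "real (card ?F2) * \<eta> \<le> \<eta>A / 2"
  proof -
    have "real (card ?F2) * \<eta> \<le> (real (card ?F2) + 1) * (\<eta>A / (2 * (real (card ?F2) + 1)))"
      unfolding \<eta>_def using eb \<eta>A by (intro mult_mono) auto
    also have "\<dots> = \<eta>A / 2" by (rule scale_cancel) 
    finally show ?thesis .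
  qed
  obtain K where K: "\<And>a. compact (K a)" "\<And>a b. a \<noteq> b \<Longrightarrow> K a \<inter> K b = {}" "{a. K a \<noteq> {}} \<subseteq> range p"
     "measure \<nu> (- (\<Union>a. K a)) \<le> \<eta>" "\<And>a y. y \<in> K a \<Longrightarrow> p (\<Psi> y 0) = a"
    using code_kernels[OF p \<eta>] by blast
  have "finite {a. K a \<noteq> {}}" using K(3) p by (auto simp: finite_code_def intro: finite_subset)
  then obtain D r where sep: "separated_codes D r K" using separated_codes_exist[where K=K, OF K(1) K(2)] by blast
  have finD: "finite D" and r: "r > 0" using sep by (auto simp: separated_codes_def)
  define cd where "cd = code D r K"
  have cdC: "cd z \<in> ?C" for z unfolding cd_def using K(3) by (intro code_in) auto
  let ?Q1 = "\<lambda>(_::'y) \<alpha>. row_frequencies DG ?C H ?lam e \<alpha>"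
  let ?Q2 = "\<lambda>t \<alpha>. dist t (\<phi>A (\<lambda>h. \<pi> (\<alpha> (0, h)))) < \<eta>A"
  have Q1: "depends_only_on ?F1 (?Q1 t)" for t by (rule row_frequencies_depends)
  have Q2: "depends_only_on ?F2 (?Q2 t)" for t
    unfolding depends_only_on_def
  proof (intro allI impI)
    fix a a' :: "'g \<times> 'h \<Rightarrow> nat" assume "\<forall>k\<in>?F2. a k = a' k"
    then have "\<phi>A (\<lambda>h. \<pi> (a (0, h))) = \<phi>A (\<lambda>h. \<pi> (a' (0, h)))" by (intro depends_only_onD[OF \<phi>A]) auto
    then show "?Q2 t a = ?Q2 t a'" by simp
  qed
  have o2: "open {t. ?Q2 t \<alpha>}" for \<alpha> by (intro open_Collect_less continuous_intros)
  let ?B1 = "{x \<in> space P. \<not> row_frequencies DG ?C H ?lam e (\<lambda>k. orbit_code T p k x)}"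
  have B1: "?B1 \<in> sets P"
    by (rule pattern_measurable[OF finF(1) orbit_code_measurable[OF p] depends_only_on_compose[OF row_frequencies_depends, where G=Not]])
  have B1m: "measure P ?B1 \<le> e * b / 4"
  proof -
    have n0: "real (card H) > 0" using H by simp
    have pos: "e\<^sup>2 * (e * b) > 0" using e eb by simp
    have "8 * ?L / (e\<^sup>2 * (e * b)) \<le> real (card H)" using N0 H by simp
    then have "8 * ?L \<le> real (card H) * (e\<^sup>2 * (e * b))" by (simp only: pos_divide_le_eq[OF pos])
    then have "?L * 2 \<le> e * b / 4 * (e\<^sup>2 * real (card H))" by (simp add: algebra_simps)
    then have "?L * 2 / (e\<^sup>2 * real (card H)) \<le> e * b / 4"
      using n0 e by (subst pos_divide_le_eq) auto
    then show ?thesis using row_frequencies_likely[OF p DG finC H(1) Hne e] by simp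
  qed
  have K5: "\<And>a y. y \<in> K a \<Longrightarrow> p (\<Psi> y 0) = a" by (fact K(5))
  have "measure \<nu> (coded_event D r K ?F1 ?Q1) \<ge> 1 - e * b / 4 - real (card ?F1) * \<eta>"
    by (rule coded_event_likely[where K=K and Q="?Q1", OF K(1) K(3) K5 K(4) p finD r finF(1) Q1 _ B1 B1m]) simp_all
  then have m1: "measure \<nu> (coded_event D r K ?F1 ?Q1) > 1 - 3 / 4 * (e * b)" using F1\<eta> eb by linarith
  have approx': "?Q2 (\<Phi> x 0) (\<lambda>k. orbit_code T p k x)" if x: "x \<in> space P" "x \<notin> BA" for x
  proof -
    have "x h \<in> space M" for h using x(1) by (auto simp: space_P)
    then have "T 0 (x h) = x h" for h using sys by (auto simp: group_system_def)
    then show ?thesis using approx[OF x] by (simp add: orbit_code_def)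
  qed
  have "measure \<nu> (coded_event D r K ?F2 ?Q2) \<ge> 1 - \<eta>A - real (card ?F2) * \<eta>"
    by (rule coded_event_likely[where K=K and Q="?Q2", OF K(1) K(3) K5 K(4) p finD r finF(2) Q2 o2 BA approx'])
  then have m2: "measure \<nu> (coded_event D r K ?F2 ?Q2) > 1 - 2 * \<eta>A" using F2\<eta> \<eta>A by linarith
  have op1: "open (coded_event D r K ?F1 ?Q1)" by (rule coded_event_open[OF finD finF(1)]) auto
  have op2: "open (coded_event D r K ?F2 ?Q2)" by (rule coded_event_open[OF finD finF(2) o2])
  obtain \<O>1 where \<O>1: "\<O>1 \<in> weak_nbhds \<nu>" "\<And>n y. y \<in> good_models \<O>1 (U n) (s n) \<Longrightarrow>
     real (card {u \<in> U n. pullback_name (s n) u y \<notin> coded_event D r K ?F1 ?Q1}) \<le> 3 / 4 * (e * b) * real (card (U n))"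
    using good_models_coded[OF op1 m1, where 'u="'v \<times> 'w"] finU by meson
  obtain \<O>2 where \<O>2: "\<O>2 \<in> weak_nbhds \<nu>" "\<And>n y. y \<in> good_models \<O>2 (U n) (s n) \<Longrightarrow>
     real (card {u \<in> U n. pullback_name (s n) u y \<notin> coded_event D r K ?F2 ?Q2}) \<le> 2 * \<eta>A * real (card (U n))"
    using good_models_coded[OF op2 m2, where 'u="'v \<times> 'w"] finU by meson
  let ?ok = "\<lambda>n u. (\<forall>x\<in>D \<times> (?F1 \<union> ?F2). s n (fst x) (s n (snd x) u) = s n (fst x + snd x) u) \<and> s n 0 u = u"
  have finX: "finite (D \<times> (?F1 \<union> ?F2))" using finD finF by simp
  have ok: "mostly U ?ok"
    by (intro mostly_conj mostly_ball finU finX sofic_prod_mult[OF sV sW] sofic_prod_zero[OF sV sW])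
  have "min (e * b / 4) \<eta>A > 0" using eb \<eta>A by simp
  from mostlyD[OF ok this]
  have "eventually (\<lambda>n. \<forall>y\<in>good_models (\<O>1 \<inter> \<O>2) (U n) (s n).
      real (card {u \<in> U n. \<not> row_frequencies DG ?C H ?lam e (\<lambda>k. cd (pullback_name (s n) (s n k u) y))})
        \<le> e * b * real (card (U n)) \<and>
      real (card {u \<in> U n. \<not> dist (y u) (\<phi>A (\<lambda>h. \<pi> (cd (pullback_name (s n) (s n (0, h) u) y)))) < \<eta>A})
        \<le> 3 * \<eta>A * real (card (U n))) sequentially"
  proof eventually_elim
    case (elim n)
    show ?case
    proof
      fix y assume y: "y \<in> good_models (\<O>1 \<inter> \<O>2) (U n) (s n)"
      have y1: "y \<in> good_models \<O>1 (U n) (s n)" and y2: "y \<in> good_models \<O>2 (U n) (s n)"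
        using y by (auto simp: good_models_def)
      let ?nok = "{u \<in> U n. \<not> ?ok n u}"
      have bound: "real (card X) \<le> (x1 + x2) * real (card (U n))"
        if "X \<subseteq> Y1 \<union> ?nok" "Y1 \<subseteq> U n" "real (card Y1) \<le> x1 * real (card (U n))" "real (card ?nok) \<le> x2 * real (card (U n))" for X Y1 x1 x2
      proof -
        have "finite (Y1 \<union> ?nok)" using that(2) finU(1)[of n] finite_subset by (intro finite_UnI) auto
        then have "card X \<le> card (Y1 \<union> ?nok)" using that(1) by (intro card_mono)
        also have "\<dots> \<le> card Y1 + card ?nok" by (rule card_Un_le)
        finally have "real (card X) \<le> real (card Y1) + real (card ?nok)" by (simp only: of_nat_add[symmetric] of_nat_le_iff)
        also have "\<dots> \<le> x1 * real (card (U n)) + x2 * real (card (U n))" by (rule add_mono[OF that(3,4)])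
        finally show ?thesis by (simp only: distrib_right)
      qed
      have nok1: "real (card ?nok) \<le> e * b / 4 * real (card (U n))"
        by (rule order_trans[OF elim]) (intro mult_right_mono, auto)
      have nok2: "real (card ?nok) \<le> \<eta>A * real (card (U n))"
        by (rule order_trans[OF elim]) (intro mult_right_mono, auto)
      let ?R1 = "{u \<in> U n. \<not> row_frequencies DG ?C H ?lam e (\<lambda>k. cd (pullback_name (s n) (s n k u) y))}"
      let ?R2 = "{u \<in> U n. \<not> dist (y u) (\<phi>A (\<lambda>h. \<pi> (cd (pullback_name (s n) (s n (0, h) u) y)))) < \<eta>A}"
      have "real (card ?R1) \<le> (3 / 4 * (e * b) + e * b / 4) * real (card (U n))"
      proof (rule bound[OF _ _ \<O>1(2)[OF y1] nok1])
        show "?R1 \<subseteq> {u \<in> U n. pullback_name (s n) u y \<notin> coded_event D r K ?F1 ?Q1} \<union> ?nok"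
        proof (rule subsetI, rule ccontr)
          fix u assume u: "u \<in> ?R1"
            and nu: "u \<notin> {u \<in> U n. pullback_name (s n) u y \<notin> coded_event D r K ?F1 ?Q1} \<union> ?nok"
          have okn: "?ok n u" and ev: "pullback_name (s n) u y \<in> coded_event D r K ?F1 ?Q1" using u nu by blast+
          have "?Q1 (y u) (\<lambda>k. code D r K (pullback_name (s n) (s n k u) y))"
          proof (rule coded_event_pullback[OF sep Q1 _ _ ev])
            show "s n d (s n k u) = s n (d + k) u" if "d \<in> D" "k \<in> ?F1" for d k
              using bspec[OF conjunct1[OF okn], of "(d, k)"] that by simp
          qed (rule conjunct2[OF okn])
          then show False using u unfolding cd_def by blast
        qed
      qed blast
      moreover have "real (card ?R2) \<le> (2 * \<eta>A + \<eta>A) * real (card (U n))"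
      proof (rule bound[OF _ _ \<O>2(2)[OF y2] nok2])
        show "?R2 \<subseteq> {u \<in> U n. pullback_name (s n) u y \<notin> coded_event D r K ?F2 ?Q2} \<union> ?nok"
        proof (rule subsetI, rule ccontr)
          fix u assume u: "u \<in> ?R2"
            and nu: "u \<notin> {u \<in> U n. pullback_name (s n) u y \<notin> coded_event D r K ?F2 ?Q2} \<union> ?nok"
          have okn: "?ok n u" and ev: "pullback_name (s n) u y \<in> coded_event D r K ?F2 ?Q2" using u nu by blast+
          have "?Q2 (y u) (\<lambda>k. code D r K (pullback_name (s n) (s n k u) y))"
          proof (rule coded_event_pullback[OF sep Q2 _ _ ev])
            show "s n d (s n k u) = s n (d + k) u" if "d \<in> D" "k \<in> ?F2" for d k
              using bspec[OF conjunct1[OF okn], of "(d, k)"] that by simp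
          qed (rule conjunct2[OF okn])
          then show False using u unfolding cd_def by blast
        qed
      qed blast
      moreover have "3 / 4 * (e * b) + e * b / 4 = e * b" "2 * \<eta>A + \<eta>A = 3 * \<eta>A" by simp_all
      ultimately show "real (card ?R1) \<le> e * b * real (card (U n)) \<and> real (card ?R2) \<le> 3 * \<eta>A * real (card (U n))"
        by (simp only:)
    qed
  qed
  then show ?thesis
    using cdC weak_nbhds_Int[OF \<O>1(1) \<O>2(1)] H(1) Hne
    by (intro exI[of _ cd] exI[of _ "\<O>1 \<inter> \<O>2"] exI[of _ H] conjI allI)
qed

text \<open>The seed \<open>(y, w)\<close> stands for the row number \<open>w\<close> in the array of codes of \<open>y\<close>.\<close>

definition seed_row :: "nat \<Rightarrow> (('g \<times> 'h \<Rightarrow> 'y) \<Rightarrow> nat) \<Rightarrow> ('v \<times> 'w \<Rightarrow> 'y) \<times> 'w \<Rightarrow> 'v \<Rightarrow> nat" where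
  "seed_row n cd j v = cd (pullback_name (s n) (v, snd j) (fst j))"

lemma typical_rows:
  assumes S: "finite S" "S \<noteq> {}" and H: "finite H" "H \<noteq> {}" and e: "e > 0"
    and freq: "\<And>y. y \<in> S \<Longrightarrow> real (card {u \<in> U n. \<not> row_frequencies DG C H (row_law M T p DG) e (\<lambda>k. cd (pullback_name (s n) (s n k u) y))})
        \<le> e * b * real (card (U n))"
  shows "\<exists>Vb\<subseteq>V n. real (card Vb) \<le> b * real (card (V n)) \<and> (\<forall>v\<in>V n - Vb. \<forall>a\<in>DG \<rightarrow>\<^sub>E C.
     \<bar>measure_pmf.prob (pmf_of_set (S \<times> W n)) {j. \<forall>g\<in>DG. seed_row n cd j (\<sigma> n g v) = a g} - row_law M T p DG a\<bar> \<le> 2 * e)"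
proof -
  let ?Z = "\<lambda>y v w a. if \<forall>g\<in>DG. cd (pullback_name (s n) (\<sigma> n g v, w) y) = a g then 1 else 0 :: real"
  let ?bad = "\<lambda>y. {u. \<not> row_frequencies DG C H (row_law M T p DG) e (\<lambda>k. cd (pullback_name (s n) (s n k u) y))}"
  have "\<exists>Vb\<subseteq>V n. real (card Vb) \<le> b * real (card (V n)) \<and>
    (\<forall>v\<in>V n - Vb. \<forall>a\<in>DG \<rightarrow>\<^sub>E C. \<bar>(\<Sum>y\<in>S. \<Sum>w\<in>W n. ?Z y v w a) / (real (card S) * real (card (W n))) - row_law M T p DG a\<bar> \<le> 2 * e)"
  proof (rule rows_typical[OF sofic_finite(1)[OF sV] sofic_finite[OF sW] S sofic_bij[OF sW] H _ row_law_01 e, where bad="?bad"])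
    show "real (card {u \<in> V n \<times> W n. u \<in> ?bad y}) \<le> e * b * real (card (V n \<times> W n))" if "y \<in> S" for y
      using freq[OF that] by (simp add: prod_sets_def)
    show "\<bar>(\<Sum>h\<in>H. ?Z y v (\<tau> n h w) a) / real (card H) - row_law M T p DG a\<bar> \<le> e"
      if "y \<in> S" "v \<in> V n" "w \<in> W n" "(v, w) \<notin> ?bad y" "a \<in> DG \<rightarrow>\<^sub>E C" for y v w a
      using that(4,5) by (simp add: row_frequencies_def prod_maps_def)
  qed auto
  moreover have "measure_pmf.prob (pmf_of_set (S \<times> W n)) {j. \<forall>g\<in>DG. seed_row n cd j (\<sigma> n g v) = a g}
     = (\<Sum>y\<in>S. \<Sum>w\<in>W n. ?Z y v w a) / (real (card S) * real (card (W n)))" for v a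
  proof -
    let ?A = "{j. \<forall>g\<in>DG. seed_row n cd j (\<sigma> n g v) = a g}"
    have fin: "finite (S \<times> W n)" "S \<times> W n \<noteq> {}" using S sofic_finite[OF sW] by auto
    have "(\<Sum>y\<in>S. \<Sum>w\<in>W n. ?Z y v w a) = (\<Sum>j\<in>S \<times> W n. if j \<in> ?A then 1 else 0)"
      by (simp add: sum.cartesian_product seed_row_def case_prod_beta')
    also have "\<dots> = real (card ((S \<times> W n) \<inter> ?A))" using fin by (simp add: sum.If_cases)
    finally show ?thesis using fin by (simp add: measure_pmf_of_set card_cartesian_product)
  qed
  ultimately show ?thesis by simp
qed

text \<open>The coarse array determines the configuration up to the small error that is allowed in
  \<open>stage_code\<close>, and this error is less than the separation \<open>\<delta>\<close>.\<close>

lemma coarse_arrays_distinct: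
  assumes sep: "y \<noteq> y' \<Longrightarrow> \<delta> \<le> mean_dist (U n) y y'"
    and rec: "real (card {u \<in> U n. \<not> dist (y u) (\<phi>A (\<lambda>h. \<pi> (cd (pullback_name (s n) (s n (0, h) u) y)))) < \<eta>A}) \<le> 3 * \<eta>A * real (card (U n))"
      "real (card {u \<in> U n. \<not> dist (y' u) (\<phi>A (\<lambda>h. \<pi> (cd (pullback_name (s n) (s n (0, h) u) y')))) < \<eta>A}) \<le> 3 * \<eta>A * real (card (U n))"
    and \<Delta>: "\<And>x y :: 'y. dist x y \<le> \<Delta>" and small: "2 * (\<eta>A + \<Delta> * (3 * \<eta>A)) < \<delta>" and \<eta>A: "\<eta>A > 0"
    and eq: "\<And>v w. v \<in> V n \<Longrightarrow> w \<in> W n \<Longrightarrow> \<pi> (seed_row n cd (y, w) v) = \<pi> (seed_row n cd (y', w) v)"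
  shows "y = y'"
proof (rule ccontr)
  assume ne: "y \<noteq> y'"
  let ?x = "\<lambda>y u. \<phi>A (\<lambda>h. \<pi> (cd (pullback_name (s n) (s n (0, h) u) y)))"
  let ?n = "real (card (U n))"
  have n: "?n > 0" using finU by (simp add: card_gt_0_iff)
  have \<Delta>0: "\<Delta> \<ge> 0" using \<Delta>[of undefined undefined] by simp
  have xx: "?x y u = ?x y' u" if u: "u \<in> U n" for u
  proof -
    have "\<pi> (cd (pullback_name (s n) (s n (0, h) u) y)) = \<pi> (cd (pullback_name (s n) (s n (0, h) u) y'))" for h
      using eq[of "fst (s n (0, h) u)" "snd (s n (0, h) u)"] sU[OF u, of "(0, h)"] by (auto simp: seed_row_def prod_sets_def mem_Times_iff)
    then show ?thesis by simp
  qed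
  have sum: "(\<Sum>u\<in>U n. dist (z u) (?x z u)) \<le> (\<eta>A + \<Delta> * (3 * \<eta>A)) * ?n"
    if "real (card {u \<in> U n. \<not> dist (z u) (?x z u) < \<eta>A}) \<le> 3 * \<eta>A * ?n" for z
  proof -
    have "(\<Sum>u\<in>U n. dist (z u) (?x z u)) \<le> (\<Sum>u\<in>U n. \<eta>A + (if \<not> dist (z u) (?x z u) < \<eta>A then \<Delta> else 0))"
    proof (rule sum_mono)
      fix u
      show "dist (z u) (?x z u) \<le> \<eta>A + (if \<not> dist (z u) (?x z u) < \<eta>A then \<Delta> else 0)"
        using \<Delta>[of "z u" "?x z u"] \<eta>A by auto
    qed
    also have "\<dots> = \<eta>A * ?n + \<Delta> * real (card {u \<in> U n. \<not> dist (z u) (?x z u) < \<eta>A})"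
      using finU by (simp add: sum.distrib sum.If_cases Int_def mult.commute)
    also have "\<dots> \<le> \<eta>A * ?n + \<Delta> * (3 * \<eta>A * ?n)" using that \<Delta>0 by (intro add_left_mono mult_left_mono)
    finally show ?thesis by (simp add: algebra_simps)
  qed
  have "(\<Sum>u\<in>U n. dist (y u) (y' u)) \<le> (\<Sum>u\<in>U n. dist (y u) (?x y u) + dist (y' u) (?x y' u))"
    by (intro sum_mono) (simp only: xx dist_triangle2)
  also have "\<dots> \<le> (\<eta>A + \<Delta> * (3 * \<eta>A)) * ?n + (\<eta>A + \<Delta> * (3 * \<eta>A)) * ?n"
    unfolding sum.distrib by (intro add_mono sum rec)
  also have "\<dots> = 2 * (\<eta>A + \<Delta> * (3 * \<eta>A)) * ?n" by simp
  also have "\<dots> < \<delta> * ?n" using small n by (intro mult_strict_right_mono)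
  finally have "mean_dist (U n) y y' < \<delta>" using n by (simp add: mean_dist_def divide_less_eq)
  then show False using sep[OF ne] by simp
qed

end

section \<open>Doubly quenched models from one good model space\<close>

lemma divide_large:
  fixes X Y Z w :: real
  assumes "Y > 0" "Z > 0" "w > 0" "X / (Y * Z) \<le> w"
  shows "X / (Y * w) \<le> Z"
proof -
  have "Y * Z > 0" using assms by simp
  then have "X \<le> w * (Y * Z)" using assms(4) by (simp only: pos_divide_le_eq)
  moreover have "Y * w > 0" using assms by simp
  moreover have "w * (Y * Z) = Z * (Y * w)" by simp
  ultimately show ?thesis by (simp only: pos_divide_le_eq)
qed

lemma mult_divide_bound:
  fixes k m X :: real
  assumes "0 \<le> k" "k \<le> m" "0 < m" "0 \<le> X" "0 < c"
  shows "k * (X / (c * m)) \<le> X / c"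
proof -
  have "k * (X / (c * m)) \<le> m * (X / (c * m))" using assms by (intro mult_right_mono) auto
  also have "\<dots> = X / c" using assms by simp
  finally show ?thesis .
qed

context coinduced_models
begin

lemma separating_kernels:
  assumes p: "finite_code M p" and \<kappa>: "\<kappa> > 0"
  shows "\<exists>K D r. (\<forall>a. compact (K a)) \<and> separated_codes D r K \<and> measure \<nu> (- (\<Union>a. K a)) \<le> \<kappa> \<and> (\<forall>a. \<forall>y\<in>K a. p (\<Psi> y 0) = a)"
proof -
  obtain K where K: "\<And>a. compact (K a)" "\<And>a b. a \<noteq> b \<Longrightarrow> K a \<inter> K b = {}" "{a. K a \<noteq> {}} \<subseteq> range p"
     "measure \<nu> (- (\<Union>a. K a)) \<le> \<kappa>" "\<forall>a. \<forall>y\<in>K a. p (\<Psi> y 0) = a"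
    using code_kernels[OF p \<kappa>] by blast
  have "finite {a. K a \<noteq> {}}" using K(3) p by (auto simp: finite_code_def intro: finite_subset)
  then obtain D r where "separated_codes D r K" using separated_codes_exist[where K=K, OF K(1) K(2)] by blast
  then show ?thesis using K(1,4,5) by (intro exI[of _ K] exI[of _ D] exI[of _ r] conjI) blast+
qed

text \<open>The point \<open>\<Phi> x\<close> itself witnesses that the array is recoverable, whenever it lies in the compact
  sets and is well approximated by the decoded array.\<close>

lemma unrecoverable_rare:
  fixes \<pi> :: "nat \<Rightarrow> nat"
  assumes K: "\<And>a. compact (K a)" "\<And>a y. y \<in> K a \<Longrightarrow> \<pi> (p (\<Psi> y 0)) = a" "measure \<nu> (- (\<Union>a. K a)) \<le> \<kappa>"
    and B: "B \<in> sets P" "measure P B \<le> \<beta>" and D: "D \<subseteq> D'"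
    and approx: "\<And>x k. x \<in> space P \<Longrightarrow> x \<notin> B \<Longrightarrow> k \<in> D' \<Longrightarrow> dist (\<Phi> x k) (decode \<phi> (\<lambda>k. orbit_code T p k x) k) < r / 2"
  shows "measure P {x \<in> space P. \<not> (\<exists>z\<in>K (\<pi> (orbit_code T p 0 x)). \<forall>k\<in>D. dist (decode \<phi> (\<lambda>k. orbit_code T p k x) k) (z k) < r / 2)} \<le> \<beta> + \<kappa>"
proof -
  obtain N0 where N0: "N0 \<in> null_sets P"
    "\<And>x k. x \<in> space P \<Longrightarrow> x \<notin> N0 \<Longrightarrow> \<Phi> (coinduced_action T k x) = right_shift k (\<Phi> x)"
    "\<And>x k. x \<in> space P \<Longrightarrow> x \<notin> N0 \<Longrightarrow> \<Psi> (\<Phi> (coinduced_action T k x)) = coinduced_action T k x"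
    by (rule exceptional_set) blast
  have KU: "(\<Union>a. K a) \<in> sets \<nu>" 
  proof -
    have "K a \<in> sets \<nu>" for a unfolding sets_\<nu> by (rule borel_closed[OF compact_imp_closed[OF K(1)]])
    then show ?thesis by (intro sets.countable_UN) auto
  qed
  have KC: "- (\<Union>a. K a) \<in> sets \<nu>" using sets.compl_sets[OF KU] by (simp add: space_\<nu> Compl_eq_Diff_UNIV)
  let ?X = "\<Phi> -` (- (\<Union>a. K a)) \<inter> space P"
  have X: "?X \<in> sets P" by (rule measurable_sets[OF \<Phi> KC])
  have mX: "measure P ?X \<le> \<kappa>" using measure_distr[OF \<Phi> KC] K(3) by (simp only: distr_\<Phi>)
  have N0s: "N0 \<in> sets P" "measure P N0 = 0" using N0(1) by (auto simp: null_sets_def measure_def)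
  have "{x \<in> space P. \<not> (\<exists>z\<in>K (\<pi> (orbit_code T p 0 x)). \<forall>k\<in>D. dist (decode \<phi> (\<lambda>k. orbit_code T p k x) k) (z k) < r / 2)} \<subseteq> B \<union> N0 \<union> ?X"
  proof (rule subsetI, rule ccontr)
    fix x assume x: "x \<in> {x \<in> space P. \<not> (\<exists>z\<in>K (\<pi> (orbit_code T p 0 x)). \<forall>k\<in>D. dist (decode \<phi> (\<lambda>k. orbit_code T p k x) k) (z k) < r / 2)}"
      and n: "x \<notin> B \<union> N0 \<union> ?X"
    have sp: "x \<in> space P" and xB: "x \<notin> B" and xN: "x \<notin> N0" and "\<Phi> x \<in> (\<Union>a. K a)" using x n by blast+
    then obtain a where a: "\<Phi> x \<in> K a" by blast
    have "x h \<in> space M" for h using sp by (auto simp: space_P)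
    then have T0: "T 0 (x h) = x h" for h using sys by (auto simp: group_system_def)
    have act: "coinduced_action T 0 x = x" using T0 by (simp add: coinduced_action_def)
    have "\<Psi> (\<Phi> x) = x" using N0(3)[OF sp xN, of 0] by (simp only: act)
    then have "\<pi> (orbit_code T p 0 x) = a" using K(2)[OF a] T0 by (simp add: orbit_code_def)
    moreover have "\<forall>k\<in>D. dist (decode \<phi> (\<lambda>k. orbit_code T p k x) k) (\<Phi> x k) < r / 2"
    proof
      fix k assume "k \<in> D"
      then have "k \<in> D'" by (rule subsetD[OF D])
      from approx[OF sp xB this] show "dist (decode \<phi> (\<lambda>k. orbit_code T p k x) k) (\<Phi> x k) < r / 2" by (simp only: dist_commute)
    qed
    ultimately have "\<exists>z\<in>K (\<pi> (orbit_code T p 0 x)). \<forall>k\<in>D. dist (decode \<phi> (\<lambda>k. orbit_code T p k x) k) (z k) < r / 2"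
      using a by (intro bexI[of _ "\<Phi> x"]) simp_all
    then show False using x by blast
  qed
  then have "measure P {x \<in> space P. \<not> (\<exists>z\<in>K (\<pi> (orbit_code T p 0 x)). \<forall>k\<in>D. dist (decode \<phi> (\<lambda>k. orbit_code T p k x) k) (z k) < r / 2)}
      \<le> measure P (B \<union> N0 \<union> ?X)"
    using B(1) N0s(1) X by (intro P.finite_measure_mono sets.Un)
  also have "\<dots> \<le> measure P B + measure P N0 + measure P ?X"
    using B(1) N0s(1) X measure_Un_le[of "B \<union> N0" P ?X] measure_Un_le[of B P N0] by simp
  also have "\<dots> \<le> \<beta> + \<kappa>" using B(2) N0s(2) mX by simp
  finally show ?thesis .
qed

lemma resampled_independent_rows:
  assumes p: "finite_code M p" and \<phi>: "depends_only_on E \<phi>" and fin: "finite E" "finite DG" "finite DH"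
    and EE: "EE = (\<lambda>(h, h'). h + h') ` (E \<times> DH)" and S: "finite S" "S \<noteq> {}"
    and cd: "\<And>z. cd z \<in> insert 0 (range p)"
    and Vb: "real (card (V n \<inter> Vb)) \<le> b * real (card (V n))" and Wb: "real (card (W n \<inter> Wb)) \<le> b * real (card (W n))"
    and typical: "\<And>v a. v \<in> V n \<Longrightarrow> v \<notin> Vb \<Longrightarrow> a \<in> DG \<rightarrow>\<^sub>E insert 0 (range p) \<Longrightarrow>
      \<bar>measure_pmf.prob (pmf_of_set (S \<times> W n)) {j. \<forall>g\<in>DG. seed_row n cd j (\<sigma> n g v) = a g} - row_law M T p DG a\<bar> \<le> e"
    and e: "e \<ge> 0"
    and compat: "\<And>w h h'. w \<in> W n \<Longrightarrow> w \<notin> Wb \<Longrightarrow> h \<in> E \<Longrightarrow> h' \<in> DH \<Longrightarrow> \<tau> n h (\<tau> n h' w) = \<tau> n (h + h') w"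
    and free: "\<And>w. w \<in> W n \<Longrightarrow> w \<notin> Wb \<Longrightarrow> inj_on (\<lambda>h. \<tau> n h w) EE"
  shows "independent_rows (V n) (W n) (\<sigma> n) (\<tau> n) (pmf_of_set (S \<times> W n)) (seed_row n cd) \<phi> (insert 0 (range p)) E DG DH EE Vb Wb e b
    (row_law M T p DG) P (\<lambda>k. orbit_code T p k)"
proof (rule independent_rows.intro)
  show "finite (insert 0 (range p))" using p by (simp add: finite_code_def)
  have "finite (S \<times> W n)" "S \<times> W n \<noteq> {}" using S sofic_finite[OF sW] by auto
  then show "finite (set_pmf (pmf_of_set (S \<times> W n)))" by simp
  show "seed_row n cd j v \<in> insert 0 (range p)" for j v unfolding seed_row_def by (rule cd)
  show "orbit_code T p k x \<in> insert 0 (range p)" for k x by (simp add: orbit_code_def)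
  have "finite EE" unfolding EE using fin by simp
  then show "measure P {x \<in> space P. \<forall>k\<in>DG \<times> EE. orbit_code T p k x = a k} = (\<Prod>h\<in>EE. row_law M T p DG (\<lambda>g\<in>DG. a (g, h)))" for a
    by (rule orbit_code_rows[OF p fin(2)])
qed (fact sofic_finite[OF sV] sofic_finite[OF sW] sofic_bij[OF sW] fin \<phi> EE Vb Wb e row_law_01 P.prob_space_axioms orbit_code_measurable[OF p]
   | rule sofic_in[OF sV] typical compat free; assumption)+

text \<open>Every separated set of good models gives rise to a measure that is quenched at the scale
  \<open>(D, r)\<close> and has half-covering numbers at the scale \<open>\<delta>1\<close> of almost its size.\<close>

definition stage_models :: "real \<Rightarrow> real \<Rightarrow> real \<Rightarrow> ('g \<times> 'h) set \<Rightarrow> real \<Rightarrow> ('g \<times> 'h \<Rightarrow> 'y) measure set \<Rightarrow> nat \<Rightarrow> bool" where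
  "stage_models \<delta>0 \<delta>1 \<zeta> D r \<O> n \<longleftrightarrow> (\<forall>S. finite S \<longrightarrow> S \<noteq> {} \<longrightarrow> S \<subseteq> good_models \<O> (U n) (s n) \<longrightarrow>
     (\<forall>y\<in>S. \<forall>y'\<in>S. y \<noteq> y' \<longrightarrow> \<delta>0 \<le> mean_dist (U n) y y') \<longrightarrow>
     (\<exists>m. prob_space m \<and> sets m = sets (PiM (U n) (\<lambda>_. borel)) \<and>
        quenched_close (U n) (s n) (pair_model_measure (U n) m) (pair_process \<nu>) D r \<and>
        (\<forall>F. finite F \<longrightarrow> measure m {y \<in> space m. \<exists>f\<in>F. mean_dist (U n) f y < \<delta>1} > 1 / 2 \<longrightarrow>
          exp (ln (real (card S)) - 5 * \<zeta> * real (card (U n))) \<le> real (card F))))"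

text \<open>The coarse data \<open>pA\<close>, \<open>K\<close>, \<open>x\<close>, \<open>t\<close> and \<open>\<delta>1\<close> are given before the accuracy \<open>(D, r)\<close>. The
  fine code \<open>p\<close> refines \<open>pA\<close> by a map \<open>\<pi>\<close> and is chosen after it.\<close>

lemma stage_models_eventually:
  assumes pA: "finite_code M pA" and EA: "finite EA" and \<phi>A: "depends_only_on EA \<phi>A" and \<eta>A: "\<eta>A > 0"
    and BA: "BA \<in> sets P" "measure P BA \<le> \<eta>A"
    and approxA: "\<And>x. x \<in> space P \<Longrightarrow> x \<notin> BA \<Longrightarrow> dist (\<Phi> x 0) (\<phi>A (\<lambda>h. pA (x h))) < \<eta>A"
    and \<Delta>: "\<And>x y :: 'y. dist x y \<le> \<Delta>" and small: "2 * (\<eta>A + \<Delta> * (3 * \<eta>A)) < \<delta>0"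
    and \<zeta>: "\<zeta> > 0" and t: "t \<ge> 0" "real (card (insert 0 (range pA))) * exp (- t) \<le> \<zeta>"
    and x: "x = \<zeta> / (4 * (t + 1))"
    and K: "\<And>a. compact (K a)" "\<And>a y. y \<in> K a \<Longrightarrow> pA (\<Psi> y 0) = a" "measure \<nu> (- (\<Union>a. K a)) \<le> x / 64"
    and sep: "separated_codes DA rA K" and \<delta>1: "\<delta>1 = \<zeta> * rA / (8 * ((t + 1) * (real (card DA) + 1)))"
    and D: "finite D" and r: "r > 0"
  shows "\<exists>\<O>\<in>weak_nbhds \<nu>. eventually (stage_models \<delta>0 \<delta>1 \<zeta> D r \<O>) sequentially"
proof -
  have DA: "finite DA" and rA: "rA > 0" using sep by (auto simp: separated_codes_def)
  have t1: "t + 1 > 0" using t by simp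
  have x0: "x > 0" unfolding x using \<zeta> t1 by simp
  let ?L = "insert 0 (range pA)"
  \<comment> \<open>A product window that contains the window \<open>D\<close> of the accuracy and the window \<open>DA\<close> on which the
    coarse code is read.\<close>
  define DG where "DG = fst ` (D \<union> DA \<union> {0})"
  define DH where "DH = snd ` (D \<union> DA \<union> {0})"
  have finD: "finite DG" "finite DH" using D DA by (auto simp: DG_def DH_def)
  have zero: "0 \<in> DG" "0 \<in> DH" by (force simp: DG_def DH_def)+
  have sub: "D \<union> DA \<subseteq> DG \<times> DH"
  proof
    fix k assume "k \<in> D \<union> DA"
    then have "k \<in> D \<union> DA \<union> {0}" by blast
    then have "fst k \<in> DG" "snd k \<in> DH" unfolding DG_def DH_def by (rule imageI)+
    then show "k \<in> DG \<times> DH" by (simp add: mem_Times_iff)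
  qed
  define nD where "nD = real (card (DG \<times> DH))"
  have "DG \<times> DH \<noteq> {}" using zero by blast
  then have nD: "nD > 0" unfolding nD_def using finD by (simp add: card_gt_0_iff)
  define \<eta> where "\<eta> = min (r / (16 * nD)) (min (rA / 2) (x / (64 * nD)))"
  have \<eta>: "\<eta> > 0" and \<eta>r: "\<eta> \<le> r / (16 * nD)" and \<eta>A: "\<eta> \<le> rA / 2" and \<eta>x: "\<eta> \<le> x / (64 * nD)"
    unfolding \<eta>_def using r rA x0 nD by simp_all
  have n\<eta>r: "nD * \<eta> \<le> r / 16" and n\<eta>x: "nD * \<eta> \<le> x / 64"
    using mult_left_mono[OF \<eta>r, of nD] mult_left_mono[OF \<eta>x, of nD] nD by simp_all
  have Y: "(\<lambda>x. \<Phi> x 0) \<in> borel_measurable (PiM UNIV (\<lambda>_::'h. M))"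
    using measurable_compose[OF \<Phi>_borel borel_measurable_continuous_onI[OF continuous_on_product_coordinates]] by (simp only: P_def)
  obtain p \<pi>0 E0 \<phi> B0 where p: "finite_code M p" and \<pi>0: "pA = \<pi>0 \<circ> p" and E0: "finite E0" and \<phi>0: "depends_only_on E0 \<phi>"
    and B0: "B0 \<in> sets (PiM UNIV (\<lambda>_::'h. M))" "measure (PiM UNIV (\<lambda>_::'h. M)) B0 \<le> \<eta>"
    and approx0: "\<forall>x\<in>space (PiM UNIV (\<lambda>_::'h. M)) - B0. dist (\<Phi> x 0) (\<phi> (\<lambda>h. p (x h))) < \<eta>"
    using code_approximation_of_map[OF M_prob Y cpt \<eta> pA] by (elim exE conjE)
  \<comment> \<open>Redefined outside the range of \<open>p\<close> so that its values lie in the finite alphabet of the coarse code.\<close>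
  define \<pi> where "\<pi> a = (if \<pi>0 a \<in> ?L then \<pi>0 a else 0)" for a
  have \<pi>L: "\<pi> a \<in> ?L" for a by (simp add: \<pi>_def)
  have \<pi>p: "\<pi> (p z) = pA z" for z
  proof -
    have "\<pi>0 (p z) = pA z" using fun_cong[OF \<pi>0, of z] by simp
    then show ?thesis by (simp add: \<pi>_def)
  qed
  define E where "E = insert 0 E0"
  have E: "finite E" using E0 by (simp add: E_def)
  have \<phi>: "depends_only_on E \<phi>" by (rule depends_only_on_mono[OF \<phi>0]) (auto simp: E_def)
  define EE where "EE = (\<lambda>(h, h'). h + h') ` (E \<times> DH)"
  have finEE: "finite EE" unfolding EE_def using E finD by simp
  have "(0, 0) \<in> E \<times> DH" using zero by (simp add: E_def)
  then have zEE: "0 \<in> EE" unfolding EE_def by (rule rev_image_eqI) simp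
  define C where "C = insert 0 (range p)"
  have finC: "finite C" using p by (simp add: C_def finite_code_def)
  have C1: "card C \<ge> 1" using finC by (simp add: C_def card_gt_0_iff Suc_le_eq)
  \<comment> \<open>With this \<open>e\<close>, the errors of the window are at most \<open>r / 4\<close> for the pair and \<open>x / 64\<close> for the
    single copy.\<close>
  define M0 where "M0 = real (card (C \<times> C) ^ card (DG \<times> EE)) * real (card EE) + 1"
  have M0: "M0 > 0" by (simp add: M0_def add_nonneg_pos)
  define e where "e = min (r / 4) (x / 32) / (4 * M0)"
  have e: "e > 0" unfolding e_def using r x0 M0 by simp
  have eM: "4 * (M0 * e) \<le> r / 4" "4 * (M0 * e) \<le> x / 32"
    unfolding e_def using M0 by simp_all
  define b where "b = min (r / 24) (min (x / 64) (\<zeta> / (16 * (t + 1))))"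
  have b: "b > 0" unfolding b_def using r x0 \<zeta> t1 by simp
  have br: "b \<le> r / 24" and bx: "b \<le> x / 64" and bt: "b \<le> \<zeta> / (16 * (t + 1))"
    unfolding b_def by (intro min.coboundedI1 min.coboundedI2 order_refl)+
  have b2: "b / 2 > 0" using b by simp
  have approx\<pi>: "dist (\<Phi> x 0) (\<phi>A (\<lambda>h. \<pi> (p (x h)))) < \<eta>A" if "x \<in> space P" "x \<notin> BA" for x
    using approxA[OF that] by (simp only: \<pi>p)
  have "\<exists>cd \<O> H. (\<forall>z. cd z \<in> insert 0 (range p)) \<and> \<O> \<in> weak_nbhds \<nu> \<and> finite H \<and> H \<noteq> {} \<and>
    eventually (\<lambda>n. \<forall>y\<in>good_models \<O> (U n) (s n).
      real (card {u \<in> U n. \<not> row_frequencies DG (insert 0 (range p)) H (row_law M T p DG) e (\<lambda>k. cd (pullback_name (s n) (s n k u) y))})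
        \<le> e * (b / 2) * real (card (U n)) \<and>
      real (card {u \<in> U n. \<not> dist (y u) (\<phi>A (\<lambda>h. \<pi> (cd (pullback_name (s n) (s n (0, h) u) y)))) < \<eta>A})
        \<le> 3 * \<eta>A * real (card (U n))) sequentially"
    by (rule stage_code[OF p finD(1) e b2 EA \<phi>A \<open>\<eta>A > 0\<close> BA]) (rule approx\<pi>)
  then obtain cd \<O> H where cd: "\<forall>z. cd z \<in> insert 0 (range p)" and \<O>: "\<O> \<in> weak_nbhds \<nu>" and H: "finite H" "H \<noteq> {}"
    and ev: "eventually (\<lambda>n. \<forall>y\<in>good_models \<O> (U n) (s n).
      real (card {u \<in> U n. \<not> row_frequencies DG (insert 0 (range p)) H (row_law M T p DG) e (\<lambda>k. cd (pullback_name (s n) (s n k u) y))})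
        \<le> e * (b / 2) * real (card (U n)) \<and>
      real (card {u \<in> U n. \<not> dist (y u) (\<phi>A (\<lambda>h. \<pi> (cd (pullback_name (s n) (s n (0, h) u) y)))) < \<eta>A})
        \<le> 3 * \<eta>A * real (card (U n))) sequentially"
    by (elim exE conjE)
  have B0': "B0 \<in> sets P" "measure P B0 \<le> \<eta>" using B0 by (simp_all only: P_def)
  have approx0': "dist (\<Phi> x 0) (\<phi> (\<lambda>h. p (x h))) < \<eta>" if "x \<in> space P" "x \<notin> B0" for x
    using that bspec[OF approx0, of x] by (simp add: P_def)
  have finDD: "finite (DG \<times> DH)" using finD by simp
  have "\<exists>B'\<in>sets P. measure P B' \<le> nD * \<eta> \<and>
     (\<forall>x\<in>space P. x \<notin> B' \<longrightarrow> (\<forall>k\<in>DG \<times> DH. dist (\<Phi> x k) (decode \<phi> (\<lambda>k. orbit_code T p k x) k) < \<eta>))"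
    unfolding nD_def by (rule window_approximation[OF B0' _ finDD]) (rule approx0')
  then obtain B where B: "B \<in> sets P" "measure P B \<le> nD * \<eta>"
    and approx: "\<forall>x\<in>space P. x \<notin> B \<longrightarrow> (\<forall>k\<in>DG \<times> DH. dist (\<Phi> x k) (decode \<phi> (\<lambda>k. orbit_code T p k x) k) < \<eta>)"
    by (elim bexE conjE)
  define ap where "ap x k = dist (\<Phi> x k) (decode \<phi> (\<lambda>k. orbit_code T p k x) k)" for x k
  have ap: "ap x k < \<eta>" if "x \<in> space P" "x \<notin> B" "k \<in> DG \<times> DH" for x k
    unfolding ap_def using approx that by blast
  have \<eta>r2: "\<eta> < r / 2"
  proof -
    have "nD \<ge> 1" using nD unfolding nD_def by (simp only: of_nat_0_less_iff real_of_nat_ge_one_iff)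
    then have "r / (16 * nD) \<le> r / 16" using r by (intro divide_left_mono) auto
    then show ?thesis using \<eta>r r by linarith
  qed
  have approx_r: "dist (\<Phi> x k) (decode \<phi> (\<lambda>k. orbit_code T p k x) k) < r / 2" if "x \<in> space P" "x \<notin> B" "k \<in> DG \<times> DH" for x k
    using ap[OF that] \<eta>r2 unfolding ap_def by linarith
  have approx_A: "dist (\<Phi> x k) (decode \<phi> (\<lambda>k. orbit_code T p k x) k) < rA / 2" if "x \<in> space P" "x \<notin> B" "k \<in> DG \<times> DH" for x k
    using ap[OF that] \<eta>A unfolding ap_def by linarith
  have K2: "\<pi> (p (\<Psi> y 0)) = a" if "y \<in> K a" for a y using K(2)[OF that] by (simp only: \<pi>p)
  have DAs: "DA \<subseteq> DG \<times> DH" using sub by blast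
  have rare: "measure P {x \<in> space P. \<not> (\<exists>z\<in>K (\<pi> (orbit_code T p 0 x)). \<forall>k\<in>DA. dist (decode \<phi> (\<lambda>k. orbit_code T p k x) k) (z k) < rA / 2)} \<le> nD * \<eta> + x / 64"
  proof (rule unrecoverable_rare[OF K(1) _ K(3) B DAs])
    show "\<pi> (p (\<Psi> y 0)) = a" if "y \<in> K a" for a y by (rule K2[OF that])
    show "dist (\<Phi> x k) (decode \<phi> (\<lambda>k. orbit_code T p k x) k) < rA / 2" if "x \<in> space P" "x \<notin> B" "k \<in> DG \<times> DH" for x k
      by (rule approx_A[OF that])
  qed
  let ?ok = "\<lambda>n w. (\<forall>hh\<in>E \<times> DH. \<tau> n (fst hh) (\<tau> n (snd hh) w) = \<tau> n (fst hh + snd hh) w) \<and> inj_on (\<lambda>h. \<tau> n h w) EE \<and> \<tau> n 0 w = w"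
  have finEH: "finite (E \<times> DH)" using E finD by simp
  have okW: "mostly W ?ok"
    by (intro mostly_conj mostly_ball sofic_finite[OF sW] finEH sofic_mult[OF sW] sofic_free[OF sW finEE] sofic_zero[OF sW])
  \<comment> \<open>Beyond this size of \<open>W n\<close>, the weak laws for the empirical averages and for the entropy and the
    constant factor of the covering bound take effect.\<close>
  define w0 where "w0 = max 1 (max (2 * (real (card EE))\<^sup>2 / ((r / 4)\<^sup>2 * r))
     (max (2 * (ln (real (card ?L)) - ln (1 - exp (- \<zeta>)))\<^sup>2 / (\<zeta>\<^sup>2 * (1 / 8))) (ln 4 / \<zeta>)))"
  have evW: "eventually (\<lambda>n. w0 \<le> real (card (W n))) sequentially"
    using sofic_card_unbounded[OF sW infH] by (simp add: filterlim_at_top)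
  have "eventually (stage_models \<delta>0 \<delta>1 \<zeta> D r \<O>) sequentially"
    using ev mostlyD[OF sofic_zero[OF sV] b2] mostlyD[OF okW b] evW
  proof eventually_elim
    case (elim n)
    show ?case
      unfolding stage_models_def
    proof (intro allI impI)
      fix S assume S: "finite S" "S \<noteq> {}" and Sg: "S \<subseteq> good_models \<O> (U n) (s n)"
        and Ssep: "\<forall>y\<in>S. \<forall>y'\<in>S. y \<noteq> y' \<longrightarrow> \<delta>0 \<le> mean_dist (U n) y y'"
      have freq: "real (card {u \<in> U n. \<not> row_frequencies DG C H (row_law M T p DG) e (\<lambda>k. cd (pullback_name (s n) (s n k u) y))})
        \<le> e * (b / 2) * real (card (U n))" if "y \<in> S" for y
        unfolding C_def by (rule conjunct1[OF bspec[OF elim(1) subsetD[OF Sg that]]])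
      have rec: "real (card {u \<in> U n. \<not> dist (y u) (\<phi>A (\<lambda>h. \<pi> (cd (pullback_name (s n) (s n (0, h) u) y)))) < \<eta>A})
        \<le> 3 * \<eta>A * real (card (U n))" if "y \<in> S" for y
        by (rule conjunct2[OF bspec[OF elim(1) subsetD[OF Sg that]]])
      have "\<exists>Vb\<subseteq>V n. real (card Vb) \<le> b / 2 * real (card (V n)) \<and> (\<forall>v\<in>V n - Vb. \<forall>a\<in>DG \<rightarrow>\<^sub>E C.
           \<bar>measure_pmf.prob (pmf_of_set (S \<times> W n)) {j. \<forall>g\<in>DG. seed_row n cd j (\<sigma> n g v) = a g} - row_law M T p DG a\<bar> \<le> 2 * e)"
        by (rule typical_rows[OF S H e]) (rule freq)
      then obtain Vb1 where Vb1: "Vb1 \<subseteq> V n" "real (card Vb1) \<le> b / 2 * real (card (V n))"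
        and typV: "\<forall>v\<in>V n - Vb1. \<forall>a\<in>DG \<rightarrow>\<^sub>E C.
           \<bar>measure_pmf.prob (pmf_of_set (S \<times> W n)) {j. \<forall>g\<in>DG. seed_row n cd j (\<sigma> n g v) = a g} - row_law M T p DG a\<bar> \<le> 2 * e"
        by (elim exE conjE)
      \<comment> \<open>The codes are read at \<open>\<sigma> 0 v\<close> and \<open>\<tau> 0 w\<close>, so the points that are moved by the identity are
        bad as well.\<close>
      define Vb where "Vb = Vb1 \<union> {v \<in> V n. \<sigma> n 0 v \<noteq> v}"
      define Wb where "Wb = {w \<in> W n. \<not> ?ok n w}"
      have Vb: "real (card (V n \<inter> Vb)) \<le> b * real (card (V n))"
      proof -
        have "V n \<inter> Vb = Vb1 \<union> {v \<in> V n. \<sigma> n 0 v \<noteq> v}" using Vb1(1) by (auto simp: Vb_def)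
        then have "real (card (V n \<inter> Vb)) \<le> real (card Vb1) + real (card {v \<in> V n. \<sigma> n 0 v \<noteq> v})"
          by (simp only: card_Un_le of_nat_add[symmetric] of_nat_le_iff)
        also have "\<dots> \<le> b / 2 * real (card (V n)) + b / 2 * real (card (V n))" by (rule add_mono[OF Vb1(2) elim(2)])
        finally show ?thesis by simp
      qed
      have Wb: "real (card (W n \<inter> Wb)) \<le> b * real (card (W n))"
      proof -
        have "W n \<inter> Wb = {w \<in> W n. \<not> ?ok n w}" by (auto simp: Wb_def)
        then show ?thesis using elim(3) by (simp only:)
      qed
      have okw: "?ok n w" if "w \<in> W n" "w \<notin> Wb" for w using that unfolding Wb_def by blast
      have rows: "independent_rows (V n) (W n) (\<sigma> n) (\<tau> n) (pmf_of_set (S \<times> W n)) (seed_row n cd) \<phi> C E DG DH EE Vb Wb (2 * e) b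
         (row_law M T p DG) P (\<lambda>k. orbit_code T p k)"
        unfolding C_def
      proof (rule resampled_independent_rows[OF p \<phi> E finD EE_def S _ Vb Wb])
        show "cd z \<in> insert 0 (range p)" for z using cd by blast
        show "\<bar>measure_pmf.prob (pmf_of_set (S \<times> W n)) {j. \<forall>g\<in>DG. seed_row n cd j (\<sigma> n g v) = a g} - row_law M T p DG a\<bar> \<le> 2 * e"
          if "v \<in> V n" "v \<notin> Vb" "a \<in> DG \<rightarrow>\<^sub>E insert 0 (range p)" for v a
          using typV that unfolding Vb_def C_def by blast
        show "0 \<le> 2 * e" using e by simp
        show "\<tau> n h (\<tau> n h' w) = \<tau> n (h + h') w" if "w \<in> W n" "w \<notin> Wb" "h \<in> E" "h' \<in> DH" for w h h'
          using bspec[OF conjunct1[OF okw[OF that(1,2)]], of "(h, h')"] that(3,4) by simp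
        show "inj_on (\<lambda>h. \<tau> n h w) EE" if "w \<in> W n" "w \<notin> Wb" for w using okw[OF that] by blast
      qed
      have Un: "U n = V n \<times> W n" by (simp add: prod_sets_def)
      have sn: "s n = (\<lambda>k. map_prod (\<sigma> n (fst k)) (\<tau> n (snd k)))" by (rule prod_maps_eq)
      define d where "d = (SOME j. j \<in> S \<times> W n)"
      define m where "m = independent_rows.model_law (V n) (W n) (\<tau> n) (pmf_of_set (S \<times> W n)) d (seed_row n cd) \<phi>"
      have w0: "w0 \<le> real (card (W n))" by (rule elim(4))
      have wpos: "real (card (W n)) > 0" using w0 unfolding w0_def by simp
      have tv2: "independent_rows.window_error (C \<times> C) DG EE (2 * (2 * e)) \<le> 4 * (M0 * e)"
        unfolding independent_rows.window_error_def[OF independent_rows_pair[OF rows]] M0_def using e by (simp add: algebra_simps)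
      have tv1: "independent_rows.window_error C DG EE (2 * e) \<le> 2 * (M0 * e)"
      proof -
        have "card C \<le> card (C \<times> C)" using C1 by (simp add: card_cartesian_product)
        then have "card C ^ card (DG \<times> EE) \<le> card (C \<times> C) ^ card (DG \<times> EE)" by (intro power_mono) auto
        then have "real (card C ^ card (DG \<times> EE)) \<le> real (card (C \<times> C) ^ card (DG \<times> EE))" by (simp only: of_nat_le_iff)
        then have "real (card C ^ card (DG \<times> EE)) * real (card EE) \<le> real (card (C \<times> C) ^ card (DG \<times> EE)) * real (card EE)"
          by (intro mult_right_mono) auto
        then have "real (card C ^ card (DG \<times> EE)) * real (card EE) \<le> M0" unfolding M0_def by linarith
        then have "real (card C ^ card (DG \<times> EE)) * real (card EE) * (2 * e) \<le> M0 * (2 * e)" using e by (intro mult_right_mono) auto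
        then show ?thesis unfolding independent_rows.window_error_def[OF rows] by (simp only: mult_ac)
      qed
      have close: "quenched_close (U n) (s n) (pair_model_measure (U n) m) (pair_process \<nu>) D r"
        unfolding Un sn m_def
      proof (rule row_model_quenched_close[OF rows _ B r approx_r])
        show "D \<subseteq> DG \<times> DH" using sub by blast
        show "4 * (nD * \<eta>) + independent_rows.window_error (C \<times> C) DG EE (2 * (2 * e)) + 6 * b + r / 4 \<le> r"
          using tv2 n\<eta>r eM(1) br by linarith
        show "2 * b \<le> r" using br r by linarith
        show "2 * (real (card EE))\<^sup>2 / ((r / 4)\<^sup>2 * real (card (W n))) \<le> r"
          by (rule divide_large) (use r wpos w0 in \<open>simp_all add: w0_def\<close>)
      qed
      have cover: "exp (ln (real (card S)) - 5 * \<zeta> * real (card (U n))) \<le> real (card F)"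
        if F: "finite F" "measure m {y \<in> space m. \<exists>f\<in>F. mean_dist (U n) f y < \<delta>1} > 1 / 2" for F
        unfolding Un
      proof (rule covering_lower_bound[OF rows S sep DAs zero(1) zEE sofic_bij[OF sV], where \<pi>=\<pi> and L="?L" and \<eta>="nD * \<eta> + x / 64" and x=x and t=t and \<delta>=\<delta>1 and d=d])
        show "\<sigma> n 0 v = v" if "v \<in> V n" "v \<notin> Vb" for v using that unfolding Vb_def by blast
        show "\<tau> n 0 w = w" if "w \<in> W n" "w \<notin> Wb" for w using okw[OF that] by blast
        show "measure P {x \<in> space P. \<not> independent_rows.recoverable \<phi> K DA rA \<pi> (\<lambda>k. orbit_code T p k x)} \<le> nD * \<eta> + x / 64"
          unfolding independent_rows.recoverable_def[OF rows] by (rule rare)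
        show "0 \<le> nD * \<eta> + x / 64" using nD \<eta> x0 by simp
        show "x > 0" by (rule x0)
        have "nD * \<eta> + x / 64 + independent_rows.window_error C DG EE (2 * e) + 2 * b \<le> x / 8"
          using n\<eta>x tv1 eM(2) bx x0 by linarith
        then show "(nD * \<eta> + x / 64 + independent_rows.window_error C DG EE (2 * e) + 2 * b) / x \<le> 1 / 8"
          using x0 by (simp add: pos_divide_le_eq)
        show "finite ?L" using pA by (simp add: finite_code_def)
        show "\<pi> a \<in> ?L" for a by (rule \<pi>L)
        show "y = y'" if "y \<in> S" "y' \<in> S" "\<And>v w. v \<in> V n \<Longrightarrow> w \<in> W n \<Longrightarrow> \<pi> (seed_row n cd (y, w) v) = \<pi> (seed_row n cd (y', w) v)" for y y'
        proof (rule coarse_arrays_distinct[OF _ rec[OF that(1)] rec[OF that(2)] \<Delta> small \<open>\<eta>A > 0\<close> that(3)])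
          show "y \<noteq> y' \<Longrightarrow> \<delta>0 \<le> mean_dist (U n) y y'" using Ssep that(1,2) by blast
        qed
        show "t \<ge> 0" by (rule t)
        show "t * (x + 2 * b + 2 * real (card DA) * \<delta>1 / rA) \<le> \<zeta>"
        proof -
          have tx: "t * x \<le> \<zeta> / 4" unfolding x using t t1 \<zeta> by (intro mult_divide_bound) auto
          have "t * b \<le> t * (\<zeta> / (16 * (t + 1)))" using bt t by (intro mult_left_mono)
          also have "\<dots> \<le> \<zeta> / 16" using t t1 \<zeta> by (intro mult_divide_bound) auto
          finally have tb: "t * b \<le> \<zeta> / 16" .
          let ?k = "real (card DA)"
          have "t * ?k \<le> (t + 1) * (?k + 1)" using t by (intro mult_mono) auto
          then have "(t * ?k) * (\<zeta> / (8 * ((t + 1) * (?k + 1)))) \<le> \<zeta> / 8"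
            using t t1 \<zeta> by (intro mult_divide_bound) auto
          moreover have "t * (2 * ?k * \<delta>1 / rA) = 2 * ((t * ?k) * (\<zeta> / (8 * ((t + 1) * (?k + 1)))))"
            unfolding \<delta>1 using rA by simp
          ultimately have td: "t * (2 * ?k * \<delta>1 / rA) \<le> \<zeta> / 4" by linarith
          have "t * (x + 2 * b + 2 * ?k * \<delta>1 / rA) = t * x + 2 * (t * b) + t * (2 * ?k * \<delta>1 / rA)"
            by (simp only: distrib_left mult.left_commute)
          then show ?thesis using tx tb td \<zeta> by linarith
        qed
        show "real (card ?L) * exp (- t) \<le> \<zeta>" by (rule t)
        show "\<zeta> > 0" by (rule \<zeta>)
        show "2 * (ln (real (card ?L)) - ln (1 - exp (- \<zeta>)))\<^sup>2 / (\<zeta>\<^sup>2 * real (card (W n))) \<le> 1 / 8"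
        proof (rule divide_large)
          show "2 * (ln (real (card ?L)) - ln (1 - exp (- \<zeta>)))\<^sup>2 / (\<zeta>\<^sup>2 * (1 / 8)) \<le> real (card (W n))"
            by (rule order_trans[OF _ w0]) (simp only: w0_def le_max_iff_disj order_refl simp_thms)
        qed (use \<zeta> wpos in simp_all)
        have "ln 4 / \<zeta> \<le> real (card (W n))" by (rule order_trans[OF _ w0]) (simp only: w0_def le_max_iff_disj order_refl simp_thms)
        then show "ln 4 \<le> \<zeta> * real (card (W n))" using \<zeta> by (simp add: pos_divide_le_eq mult.commute)
        show "finite F" by (rule F)
        show "measure (independent_rows.model_law (V n) (W n) (\<tau> n) (pmf_of_set (S \<times> W n)) d (seed_row n cd) \<phi>)
           {y \<in> space (independent_rows.model_law (V n) (W n) (\<tau> n) (pmf_of_set (S \<times> W n)) d (seed_row n cd) \<phi>). \<exists>f\<in>F. mean_dist (V n \<times> W n) f y < \<delta>1} > 1 / 2"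
          using F(2) unfolding Un m_def .
      qed
      have m: "prob_space m" "sets m = sets (PiM (U n) (\<lambda>_. borel))"
        unfolding m_def Un by (rule independent_rows.model_law_prob[OF rows])+
      show "\<exists>m. prob_space m \<and> sets m = sets (PiM (U n) (\<lambda>_. borel)) \<and>
        quenched_close (U n) (s n) (pair_model_measure (U n) m) (pair_process \<nu>) D r \<and>
        (\<forall>F. finite F \<longrightarrow> measure m {y \<in> space m. \<exists>f\<in>F. mean_dist (U n) f y < \<delta>1} > 1 / 2 \<longrightarrow>
          exp (ln (real (card S)) - 5 * \<zeta> * real (card (U n))) \<le> real (card F))"
        by (intro exI[of _ m] conjI m close allI impI cover)
    qed
  qed
  then show ?thesis using \<O> by blast
qed

text \<open>The order of the choices: the coarse code approximates the process well enough to separate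
  points at distance \<open>\<delta>0\<close>; its alphabet determines \<open>t\<close>, and hence the allowed proportion \<open>x\<close> of errors
  in a Hamming ball of exponential rate \<open>\<zeta>\<close>; the compact sets for \<open>x\<close> determine \<open>\<delta>1\<close>.\<close>

lemma stage_models_exist:
  assumes \<delta>0: "\<delta>0 > 0" and \<zeta>: "\<zeta> > 0"
  shows "\<exists>\<delta>1>0. \<forall>D r. finite D \<longrightarrow> r > 0 \<longrightarrow> (\<exists>\<O>\<in>weak_nbhds \<nu>. eventually (stage_models \<delta>0 \<delta>1 \<zeta> D r \<O>) sequentially)"
proof -
  have "bounded (UNIV :: 'y set)" by (rule compact_imp_bounded[OF cpt])
  then obtain \<Delta> where \<Delta>: "\<And>x y :: 'y. dist x y \<le> \<Delta>" by (metis UNIV_I bounded_two_points)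
  have \<Delta>0: "\<Delta> \<ge> 0" using \<Delta>[of undefined undefined] by simp
  define \<eta>A where "\<eta>A = \<delta>0 / (4 * (1 + 3 * \<Delta>))"
  have \<eta>A: "\<eta>A > 0" unfolding \<eta>A_def using \<delta>0 \<Delta>0 by simp
  have "\<eta>A * (1 + 3 * \<Delta>) = \<delta>0 / 4" unfolding \<eta>A_def using \<Delta>0 by (simp add: field_simps)
  then have "2 * (\<eta>A + \<Delta> * (3 * \<eta>A)) = \<delta>0 / 2" by (simp add: algebra_simps)
  then have small: "2 * (\<eta>A + \<Delta> * (3 * \<eta>A)) < \<delta>0" using \<delta>0 by simp
  have Y: "(\<lambda>x. \<Phi> x 0) \<in> borel_measurable (PiM UNIV (\<lambda>_::'h. M))"
    using measurable_compose[OF \<Phi>_borel borel_measurable_continuous_onI[OF continuous_on_product_coordinates]] by (simp only: P_def)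
  have "finite_code M (\<lambda>_. 0)" by (simp add: finite_code_def)
  from code_approximation_of_map[OF M_prob Y cpt \<eta>A this]
  obtain pA EA \<phi>A BA where pA: "finite_code M pA" and EA: "finite EA" and \<phi>A: "depends_only_on EA \<phi>A"
    and BA: "BA \<in> sets (PiM UNIV (\<lambda>_::'h. M))" "measure (PiM UNIV (\<lambda>_::'h. M)) BA \<le> \<eta>A"
    and approx: "\<forall>x\<in>space (PiM UNIV (\<lambda>_::'h. M)) - BA. dist (\<Phi> x 0) (\<phi>A (\<lambda>h. pA (x h))) < \<eta>A"
    by (elim exE conjE)
  have BA': "BA \<in> sets P" "measure P BA \<le> \<eta>A" using BA by (simp_all only: P_def)
  have approx': "dist (\<Phi> x 0) (\<phi>A (\<lambda>h. pA (x h))) < \<eta>A" if "x \<in> space P" "x \<notin> BA" for x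
    using that bspec[OF approx, of x] by (simp add: P_def)
  let ?L = "insert 0 (range pA)"
  have L: "real (card ?L) > 0" using pA by (simp add: finite_code_def card_gt_0_iff)
  \<comment> \<open>The least \<open>t\<close> for which the second term of the Hamming bound is at most \<open>\<zeta>\<close> for each place.\<close>
  define t where "t = max 0 (ln (real (card ?L) / \<zeta>))"
  have t: "t \<ge> 0" by (simp add: t_def)
  have "real (card ?L) / \<zeta> = exp (ln (real (card ?L) / \<zeta>))" using L \<zeta> by simp
  also have "\<dots> \<le> exp t" unfolding t_def by simp
  finally have "real (card ?L) \<le> exp t * \<zeta>" using \<zeta> by (simp add: pos_divide_le_eq)
  then have tL: "real (card ?L) * exp (- t) \<le> \<zeta>"
    by (simp add: exp_minus field_simps)
  define x where "x = \<zeta> / (4 * (t + 1))"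
  have x: "x / 64 > 0" unfolding x_def using \<zeta> t by simp
  obtain K D r where K: "\<forall>a. compact (K a)" "separated_codes D r K" "measure \<nu> (- (\<Union>a. K a)) \<le> x / 64" "\<forall>a. \<forall>y\<in>K a. pA (\<Psi> y 0) = a"
    using separating_kernels[OF pA x] by (elim exE conjE)
  have r: "r > 0" using K(2) by (simp add: separated_codes_def)
  define \<delta>1 where "\<delta>1 = \<zeta> * r / (8 * ((t + 1) * (real (card D) + 1)))"
  have "\<delta>1 > 0" unfolding \<delta>1_def using \<zeta> r t by (intro divide_pos_pos mult_pos_pos) auto
  moreover have "\<exists>\<O>\<in>weak_nbhds \<nu>. eventually (stage_models \<delta>0 \<delta>1 \<zeta> D' r' \<O>) sequentially" if "finite D'" "r' > 0" for D' r'
  proof (rule stage_models_eventually[OF pA EA \<phi>A \<eta>A BA' approx' \<Delta> small \<zeta> t tL x_def _ _ K(3) K(2) \<delta>1_def that])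
    show "compact (K a)" for a using K(1) by blast
    show "pA (\<Psi> y 0) = a" if "y \<in> K a" for a y using K(4) that by blast
  qed
  ultimately show ?thesis by blast
qed

end

section \<open>The entropies of a co-induced process\<close>

context coinduced_models
begin

lemma good_models_separated:
  fixes \<O> :: "('g \<times> 'h \<Rightarrow> 'y) measure set"
  assumes big: "log_enat (set_cov \<delta> (good_models \<O> (U n) (s n)) (mean_dist (U n))) / ereal (real (card (U n))) > ereal c"
    and \<delta>: "\<delta> > 0"
  shows "\<exists>S. finite S \<and> S \<noteq> {} \<and> S \<subseteq> good_models \<O> (U n) (s n) \<and>
     (\<forall>y\<in>S. \<forall>y'\<in>S. y \<noteq> y' \<longrightarrow> \<delta> \<le> mean_dist (U n) y y') \<and> c * real (card (U n)) \<le> ln (real (card S))"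
proof -
  let ?k = "real (card (U n))" and ?cov = "set_cov \<delta> (good_models \<O> (U n) (s n)) (mean_dist (U n))"
  have k: "?k > 0" using finU by (simp add: card_gt_0_iff)
  have "\<exists>N. N > 0 \<and> enat N \<le> ?cov \<and> c * ?k \<le> ln (real N)"
  proof (cases ?cov)
    case (enat N)
    have N: "N > 0"
    proof (rule ccontr)
      assume "\<not> N > 0"
      then have "log_enat ?cov = -\<infinity>" using enat by (simp add: log_enat_def)
      then show False using big k by simp
    qed
    then have "log_enat ?cov = ereal (ln (real N))" using enat by (simp add: log_enat_def)
    then have "c < ln (real N) / ?k" using big k by simp
    then have "c * ?k \<le> ln (real N)" using k by (simp add: pos_less_divide_eq)
    then show ?thesis using N enat by auto
  next
    case infinity
    obtain N :: nat where N: "exp (c * ?k) \<le> real N" using real_arch_simple by blast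
    then have N0: "real N > 0" using exp_gt_zero[of "c * ?k"] by linarith
    then have "c * ?k \<le> ln (real N)" using N by (simp add: ln_ge_iff)
    then show ?thesis using N0 infinity by (intro exI[of _ N]) simp
  qed
  then obtain N where N: "N > 0" "enat N \<le> ?cov" "c * ?k \<le> ln (real N)" by blast
  have sym: "mean_dist (U n) x y = mean_dist (U n) y x" for x y :: "'v \<times> 'w \<Rightarrow> 'y" by (simp add: mean_dist_def dist_commute)
  have refl: "mean_dist (U n) z z < \<delta>" for z :: "'v \<times> 'w \<Rightarrow> 'y" using \<delta> by (simp add: mean_dist_def)
  have "\<exists>S\<subseteq>good_models \<O> (U n) (s n). finite S \<and> card S = N \<and> (\<forall>y\<in>S. \<forall>y'\<in>S. y \<noteq> y' \<longrightarrow> \<delta> \<le> mean_dist (U n) y y')"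
    by (rule separated_set_of_set_cov[where d="mean_dist (U n)" and \<delta>=\<delta>]) (rule sym refl N(2))+
  then obtain S where S: "S \<subseteq> good_models \<O> (U n) (s n)" "finite S" "card S = N"
      "\<forall>y\<in>S. \<forall>y'\<in>S. y \<noteq> y' \<longrightarrow> \<delta> \<le> mean_dist (U n) y y'"
    by (elim exE conjE)
  then have "S \<noteq> {}" using N(1) by auto
  then show ?thesis using S N(3) by (intro exI[of _ S]) simp
qed

text \<open>Diagonal choice: the stages have windows that exhaust the group and accuracies that tend to
  \<open>0\<close>, and each stage uses an index at which the good models have exponential rate at least \<open>c\<close>.\<close>

lemma doubly_quenched_entropy_ge:
  assumes c: "ereal c < (INF \<O>\<in>weak_nbhds \<nu>. limsup (\<lambda>n. log_enat (set_cov \<delta>0 (good_models \<O> (U n) (s n)) (mean_dist (U n))) / ereal (real (card (U n)))))"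
    and \<delta>0: "\<delta>0 > 0" and \<zeta>: "\<zeta> > 0"
  shows "ereal (c - 5 * \<zeta>) \<le> doubly_quenched_entropy U s \<nu>"
proof -
  obtain \<delta>1 where \<delta>1: "\<delta>1 > 0" and stage: "\<And>D r. finite D \<Longrightarrow> r > 0 \<Longrightarrow> \<exists>\<O>\<in>weak_nbhds \<nu>. eventually (stage_models \<delta>0 \<delta>1 \<zeta> D r \<O>) sequentially"
    using stage_models_exist[OF \<delta>0 \<zeta>] by blast
  define D :: "nat \<Rightarrow> ('g \<times> 'h) set" where "D i = from_nat ` {..i}" for i
  define r where "r i = 1 / real (Suc i)" for i
  define good where "good i n m \<longleftrightarrow> prob_space m \<and> sets m = sets (PiM (U n) (\<lambda>_. borel)) \<and>
    quenched_close (U n) (s n) (pair_model_measure (U n) m) (pair_process \<nu>) (D i) (r i) \<and>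
    (\<forall>F. finite F \<longrightarrow> measure m {y \<in> space m. \<exists>f\<in>F. mean_dist (U n) f y < \<delta>1} > 1 / 2 \<longrightarrow>
       exp ((c - 5 * \<zeta>) * real (card (U n))) \<le> real (card F))" for i n and m :: "('v \<times> 'w \<Rightarrow> 'y) measure"
  have step: "\<exists>n>n0. \<exists>m. good i n m" for i n0
  proof -
    have "finite (D i)" "r i > 0" by (simp_all add: D_def r_def)
    from stage[OF this] obtain \<O> where \<O>: "\<O> \<in> weak_nbhds \<nu>" and ev: "eventually (stage_models \<delta>0 \<delta>1 \<zeta> (D i) (r i) \<O>) sequentially"
      by (elim bexE)
    let ?f = "\<lambda>n. log_enat (set_cov \<delta>0 (good_models \<O> (U n) (s n)) (mean_dist (U n))) / ereal (real (card (U n)))"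
    have "\<exists>n>n0. stage_models \<delta>0 \<delta>1 \<zeta> (D i) (r i) \<O> n \<and> ?f n > ereal c"
    proof (rule ccontr)
      assume n: "\<not> ?thesis"
      have "eventually (\<lambda>n. ?f n \<le> ereal c) sequentially"
        using ev eventually_gt_at_top[of n0]
      proof eventually_elim
        case (elim n)
        show ?case
        proof (rule ccontr)
          assume "\<not> ?f n \<le> ereal c"
          then have "?f n > ereal c" by (simp only: not_le)
          then show False using n elim by (elim notE) (intro exI[of _ n] conjI)
        qed
      qed
      then have "limsup ?f \<le> ereal c" by (rule Limsup_bounded)
      moreover have "ereal c < limsup ?f" using c \<O> by (rule less_INF_D)
      ultimately show False by simp
    qed
    then obtain n where n: "n > n0" and st: "stage_models \<delta>0 \<delta>1 \<zeta> (D i) (r i) \<O> n" and f: "?f n > ereal c" by (elim exE conjE)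
    obtain S where S: "finite S" "S \<noteq> {}" "S \<subseteq> good_models \<O> (U n) (s n)"
      "\<forall>y\<in>S. \<forall>y'\<in>S. y \<noteq> y' \<longrightarrow> \<delta>0 \<le> mean_dist (U n) y y'" "c * real (card (U n)) \<le> ln (real (card S))"
      using good_models_separated[OF f \<delta>0] by (elim exE conjE)
    obtain m where m: "prob_space m" "sets m = sets (PiM (U n) (\<lambda>_. borel))"
       "quenched_close (U n) (s n) (pair_model_measure (U n) m) (pair_process \<nu>) (D i) (r i)"
       and cov: "\<forall>F. finite F \<longrightarrow> measure m {y \<in> space m. \<exists>f\<in>F. mean_dist (U n) f y < \<delta>1} > 1 / 2 \<longrightarrow>
          exp (ln (real (card S)) - 5 * \<zeta> * real (card (U n))) \<le> real (card F)"
      using st[unfolded stage_models_def, THEN spec, THEN mp, OF S(1), THEN mp, OF S(2), THEN mp, OF S(3), THEN mp, OF S(4)]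
      by (elim exE conjE)
    have "exp ((c - 5 * \<zeta>) * real (card (U n))) \<le> exp (ln (real (card S)) - 5 * \<zeta> * real (card (U n)))"
      using S(5) by (simp add: left_diff_distrib)
    then have "good i n m"
      unfolding good_def using m cov[THEN spec, THEN mp, THEN mp] by (intro conjI allI impI) (assumption | rule order_trans)+
    then show ?thesis using n by (intro exI[of _ n] conjI exI[of _ m])
  qed
  obtain \<rho> where \<rho>: "\<And>i. \<exists>m. good i (\<rho> i) m" and mono: "\<And>i. \<rho> i < \<rho> (Suc i)"
  proof -
    have "\<exists>n. \<exists>m. good 0 n m" using step[of 0 0] by (elim exE conjE) (intro exI)
    moreover have "\<exists>n'. (\<exists>m. good (Suc i) n' m) \<and> n < n'" for i n
      using step[of n "Suc i"] by (elim exE conjE) (intro exI conjI)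
    ultimately have "\<exists>f. \<forall>i. (\<exists>m. good i (f i) m) \<and> f i < f (Suc i)" by (rule dependent_nat_choice)
    then obtain f where f: "\<forall>i. (\<exists>m. good i (f i) m) \<and> f i < f (Suc i)" by (elim exE)
    show ?thesis by (rule that[of f]) (use f in simp_all)
  qed
  then have "\<exists>m. \<forall>i. good i (\<rho> i) (m i)" by (intro choice allI)
  then obtain m where "\<forall>i. good i (\<rho> i) (m i)" by (elim exE)
  then have m: "good i (\<rho> i) (m i)" for i by (rule spec)
  have mm: "model_measures (U \<circ> \<rho>) m"
    using m by (simp add: model_measures_def good_def)
  have "doubly_quenched_converges (U \<circ> \<rho>) (s \<circ> \<rho>) m \<nu>"
    unfolding doubly_quenched_converges_def
  proof (rule quenched_close_imp_converges[where D=D and r=r])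
    show "finite ((U \<circ> \<rho>) i)" "(U \<circ> \<rho>) i \<noteq> {}" for i using finU by simp_all
    show "compact (UNIV :: ('y \<times> 'y) set)" using compact_Times[OF cpt cpt] by simp
    show "model_measures (U \<circ> \<rho>) (\<lambda>i. pair_model_measure ((U \<circ> \<rho>) i) (m i))"
      unfolding model_measures_def
    proof (intro allI conjI)
      fix i
      show "prob_space (pair_model_measure ((U \<circ> \<rho>) i) (m i))"
        using m[of i] by (intro pair_model_measure_prob) (simp_all add: good_def)
      show "sets (pair_model_measure ((U \<circ> \<rho>) i) (m i)) = sets (PiM ((U \<circ> \<rho>) i) (\<lambda>_. borel))"
        by (simp add: pair_model_measure_def)
    qed
    show "quenched_close ((U \<circ> \<rho>) i) ((s \<circ> \<rho>) i) (pair_model_measure ((U \<circ> \<rho>) i) (m i)) (pair_process \<nu>) (D i) (r i)" for i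
      using m[of i] by (simp add: good_def)
    show "eventually (\<lambda>i. F \<subseteq> D i) sequentially" if F: "finite F" for F :: "('g \<times> 'h) set"
    proof -
      have "F \<subseteq> from_nat ` UNIV" by simp
      then obtain I :: "nat set" where I: "finite I" "F = from_nat ` I" using finite_subset_image[OF F, of from_nat UNIV] by auto
      obtain N where N: "I \<subseteq> {..N}" using I(1) finite_nat_iff_bounded_le by blast
      have "F \<subseteq> D i" if "N \<le> i" for i using I(2) N that by (auto simp: D_def)
      then show ?thesis by (auto simp: eventually_sequentially)
    qed
    show "r \<longlonglongrightarrow> 0" unfolding r_def using LIMSEQ_inverse_real_of_nat by (simp add: inverse_eq_divide)
  qed
  then have mem: "(\<rho>, m) \<in> {(r, m). strict_mono r \<and> model_measures (U \<circ> r) m \<and> doubly_quenched_converges (U \<circ> r) (s \<circ> r) m \<nu>}"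
    using mm mono by (simp add: strict_mono_Suc_iff)
  have "ereal (c - 5 * \<zeta>) \<le> model_growth (U \<circ> \<rho>) m"
    unfolding model_growth_def
  proof (rule SUP_upper2[where i=\<delta>1], use \<delta>1 in simp, rule SUP_upper2[where i="1/2"], simp, rule le_Limsup)
    show "\<forall>\<^sub>F i in sequentially. ereal (c - 5 * \<zeta>) \<le> log_enat (measure_cov (1 / 2) \<delta>1 (m i) (mean_dist ((U \<circ> \<rho>) i))) / ereal (real (card ((U \<circ> \<rho>) i)))"
    proof (rule always_eventually, rule allI)
      fix i
      let ?k = "real (card (U (\<rho> i)))"
      have k: "?k > 0" using finU by (simp add: card_gt_0_iff)
      have "ereal ((c - 5 * \<zeta>) * ?k) \<le> log_enat (measure_cov (1 / 2) \<delta>1 (m i) (mean_dist (U (\<rho> i))))"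
      proof (rule log_enat_measure_cov_ge)
        fix F assume "finite F" "1 - 1 / 2 < measure (m i) {y \<in> space (m i). \<exists>f\<in>F. mean_dist (U (\<rho> i)) f y < \<delta>1}"
        then show "exp ((c - 5 * \<zeta>) * ?k) \<le> real (card F)" using m[of i] by (simp add: good_def)
      qed
      then have "ereal ((c - 5 * \<zeta>) * ?k) / ereal ?k \<le> log_enat (measure_cov (1 / 2) \<delta>1 (m i) (mean_dist (U (\<rho> i)))) / ereal ?k"
        using k by (intro ereal_divide_right_mono) simp_all
      then show "ereal (c - 5 * \<zeta>) \<le> log_enat (measure_cov (1 / 2) \<delta>1 (m i) (mean_dist ((U \<circ> \<rho>) i))) / ereal (real (card ((U \<circ> \<rho>) i)))"
        using k by simp
    qed
  qed simp
  then show ?thesis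
    unfolding doubly_quenched_entropy_def by (intro SUP_upper2[OF mem]) simp
qed

text \<open>Given \<open>a < c\<close> below the entropy at scale \<open>\<delta>0\<close>, the loss \<open>\<zeta>\<close> is chosen with \<open>c - 5 * \<zeta> = a\<close>.\<close>

lemma sofic_entropy_le_doubly_quenched_entropy: "sofic_entropy U s \<nu> \<le> doubly_quenched_entropy U s \<nu>"
  unfolding sofic_entropy_def
proof (rule SUP_least)
  fix \<delta>0 :: real assume "\<delta>0 \<in> {0<..}"
  then have \<delta>0: "\<delta>0 > 0" by simp
  let ?I = "INF \<O>\<in>weak_nbhds \<nu>. limsup (\<lambda>n. log_enat (set_cov \<delta>0 (good_models \<O> (U n) (s n)) (mean_dist (U n))) / ereal (real (card (U n))))"
  show "?I \<le> doubly_quenched_entropy U s \<nu>"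
  proof (rule dense_le)
    fix x assume x: "x < ?I"
    obtain c where c: "x < ereal c" "ereal c < ?I" using ereal_dense2[OF x] by blast
    show "x \<le> doubly_quenched_entropy U s \<nu>"
    proof (cases x)
      case (real a)
      then have "(c - a) / 5 > 0" using c(1) by simp
      from doubly_quenched_entropy_ge[OF c(2) \<delta>0 this] have "ereal (c - 5 * ((c - a) / 5)) \<le> doubly_quenched_entropy U s \<nu>" .
      moreover have "c - 5 * ((c - a) / 5) = a" by (simp add: field_simps)
      ultimately show ?thesis using real by (simp only:)
    qed (use c in simp_all)
  qed
qed

end

theorem theoremE:
  fixes V :: "nat \<Rightarrow> 'v set"
    and \<sigma> :: "nat \<Rightarrow> 'g::{group_add,countable} \<Rightarrow> 'v \<Rightarrow> 'v"
    and W :: "nat \<Rightarrow> 'w set"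
    and \<tau> :: "nat \<Rightarrow> 'h::{group_add,countable} \<Rightarrow> 'w \<Rightarrow> 'w"
    and M :: "'x measure"
    and T :: "'g \<Rightarrow> 'x \<Rightarrow> 'x"
    and \<nu> :: "('g \<times> 'h \<Rightarrow> 'y::polish_space) measure"
  assumes "sofic_approximation V \<sigma>"
    and "sofic_approximation W \<tau>"
    and "group_system M T"
    and "infinite (UNIV :: 'h set)"
    and "metric_process \<nu>"
    and "isomorphic_systems (coinduced_measure M) (coinduced_action T) \<nu> right_shift"
  shows "sofic_entropy (prod_sets V W) (prod_maps \<sigma> \<tau>) \<nu>
           = quenched_entropy (prod_sets V W) (prod_maps \<sigma> \<tau>) \<nu> \<and>
         quenched_entropy (prod_sets V W) (prod_maps \<sigma> \<tau>) \<nu>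
           = doubly_quenched_entropy (prod_sets V W) (prod_maps \<sigma> \<tau>) \<nu>"
proof -
  obtain \<Phi> \<Psi> where \<Phi>: "\<Phi> \<in> measurable (coinduced_measure M) \<nu>" and \<Psi>: "\<Psi> \<in> measurable \<nu> (coinduced_measure M)"
    and distr: "distr (coinduced_measure M) \<nu> \<Phi> = \<nu>" and inverse: "AE x in coinduced_measure M. \<Psi> (\<Phi> x) = x"
    and equivariant: "\<forall>k. AE x in coinduced_measure M. \<Phi> (coinduced_action T k x) = right_shift k (\<Phi> x)"
    using assms(6) unfolding isomorphic_systems_def by (elim exE conjE)
  interpret coinduced_models M T \<nu> \<Phi> \<Psi> V \<sigma> W \<tau>
  proof
    show "AE x in coinduced_measure M. \<Phi> (coinduced_action T k x) = right_shift k (\<Phi> x)" for k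
      using equivariant by blast
  qed (fact assms(1-5) \<Phi> \<Psi> distr inverse)+
  have fin: "finite (U n) \<and> U n \<noteq> {}" for n using finU by blast
  have "quenched_entropy U s \<nu> \<le> sofic_entropy U s \<nu>"
    by (rule quenched_entropy_le_sofic_entropy[OF fin])
  moreover have "doubly_quenched_entropy U s \<nu> \<le> quenched_entropy U s \<nu>"
    by (rule doubly_quenched_entropy_le_quenched_entropy[OF fin sU \<nu>_borel_probs])
  ultimately show ?thesis using sofic_entropy_le_doubly_quenched_entropy by (intro conjI antisym) (auto intro: order_trans)
qed

end
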